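(* Let $n\ge 3$ be an integer and let $G$ be a finite group containing a normal subgroup $N$ such that $G/N\simeq C_{2^n}$, the cyclic group of order $2^n$. Let $k$ be a field with $\operatorname{char} k=0$ such that $k(\zeta_{2^n})/k$ is not a cyclic extension, where $\zeta_{2^n}$ is a primitive $2^n$-th root of unity. Then $k(G)$ is not stably rational over $k$, and moreover $k(G)$ is not retract rational over $k$.
   Context: For a finite group $G$ and a field $k$, let $k(x_g : g\in G)$ be the rational function field in $|G|$ variables indexed by $G$, on which $G$ acts by $k$-automorphisms via $h\cdot x_g=x_{hg}$ for $g,h\in G$. Define $k(G):=k(x_g:g\in G)^G$, the fixed field. A finitely generated field extension $L/k$ is stably rational over $k$ if $L(y_1,\dots,y_m)$ is purely transcendental over $k$ for some $m\ge 0$ and some elements $y_1,\dots,y_m$ algebraically independent over $L$. A field extension $L/k$ is retract rational over $k$ if there are irreducible quasi-projective varieties $U,Y,X$ over $k$ and $k$-morphisms $\varphi:U\to Y$, $\psi:Y\to X$ such that (i) $L$ is the function field of $X$; (ii) $U$ is a (non-empty) open subset of $X$ and $\psi\circ\varphi:U\to X$ is the inclusion map; (iii) $Y$ is an open subset of the affine space $\mathbb{A}^m_k$ for some positive integer $m$. (Stably rational implies retract rational.) A cyclic extension is a Galois extension with cyclic Galois group. *)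

theory Defs
  imports
    "HOL-Library.Poly_Mapping"
    "HOL-Algebra.Algebraic_Closure_Type"
    "HOL-Algebra.Elementary_Groups"
    "HOL-Algebra.Generated_Fields"
    "HOL-Algebra.Bij"
begin

section \<open>Multivariate polynomials\<close>

text \<open>
  The type \<^typ>\<open>('i \<Rightarrow>\<^sub>0 nat) \<Rightarrow>\<^sub>0 'a\<close> is an instance of \<^class>\<open>idom\<close> only for linearly ordered
  \<open>'i\<close>. A copy of it carries the instance for arbitrary index types, so that variables can be
  indexed by the elements of an arbitrary group.
\<close>

typedef (overloaded) ('i, 'a :: zero) mpoly = "UNIV :: (('i \<Rightarrow>\<^sub>0 nat) \<Rightarrow>\<^sub>0 'a) set"
  morphisms mapping_of MPoly ..

setup_lifting type_definition_mpoly

instantiation mpoly :: (type, comm_ring_1) comm_ring_1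
begin

lift_definition zero_mpoly :: "('a, 'b) mpoly" is 0 .
lift_definition one_mpoly :: "('a, 'b) mpoly" is 1 .
lift_definition plus_mpoly :: "('a, 'b) mpoly \<Rightarrow> ('a, 'b) mpoly \<Rightarrow> ('a, 'b) mpoly" is "(+)" .
lift_definition minus_mpoly :: "('a, 'b) mpoly \<Rightarrow> ('a, 'b) mpoly \<Rightarrow> ('a, 'b) mpoly" is "(-)" .
lift_definition uminus_mpoly :: "('a, 'b) mpoly \<Rightarrow> ('a, 'b) mpoly" is uminus .
lift_definition times_mpoly :: "('a, 'b) mpoly \<Rightarrow> ('a, 'b) mpoly \<Rightarrow> ('a, 'b) mpoly" is "(*)" .

instance
  by standard (transfer; simp add: algebra_simps)+

end

definition mcoeff :: "('i, 'a :: zero) mpoly \<Rightarrow> ('i \<Rightarrow>\<^sub>0 nat) \<Rightarrow> 'a" where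
  "mcoeff p m = Poly_Mapping.lookup (mapping_of p) m"

definition mmonom :: "('i \<Rightarrow>\<^sub>0 nat) \<Rightarrow> 'a \<Rightarrow> ('i, 'a :: comm_ring_1) mpoly" where
  "mmonom m c = MPoly (Poly_Mapping.single m c)"

definition mconst :: "'a \<Rightarrow> ('i, 'a :: comm_ring_1) mpoly" where
  "mconst c = mmonom 0 c"

definition mvar :: "'i \<Rightarrow> ('i, 'a :: comm_ring_1) mpoly" where
  "mvar i = mmonom (Poly_Mapping.single i 1) 1"

definition monom_eval :: "('i \<Rightarrow> 'b) \<Rightarrow> ('i \<Rightarrow>\<^sub>0 nat) \<Rightarrow> 'b :: comm_ring_1" where
  "monom_eval v m = (\<Prod>i\<in>Poly_Mapping.keys m. v i ^ Poly_Mapping.lookup m i)"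

text \<open>Evaluation at the point \<open>v\<close>, the coefficients being mapped along \<open>h\<close>.\<close>

definition meval ::
    "('a :: comm_ring_1 \<Rightarrow> 'b) \<Rightarrow> ('i \<Rightarrow> 'b) \<Rightarrow> ('i, 'a) mpoly \<Rightarrow> 'b :: comm_ring_1" where
  "meval h v p = (\<Sum>m\<in>Poly_Mapping.keys (mapping_of p). h (mcoeff p m) * monom_eval v m)"

lemma mpoly_eqI: "(\<And>m. mcoeff p m = mcoeff q m) \<Longrightarrow> p = q"
  unfolding mcoeff_def by (metis mapping_of_inject poly_mapping_eqI)

lemma mcoeff_simps [simp]:
  "mcoeff 0 m = 0" "mcoeff (p + q) m = mcoeff p m + mcoeff q m"
  by (simp_all add: mcoeff_def zero_mpoly.rep_eq plus_mpoly.rep_eq lookup_add)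

lemma mcoeff_monom: "mcoeff (mmonom m c) m' = (c when m = m')"
  by (simp add: mcoeff_def mmonom_def MPoly_inverse lookup_single)

lemma mmonom_mult: "mmonom m c * mmonom m' d = mmonom (m + m') (c * d)"
  unfolding mmonom_def by (simp add: times_mpoly_def MPoly_inverse mult_single)

lemma mmonom_0_1: "mmonom 0 1 = 1"
  by (simp add: mmonom_def one_mpoly_def)

lemma monom_eval_superset:
  assumes "finite A" "Poly_Mapping.keys m \<subseteq> A"
  shows "monom_eval v m = (\<Prod>i\<in>A. v i ^ Poly_Mapping.lookup m i)"
  unfolding monom_eval_def
  by (rule prod.mono_neutral_left) (use assms in \<open>auto simp: in_keys_iff\<close>)

lemma monom_eval_add: "monom_eval v (m + m') = monom_eval v m * monom_eval v m'"
proof -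
  let ?A = "Poly_Mapping.keys m \<union> Poly_Mapping.keys m'"
  have "Poly_Mapping.keys (m + m') \<subseteq> ?A" by (rule keys_add)
  then show ?thesis
    by (simp add: monom_eval_superset[of ?A] lookup_add power_add prod.distrib)
qed

lemma monom_eval_0 [simp]: "monom_eval v 0 = 1"
  by (simp add: monom_eval_def)

lemma mpoly_sum_monoms:
  fixes p :: "('i, 'a :: comm_ring_1) mpoly"
  shows "p = (\<Sum>m\<in>Poly_Mapping.keys (mapping_of p). mmonom m (mcoeff p m))"
proof (rule mpoly_eqI)
  fix m :: "'i \<Rightarrow>\<^sub>0 nat"
  have sum: "mcoeff (sum f A) m = (\<Sum>x\<in>A. mcoeff (f x) m)"
    for f :: "_ \<Rightarrow> ('i, 'a) mpoly" and A :: "('i \<Rightarrow>\<^sub>0 nat) set"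
    by (induction A rule: infinite_finite_induct) auto
  show "mcoeff p m = mcoeff (\<Sum>m\<in>Poly_Mapping.keys (mapping_of p). mmonom m (mcoeff p m)) m"
    by (simp add: sum mcoeff_monom when_def in_keys_iff flip: mcoeff_def)
qed

locale coeff_hom =
  fixes h :: "'a :: comm_ring_1 \<Rightarrow> 'b :: comm_ring_1"
  assumes hom_add: "h (a + b) = h a + h b"
    and hom_mult: "h (a * b) = h a * h b"
    and hom_one: "h 1 = 1"
begin

lemma hom_zero: "h 0 = 0"
  using hom_add[of 0 0] by simp

lemma meval_superset:
  assumes "finite A" "Poly_Mapping.keys (mapping_of p) \<subseteq> A"
  shows "meval h v p = (\<Sum>m\<in>A. h (mcoeff p m) * monom_eval v m)"
  unfolding meval_def
  by (rule sum.mono_neutral_left) (use assms in \<open>auto simp: in_keys_iff mcoeff_def hom_zero\<close>)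

lemma meval_add: "meval h v (p + q) = meval h v p + meval h v q"
proof -
  let ?A = "Poly_Mapping.keys (mapping_of p) \<union> Poly_Mapping.keys (mapping_of q)"
  have "Poly_Mapping.keys (mapping_of (p + q)) \<subseteq> ?A"
    by (simp add: plus_mpoly.rep_eq keys_add)
  then show ?thesis
    by (simp add: meval_superset[of ?A] hom_add distrib_right sum.distrib)
qed

lemma meval_0 [simp]: "meval h v 0 = 0"
  by (simp add: meval_def zero_mpoly.rep_eq)

lemma meval_sum: "meval h v (sum f A) = (\<Sum>x\<in>A. meval h v (f x))"
  by (induction A rule: infinite_finite_induct) (auto simp: meval_add)

lemma meval_monom: "meval h v (mmonom m c) = h c * monom_eval v m"
  by (simp add: meval_superset[of "{m}"] mmonom_def MPoly_inverse mcoeff_monom[unfolded mmonom_def])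

lemma meval_mult: "meval h v (p * q) = meval h v p * meval h v q"
proof -
  have "meval h v (p * q) = meval h v ((\<Sum>m\<in>Poly_Mapping.keys (mapping_of p). mmonom m (mcoeff p m)) *
      (\<Sum>m\<in>Poly_Mapping.keys (mapping_of q). mmonom m (mcoeff q m)))"
    using mpoly_sum_monoms by metis
  also have "\<dots> = (\<Sum>m\<in>Poly_Mapping.keys (mapping_of p). \<Sum>m'\<in>Poly_Mapping.keys (mapping_of q).
      (h (mcoeff p m) * monom_eval v m) * (h (mcoeff q m') * monom_eval v m'))"
    by (simp only: sum_product meval_sum mmonom_mult meval_monom monom_eval_add hom_mult ac_simps)
  also have "\<dots> = meval h v p * meval h v q"
    by (simp only: sum_product meval_def)
  finally show ?thesis .
qed

lemma meval_const: "meval h v (mconst c) = h c"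
  by (simp add: mconst_def meval_monom)

lemma meval_1 [simp]: "meval h v 1 = 1"
  using meval_const[of v 1] by (simp add: mconst_def mmonom_0_1 hom_one)

lemma meval_var: "meval h v (mvar i) = v i"
  by (simp add: mvar_def meval_monom hom_one monom_eval_def)

end

interpretation mconst: coeff_hom mconst
proof
  show "mconst (a + b) = mconst a + mconst b" for a b :: 'a
    by (rule mpoly_eqI) (simp add: mconst_def mcoeff_monom when_def)
qed (simp_all add: mconst_def mmonom_mult mmonom_0_1)

definition mrename :: "('i \<Rightarrow> 'j) \<Rightarrow> ('i, 'a :: comm_ring_1) mpoly \<Rightarrow> ('j, 'a) mpoly" where
  "mrename f p = meval mconst (mvar \<circ> f) p"

lemma mrename_simps:
  "mrename f 0 = 0" "mrename f 1 = 1" "mrename f (p + q) = mrename f p + mrename f q"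
  "mrename f (p * q) = mrename f p * mrename f q" "mrename f (mconst c) = mconst c"
  "mrename f (mvar i) = mvar (f i)"
  by (simp_all add: mrename_def mconst.meval_add mconst.meval_mult mconst.meval_const
      mconst.meval_var)

lemma mrename_sum: "mrename f (sum g A) = (\<Sum>x\<in>A. mrename f (g x))"
  by (simp add: mrename_def mconst.meval_sum)

lemma mrename_prod: "mrename f (prod g A) = (\<Prod>x\<in>A. mrename f (g x))"
  by (induction A rule: infinite_finite_induct) (auto simp: mrename_simps)

lemma mrename_power: "mrename f (p ^ n) = mrename f p ^ n"
  by (induction n) (auto simp: mrename_simps)

lemma mvar_power: "mvar i ^ n = mmonom (Poly_Mapping.single i n) 1"
  by (induction n) (simp_all add: mmonom_0_1 mvar_def mmonom_mult single_add[symmetric])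

lemma monom_eval_mvar: "monom_eval mvar m = mmonom m 1"
proof -
  have *: "(\<Prod>i\<in>A. mvar i ^ Poly_Mapping.lookup m i) = mmonom (\<Sum>i\<in>A. Poly_Mapping.single i (Poly_Mapping.lookup m i)) 1"
    if "finite A" for A
    using that by (induction A) (simp_all add: mmonom_0_1 mvar_power mmonom_mult)
  have "(\<Sum>i\<in>Poly_Mapping.keys m. Poly_Mapping.single i (Poly_Mapping.lookup m i)) = m"
    by (rule poly_mapping_eqI) (simp add: lookup_sum lookup_single when_def in_keys_iff)
  with *[of "Poly_Mapping.keys m"] show ?thesis
    by (simp add: monom_eval_def)
qed

lemma mpoly_as_meval: "p = meval mconst mvar p"
  using mpoly_sum_monoms[of p]
  by (simp add: meval_def monom_eval_mvar mconst_def mmonom_mult)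

lemma mrename_cong:
  assumes "\<And>m i. m \<in> Poly_Mapping.keys (mapping_of p) \<Longrightarrow> i \<in> Poly_Mapping.keys m \<Longrightarrow> f i = g i"
  shows "mrename f p = mrename g p"
  unfolding mrename_def meval_def monom_eval_def
  by (intro sum.cong prod.cong refl arg_cong2[of _ _ _ _ "(*)"]) (use assms in auto)

lemma mrename_mrename: "mrename g (mrename f p) = mrename (g \<circ> f) p"
proof -
  have "mrename g (mrename f p) =
      mrename g (\<Sum>m\<in>Poly_Mapping.keys (mapping_of p). mconst (mcoeff p m) * monom_eval (mvar \<circ> f) m)"
    by (simp add: mrename_def[of f] meval_def)
  also have "\<dots> = mrename (g \<circ> f) p"
    by (simp add: mrename_sum mrename_simps monom_eval_def mrename_prod mrename_power)
       (simp add: mrename_def meval_def monom_eval_def)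
  finally show ?thesis .
qed

lemma mrename_id: "mrename (\<lambda>i. i) p = p"
  using mpoly_as_meval[of p] by (simp add: mrename_def comp_def)

instance mpoly :: (type, idom) idom
proof
  fix p q :: "('a, 'b) mpoly"
  assume nz: "p \<noteq> 0" "q \<noteq> 0"
  define V where "V = (\<Union>m\<in>Poly_Mapping.keys (mapping_of p) \<union> Poly_Mapping.keys (mapping_of q). Poly_Mapping.keys m)"
  have "finite V" by (simp add: V_def)
  then obtain f :: "'a \<Rightarrow> nat" where f: "inj_on f V"
    using finite_imp_inj_to_nat_seg by metis
  define g where "g = inv_into V f"
  have inverse: "mrename g (mrename f r) = r"
    if "Poly_Mapping.keys (mapping_of r) \<subseteq> Poly_Mapping.keys (mapping_of p) \<union> Poly_Mapping.keys (mapping_of q)" for r :: "('a, 'b) mpoly"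
  proof -
    have "mrename (g \<circ> f) r = mrename (\<lambda>i. i) r"
    proof (rule mrename_cong)
      fix m i assume "m \<in> Poly_Mapping.keys (mapping_of r)" "i \<in> Poly_Mapping.keys m"
      then have "i \<in> V" using that by (auto simp: V_def)
      then show "(g \<circ> f) i = i" by (simp add: g_def inv_into_f_f[OF f])
    qed
    then show ?thesis by (simp add: mrename_mrename mrename_id)
  qed
  have "mrename f p \<noteq> 0" "mrename f q \<noteq> 0"
    using inverse[of p] inverse[of q] nz by (auto simp: mrename_simps)
  then have "mapping_of (mrename f p) * mapping_of (mrename f q) \<noteq> 0"
    by (metis mapping_of_inject no_zero_divisors zero_mpoly.rep_eq)
  then have "mrename f (p * q) \<noteq> 0"
    unfolding mrename_simps by (metis times_mpoly.rep_eq zero_mpoly.rep_eq)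
  then show "p * q \<noteq> 0"
    by (metis mrename_simps(1))
qed


section \<open>Fields\<close>

text \<open>
  All fields other than the base field are subfields of types of class \<^class>\<open>field\<close>. The base
  field is given as a subset or along an embedding.
\<close>

definition adjoin :: "'e :: field set \<Rightarrow> 'e set \<Rightarrow> 'e set" where
  "adjoin K S = generate_field ring_of_type_algebra (K \<union> S)"

definition aut_group :: "'e :: field set \<Rightarrow> 'e set \<Rightarrow> ('e \<Rightarrow> 'e) monoid" where
  "aut_group K L = (BijGroup L)\<lparr>carrier :=
     {\<sigma> \<in> Bij L. (\<forall>x\<in>L. \<forall>y\<in>L. \<sigma> (x + y) = \<sigma> x + \<sigma> y \<and> \<sigma> (x * y) = \<sigma> x * \<sigma> y) \<and>
       (\<forall>x\<in>K. \<sigma> x = x)}\<rparr>"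

definition algebraic_extension :: "'e :: field set \<Rightarrow> 'e set \<Rightarrow> bool" where
  "algebraic_extension K L \<longleftrightarrow>
     subfield K ring_of_type_algebra \<and> subfield L ring_of_type_algebra \<and> K \<subseteq> L \<and>
     (\<forall>x\<in>L. \<exists>p. p \<noteq> 0 \<and> (\<forall>i. Polynomial.coeff p i \<in> K) \<and> poly p x = 0)"

text \<open>An algebraic extension is Galois iff \<open>K\<close> is the fixed field of its automorphism group.\<close>

definition galois_extension :: "'e :: field set \<Rightarrow> 'e set \<Rightarrow> bool" where
  "galois_extension K L \<longleftrightarrow>
     algebraic_extension K L \<and> {x \<in> L. \<forall>\<sigma>\<in>carrier (aut_group K L). \<sigma> x = x} = K"

definition cyclic_extension :: "'e :: field set \<Rightarrow> 'e set \<Rightarrow> bool" where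
  "cyclic_extension K L \<longleftrightarrow> galois_extension K L \<and> cyclic_group (aut_group K L)"

definition primitive_root_of_unity :: "nat \<Rightarrow> 'e :: field \<Rightarrow> bool" where
  "primitive_root_of_unity n z \<longleftrightarrow> n > 0 \<and> z ^ n = 1 \<and> (\<forall>j. 0 < j \<and> j < n \<longrightarrow> z ^ j \<noteq> 1)"

definition alg_independent :: "'e :: field set \<Rightarrow> 'e set \<Rightarrow> bool" where
  "alg_independent K B \<longleftrightarrow>
     (\<forall>p :: ('e, 'e) mpoly.
        (\<forall>m. mcoeff p m \<in> K \<and> (mcoeff p m \<noteq> 0 \<longrightarrow> Poly_Mapping.keys m \<subseteq> B)) \<longrightarrow>
        meval (\<lambda>c. c) (\<lambda>b. b) p = 0 \<longrightarrow> p = 0)"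

definition purely_transcendental :: "'e :: field set \<Rightarrow> 'e set \<Rightarrow> bool" where
  "purely_transcendental K L \<longleftrightarrow> (\<exists>B. alg_independent K B \<and> L = adjoin K B)"

type_synonym ('i, 'a) ratfun = "('i, 'a) mpoly fract"

definition rf_const :: "'a :: field \<Rightarrow> ('i, 'a) ratfun" where
  "rf_const c = to_fract (mconst c)"

definition rf_var :: "'i \<Rightarrow> ('i, 'a :: field) ratfun" where
  "rf_var i = to_fract (mvar i)"

text \<open>
  Here \<open>L\<close> is regarded as an extension of the type \<^typ>\<open>'k\<close> along \<open>\<iota>\<close>, and \<open>L(y\<^sub>1, \<dots>, y\<^sub>m)\<close>
  is realised inside the rational functions over the type that surrounds \<open>L\<close>. Up to
  isomorphism over \<open>L\<close> it does not depend on the choice of independent elements.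
\<close>

definition stably_rational :: "('k :: field \<Rightarrow> 'e :: field) \<Rightarrow> 'e set \<Rightarrow> bool" where
  "stably_rational \<iota> L \<longleftrightarrow>
     (\<exists>m. purely_transcendental (range (\<lambda>c. rf_const (\<iota> c) :: (nat, 'e) ratfun))
            (adjoin (rf_const ` L) (rf_var ` {..<m})))"


section \<open>The field of the Noether problem\<close>

definition ratfun_field :: "('g, 'b) monoid_scheme \<Rightarrow> ('g, 'k :: field) ratfun set" where
  "ratfun_field G = adjoin (range rf_const) (rf_var ` carrier G)"

text \<open>
  The action of \<open>h\<close> is the unique automorphism over the constants that sends the variable of \<open>g\<close>
  to that of \<open>h g\<close>; lemma \<open>noether_action_exists_unique\<close> shows that the description is proper.
\<close>

definition noether_action ::
    "('g, 'b) monoid_scheme \<Rightarrow> 'g \<Rightarrow> ('g, 'k :: field) ratfun \<Rightarrow> ('g, 'k) ratfun" where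
  "noether_action G h = (THE \<sigma>. \<sigma> \<in> carrier (aut_group (range rf_const) (ratfun_field G)) \<and>
     (\<forall>g\<in>carrier G. \<sigma> (rf_var g) = rf_var (h \<otimes>\<^bsub>G\<^esub> g)))"

definition noether_field :: "('g, 'b) monoid_scheme \<Rightarrow> ('g, 'k :: field) ratfun set" where
  "noether_field G = {f \<in> ratfun_field G. \<forall>h\<in>carrier G. noether_action G h f = f}"


subsection \<open>Existence and uniqueness of the action\<close>

lemma ring_of_type_algebra_simps [simp]:
  "carrier ring_of_type_algebra = UNIV"
  "x \<otimes>\<^bsub>ring_of_type_algebra\<^esub> y = x * y" "x \<oplus>\<^bsub>ring_of_type_algebra\<^esub> y = x + y"
  "\<one>\<^bsub>ring_of_type_algebra\<^esub> = 1" "\<zero>\<^bsub>ring_of_type_algebra\<^esub> = 0"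
  by (simp_all add: ring_of_type_algebra_def)

lemma ring_of_type_algebra_inverses:
  fixes x :: "'e :: field"
  shows "\<ominus>\<^bsub>ring_of_type_algebra\<^esub> x = - x"
    and "x \<noteq> 0 \<Longrightarrow> inv\<^bsub>ring_of_type_algebra\<^esub> x = inverse x"
proof -
  interpret R: field "ring_of_type_algebra :: 'e ring" ..
  show "\<ominus>\<^bsub>ring_of_type_algebra\<^esub> x = - x"
    by (rule R.minus_equality) auto
  show "inv\<^bsub>ring_of_type_algebra\<^esub> x = inverse x" if "x \<noteq> 0"
    by (rule R.comm_inv_char) (use that in auto)
qed

lemma adjoin_closed:
  "1 \<in> adjoin K S" "x \<in> K \<Longrightarrow> x \<in> adjoin K S" "x \<in> S \<Longrightarrow> x \<in> adjoin K S"
  "x \<in> adjoin K S \<Longrightarrow> y \<in> adjoin K S \<Longrightarrow> x + y \<in> adjoin K S"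
  "x \<in> adjoin K S \<Longrightarrow> y \<in> adjoin K S \<Longrightarrow> x * y \<in> adjoin K S"
  "x \<in> adjoin K S \<Longrightarrow> - x \<in> adjoin K S"
  "x \<in> adjoin K S \<Longrightarrow> x \<noteq> 0 \<Longrightarrow> inverse x \<in> adjoin K S"
  using generate_field.intros[where R = ring_of_type_algebra and H = "K \<union> S"]
  unfolding adjoin_def
  by (auto simp: ring_of_type_algebra_inverses)

lemma adjoin_induct [consumes 1, case_names one base add mult minus inverse]:
  assumes "x \<in> adjoin K S"
    and "P 1" "\<And>x. x \<in> K \<union> S \<Longrightarrow> P x"
    and "\<And>x y. x \<in> adjoin K S \<Longrightarrow> y \<in> adjoin K S \<Longrightarrow> P x \<Longrightarrow> P y \<Longrightarrow> P (x + y)"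
    and "\<And>x y. x \<in> adjoin K S \<Longrightarrow> y \<in> adjoin K S \<Longrightarrow> P x \<Longrightarrow> P y \<Longrightarrow> P (x * y)"
    and "\<And>x. x \<in> adjoin K S \<Longrightarrow> P x \<Longrightarrow> P (- x)"
    and "\<And>x. x \<in> adjoin K S \<Longrightarrow> x \<noteq> 0 \<Longrightarrow> P x \<Longrightarrow> P (inverse x)"
  shows "P x"
  using assms(1) unfolding adjoin_def
  by (induction rule: generate_field.induct)
     (use assms(2-) in \<open>auto simp: adjoin_def ring_of_type_algebra_inverses\<close>)

lemma aut_group_cong:
  assumes "\<sigma> \<in> carrier (aut_group K (adjoin K S))" "\<tau> \<in> carrier (aut_group K (adjoin K S))"
    and "\<And>x. x \<in> S \<Longrightarrow> \<sigma> x = \<tau> x"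
  shows "\<sigma> = \<tau>"
proof (rule extensionalityI)
  let ?L = "adjoin K S"
  show "\<sigma> \<in> extensional ?L" "\<tau> \<in> extensional ?L"
    using assms by (auto simp: aut_group_def Bij_def)
  have hom: "f (x + y) = f x + f y" "f (x * y) = f x * f y"
    if "f \<in> {\<sigma>, \<tau>}" "x \<in> ?L" "y \<in> ?L" for f x y
    using assms that by (auto simp: aut_group_def)
  have inj: "inj_on f ?L" if "f \<in> {\<sigma>, \<tau>}" for f
    using assms that by (auto simp: aut_group_def Bij_def bij_betw_def)
  have zero: "0 \<in> ?L"
    using adjoin_closed(4)[OF adjoin_closed(1) adjoin_closed(6)[OF adjoin_closed(1)]] by simp
  have f0: "f 0 = 0" if "f \<in> {\<sigma>, \<tau>}" for f
    using hom(1)[OF that zero zero] by (metis add.right_neutral add_left_cancel)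
  have f1: "f 1 = 1" if "f \<in> {\<sigma>, \<tau>}" for f
  proof -
    have "f 1 \<noteq> f 0"
      using inj[OF that] zero adjoin_closed(1) by (metis inj_onD zero_neq_one)
    then show ?thesis
      using hom(2)[OF that adjoin_closed(1) adjoin_closed(1)] f0[OF that] by simp
  qed
  have fm: "f (- x) = - f x" if "f \<in> {\<sigma>, \<tau>}" "x \<in> ?L" for f x
    using hom(1)[OF that(1) that(2) adjoin_closed(6)[OF that(2)]] f0[OF that(1)]
    by (simp add: eq_neg_iff_add_eq_0 add.commute)
  have fi: "f (inverse x) = inverse (f x)" if "f \<in> {\<sigma>, \<tau>}" "x \<in> ?L" "x \<noteq> 0" for f x
    using hom(2)[OF that(1) that(2) adjoin_closed(7)[OF that(2,3)]] f1[OF that(1)] that(3)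
    by (simp add: inverse_unique)
  show "\<sigma> x = \<tau> x" if "x \<in> ?L" for x
    using that
  proof (induction rule: adjoin_induct)
    case (base x)
    then show ?case using assms by (auto simp: aut_group_def)
  qed (simp_all add: hom f1 fm fi)
qed

lemma Fract_extension:
  fixes \<rho> :: "'a :: idom \<Rightarrow> 'a"
  assumes "\<And>a b. \<rho> (a + b) = \<rho> a + \<rho> b" "\<And>a b. \<rho> (a * b) = \<rho> a * \<rho> b" "\<And>a. \<rho> a = 0 \<Longrightarrow> a = 0"
    and "\<rho> 1 = 1"
  obtains T :: "'a fract \<Rightarrow> 'a fract"
  where "\<And>x y. T (x + y) = T x + T y" "\<And>x y. T (x * y) = T x * T y"
    and "\<And>a b. b \<noteq> 0 \<Longrightarrow> T (Fract a b) = Fract (\<rho> a) (\<rho> b)"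
proof -
  have nz: "\<rho> b \<noteq> 0" if "b \<noteq> 0" for b
    using assms(3) that by blast
  define T where "T x = (SOME y. \<exists>a b. b \<noteq> 0 \<and> x = Fract a b \<and> y = Fract (\<rho> a) (\<rho> b))" for x
  have T: "T (Fract a b) = Fract (\<rho> a) (\<rho> b)" if "b \<noteq> 0" for a b
  proof -
    have "\<exists>y c d. d \<noteq> 0 \<and> Fract a b = Fract c d \<and> y = Fract (\<rho> c) (\<rho> d)"
      using that by blast
    then obtain c d where cd: "d \<noteq> 0" "Fract a b = Fract c d" "T (Fract a b) = Fract (\<rho> c) (\<rho> d)"
      unfolding T_def by (smt (verit, ccfv_threshold) someI_ex)
    then have "\<rho> a * \<rho> d = \<rho> c * \<rho> b"
      using that assms(2) by (simp add: eq_fract) metis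
    then show ?thesis
      using cd that assms(3) by (metis eq_fract(1))
  qed
  show ?thesis
  proof (rule that[of T])
    show "T (x + y) = T x + T y" for x y
      by (cases x, cases y) (simp add: T nz assms(1,2))
    show "T (x * y) = T x * T y" for x y
      by (cases x, cases y) (simp add: T nz assms(1,2))
  qed (rule T)
qed

theorem noether_action_exists_unique:
  fixes G :: "('g, 'b) monoid_scheme"
  assumes "group G" "h \<in> carrier G"
  shows "\<exists>!\<sigma>. \<sigma> \<in> carrier (aut_group (range rf_const) (ratfun_field G :: ('g, 'k :: field) ratfun set)) \<and>
    (\<forall>g\<in>carrier G. \<sigma> (rf_var g) = rf_var (h \<otimes>\<^bsub>G\<^esub> g))"
proof -
  interpret group G by fact
  let ?K = "range rf_const :: ('g, 'k) ratfun set"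
  let ?S = "rf_var ` carrier G :: ('g, 'k) ratfun set"
  let ?L = "ratfun_field G :: ('g, 'k) ratfun set"
  define P where "P h g = (if g \<in> carrier G then h \<otimes>\<^bsub>G\<^esub> g else g)" for h g
  have PP: "P (inv\<^bsub>G\<^esub> h) \<circ> P h = (\<lambda>g. g)" if "h \<in> carrier G" for h
    using that by (auto simp: P_def fun_eq_iff m_assoc[symmetric])
  have ex: "\<exists>T :: ('g, 'k) ratfun \<Rightarrow> _. (\<forall>x y. T (x + y) = T x + T y) \<and> (\<forall>x y. T (x * y) = T x * T y)
      \<and> (\<forall>a b. b \<noteq> 0 \<longrightarrow> T (Fract a b) = Fract (mrename (P h) a) (mrename (P h) b))"
    if h: "h \<in> carrier G" for h
  proof -
    have zero: "a = 0" if "mrename (P h) a = 0" for a :: "('g, 'k) mpoly"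
    proof -
      have "mrename (P (inv\<^bsub>G\<^esub> h)) (mrename (P h) a) = a"
        using PP[OF h] by (simp add: mrename_mrename mrename_id)
      then show ?thesis using that by (simp add: mrename_simps)
    qed
    obtain T :: "('g, 'k) ratfun \<Rightarrow> ('g, 'k) ratfun"
      where "\<And>x y. T (x + y) = T x + T y" "\<And>x y. T (x * y) = T x * T y"
        and "\<And>a b. b \<noteq> 0 \<Longrightarrow> T (Fract a b) = Fract (mrename (P h) a) (mrename (P h) b)"
      by (rule Fract_extension[OF mrename_simps(3,4) zero mrename_simps(2)]) auto
    then show ?thesis
      by blast
  qed
  define T :: "'g \<Rightarrow> ('g, 'k) ratfun \<Rightarrow> ('g, 'k) ratfun" where
    "T h = (SOME T. (\<forall>x y. T (x + y) = T x + T y) \<and> (\<forall>x y. T (x * y) = T x * T y)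
      \<and> (\<forall>a b. b \<noteq> 0 \<longrightarrow> T (Fract a b) = Fract (mrename (P h) a) (mrename (P h) b)))" for h
  have T_all: "(\<forall>x y. T h (x + y) = T h x + T h y) \<and> (\<forall>x y. T h (x * y) = T h x * T h y)
      \<and> (\<forall>a b. b \<noteq> 0 \<longrightarrow> T h (Fract a b) = Fract (mrename (P h) a) (mrename (P h) b))"
    if "h \<in> carrier G" for h
    unfolding T_def by (rule someI_ex[OF ex[OF that]])
  have T_add: "T h (x + y) = T h x + T h y" and T_mult: "T h (x * y) = T h x * T h y"
    and T_Fract: "b \<noteq> 0 \<Longrightarrow> T h (Fract a b) = Fract (mrename (P h) a) (mrename (P h) b)"
    if "h \<in> carrier G" for h x y a b
    using T_all[OF that] by blast+
  have T_const: "T h (rf_const c) = rf_const c" if "h \<in> carrier G" for h c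
    using T_Fract[OF that, of 1 "mconst c"] by (simp add: rf_const_def to_fract_def mrename_simps)
  have T_var: "T h (rf_var g) = rf_var (P h g)" if "h \<in> carrier G" for h g
    using T_Fract[OF that, of 1 "mvar g"] by (simp add: rf_var_def to_fract_def mrename_simps)
  have T_inv: "T (inv\<^bsub>G\<^esub> h) (T h x) = x" if h: "h \<in> carrier G" for h x
  proof (cases x)
    case (Fract a b)
    have undo: "mrename (P (inv\<^bsub>G\<^esub> h)) (mrename (P h) a) = a" for a :: "('g, 'k) mpoly"
      using PP[OF h] by (simp add: mrename_mrename mrename_id)
    have "mrename (P h) b \<noteq> 0"
      using undo[of b] Fract(2) by (auto simp: mrename_simps)
    then show ?thesis
      using Fract h by (simp add: T_Fract undo)
  qed
  have T_0: "T h 0 = 0" if "h \<in> carrier G" for h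
    using T_add[OF that, of 0 0] by (metis add.right_neutral add_left_cancel)
  have T_1: "T h 1 = 1" if "h \<in> carrier G" for h
    using T_const[OF that, of 1]
    by (simp add: rf_const_def to_fract_def mconst_def mmonom_0_1 One_fract_def)
  have T_minus: "T h (- x) = - T h x" if "h \<in> carrier G" for h x
    using T_add[OF that, of x "- x"] T_0[OF that] by (simp add: eq_neg_iff_add_eq_0 add.commute)
  have T_inverse: "T h (inverse x) = inverse (T h x)" if "h \<in> carrier G" "x \<noteq> 0" for h x
    using T_mult[OF that(1), of x "inverse x"] T_1[OF that(1)] that(2)
    by (simp add: inverse_unique)
  have T_in: "T h x \<in> ?L" if h: "h \<in> carrier G" and x: "x \<in> ?L" for h x
    using x unfolding ratfun_field_def
  proof (induction rule: adjoin_induct)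
    case (inverse x)
    have "T h x \<noteq> 0" using T_inv[OF h, of x] inverse T_0[of "inv\<^bsub>G\<^esub> h"] h by auto
    then show ?case using inverse h by (simp add: T_inverse adjoin_closed)
  qed (use h in \<open>auto simp: T_add T_mult T_minus T_1 T_const T_var P_def adjoin_closed\<close>)
  have "bij_betw (T h) ?L ?L"
    by (rule bij_betw_byWitness[of _ "T (inv\<^bsub>G\<^esub> h)"])
       (use assms T_in T_inv T_inv[of "inv\<^bsub>G\<^esub> h"] in auto)
  then have "restrict (T h) ?L \<in> Bij ?L"
    by (auto simp: Bij_def cong: bij_betw_cong)
  moreover have "x + y \<in> ?L" "x * y \<in> ?L" if "x \<in> ?L" "y \<in> ?L" for x y
    using that by (auto simp: ratfun_field_def adjoin_closed)
  moreover have "rf_const c \<in> ?L" "g \<in> carrier G \<Longrightarrow> rf_var g \<in> ?L" for c g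
    by (auto simp: ratfun_field_def adjoin_closed)
  ultimately have T: "restrict (T h) ?L \<in> carrier (aut_group ?K ?L) \<and>
      (\<forall>g\<in>carrier G. restrict (T h) ?L (rf_var g) = rf_var (h \<otimes>\<^bsub>G\<^esub> g))"
    using assms by (auto simp: aut_group_def T_add T_mult T_const T_var P_def)
  then show ?thesis
  proof (rule ex1I[of _ "restrict (T h) ?L"])
    fix \<sigma>
    assume \<sigma>: "\<sigma> \<in> carrier (aut_group ?K ?L) \<and>
      (\<forall>g\<in>carrier G. \<sigma> (rf_var g) = rf_var (h \<otimes>\<^bsub>G\<^esub> g))"
    show "\<sigma> = restrict (T h) ?L"
      using T \<sigma> unfolding ratfun_field_def by (intro aut_group_cong[of _ ?K ?S]) auto
  qed
qed


section \<open>Quasi-projective varieties\<close>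

no_notation Polynomials.var (\<open>X\<index>\<close>)
no_notation Multiplicative_Group.phi' (\<open>\<phi> _\<close>)

text \<open>
  Varieties over the field \<^typ>\<open>'k\<close> are treated classically: points have coordinates in the
  algebraic closure, while closed sets, regular functions and morphisms are given by polynomials
  with coefficients in \<^typ>\<open>'k\<close>. Irreducibility accordingly refers to the Zariski topology over
  \<^typ>\<open>'k\<close>. A point of projective \<open>N\<close>-space is the set of all its homogeneous coordinate vectors;
  these are indexed by \<^typ>\<open>nat\<close> and vanish beyond \<open>N\<close>.
\<close>

type_synonym 'k point = "(nat \<Rightarrow> 'k alg_closure) set"

definition proj_space :: "nat \<Rightarrow> 'k :: field point set" where
  "proj_space N = {{\<lambda>i. c * v i | c. c \<noteq> 0} | v. (\<exists>i. v i \<noteq> 0) \<and> (\<forall>i>N. v i = 0)}"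

definition homogeneous :: "nat \<Rightarrow> nat \<Rightarrow> (nat, 'k :: field) mpoly \<Rightarrow> bool" where
  "homogeneous N d F \<longleftrightarrow> (\<forall>m. mcoeff F m \<noteq> 0 \<longrightarrow>
     Poly_Mapping.keys m \<subseteq> {..N} \<and> (\<Sum>i\<in>Poly_Mapping.keys m. Poly_Mapping.lookup m i) = d)"

definition zariski_closed :: "nat \<Rightarrow> 'k :: field point set \<Rightarrow> bool" where
  "zariski_closed N Z \<longleftrightarrow> (\<exists>S :: (nat, 'k) mpoly set. (\<forall>F\<in>S. \<exists>d. homogeneous N d F) \<and>
     Z = {P \<in> proj_space N. \<forall>F\<in>S. \<forall>v\<in>P. meval to_ac v F = 0})"

definition quasi_projective :: "nat \<Rightarrow> 'k :: field point set \<Rightarrow> bool" where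
  "quasi_projective N X \<longleftrightarrow> (\<exists>Z W. zariski_closed N Z \<and> zariski_closed N W \<and> X = Z - W)"

definition open_in :: "nat \<Rightarrow> 'k :: field point set \<Rightarrow> 'k point set \<Rightarrow> bool" where
  "open_in N X U \<longleftrightarrow> (\<exists>W. zariski_closed N W \<and> U = X - W)"

definition irreducible_variety :: "nat \<Rightarrow> 'k :: field point set \<Rightarrow> bool" where
  "irreducible_variety N X \<longleftrightarrow> quasi_projective N X \<and> X \<noteq> {} \<and>
     (\<forall>A B. zariski_closed N A \<and> zariski_closed N B \<and> X \<subseteq> A \<union> B \<longrightarrow> X \<subseteq> A \<or> X \<subseteq> B)"

definition regular_on :: "nat \<Rightarrow> 'k :: field point set \<Rightarrow> ('k point \<Rightarrow> 'k alg_closure) \<Rightarrow> bool" where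
  "regular_on N X f \<longleftrightarrow> (\<forall>P\<in>X. \<exists>U d F H. open_in N X U \<and> P \<in> U \<and>
     homogeneous N d F \<and> homogeneous N d H \<and>
     (\<forall>Q\<in>U. \<forall>v\<in>Q. meval to_ac v H \<noteq> 0 \<and> f Q = meval to_ac v F / meval to_ac v H))"

definition morphism ::
    "nat \<Rightarrow> 'k :: field point set \<Rightarrow> nat \<Rightarrow> 'k point set \<Rightarrow> ('k point \<Rightarrow> 'k point) \<Rightarrow> bool" where
  "morphism N X M Y \<phi> \<longleftrightarrow> \<phi> ` X \<subseteq> Y \<and>
     (\<forall>V. open_in M Y V \<longrightarrow> open_in N X {P \<in> X. \<phi> P \<in> V} \<and>
       (\<forall>f. regular_on M V f \<longrightarrow> regular_on N {P \<in> X. \<phi> P \<in> V} (f \<circ> \<phi>)))"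

text \<open>
  The function field of an irreducible variety, as the ring of germs of regular functions on
  nonempty open subsets.
\<close>

definition germ_pairs ::
    "nat \<Rightarrow> 'k :: field point set \<Rightarrow> ('k point set \<times> ('k point \<Rightarrow> 'k alg_closure)) set" where
  "germ_pairs N X = {(U, f). open_in N X U \<and> U \<noteq> {} \<and> regular_on N U f}"

definition germ_rel ::
    "nat \<Rightarrow> 'k :: field point set \<Rightarrow> ('k point set \<times> ('k point \<Rightarrow> 'k alg_closure)) rel" where
  "germ_rel N X = {((U, f), (V, g)).
     (U, f) \<in> germ_pairs N X \<and> (V, g) \<in> germ_pairs N X \<and> (\<forall>P\<in>U \<inter> V. f P = g P)}"

definition germ_const ::
    "nat \<Rightarrow> 'k :: field point set \<Rightarrow> 'k \<Rightarrow> ('k point set \<times> ('k point \<Rightarrow> 'k alg_closure)) set" where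
  "germ_const N X c = germ_rel N X `` {(X, \<lambda>_. to_ac c)}"

definition function_field ::
    "nat \<Rightarrow> 'k :: field point set \<Rightarrow> ('k point set \<times> ('k point \<Rightarrow> 'k alg_closure)) set ring" where
  "function_field N X =
     \<lparr>carrier = germ_pairs N X // germ_rel N X,
      monoid.mult = (\<lambda>A B. \<Union>(U, f)\<in>A. \<Union>(V, g)\<in>B. germ_rel N X `` {(U \<inter> V, \<lambda>P. f P * g P)}),
      one = germ_const N X 1,
      ring.zero = germ_const N X 0,
      add = (\<lambda>A B. \<Union>(U, f)\<in>A. \<Union>(V, g)\<in>B. germ_rel N X `` {(U \<inter> V, \<lambda>P. f P + g P)})\<rparr>"

definition is_function_field ::
    "('k :: field \<Rightarrow> 'e :: field) \<Rightarrow> 'e set \<Rightarrow> nat \<Rightarrow> 'k point set \<Rightarrow> bool" where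
  "is_function_field \<iota> L N X \<longleftrightarrow>
     (\<exists>\<theta> \<in> ring_iso (function_field N X) (ring_of_type_algebra\<lparr>carrier := L\<rparr>).
        \<forall>c. \<theta> (germ_const N X c) = \<iota> c)"

text \<open>Affine \<open>m\<close>-space, identified with the standard chart of projective \<open>m\<close>-space.\<close>

definition affine_space :: "nat \<Rightarrow> 'k :: field point set" where
  "affine_space m = {P \<in> proj_space m. \<forall>v\<in>P. v 0 \<noteq> 0}"

definition retract_rational :: "('k :: field \<Rightarrow> 'e :: field) \<Rightarrow> 'e set \<Rightarrow> bool" where
  "retract_rational \<iota> L \<longleftrightarrow>
     (\<exists>N m (X :: 'k point set) U Y \<phi> \<psi>.
        irreducible_variety N X \<and> irreducible_variety N U \<and> irreducible_variety m Y \<and>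
        morphism N U m Y \<phi> \<and> morphism m Y N X \<psi> \<and>
        is_function_field \<iota> L N X \<and>
        open_in N X U \<and> (\<forall>P\<in>U. \<psi> (\<phi> P) = P) \<and>
        m > 0 \<and> open_in m (affine_space m) Y)"

end

(*
  Let zeta be a primitive 2^n-th root of unity. As k(zeta)/k is not cyclic, there are automorphisms
  of the algebraic closure over k with eps(zeta) = 1/zeta and lam(zeta) = -zeta. Both retract and
  stable rationality provide an embedding of the field L = k(G) into a rational function field over k
  that has a left inverse given by evaluation at an L-rational point.

  The quadratic extension of L inside the cyclic extension of degree 2^n is L(delta) with delta^2 in L.
  The Lagrange resolvent of the cyclic extension ties delta^2 to norm-like relations with coefficients
  in L. Along a line from a k-rational point to the L-rational point these become identities between
  polynomials in one variable, in which (because n >= 3) every irreducible factor that is stable under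
  a transformation of zeta to -1/zeta or -zeta occurs to an even power. Hence delta^2 is a square times
  a norm w * lam(w) with w invariant under eps. This gives a rational function u over the algebraic closure
  with u * lam(u) = 1 and eps(u) = u, which is negated by a generator of the cyclic quotient. Writing u
  in lowest terms, its numerator would be multiplied by a root of unity of 2-power order that is fixed
  by eps and negated by lam, which is impossible.
*)

theory Submission
  imports Defs
begin

text \<open>The bound n >= 3 comes from exponents. With m = 2^n, -\<zeta> is \<zeta>^\<chi> for
  \<chi> = m/2 + 1 and -1/\<zeta> is \<zeta>^\<chi> for \<chi> = m/2 - 1. If \<theta> is the m-th
  power of the resolvent, then \<theta>(\<zeta>^\<chi>) \<theta>(\<zeta>)^(m - \<chi>) is an m-th
  power, so at a stable prime (m - \<chi> + 1) v(\<theta>) is divisible by m, up to a common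
  denominator. Here m - \<chi> + 1 is m/2 or m/2 + 2; for n >= 3 both contain 2 to a lower power
  than m does, while for n = 2 the second would be m itself and say nothing.

  The factorisation in one variable leaves an uncontrolled constant c. Multiplying the values at the
  two ends of the line turns it into c^2, at the price of a factor from k, the value at the
  k-rational end. That factor is removed by specialising the resulting identity once more, at a
  point with natural number coordinates, which all automorphisms of the coefficients fix.

  The resolvents are kept as polynomials modulo x^(m/2) + 1 instead of elements of L(\<zeta>): the
  embedding to be applied is defined on L only, and it acts on identities between polynomials with
  coefficients in L.\<close>

lemma coeff_hom_diff: "coeff_hom h \<Longrightarrow> h (a - b) = h a - h b"
  by (metis coeff_hom.hom_add diff_add_cancel eq_diff_eq)

lemma coeff_hom_minus: "coeff_hom h \<Longrightarrow> h (- a) = - h a"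
  using coeff_hom_diff[of h 0 a] by (simp add: coeff_hom.hom_zero)

lemma coeff_hom_sum: "coeff_hom h \<Longrightarrow> h (sum f A) = (\<Sum>x\<in>A. h (f x))"
  by (induction A rule: infinite_finite_induct) (auto simp: coeff_hom.hom_zero coeff_hom.hom_add)

lemma coeff_hom_prod: "coeff_hom h \<Longrightarrow> h (prod f A) = (\<Prod>x\<in>A. h (f x))"
  by (induction A rule: infinite_finite_induct) (auto simp: coeff_hom.hom_one coeff_hom.hom_mult)

lemma coeff_hom_power: "coeff_hom h \<Longrightarrow> h (x ^ n) = h x ^ n"
  by (induction n) (auto simp: coeff_hom.hom_one coeff_hom.hom_mult)

lemma coeff_hom_of_nat: "coeff_hom h \<Longrightarrow> h (of_nat n) = of_nat n"
  by (induction n) (auto simp: coeff_hom.hom_zero coeff_hom.hom_one coeff_hom.hom_add)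

lemma coeff_hom_comp: "coeff_hom f \<Longrightarrow> coeff_hom g \<Longrightarrow> coeff_hom (f \<circ> g)"
  by (simp add: coeff_hom_def)

lemma coeff_hom_id: "coeff_hom (\<lambda>x. x)"
  by (simp add: coeff_hom_def)

lemma coeff_hom_eq_0_iff:
  fixes h :: "'a :: field \<Rightarrow> 'b :: idom"
  assumes "coeff_hom h"
  shows "h x = 0 \<longleftrightarrow> x = 0"
proof
  assume "h x = 0"
  show "x = 0"
  proof (rule ccontr)
    assume "x \<noteq> 0"
    then have "h (x * inverse x) = 1"
      using assms by (simp add: coeff_hom.hom_one)
    then show False
      using \<open>h x = 0\<close> by (simp add: coeff_hom.hom_mult[OF assms])
  qed
qed (simp add: coeff_hom.hom_zero[OF assms])

lemma coeff_hom_inj: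
  fixes h :: "'a :: field \<Rightarrow> 'b :: idom"
  assumes "coeff_hom h"
  shows "inj h"
  by (rule injI) (metis assms coeff_hom_diff coeff_hom_eq_0_iff eq_iff_diff_eq_0)

lemma coeff_hom_inverse:
  fixes h :: "'a :: field \<Rightarrow> 'b :: field"
  assumes "coeff_hom h"
  shows "h (inverse x) = inverse (h x)"
proof (cases "x = 0")
  case False
  then have "h x * h (inverse x) = 1"
    using assms by (simp add: coeff_hom.hom_one flip: coeff_hom.hom_mult)
  then show ?thesis by (simp add: inverse_unique)
qed (simp add: coeff_hom.hom_zero[OF assms])

lemma coeff_hom_divide:
  fixes h :: "'a :: field \<Rightarrow> 'b :: field"
  assumes "coeff_hom h"
  shows "h (x / y) = h x / h y"
  by (simp add: divide_inverse coeff_hom.hom_mult[OF assms] coeff_hom_inverse[OF assms])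

lemma coeff_hom_to_fract: "coeff_hom to_fract"
  by (simp add: coeff_hom_def)

lemma coeff_hom_rf_const: "coeff_hom rf_const"
  unfolding rf_const_def
  using coeff_hom_comp[OF coeff_hom_to_fract mconst.coeff_hom_axioms] by (simp add: comp_def)

lemma coeff_hom_to_ac: "coeff_hom to_ac"
  by (simp add: coeff_hom_def)

lemma coeff_hom_const_poly: "coeff_hom (\<lambda>c. [:c:])"
  by (simp add: coeff_hom_def one_pCons)

lemma coeff_hom_poly: "coeff_hom (\<lambda>p. poly p x)"
  by (simp add: coeff_hom_def)

lemma coeff_hom_map_poly: "coeff_hom h \<Longrightarrow> coeff_hom (map_poly h)"
  unfolding coeff_hom_def[of "map_poly h"]
  by (intro conjI allI poly_eqI)
     (auto simp: coeff_map_poly coeff_hom.hom_zero coeff_hom.hom_add coeff_hom.hom_mult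
       coeff_mult coeff_hom_sum map_poly_1' coeff_hom.hom_one)

lemma coeff_hom_poly_map: "coeff_hom h \<Longrightarrow> h (poly p x) = poly (map_poly h p) (h x)"
  by (induction p) (auto simp: map_poly_pCons coeff_hom.hom_zero coeff_hom.hom_add coeff_hom.hom_mult)

lemma map_poly_comp_coeff_hom:
  "coeff_hom f \<Longrightarrow> coeff_hom g \<Longrightarrow> map_poly f (map_poly g p) = map_poly (f \<circ> g) p"
  by (rule poly_eqI) (simp add: coeff_map_poly coeff_hom.hom_zero)

text \<open>Changes of coefficients, renamings and substitutions are all evaluations, so this one
  rule lets homomorphisms pass through each of them.\<close>

lemma meval_hom:
  assumes "coeff_hom \<phi>"
  shows "\<phi> (meval h v p) = meval (\<phi> \<circ> h) (\<phi> \<circ> v) p"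
  by (simp add: meval_def monom_eval_def coeff_hom_sum[OF assms] coeff_hom.hom_mult[OF assms]
      coeff_hom_prod[OF assms] coeff_hom_power[OF assms])

lemma coeff_hom_meval: "coeff_hom h \<Longrightarrow> coeff_hom (meval h v)"
  by (simp add: coeff_hom_def[of "meval h v"] coeff_hom.meval_add coeff_hom.meval_mult coeff_hom.meval_1)

section \<open>Polynomials in a given set of variables\<close>

definition vars_in :: "'i set \<Rightarrow> ('i, 'a :: comm_ring_1) mpoly set" where
  "vars_in V = {p. \<forall>m. mcoeff p m \<noteq> 0 \<longrightarrow> Poly_Mapping.keys m \<subseteq> V}"

lemma keys_mapping_of: "m \<in> Poly_Mapping.keys (mapping_of p) \<longleftrightarrow> mcoeff p m \<noteq> 0"
  by (simp add: mcoeff_def in_keys_iff)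

lemma mconst_vars_in [simp]: "mconst c \<in> vars_in V"
  by (auto simp: vars_in_def mconst_def mcoeff_monom)

lemma mvar_vars_in: "i \<in> V \<Longrightarrow> mvar i \<in> vars_in V"
  by (auto simp: vars_in_def mvar_def mcoeff_monom split: if_splits)

lemma add_vars_in: "p \<in> vars_in V \<Longrightarrow> q \<in> vars_in V \<Longrightarrow> p + q \<in> vars_in V"
  unfolding vars_in_def by simp (metis add.right_neutral)

lemma sum_vars_in: "(\<And>x. x \<in> A \<Longrightarrow> f x \<in> vars_in V) \<Longrightarrow> sum f A \<in> vars_in V"
proof (induction A rule: infinite_finite_induct)
  case (insert x F)
  then show ?case by (simp add: add_vars_in)
qed (auto simp: vars_in_def)

lemma mult_vars_in:
  assumes "p \<in> vars_in V" "q \<in> vars_in V"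
  shows "p * q \<in> vars_in V"
proof -
  have "p * q = (\<Sum>m\<in>Poly_Mapping.keys (mapping_of p). \<Sum>m'\<in>Poly_Mapping.keys (mapping_of q).
      mmonom (m + m') (mcoeff p m * mcoeff q m'))"
    unfolding mmonom_mult[symmetric] sum_product[symmetric]
    by (rule arg_cong2[where f = "(*)", OF mpoly_sum_monoms mpoly_sum_monoms])
  also have "\<dots> \<in> vars_in V"
  proof (intro sum_vars_in)
    fix m m' assume "m \<in> Poly_Mapping.keys (mapping_of p)" "m' \<in> Poly_Mapping.keys (mapping_of q)"
    then have "Poly_Mapping.keys m \<subseteq> V" "Poly_Mapping.keys m' \<subseteq> V"
      using assms by (auto simp: vars_in_def keys_mapping_of)
    then have "Poly_Mapping.keys (m + m') \<subseteq> V"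
      using keys_add[of m m'] by blast
    then show "mmonom (m + m') (mcoeff p m * mcoeff q m') \<in> vars_in V"
      by (auto simp: vars_in_def mcoeff_monom)
  qed
  finally show ?thesis .
qed

lemma minus_vars_in: "p \<in> vars_in V \<Longrightarrow> - p \<in> vars_in V"
  using mult_vars_in[OF mconst_vars_in[of "- 1"], of p V]
  by (simp add: coeff_hom_minus[OF mconst.coeff_hom_axioms] mconst.hom_one)

text \<open>\<open>meval mconst mvar p\<close> rebuilds p from constants and the variables that
  occur in it by sums, products and powers, so a property only has to survive these
  operations.\<close>

lemma vars_in_induct [consumes 1, case_names const var add mult]:
  assumes "p \<in> vars_in V"
    and const: "\<And>c. P (mconst c)" and var: "\<And>i. i \<in> V \<Longrightarrow> P (mvar i)"
    and add: "\<And>p q. p \<in> vars_in V \<Longrightarrow> q \<in> vars_in V \<Longrightarrow> P p \<Longrightarrow> P q \<Longrightarrow> P (p + q)"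
    and mult: "\<And>p q. p \<in> vars_in V \<Longrightarrow> q \<in> vars_in V \<Longrightarrow> P p \<Longrightarrow> P q \<Longrightarrow> P (p * q)"
  shows "P p"
proof -
  let ?Q = "\<lambda>p. p \<in> vars_in V \<and> P p"
  have one: "?Q 1"
    using const[of 1] mconst_vars_in[of 1 V] by (simp add: mconst.hom_one)
  have power: "?Q (x ^ n)" if "?Q x" for x n
    using that one by (induction n) (auto intro: mult mult_vars_in)
  have prod: "?Q (prod f A)" if "\<And>x. x \<in> A \<Longrightarrow> ?Q (f x)" for f :: "'a \<Rightarrow> _" and A
    using that one by (induction A rule: infinite_finite_induct) (auto intro: mult mult_vars_in)
  have sum: "?Q (sum f A)" if "\<And>x. x \<in> A \<Longrightarrow> ?Q (f x)" for f :: "('a \<Rightarrow>\<^sub>0 nat) \<Rightarrow> _" and A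
    using that const[of 0] mconst_vars_in[of 0 V]
    by (induction A rule: infinite_finite_induct) (auto intro: add add_vars_in simp: mconst.hom_zero)
  have "?Q (meval mconst mvar p)"
    unfolding meval_def monom_eval_def
  proof (rule sum)
    fix m assume "m \<in> Poly_Mapping.keys (mapping_of p)"
    then have "Poly_Mapping.keys m \<subseteq> V"
      using assms(1) by (auto simp: vars_in_def keys_mapping_of)
    then have "?Q (\<Prod>i\<in>Poly_Mapping.keys m. mvar i ^ Poly_Mapping.lookup m i)"
      by (intro prod power) (auto intro: var mvar_vars_in)
    then show "?Q (mconst (mcoeff p m) * (\<Prod>i\<in>Poly_Mapping.keys m. mvar i ^ Poly_Mapping.lookup m i))"
      using const by (auto intro: mult mult_vars_in)
  qed
  then show ?thesis using mpoly_as_meval[of p] by simp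
qed

lemma vars_in_mono: "V \<subseteq> W \<Longrightarrow> vars_in V \<subseteq> vars_in W"
  by (auto simp: vars_in_def)

lemma vars_in_UNIV [simp]: "p \<in> vars_in UNIV"
  by (simp add: vars_in_def)

lemma finite_vars: "\<exists>V. finite V \<and> p \<in> vars_in V"
  by (rule exI[of _ "\<Union>m\<in>Poly_Mapping.keys (mapping_of p). Poly_Mapping.keys m"])
     (auto simp: vars_in_def keys_mapping_of)

lemma meval_cong_vars:
  assumes "coeff_hom h" "p \<in> vars_in V" "\<And>i. i \<in> V \<Longrightarrow> v i = w i"
  shows "meval h v p = meval h w p"
  using assms(2)
  by (induction rule: vars_in_induct)
     (use assms in \<open>auto simp: coeff_hom.meval_add coeff_hom.meval_mult coeff_hom.meval_const coeff_hom.meval_var\<close>)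

lemma vars_in_empty: "p \<in> vars_in {} \<Longrightarrow> \<exists>c. p = mconst c"
proof (induction rule: vars_in_induct)
  case (add p q)
  then show ?case by (metis mconst.hom_add)
next
  case (mult p q)
  then show ?case by (metis mconst.hom_mult)
qed auto

text \<open>Splits off the variable j; induction over a finite set of variables thereby turns into
  arguments about univariate polynomials over a smaller ring.\<close>

lemma vars_in_insert_poly:
  assumes "p \<in> vars_in (insert j V)"
  shows "\<exists>f. (\<forall>i. coeff f i \<in> vars_in V) \<and> poly f (mvar j) = p"
proof -
  have zero: "0 \<in> vars_in V" for V
    by (simp add: vars_in_def)
  show ?thesis
    using assms
  proof (induction rule: vars_in_induct)
    case (const c)
    show ?case
      by (rule exI[of _ "[:mconst c:]"]) (auto simp: coeff_pCons zero split: nat.split)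
  next
    case (var i)
    show ?case
    proof (cases "i = j")
      case True
      then show ?thesis
        using mconst_vars_in[of 1 V]
        by (intro exI[of _ "[:0, 1:]"]) (auto simp: coeff_pCons zero mconst.hom_one split: nat.split)
    next
      case False
      then show ?thesis
        using var by (intro exI[of _ "[:mvar i:]"]) (auto simp: coeff_pCons zero mvar_vars_in split: nat.split)
    qed
  next
    case (add p q)
    then obtain f g where "\<forall>i. coeff f i \<in> vars_in V" "poly f (mvar j) = p"
      "\<forall>i. coeff g i \<in> vars_in V" "poly g (mvar j) = q" by blast
    then show ?case
      by (intro exI[of _ "f + g"]) (auto simp: add_vars_in)
  next
    case (mult p q)
    then obtain f g where "\<forall>i. coeff f i \<in> vars_in V" "poly f (mvar j) = p"
      "\<forall>i. coeff g i \<in> vars_in V" "poly g (mvar j) = q" by blast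
    then show ?case
      by (intro exI[of _ "f * g"]) (auto simp: mult_vars_in coeff_mult intro!: sum_vars_in)
  qed
qed

lemma poly_mvar_vars_in:
  assumes "\<And>i. coeff f i \<in> vars_in V"
  shows "poly f (mvar j) \<in> vars_in (insert j V)"
proof -
  have 1: "1 \<in> vars_in (insert j V)"
    using mconst_vars_in[of 1 "insert j V"] by (simp add: mconst.hom_one)
  have "mvar j ^ n \<in> vars_in (insert j V)" for n
    using 1 by (induction n) (auto intro: mult_vars_in mvar_vars_in)
  then show ?thesis
    unfolding poly_altdef
    using assms vars_in_mono[of V "insert j V"] by (intro sum_vars_in mult_vars_in) auto
qed

text \<open>The substitution \<open>\<Phi>\<close> sends \<open>mvar j\<close> to the indeterminate
  and every other variable to itself as a constant polynomial, so it recovers f from its value at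
  \<open>mvar j\<close>.\<close>

lemma poly_mvar_eq_0:
  fixes f :: "('i, 'a :: comm_ring_1) mpoly poly"
  assumes "\<And>i. coeff f i \<in> vars_in V" "j \<notin> V" "poly f (mvar j) = 0"
  shows "f = 0"
proof -
  define \<Phi> :: "('i, 'a) mpoly \<Rightarrow> ('i, 'a) mpoly poly"
    where "\<Phi> = meval (\<lambda>c. [:mconst c:]) (\<lambda>i. if i = j then [:0, 1:] else [:mvar i:])"
  have h: "coeff_hom (\<lambda>c. [:mconst c :: ('i, 'a) mpoly:])"
    using coeff_hom_comp[OF coeff_hom_const_poly mconst.coeff_hom_axioms] by (simp add: comp_def)
  then have \<Phi>: "coeff_hom \<Phi>"
    unfolding \<Phi>_def by (rule coeff_hom_meval)
  have const: "\<Phi> c = [:c:]" if "c \<in> vars_in V" for c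
    using that
    by (induction rule: vars_in_induct)
       (use assms(2) in \<open>auto simp: \<Phi>_def coeff_hom.meval_const[OF h] coeff_hom.meval_var[OF h]
         coeff_hom.hom_add[OF \<Phi>, unfolded \<Phi>_def] coeff_hom.hom_mult[OF \<Phi>, unfolded \<Phi>_def]\<close>)
  have "\<Phi> (poly f (mvar j)) = (\<Sum>i\<le>degree f. \<Phi> (coeff f i) * \<Phi> (mvar j) ^ i)"
    by (simp add: poly_altdef coeff_hom_sum[OF \<Phi>] coeff_hom.hom_mult[OF \<Phi>] coeff_hom_power[OF \<Phi>])
  also have "\<dots> = (\<Sum>i\<le>degree f. monom (coeff f i) i)"
    using assms(1) by (simp add: const monom_altdef) (simp add: \<Phi>_def coeff_hom.meval_var[OF h])
  also have "\<dots> = f"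
    by (rule poly_as_sum_of_monoms)
  finally show ?thesis
    using assms(3) coeff_hom.hom_zero[OF \<Phi>] by simp
qed

lemma poly_nonroot_nat:
  fixes f :: "'a :: {idom, ring_char_0} poly"
  assumes "f \<noteq> 0"
  shows "\<exists>n :: nat. poly f (of_nat n) \<noteq> 0"
proof (rule ccontr)
  assume "\<not> ?thesis"
  then have "range (of_nat :: nat \<Rightarrow> 'a) \<subseteq> {x. poly f x = 0}" by auto
  then have "finite (range (of_nat :: nat \<Rightarrow> 'a))"
    using poly_roots_finite[OF assms] finite_subset by blast
  then show False
    using finite_imageD[of "of_nat :: nat \<Rightarrow> 'a" UNIV] inj_of_nat by auto
qed

text \<open>Choose the other coordinates so that the leading coefficient in the variable j survives;
  then only finitely many values for j are excluded. Natural numbers serve as coordinates because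
  every homomorphism fixes them.\<close>

lemma mpoly_nonroot_nat:
  fixes h :: "'a :: comm_ring_1 \<Rightarrow> 'b :: {idom, ring_char_0}"
  assumes h: "coeff_hom h" "\<And>c. h c = 0 \<Longrightarrow> c = 0" and "p \<noteq> 0"
  shows "\<exists>u :: 'i \<Rightarrow> nat. meval h (\<lambda>i. of_nat (u i)) p \<noteq> 0"
proof -
  obtain V where "finite V" "p \<in> vars_in V"
    using finite_vars by blast
  then show ?thesis
    using \<open>p \<noteq> 0\<close>
  proof (induction V arbitrary: p rule: finite_induct)
    case empty
    then obtain c where "p = mconst c" using vars_in_empty by blast
    then show ?case
      using h(1) h(2)[of c] empty(2) by (auto simp: coeff_hom.meval_const mconst.hom_zero)
  next
    case (insert j V)
    obtain f where f: "\<forall>i. coeff f i \<in> vars_in V" "poly f (mvar j) = p"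
      using vars_in_insert_poly[OF insert.prems(1)] by blast
    then have "f \<noteq> 0" using insert.prems by auto
    then obtain u where u: "meval h (\<lambda>i. of_nat (u i)) (lead_coeff f) \<noteq> 0"
      using insert.IH[of "lead_coeff f"] f by auto
    let ?e = "meval h (\<lambda>i. of_nat (u i))"
    have e: "coeff_hom ?e" using h(1) by (rule coeff_hom_meval)
    have "map_poly ?e f \<noteq> 0"
      using u coeff_hom.hom_zero[OF e]
      by (auto dest!: arg_cong[where f = "\<lambda>q. coeff q (degree f)"] simp: coeff_map_poly)
    then obtain n where n: "poly (map_poly ?e f) (of_nat n) \<noteq> 0"
      using poly_nonroot_nat by blast
    let ?u = "u(j := n)"
    let ?e' = "meval h (\<lambda>i. of_nat (?u i))"
    have e': "coeff_hom ?e'" using h(1) by (rule coeff_hom_meval)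
    \<comment> \<open>The coefficients of f do not involve j, so the new coordinate does not affect
      them.\<close>
    have "map_poly ?e' f = map_poly ?e f"
    proof (rule poly_eqI)
      show "coeff (map_poly ?e' f) i = coeff (map_poly ?e f) i" for i
        using f(1) insert.hyps(2) coeff_hom.hom_zero[OF e] coeff_hom.hom_zero[OF e']
        by (simp add: coeff_map_poly) (rule meval_cong_vars[OF h(1), of _ V]; auto)
    qed
    then have "?e' p = poly (map_poly ?e f) (of_nat n)"
      using f(2) coeff_hom_poly_map[OF e', of f "mvar j"] by (simp add: coeff_hom.meval_var[OF h(1)])
    then show ?case using n by (intro exI[of _ ?u]) simp
  qed
qed

section \<open>Values of rational functions at points\<close>

definition has_val ::
    "('a :: idom \<Rightarrow> 'b :: field) \<Rightarrow> ('i \<Rightarrow> 'b) \<Rightarrow> ('i, 'a) mpoly fract \<Rightarrow> 'b \<Rightarrow> bool" where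
  "has_val h v r c \<longleftrightarrow>
     (\<exists>A B. B \<noteq> 0 \<and> r = Fract A B \<and> meval h v B \<noteq> 0 \<and> c = meval h v A / meval h v B)"

text \<open>A point may be a pole. The relation \<open>has_val\<close> asks for one representation
  with nonvanishing denominator, so values of sums and products need no lowest terms;
  \<open>rf_eval\<close> is meaningful only where such a value exists.\<close>

definition rf_eval :: "('a :: idom \<Rightarrow> 'b :: field) \<Rightarrow> ('i \<Rightarrow> 'b) \<Rightarrow> ('i, 'a) mpoly fract \<Rightarrow> 'b" where
  "rf_eval h v r = (THE c. has_val h v r c)"

context
  fixes h :: "'a :: idom \<Rightarrow> 'b :: field"
  assumes h: "coeff_hom h"
begin

lemma has_val_Fract:
  assumes "meval h v B \<noteq> 0" "c * meval h v B = meval h v A"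
  shows "has_val h v (Fract A B) c"
  using assms coeff_hom.meval_0[OF h]
  unfolding has_val_def by (intro exI[of _ A] exI[of _ B]) (auto simp: field_simps)

lemma has_val_unique:
  assumes "has_val h v r c" "has_val h v r d"
  shows "c = d"
proof -
  obtain A B C D where *: "B \<noteq> 0" "r = Fract A B" "meval h v B \<noteq> 0" "c = meval h v A / meval h v B"
    "D \<noteq> 0" "r = Fract C D" "meval h v D \<noteq> 0" "d = meval h v C / meval h v D"
    using assms unfolding has_val_def by blast
  then have "A * D = C * B" by (simp add: eq_fract)
  then have "meval h v A * meval h v D = meval h v C * meval h v B"
    by (simp flip: coeff_hom.meval_mult[OF h])
  then show ?thesis using * by (simp add: frac_eq_eq)
qed

lemma rf_eval_eq: "has_val h v r c \<Longrightarrow> rf_eval h v r = c"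
  unfolding rf_eval_def by (rule the_equality) (auto intro: has_val_unique)

lemma has_val_to_fract: "has_val h v (to_fract p) (meval h v p)"
  unfolding to_fract_def by (rule has_val_Fract) (simp_all add: coeff_hom.meval_1[OF h])

lemma has_val_add:
  assumes "has_val h v r c" "has_val h v s d"
  shows "has_val h v (r + s) (c + d)"
proof -
  obtain A B C D where *: "B \<noteq> 0" "r = Fract A B" "meval h v B \<noteq> 0" "c = meval h v A / meval h v B"
    "D \<noteq> 0" "s = Fract C D" "meval h v D \<noteq> 0" "d = meval h v C / meval h v D"
    using assms unfolding has_val_def by blast
  then have "r + s = Fract (A * D + C * B) (B * D)" by simp
  moreover have "has_val h v (Fract (A * D + C * B) (B * D)) (c + d)"
    using * by (intro has_val_Fract) (simp_all add: coeff_hom.meval_mult[OF h] coeff_hom.meval_add[OF h] add_frac_eq)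
  ultimately show ?thesis by simp
qed

lemma has_val_mult:
  assumes "has_val h v r c" "has_val h v s d"
  shows "has_val h v (r * s) (c * d)"
proof -
  obtain A B C D where *: "B \<noteq> 0" "r = Fract A B" "meval h v B \<noteq> 0" "c = meval h v A / meval h v B"
    "D \<noteq> 0" "s = Fract C D" "meval h v D \<noteq> 0" "d = meval h v C / meval h v D"
    using assms unfolding has_val_def by blast
  then have "r * s = Fract (A * C) (B * D)" by simp
  moreover have "has_val h v (Fract (A * C) (B * D)) (c * d)"
    using * by (intro has_val_Fract) (simp_all add: coeff_hom.meval_mult[OF h])
  ultimately show ?thesis by simp
qed

lemma has_val_inverse:
  assumes "has_val h v r c" "c \<noteq> 0"
  shows "has_val h v (inverse r) (inverse c)"
proof -
  obtain A B where *: "B \<noteq> 0" "r = Fract A B" "meval h v B \<noteq> 0" "c = meval h v A / meval h v B"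
    using assms unfolding has_val_def by blast
  then have "has_val h v (Fract B A) (inverse c)"
    using assms(2) by (intro has_val_Fract) auto
  then show ?thesis using * by simp
qed

lemma has_val_const: "has_val h v (to_fract (mconst c)) (h c)"
  using has_val_to_fract[of v "mconst c"] by (simp add: coeff_hom.meval_const[OF h])

lemma has_val_1: "has_val h v 1 1"
  using has_val_to_fract[of v 1] by (simp add: coeff_hom.meval_1[OF h])

lemma has_val_minus: "has_val h v r c \<Longrightarrow> has_val h v (- r) (- c)"
  using has_val_mult[of v "- 1" "- 1" r c] has_val_to_fract[of v "- 1"]
  by (simp add: coeff_hom_minus[OF coeff_hom_meval[OF h]] coeff_hom.meval_1[OF h])

lemma has_val_power: "has_val h v r c \<Longrightarrow> has_val h v (r ^ n) (c ^ n)"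
  by (induction n) (auto intro: has_val_1 has_val_mult)

end

lemma mcoeff_meval_mconst:
  fixes a :: "'a :: comm_ring_1 \<Rightarrow> 'b :: comm_ring_1" and p :: "('i, 'a) mpoly"
  assumes "coeff_hom a"
  shows "mcoeff (meval (mconst \<circ> a) mvar p) m = a (mcoeff p m)"
proof -
  have sum: "mcoeff (sum f A) m = (\<Sum>x\<in>A. mcoeff (f x) m)"
    for f :: "_ \<Rightarrow> ('i, 'b) mpoly" and A :: "('i \<Rightarrow>\<^sub>0 nat) set"
    by (induction A rule: infinite_finite_induct) auto
  show ?thesis
    by (simp add: meval_def monom_eval_mvar sum mconst_def mmonom_mult mcoeff_monom when_def
        keys_mapping_of coeff_hom.hom_zero[OF assms])
qed

text \<open>Renaming back by the inverse permutation leaves a acting on the coefficients alone, and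
  a has trivial kernel.\<close>

lemma meval_perm_eq_0:
  fixes a :: "'a :: comm_ring_1 \<Rightarrow> 'b :: comm_ring_1"
  assumes a: "coeff_hom a" "\<And>c. a c = 0 \<Longrightarrow> c = 0" and \<pi>: "bij \<pi>"
    and "meval (mconst \<circ> a) (mvar \<circ> \<pi>) p = 0"
  shows "p = 0"
proof -
  have r: "coeff_hom (mrename (inv_into UNIV \<pi>))"
    by (simp add: coeff_hom_def mrename_simps)
  have "mrename (inv_into UNIV \<pi>) (meval (mconst \<circ> a) (mvar \<circ> \<pi>) p) = meval (mconst \<circ> a) mvar p"
    unfolding meval_hom[OF r] using \<pi> by (simp add: comp_def mrename_simps bij_is_inj)
  then have "meval (mconst \<circ> a) mvar p = 0"
    using assms(4) by (simp add: mrename_simps)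
  then have "a (mcoeff p m) = 0" for m
    using mcoeff_meval_mconst[OF a(1), of p m] by simp
  then show "p = 0"
    using a(2) by (intro mpoly_eqI) simp
qed

text \<open>No denominator vanishes at such a point, so evaluation is a homomorphism on the whole
  field of fractions. Coefficient maps combined with permutations of the variables are of this
  kind.\<close>

locale inj_eval =
  fixes h :: "'a :: idom \<Rightarrow> 'b :: field" and v :: "'i \<Rightarrow> 'b"
  assumes hom: "coeff_hom h" and nz: "meval h v p = 0 \<Longrightarrow> p = 0"
begin

lemma has_val_rf_eval: "has_val h v r (rf_eval h v r)"
proof -
  obtain A B where "B \<noteq> 0" "r = Fract A B"
    by (cases r) auto
  then have "has_val h v r (meval h v A / meval h v B)"
    unfolding has_val_def using nz by blast
  then show ?thesis using rf_eval_eq[OF hom] by metis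
qed

lemma coeff_hom_rf_eval: "coeff_hom (rf_eval h v)"
  unfolding coeff_hom_def
  by (intro conjI allI rf_eval_eq[OF hom] has_val_add[OF hom] has_val_mult[OF hom] has_val_1[OF hom]
      has_val_rf_eval)

lemma rf_eval_to_fract: "rf_eval h v (to_fract p) = meval h v p"
  by (intro rf_eval_eq[OF hom] has_val_to_fract[OF hom])

lemma rf_eval_const: "rf_eval h v (to_fract (mconst c)) = h c"
  by (intro rf_eval_eq[OF hom] has_val_const[OF hom])

lemma rf_eval_var: "rf_eval h v (to_fract (mvar i)) = v i"
  by (simp add: rf_eval_to_fract coeff_hom.meval_var[OF hom])

end

lemma inj_eval_perm:
  fixes a :: "'a :: field \<Rightarrow> 'b :: field" and \<pi> :: "'i \<Rightarrow> 'j"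
  assumes "coeff_hom a" "bij \<pi>"
  shows "inj_eval (rf_const \<circ> a) (rf_var \<circ> \<pi>)"
proof (rule inj_eval.intro)
  show "coeff_hom (rf_const \<circ> a)"
    by (intro coeff_hom_comp coeff_hom_rf_const assms)
  have "(rf_const :: 'b \<Rightarrow> ('j, 'b) ratfun) \<circ> a = to_fract \<circ> (mconst \<circ> a)" "(rf_var :: 'j \<Rightarrow> ('j, 'b) ratfun) \<circ> \<pi> = to_fract \<circ> (mvar \<circ> \<pi>)"
    by (auto simp: rf_const_def rf_var_def)
  then have "meval (rf_const \<circ> a) (rf_var \<circ> \<pi>) p = to_fract (meval (mconst \<circ> a) (mvar \<circ> \<pi>) p)" for p
    by (simp only: meval_hom[OF coeff_hom_to_fract])
  then show "meval (rf_const \<circ> a) (rf_var \<circ> \<pi>) p = 0 \<Longrightarrow> p = 0" for p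
    using meval_perm_eq_0[OF assms(1) _ assms(2)] coeff_hom_eq_0_iff[OF assms(1)] by simp
qed

section \<open>Unique factorisation\<close>

text \<open>
  The rings are subsets of a surrounding domain, because the number of variables varies in the
  induction below.
\<close>

definition subdomain :: "'a :: idom set \<Rightarrow> bool" where
  "subdomain A \<longleftrightarrow> 1 \<in> A \<and> (\<forall>a\<in>A. \<forall>b\<in>A. a + b \<in> A \<and> a * b \<in> A \<and> - a \<in> A)"

definition dvd_in :: "'a :: idom set \<Rightarrow> 'a \<Rightarrow> 'a \<Rightarrow> bool" where
  "dvd_in A a b \<longleftrightarrow> (\<exists>c\<in>A. b = a * c)"

definition prime_in :: "'a :: idom set \<Rightarrow> 'a \<Rightarrow> bool" where
  "prime_in A p \<longleftrightarrow> p \<in> A \<and> p \<noteq> 0 \<and> \<not> dvd_in A p 1 \<and>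
     (\<forall>a\<in>A. \<forall>b\<in>A. dvd_in A p (a * b) \<longrightarrow> dvd_in A p a \<or> dvd_in A p b)"

text \<open>The index counts the prime factors; it is the measure by which the induction in
  \<open>primitive_part\<close> terminates.\<close>

inductive factors_in :: "'a :: idom set \<Rightarrow> nat \<Rightarrow> 'a \<Rightarrow> bool" for A where
  unit: "u \<in> A \<Longrightarrow> dvd_in A u 1 \<Longrightarrow> factors_in A 0 u"
| prime: "prime_in A p \<Longrightarrow> factors_in A n a \<Longrightarrow> factors_in A (Suc n) (p * a)"

text \<open>The factors are prime and not merely irreducible, so existence of factorisations already
  implies their uniqueness up to units.\<close>

definition ufd :: "'a :: idom set \<Rightarrow> bool" where
  "ufd A \<longleftrightarrow> subdomain A \<and> (\<forall>a\<in>A. a \<noteq> 0 \<longrightarrow> (\<exists>n. factors_in A n a))"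

locale subdomain_locale =
  fixes A :: "'a :: idom set"
  assumes subdomain: "subdomain A"
begin

lemma closed [intro, simp]:
  "1 \<in> A" "0 \<in> A" "a \<in> A \<Longrightarrow> b \<in> A \<Longrightarrow> a + b \<in> A" "a \<in> A \<Longrightarrow> b \<in> A \<Longrightarrow> a * b \<in> A"
  "a \<in> A \<Longrightarrow> - a \<in> A"
  using subdomain unfolding subdomain_def by (blast, metis add.right_inverse, blast+)

lemma diff_closed [intro, simp]: "a \<in> A \<Longrightarrow> b \<in> A \<Longrightarrow> a - b \<in> A"
  using closed(3)[of a "- b"] by simp

lemma power_closed [intro, simp]: "a \<in> A \<Longrightarrow> a ^ n \<in> A"
  by (induction n) auto

lemma sum_closed: "(\<And>x. x \<in> S \<Longrightarrow> f x \<in> A) \<Longrightarrow> sum f S \<in> A"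
  by (induction S rule: infinite_finite_induct) auto

lemma dvd_in_refl: "dvd_in A a a"
  unfolding dvd_in_def by (rule bexI[of _ 1]) auto

lemma dvd_in_trans: "dvd_in A a b \<Longrightarrow> dvd_in A b c \<Longrightarrow> dvd_in A a c"
  unfolding dvd_in_def by (metis closed(4) mult.assoc)

lemma dvd_in_mult: "dvd_in A a b \<Longrightarrow> c \<in> A \<Longrightarrow> dvd_in A a (b * c)"
  unfolding dvd_in_def by (metis closed(4) mult.assoc)

lemma factors_in_closed: "factors_in A n a \<Longrightarrow> a \<in> A \<and> a \<noteq> 0"
proof (induction rule: factors_in.induct)
  case (unit u)
  then show ?case by (auto simp: dvd_in_def)
next
  case (prime p n a)
  then show ?case by (auto simp: prime_in_def)
qed

lemma factors_in_unit_mult: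
  assumes "factors_in A n a" "u \<in> A" "dvd_in A u 1"
  shows "factors_in A n (u * a)"
  using assms(1)
proof (induction rule: factors_in.induct)
  case (unit v)
  then obtain c d where "c \<in> A" "d \<in> A" "1 = u * c" "1 = v * d"
    using assms(3) by (auto simp: dvd_in_def)
  then have "1 = (u * v) * (c * d)"
    by (metis mult.assoc mult.left_commute mult_1)
  then have "dvd_in A (u * v) 1"
    using \<open>c \<in> A\<close> \<open>d \<in> A\<close> unfolding dvd_in_def by blast
  then show ?case
    using unit assms by (intro factors_in.unit) auto
next
  case (prime p n a)
  then show ?case
    using factors_in.prime[OF prime(1) prime(3)] by (simp add: mult.left_commute)
qed

lemma factors_in_mult: "factors_in A n a \<Longrightarrow> factors_in A k b \<Longrightarrow> factors_in A (n + k) (a * b)"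
proof (induction rule: factors_in.induct)
  case (unit u)
  then show ?case by (simp add: factors_in_unit_mult)
next
  case (prime p n a)
  then show ?case by (simp add: factors_in.prime mult.assoc)
qed

lemma prime_dvd_unit: "prime_in A p \<Longrightarrow> u \<in> A \<Longrightarrow> dvd_in A u 1 \<Longrightarrow> \<not> dvd_in A p u"
  using dvd_in_trans unfolding prime_in_def by blast

text \<open>Either q divides the first prime factor, and then differs from it by a unit, or it
  divides the rest. The exact drop of the count by one is what the induction in
  \<open>primitive_part\<close> uses.\<close>

lemma factors_in_divide_prime:
  assumes "factors_in A n a" "prime_in A q" "dvd_in A q a"
  shows "\<exists>k b. n = Suc k \<and> a = q * b \<and> factors_in A k b"
  using assms
proof (induction rule: factors_in.induct)
  case (unit u)
  then show ?case using prime_dvd_unit by blast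
next
  case (prime p n a)
  have pa: "p \<in> A" "a \<in> A" "p \<noteq> 0"
    using prime factors_in_closed by (auto simp: prime_in_def)
  consider "dvd_in A q p" | "dvd_in A q a"
    using prime pa unfolding prime_in_def by blast
  then show ?case
  proof cases
    case 1
    then obtain c where c: "c \<in> A" "p = q * c" by (auto simp: dvd_in_def)
    have q: "q \<in> A" "q \<noteq> 0" using prime(4) by (auto simp: prime_in_def)
    have "dvd_in A p (q * c)" using c dvd_in_refl by simp
    then have "dvd_in A p q \<or> dvd_in A p c"
      using prime(1) q c unfolding prime_in_def by blast
    moreover have "\<not> dvd_in A p c"
    proof
      assume "dvd_in A p c"
      then obtain d where d: "d \<in> A" "c = p * d" by (auto simp: dvd_in_def)
      have "p * (q * d) = p * 1" by (metis c(2) d(2) mult.left_commute mult.right_neutral)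
      then have "q * d = 1" using pa(3) by (subst (asm) mult_cancel_left) simp
      then have "dvd_in A q 1" using d unfolding dvd_in_def by metis
      then show False using prime(4) by (simp add: prime_in_def)
    qed
    ultimately obtain d where d: "d \<in> A" "q = p * d" by (auto simp: dvd_in_def)
    have "q * (c * d) = q * 1" by (metis c(2) d(2) mult.assoc mult.right_neutral)
    then have "c * d = 1" using q(2) by (subst (asm) mult_cancel_left) simp
    then have "dvd_in A c 1" using d unfolding dvd_in_def by metis
    then have "factors_in A n (c * a)"
      using c prime by (intro factors_in_unit_mult) auto
    then show ?thesis using c by (intro exI[of _ n] exI[of _ "c * a"]) (simp add: mult.assoc)
  next
    case 2
    then obtain k b where "n = Suc k" "a = q * b" "factors_in A k b"
      using prime by blast
    moreover from this have "factors_in A n (p * b)"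
      using prime(1) factors_in.prime by blast
    ultimately show ?thesis
      by (intro exI[of _ n] exI[of _ "p * b"]) (simp add: mult.left_commute)
  qed
qed

end

subsection \<open>Gauss's lemma\<close>

definition polys_over :: "'a :: idom set \<Rightarrow> 'a poly set" where
  "polys_over A = {f. \<forall>i. coeff f i \<in> A}"

locale ufd_locale = subdomain_locale +
  assumes factors: "a \<in> A \<Longrightarrow> a \<noteq> 0 \<Longrightarrow> \<exists>n. factors_in A n a"
begin

lemma polys_over_closed:
  "f \<in> polys_over A \<Longrightarrow> g \<in> polys_over A \<Longrightarrow> f + g \<in> polys_over A"
  "f \<in> polys_over A \<Longrightarrow> g \<in> polys_over A \<Longrightarrow> f * g \<in> polys_over A"
  "f \<in> polys_over A \<Longrightarrow> - f \<in> polys_over A"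
  "a \<in> A \<Longrightarrow> [:a:] \<in> polys_over A"
  by (auto simp: polys_over_def coeff_mult coeff_pCons intro!: sum_closed split: nat.split)

lemma const_polys_over_iff: "[:a:] \<in> polys_over A \<longleftrightarrow> a \<in> A"
  using polys_over_closed(4) by (auto simp: polys_over_def dest: spec[of _ 0])

lemma subdomain_polys_over: "subdomain (polys_over A)"
  unfolding subdomain_def using polys_over_closed polys_over_closed(4)[of 1] by (auto simp: one_pCons)

sublocale P: subdomain_locale "polys_over A"
  by unfold_locales (rule subdomain_polys_over)

lemma smult_polys_over: "a \<in> A \<Longrightarrow> f \<in> polys_over A \<Longrightarrow> smult a f \<in> polys_over A"
  by (auto simp: polys_over_def)

lemma monom_polys_over: "a \<in> A \<Longrightarrow> monom a n \<in> polys_over A"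
  by (auto simp: polys_over_def)

lemma lead_coeff_in: "f \<in> polys_over A \<Longrightarrow> lead_coeff f \<in> A"
  by (auto simp: polys_over_def)

lemma dvd_const_iff:
  assumes "f \<in> polys_over A"
  shows "dvd_in (polys_over A) [:a:] f \<longleftrightarrow> (\<forall>i. dvd_in A a (coeff f i))"
proof
  assume "dvd_in (polys_over A) [:a:] f"
  then show "\<forall>i. dvd_in A a (coeff f i)"
    by (auto simp: dvd_in_def polys_over_def)
next
  assume "\<forall>i. dvd_in A a (coeff f i)"
  then obtain c where c: "\<And>i. c i \<in> A" "\<And>i. coeff f i = a * c i"
    unfolding dvd_in_def by metis
  define g where "g = (\<Sum>i\<le>degree f. monom (c i) i)"
  have "g \<in> polys_over A"
    unfolding g_def by (intro P.sum_closed monom_polys_over c)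
  moreover have "f = smult a g"
    by (rule poly_eqI) (auto simp: g_def coeff_sum coeff_eq_0 simp flip: c(2))
  ultimately show "dvd_in (polys_over A) [:a:] f"
    unfolding dvd_in_def by auto
qed

text \<open>Let i and j be the first positions at which the coefficients of f and g are not
  divisible by p. In the coefficient of f * g at i + j all summands but one are divisible by
  p.\<close>

lemma prime_const_polys:
  assumes p: "prime_in A p"
  shows "prime_in (polys_over A) [:p:]"
proof -
  let ?P = "polys_over A"
  have 1: "[:p:] \<in> ?P" "[:p:] \<noteq> 0"
    using p by (auto simp: prime_in_def polys_over_closed)
  have 2: "\<not> dvd_in ?P [:p:] 1"
    using p dvd_const_iff[OF P.closed(1), of p] by (auto simp: prime_in_def dest: spec[of _ 0])
  have 3: "dvd_in ?P [:p:] f \<or> dvd_in ?P [:p:] g"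
    if fg: "f \<in> ?P" "g \<in> ?P" and dvd: "dvd_in ?P [:p:] (f * g)" for f g
  proof (rule ccontr)
    assume "\<not> ?thesis"
    then have ex: "\<exists>i. \<not> dvd_in A p (coeff f i)" "\<exists>i. \<not> dvd_in A p (coeff g i)"
      using fg dvd_const_iff by auto
    define i j where "i = (LEAST i. \<not> dvd_in A p (coeff f i))" and "j = (LEAST i. \<not> dvd_in A p (coeff g i))"
    have i: "\<not> dvd_in A p (coeff f i)" "\<And>k. k < i \<Longrightarrow> dvd_in A p (coeff f k)"
      using LeastI_ex[OF ex(1)] not_less_Least unfolding i_def by blast+
    have j: "\<not> dvd_in A p (coeff g j)" "\<And>k. k < j \<Longrightarrow> dvd_in A p (coeff g k)"
      using LeastI_ex[OF ex(2)] not_less_Least unfolding j_def by blast+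
    have coeffs: "coeff f k \<in> A" "coeff g k \<in> A" for k
      using fg by (auto simp: polys_over_def)
    define I where "I = {c. dvd_in A p c}"
    have I_sum: "sum h S \<in> I" if "\<And>x. x \<in> S \<Longrightarrow> h x \<in> I" for h :: "nat \<Rightarrow> 'a" and S
    proof -
      have "\<forall>x\<in>S. \<exists>c. c \<in> A \<and> h x = p * c"
        using that by (auto simp: I_def dvd_in_def)
      then obtain c where "\<forall>x\<in>S. c x \<in> A \<and> h x = p * c x"
        by (rule bchoice[THEN exE])
      then have "sum h S = p * sum c S" "sum c S \<in> A"
        by (simp add: sum_distrib_left, simp add: sum_closed)
      then show ?thesis unfolding I_def dvd_in_def by blast
    qed
    let ?h = "\<lambda>k. coeff f k * coeff g (i + j - k)"
    have "coeff (f * g) (i + j) = (\<Sum>k\<le>i + j. ?h k)"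
      by (simp add: coeff_mult)
    also have "\<dots> = ?h i + (\<Sum>k\<in>{..i + j} - {i}. ?h k)"
      by (subst sum.remove[of _ i]) auto
    finally have eq: "coeff f i * coeff g j = coeff (f * g) (i + j) - (\<Sum>k\<in>{..i + j} - {i}. ?h k)"
      by simp
    have "(\<Sum>k\<in>{..i + j} - {i}. ?h k) \<in> I"
    proof (rule I_sum)
      fix k assume "k \<in> {..i + j} - {i}"
      then consider "k < i" | "i + j - k < j" by force
      then show "?h k \<in> I"
      proof cases
        case 1
        then show ?thesis using i(2) coeffs unfolding I_def by (auto intro: dvd_in_mult)
      next
        case 2
        then show ?thesis
          using dvd_in_mult[OF j(2) coeffs(1)] unfolding I_def by (simp add: mult.commute)
      qed
    qed
    moreover have "coeff (f * g) (i + j) \<in> I"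
      using dvd dvd_const_iff[OF P.closed(4)[OF fg]] unfolding I_def by blast
    ultimately have "dvd_in A p (coeff f i * coeff g j)"
      unfolding eq I_def dvd_in_def by (auto simp: right_diff_distrib[symmetric])
    then show False
      using i(1) j(1) p coeffs unfolding prime_in_def by blast
  qed
  show ?thesis
    unfolding prime_in_def using 1 2 3 by blast
qed

definition primitive :: "'a poly \<Rightarrow> bool" where
  "primitive f \<longleftrightarrow> f \<in> polys_over A \<and> f \<noteq> 0 \<and> (\<forall>p. prime_in A p \<longrightarrow> \<not> dvd_in (polys_over A) [:p:] f)"

text \<open>The primes of e are removed one at a time: each divides f * h, hence h by Gauss's lemma,
  since f is primitive. This takes the place of passing to the field of fractions and back.\<close>

lemma primitive_cancel:
  assumes "primitive f" "h \<in> polys_over A" "g \<in> polys_over A" "f * h = smult e g" "e \<in> A" "e \<noteq> 0"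
  shows "\<exists>h'\<in>polys_over A. h = smult e h' \<and> g = f * h'"
proof -
  obtain n where "factors_in A n e" using factors assms by blast
  then have "f * h = smult e g \<longrightarrow> (\<exists>h'\<in>polys_over A. h = smult e h' \<and> g = f * h')"
    using assms(2,3)
  proof (induction arbitrary: h g rule: factors_in.induct)
    case (unit u)
    then obtain c where c: "c \<in> A" "1 = u * c" by (auto simp: dvd_in_def)
    have "h = smult u (smult c h)" using c by simp
    moreover have "g = f * smult c h" if "f * h = smult u g"
      using that c by (simp add: mult.commute)
    ultimately show ?case using unit c by (intro impI bexI[of _ "smult c h"]) (auto intro: smult_polys_over)
  next
    case (prime p n a)
    show ?case
    proof
      assume eq: "f * h = smult (p * a) g"
      have a: "a \<in> A" using prime.hyps(2) factors_in_closed by blast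
      have p: "p \<in> A" "p \<noteq> 0" using prime.hyps(1) by (auto simp: prime_in_def)
      have "dvd_in (polys_over A) [:p:] (f * h)"
        unfolding dvd_in_def eq using a prime.prems(2)
        by (intro bexI[of _ "smult a g"]) (simp_all add: smult_polys_over mult.commute)
      then have "dvd_in (polys_over A) [:p:] f \<or> dvd_in (polys_over A) [:p:] h"
        using prime_const_polys[OF prime(1)] assms(1) prime.prems
        unfolding prime_in_def[of "polys_over A"] primitive_def by blast
      then have "dvd_in (polys_over A) [:p:] h"
        using assms(1) prime.hyps(1) unfolding primitive_def by blast
      then obtain k where k: "k \<in> polys_over A" "h = smult p k" by (auto simp: dvd_in_def)
      then have "smult p (f * k) = smult p (smult a g)" using eq by simp
      then have "smult p (f * k - smult a g) = 0" by (simp add: smult_diff_right)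
      then have "f * k = smult a g" using p by simp
      then obtain h' where "h' \<in> polys_over A" "k = smult a h'" "g = f * h'"
        using prime.IH[OF k(1) prime.prems(2)] by blast
      then show "\<exists>h'\<in>polys_over A. h = smult (p * a) h' \<and> g = f * h'" using k by auto
    qed
  qed
  then show ?thesis using assms by blast
qed

text \<open>A prime constant that divides f divides its leading coefficient, whose number of prime
  factors limits how often one can be split off.\<close>

lemma primitive_part:
  assumes "f \<in> polys_over A" "f \<noteq> 0"
  shows "\<exists>c g. c \<in> A \<and> c \<noteq> 0 \<and> primitive g \<and> f = smult c g"
proof -
  obtain n where "factors_in A n (lead_coeff f)" using factors assms lead_coeff_in by force
  then show ?thesis
    using assms
  proof (induction n arbitrary: f rule: less_induct)
    case (less n)
    show ?case
    proof (cases "primitive f")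
      case True
      then show ?thesis by (intro exI[of _ 1] exI[of _ f]) auto
    next
      case False
      then obtain p where p: "prime_in A p" "dvd_in (polys_over A) [:p:] f"
        using less.prems unfolding primitive_def by blast
      then obtain g where g: "g \<in> polys_over A" "f = smult p g" by (auto simp: dvd_in_def)
      have p0: "p \<in> A" "p \<noteq> 0" using p by (auto simp: prime_in_def)
      have "lead_coeff f = p * lead_coeff g" using g by simp
      moreover have "lead_coeff g \<in> A" using g lead_coeff_in by blast
      ultimately have "dvd_in A p (lead_coeff f)" unfolding dvd_in_def by blast
      then obtain k b where k: "n = Suc k" "lead_coeff f = p * b" "factors_in A k b"
        using factors_in_divide_prime[OF less.prems(1) p(1)] by blast
      then have "b = lead_coeff g" using \<open>lead_coeff f = p * lead_coeff g\<close> p0 by simp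
      then obtain c g' where "c \<in> A" "c \<noteq> 0" "primitive g'" "g = smult c g'"
        using less.IH[of k g] k g less.prems by auto
      then show ?thesis using g p0 by (intro exI[of _ "p * c"] exI[of _ g']) auto
    qed
  qed
qed

text \<open>Multiplying f by the leading coefficient of g before each subtraction avoids division in
  A.\<close>

lemma pseudo_division:
  assumes "g \<in> polys_over A" "g \<noteq> 0" "f \<in> polys_over A"
  shows "\<exists>e q r. e \<in> A \<and> e \<noteq> 0 \<and> q \<in> polys_over A \<and> r \<in> polys_over A \<and> smult e f = g * q + r \<and>
    (r = 0 \<or> degree r < degree g)"
  using assms(3)
proof (induction "degree f" arbitrary: f rule: less_induct)
  case less
  show ?case
  proof (cases "f = 0 \<or> degree f < degree g")
    case True
    then show ?thesis
      using less.prems by (intro exI[of _ 1] exI[of _ 0] exI[of _ f]) auto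
  next
    case False
    define b where "b = lead_coeff g"
    have b: "b \<in> A" "b \<noteq> 0" using assms lead_coeff_in by (auto simp: b_def)
    define t where "t = monom (lead_coeff f) (degree f - degree g)"
    have t: "t \<in> polys_over A" unfolding t_def by (intro monom_polys_over lead_coeff_in less.prems)
    define f' where "f' = smult b f - g * t"
    have f': "f' \<in> polys_over A"
      unfolding f'_def using b t assms less.prems by (intro P.diff_closed smult_polys_over P.closed(4))
    show ?thesis
    proof (cases "degree f' < degree f")
      case True
      then obtain e q r where eqr: "e \<in> A" "e \<noteq> 0" "q \<in> polys_over A" "r \<in> polys_over A"
          "smult e f' = g * q + r" "r = 0 \<or> degree r < degree g"
        using less.hyps f' by blast
      have "smult (e * b) f = g * (q + smult e t) + r"
        using eqr(5) unfolding f'_def by (simp add: smult_diff_right algebra_simps)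
      then show ?thesis
        using eqr b t by (intro exI[of _ "e * b"] exI[of _ "q + smult e t"] exI[of _ r])
          (auto intro: smult_polys_over)
    next
      case F: False
      have "degree (g * t) = degree f"
        using False assms by (cases "t = 0") (auto simp: t_def degree_mult_eq degree_monom_eq)
      moreover have "lead_coeff t = lead_coeff f"
        unfolding t_def by (rule lead_coeff_monom)
      then have "coeff (g * t) (degree f) = b * lead_coeff f"
        using \<open>degree (g * t) = degree f\<close> by (metis lead_coeff_mult b_def)
      ultimately have "degree f' \<le> degree f" "coeff f' (degree f) = 0"
        unfolding f'_def using b by (auto intro!: degree_diff_le)
      moreover from this have "degree f' = degree f"
        using F by simp
      ultimately have "lead_coeff f' = 0" by simp
      then have "f' = 0" by simp
      then have "smult b f = g * t + 0" unfolding f'_def by simp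
      then show ?thesis using b t by (intro exI[of _ b] exI[of _ t] exI[of _ 0]) auto
    qed
  qed
qed

lemma unit_if_no_prime:
  assumes "a \<in> A" "a \<noteq> 0" "\<And>p. prime_in A p \<Longrightarrow> \<not> dvd_in A p a"
  shows "dvd_in A a 1"
proof -
  obtain n where "factors_in A n a" using factors assms by blast
  then show ?thesis
    using assms(3)
  proof cases
    case (prime p n b)
    then have "dvd_in A p a"
      using factors_in_closed unfolding dvd_in_def by blast
    then show ?thesis using assms(3) prime by blast
  qed auto
qed

lemma const_dvd_unit:
  assumes "a \<in> A" "dvd_in A a 1"
  shows "dvd_in (polys_over A) [:a:] 1"
  using assms unfolding dvd_in_def by (auto simp: one_pCons intro!: bexI[of _ "[:c:]" for c] polys_over_closed)

text \<open>Bezout without fractions: a nonzero combination r of f and a of least degree divides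
  constant multiples of both. The primitive part of r divides f. By irreducibility it is a constant,
  and then f divides b, or it is f up to a unit, and then f divides a.\<close>

lemma primitive_irreducible_prime:
  assumes f: "primitive f" "degree f > 0"
    and irr: "\<And>g h. g \<in> polys_over A \<Longrightarrow> h \<in> polys_over A \<Longrightarrow> f = g * h \<Longrightarrow> degree g = 0 \<or> degree h = 0"
  shows "prime_in (polys_over A) f"
proof -
  let ?P = "polys_over A"
  have fP: "f \<in> ?P" "f \<noteq> 0" using f by (auto simp: primitive_def)
  have "\<not> dvd_in ?P f 1"
  proof
    assume "dvd_in ?P f 1"
    then obtain c where c: "1 = f * c" by (auto simp: dvd_in_def)
    then have "c \<noteq> 0" by auto
    then have "degree (f * c) = degree f + degree c"
      using fP by (intro degree_mult_eq)
    then show False using f(2) by (simp flip: c)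
  qed
  moreover have "dvd_in ?P f a \<or> dvd_in ?P f b"
    if ab: "a \<in> ?P" "b \<in> ?P" and c: "c \<in> ?P" "a * b = f * c" for a b c
  proof (cases "a = 0")
    case True
    then show ?thesis unfolding dvd_in_def by (auto intro!: bexI[of _ 0])
  next
    case False
    define J where "J = {r \<in> ?P. r \<noteq> 0 \<and> (\<exists>u\<in>?P. \<exists>v\<in>?P. r = u * f + v * a)}"
    have "f = 1 * f + 0 * a" by simp
    then have fJ: "f \<in> J"
      unfolding J_def using fP P.closed(1,2) by blast
    define r where "r = arg_min degree (\<lambda>r. r \<in> J)"
    have r: "r \<in> J" and min: "\<And>r'. r' \<in> J \<Longrightarrow> degree r \<le> degree r'"
      unfolding r_def using arg_min_natI[of "\<lambda>r. r \<in> J" f degree] arg_min_nat_le[of "\<lambda>r. r \<in> J" _ degree] fJ by auto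
    then obtain u v where uv: "u \<in> ?P" "v \<in> ?P" "r = u * f + v * a" and rP: "r \<in> ?P" "r \<noteq> 0"
      unfolding J_def by blast
    have div: "\<exists>e q. e \<in> A \<and> e \<noteq> 0 \<and> q \<in> ?P \<and> smult e x = r * q"
      if x: "x \<in> ?P" "\<exists>u'\<in>?P. \<exists>v'\<in>?P. x = u' * f + v' * a" for x
    proof -
      obtain e q s where eqs: "e \<in> A" "e \<noteq> 0" "q \<in> ?P" "s \<in> ?P" "smult e x = r * q + s"
          "s = 0 \<or> degree s < degree r"
        using pseudo_division[OF rP x(1)] by blast
      obtain u' v' where u'v': "u' \<in> ?P" "v' \<in> ?P" "x = u' * f + v' * a" using x by blast
      have "s = (smult e u' - q * u) * f + (smult e v' - q * v) * a"
        using eqs(5) unfolding u'v'(3) uv(3) by (simp add: algebra_simps smult_add_right)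
      moreover have "smult e u' - q * u \<in> ?P" "smult e v' - q * v \<in> ?P"
        using eqs uv u'v' by (auto intro: smult_polys_over)
      ultimately have "s = 0 \<or> s \<in> J"
        unfolding J_def using eqs(4) by blast
      then have "s = 0" using eqs(6) min by force
      then show ?thesis using eqs by auto
    qed
    obtain e q where e: "e \<in> A" "e \<noteq> 0" "q \<in> ?P" "smult e f = r * q"
      using div[OF fP(1)] fJ unfolding J_def by blast
    have "a = 0 * f + 1 * a" by simp
    then have "\<exists>u'\<in>?P. \<exists>v'\<in>?P. a = u' * f + v' * a"
      using P.closed(1,2) by blast
    then obtain e' q' where e': "e' \<in> A" "e' \<noteq> 0" "q' \<in> ?P" "smult e' a = r * q'"
      using div[OF ab(1)] by blast
    obtain k r0 where r0: "k \<in> A" "k \<noteq> 0" "primitive r0" "r = smult k r0"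
      using primitive_part[OF rP] by blast
    have r0P: "r0 \<in> ?P" using r0 by (simp add: primitive_def)
    have "r0 * smult k q = smult e f"
      using e r0 by simp
    then obtain h where h: "h \<in> ?P" "f = r0 * h"
      using primitive_cancel[OF r0(3) smult_polys_over[OF r0(1) e(3)] fP(1) _ e(1,2)] by blast
    have "degree r0 = 0 \<or> degree h = 0" by (rule irr[OF r0P h])
    then show ?thesis
    proof
      assume "degree r0 = 0"
      then obtain c0 where c0: "r0 = [:c0:]" by (rule degree_eq_zeroE)
      have rc: "r = [:k * c0:]" "k * c0 \<noteq> 0" "k * c0 \<in> A"
        using r0 c0 rP r0P const_polys_over_iff by auto
      \<comment> \<open>Multiplying the combination by b gives a multiple of f, because f divides a
        * b.\<close>
      have "f * (u * b + v * c) = r * b"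
        unfolding uv(3) using c(2) by (simp add: algebra_simps)
      then have eq: "f * (u * b + v * c) = smult (k * c0) b" unfolding rc(1) by simp
      have "u * b + v * c \<in> ?P" using uv ab c by auto
      then have "\<exists>h'\<in>?P. b = f * h'"
        using primitive_cancel[OF f(1) _ ab(2) eq rc(3,2)] by blast
      then show ?thesis unfolding dvd_in_def by blast
    next
      assume "degree h = 0"
      then obtain c0 where c0: "h = [:c0:]" by (rule degree_eq_zeroE)
      have c0A: "c0 \<in> A" "c0 \<noteq> 0"
        using h c0 fP const_polys_over_iff by auto
      \<comment> \<open>A prime factor of this constant would divide f, which is primitive.\<close>
      have "dvd_in A c0 1"
      proof (rule unit_if_no_prime[OF c0A])
        fix p assume p: "prime_in A p"
        show "\<not> dvd_in A p c0"
        proof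
          assume "dvd_in A p c0"
          then obtain d where "d \<in> A" "c0 = p * d" by (auto simp: dvd_in_def)
          then have "f = [:p:] * smult d r0" "smult d r0 \<in> ?P"
            using h c0 r0P by (auto intro: smult_polys_over simp: mult.commute)
          then have "dvd_in ?P [:p:] f" unfolding dvd_in_def by blast
          then show False using f(1) p by (simp add: primitive_def)
        qed
      qed
      then obtain d where d: "d \<in> A" "1 = c0 * d" by (auto simp: dvd_in_def)
      have "r0 = smult d f"
        using h c0 d by (simp add: mult.commute)
      then have eq: "f * smult (k * d) q' = smult e' a"
        using e'(4) r0(4) by (simp add: mult.commute)
      have "\<exists>h'\<in>?P. a = f * h'"
        using primitive_cancel[OF f(1) _ ab(1) eq e'(1,2)] r0 d e' by (auto intro: smult_polys_over)
      then show ?thesis unfolding dvd_in_def by blast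
    qed
  qed
  ultimately show ?thesis
    unfolding prime_in_def using fP by (auto simp: dvd_in_def[of _ _ "_ * _"])
qed

text \<open>The constant part is factored in A. The primitive part is split as long as it has
  factors of positive degree, and what cannot be split further is prime.\<close>

theorem ufd_polys_over: "ufd (polys_over A)"
  unfolding ufd_def
proof (intro conjI ballI impI)
  show "subdomain (polys_over A)" by (rule subdomain_polys_over)
  let ?P = "polys_over A"
  fix f assume f: "f \<in> ?P" "f \<noteq> 0"
  have const: "\<exists>n. factors_in ?P n [:a:]" if "factors_in A k a" for k a
    using that
  proof (induction rule: factors_in.induct)
    case (unit u)
    then show ?case
      by (intro exI[of _ 0] factors_in.unit polys_over_closed const_dvd_unit)
  next
    case (prime p n a)
    then obtain n where "factors_in ?P n [:a:]" by blast
    then have "factors_in ?P (Suc n) ([:p:] * [:a:])"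
      by (intro factors_in.prime prime_const_polys prime)
    then show ?case by (auto simp: mult.commute)
  qed
  have prim: "\<exists>n. factors_in ?P n f" if "primitive f" for f
    using that
  proof (induction "degree f" arbitrary: f rule: less_induct)
    case less
    note fP = less.prems[unfolded primitive_def]
    show ?case
    proof (cases "degree f = 0")
      case True
      then obtain c where "f = [:c:]" by (rule degree_eq_zeroE)
      moreover have "c \<in> A" "c \<noteq> 0"
        using fP \<open>f = [:c:]\<close> const_polys_over_iff by auto
      ultimately show ?thesis using factors const by blast
    next
      case deg: False
      show ?thesis
      proof (cases "\<exists>g h. g \<in> ?P \<and> h \<in> ?P \<and> f = g * h \<and> degree g \<noteq> 0 \<and> degree h \<noteq> 0")
        case True
        then obtain g h where gh: "g \<in> ?P" "h \<in> ?P" "f = g * h" "degree g \<noteq> 0" "degree h \<noteq> 0" by blast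
        have nz: "g \<noteq> 0" "h \<noteq> 0" using gh fP by auto
        then have "degree f = degree g + degree h" using gh degree_mult_eq by blast
        then have lt: "degree g < degree f" "degree h < degree f" using gh by auto
        have "primitive g"
          unfolding primitive_def using gh nz fP P.dvd_in_mult[of _ g h] by auto
        moreover have "primitive h"
          unfolding primitive_def using gh nz fP P.dvd_in_mult[of _ h g] by (auto simp: mult.commute)
        ultimately show ?thesis
          using less.hyps lt P.factors_in_mult gh(3) by blast
      next
        case False
        then have "prime_in ?P f"
          using deg by (intro primitive_irreducible_prime less.prems) auto
        moreover have "factors_in ?P 0 1"
          by (intro factors_in.unit P.closed P.dvd_in_refl)
        ultimately have "factors_in ?P (Suc 0) (f * 1)"
          by (rule factors_in.prime)
        then show ?thesis by auto
      qed
    qed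
  qed
  obtain c g where cg: "c \<in> A" "c \<noteq> 0" "primitive g" "f = smult c g"
    using primitive_part f by blast
  obtain j where "factors_in A j c"
    using factors[OF cg(1,2)] by blast
  then obtain n where "factors_in ?P n [:c:]"
    using const by blast
  moreover obtain k where "factors_in ?P k g"
    using prim[OF cg(3)] by blast
  ultimately have "factors_in ?P (n + k) ([:c:] * g)"
    by (rule P.factors_in_mult)
  then show "\<exists>n. factors_in ?P n f" using cg by auto
qed

text \<open>The last clause is what lowest terms are for: any equal fraction comes from the reduced
  one by a common factor in A. The primes of b are treated in turn, each being cancelled against the
  numerator or kept in the denominator.\<close>

lemma lowest_terms:
  assumes "a \<in> A" "b \<in> A" "b \<noteq> 0"
  shows "\<exists>a0\<in>A. \<exists>b0\<in>A. b0 \<noteq> 0 \<and> a * b0 = a0 * b \<and>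
    (\<forall>a'\<in>A. \<forall>b'\<in>A. a' * b0 = a0 * b' \<longrightarrow> (\<exists>r\<in>A. a' = r * a0 \<and> b' = r * b0))"
proof -
  obtain n where "factors_in A n b" using factors assms by blast
  then show ?thesis
  proof (induction rule: factors_in.induct)
    case (unit u)
    then obtain c where c: "c \<in> A" "1 = u * c" by (auto simp: dvd_in_def)
    then show ?case
      using assms(1) by (intro bexI[of _ "a * c"] bexI[of _ 1]) (auto simp: ac_simps)
  next
    case (prime p n b)
    then obtain a0 b0 where ab: "a0 \<in> A" "b0 \<in> A" "b0 \<noteq> 0" "a * b0 = a0 * b"
      and red: "\<And>a' b'. a' \<in> A \<Longrightarrow> b' \<in> A \<Longrightarrow> a' * b0 = a0 * b' \<Longrightarrow> \<exists>r\<in>A. a' = r * a0 \<and> b' = r * b0"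
      by blast
    have p: "p \<in> A" "p \<noteq> 0" using prime by (auto simp: prime_in_def)
    show ?case
    proof (cases "dvd_in A p a0")
      case True
      then obtain a2 where a2: "a2 \<in> A" "a0 = p * a2" by (auto simp: dvd_in_def)
      have "\<exists>r\<in>A. a' = r * a2 \<and> b' = r * b0" if "a' \<in> A" "b' \<in> A" "a' * b0 = a2 * b'" for a' b'
      proof -
        note prems = that
        have "(p * a') * b0 = a0 * b'" using that a2 by (simp add: ac_simps)
        then obtain r where r: "r \<in> A" "p * a' = r * a0" "b' = r * b0"
          using red[of "p * a'" b'] prems p by auto
        then have "p * a' = p * (r * a2)" using a2 by (simp add: ac_simps)
        then have "a' = r * a2" using p by simp
        then show ?thesis using r by blast
      qed
      then show ?thesis
        using ab a2 by (intro bexI[of _ a2] bexI[of _ b0]) (auto simp: ac_simps)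
    next
      case False
      have "\<exists>r\<in>A. a' = r * a0 \<and> b' = r * (p * b0)"
        if "a' \<in> A" "b' \<in> A" "a' * (p * b0) = a0 * b'" for a' b'
      proof -
        note prems = that
        have "(a' * p) * b0 = a0 * b'" using that by (simp add: ac_simps)
        then obtain r where r: "r \<in> A" "a' * p = r * a0" "b' = r * b0"
          using red[of "a' * p" b'] prems p by auto
        then have "dvd_in A p (r * a0)" unfolding dvd_in_def using that by (metis mult.commute)
        then have "dvd_in A p r" using prime(1) r ab False unfolding prime_in_def by blast
        then obtain r1 where r1: "r1 \<in> A" "r = p * r1" by (auto simp: dvd_in_def)
        then have "p * a' = p * (r1 * a0)" using r by (simp add: ac_simps)
        then have "a' = r1 * a0" using p by simp
        then show ?thesis using r r1 by (intro bexI[of _ r1]) (auto simp: ac_simps)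
      qed
      moreover have "a * (p * b0) = a0 * (p * b)"
        using ab(4) by (metis mult.left_commute)
      moreover have "p * b0 \<in> A" "p * b0 \<noteq> 0"
        using p ab by auto
      ultimately show ?thesis using ab(1) by blast
    qed
  qed
qed

end

text \<open>Carries the result on univariate polynomials over to polynomials in one more variable
  inside the fixed type of multivariate polynomials.\<close>

lemma ufd_iso:
  fixes B :: "'a :: idom set" and C :: "'b :: idom set"
  assumes "ufd B" and bij: "bij_betw \<phi> B C"
    and add: "\<And>x y. x \<in> B \<Longrightarrow> y \<in> B \<Longrightarrow> \<phi> (x + y) = \<phi> x + \<phi> y"
    and mult: "\<And>x y. x \<in> B \<Longrightarrow> y \<in> B \<Longrightarrow> \<phi> (x * y) = \<phi> x * \<phi> y"
    and one: "\<phi> 1 = 1"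
  shows "ufd C"
proof -
  interpret B: subdomain_locale B
    using assms(1) by unfold_locales (simp add: ufd_def)
  have in_C: "\<phi> x \<in> C" if "x \<in> B" for x using bij that by (auto simp: bij_betw_def)
  have ex: "\<exists>x\<in>B. y = \<phi> x" if "y \<in> C" for y using bij that by (auto simp: bij_betw_def)
  have inj: "x = y" if "\<phi> x = \<phi> y" "x \<in> B" "y \<in> B" for x y
    using bij that by (auto simp: bij_betw_def inj_on_def)
  have zero: "\<phi> 0 = 0" using add[of 0 0] B.closed(2) by (metis add.right_neutral add_left_cancel)
  have minus: "\<phi> (- x) = - \<phi> x" if "x \<in> B" for x
    using add[of x "- x"] that zero by (simp add: eq_neg_iff_add_eq_0 add.commute)
  have dvd: "dvd_in C (\<phi> x) (\<phi> y) \<longleftrightarrow> dvd_in B x y" if "x \<in> B" "y \<in> B" for x y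
  proof
    assume "dvd_in B x y"
    then show "dvd_in C (\<phi> x) (\<phi> y)"
      using that in_C mult unfolding dvd_in_def by blast
  next
    assume "dvd_in C (\<phi> x) (\<phi> y)"
    then obtain c where "c \<in> B" "\<phi> y = \<phi> x * \<phi> c"
      unfolding dvd_in_def using ex by blast
    then have "y = x * c" using that mult[of x c] inj[of y "x * c"] by simp
    then show "dvd_in B x y" using \<open>c \<in> B\<close> unfolding dvd_in_def by blast
  qed
  have prime: "prime_in C (\<phi> p)" if p: "prime_in B p" for p
  proof -
    have pB: "p \<in> B" "p \<noteq> 0" using p by (auto simp: prime_in_def)
    have "\<phi> p \<noteq> 0" using inj[of p 0] pB zero by auto
    moreover have "\<not> dvd_in C (\<phi> p) 1"
      using dvd[OF pB(1) B.closed(1)] p one by (simp add: prime_in_def)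
    moreover have "dvd_in C (\<phi> p) a \<or> dvd_in C (\<phi> p) b"
      if "a \<in> C" "b \<in> C" "dvd_in C (\<phi> p) (a * b)" for a b
    proof -
      obtain x y where xy: "x \<in> B" "a = \<phi> x" "y \<in> B" "b = \<phi> y"
        using ex \<open>a \<in> C\<close> \<open>b \<in> C\<close> by blast
      then have "dvd_in B p (x * y)"
        using that(3) pB dvd[of p "x * y"] by (simp add: mult)
      then have "dvd_in B p x \<or> dvd_in B p y"
        using p xy unfolding prime_in_def by blast
      then show ?thesis using dvd pB xy by auto
    qed
    ultimately show ?thesis
      unfolding prime_in_def using in_C[OF pB(1)] by blast
  qed
  have fact: "factors_in C n (\<phi> x)" if "factors_in B n x" for n x
    using that
  proof (induction rule: factors_in.induct)
    case (unit u)
    then show ?case using dvd[of u 1] one in_C by (intro factors_in.unit) auto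
  next
    case (prime p n a)
    then have "p \<in> B" "a \<in> B" using B.factors_in_closed by (auto simp: prime_in_def)
    then show ?case
      using factors_in.prime[OF _ prime.IH] prime.hyps \<open>\<And>p. prime_in B p \<Longrightarrow> prime_in C (\<phi> p)\<close> mult by simp
  qed
  have "subdomain C"
    unfolding subdomain_def
  proof (intro conjI ballI)
    show "1 \<in> C" using in_C[of 1] one by simp
    fix a b assume "a \<in> C" "b \<in> C"
    then obtain x y where xy: "x \<in> B" "a = \<phi> x" "y \<in> B" "b = \<phi> y" using ex by blast
    show "a + b \<in> C" using xy in_C[of "x + y"] by (simp add: add)
    show "a * b \<in> C" using xy in_C[of "x * y"] by (simp add: mult)
    show "- a \<in> C" using xy in_C[of "- x"] by (simp add: minus)
  qed
  moreover have "\<exists>n. factors_in C n y" if "y \<in> C" "y \<noteq> 0" for y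
  proof -
    obtain x where "x \<in> B" "y = \<phi> x" "x \<noteq> 0" using ex \<open>y \<in> C\<close> \<open>y \<noteq> 0\<close> zero by blast
    then show ?thesis using fact assms(1) unfolding ufd_def by blast
  qed
  ultimately show ?thesis unfolding ufd_def by blast
qed

section \<open>Polynomials in finitely many variables: factoriality and units\<close>

lemma mconst_eq_iff: "mconst x = mconst y \<longleftrightarrow> x = y"
  by (auto simp: mconst_def mcoeff_monom dest: arg_cong[where f = "\<lambda>p. mcoeff p 0"])

lemma subdomain_vars_in: "subdomain (vars_in V :: ('i, 'a :: idom) mpoly set)"
  unfolding subdomain_def
  using mconst_vars_in[of 1 V] by (auto simp: mconst.hom_one add_vars_in mult_vars_in minus_vars_in)

lemma ufd_vars_in:
  assumes "finite V"
  shows "ufd (vars_in V :: ('i, 'a :: field) mpoly set)"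
  using assms
proof (induction V rule: finite_induct)
  case empty
  have "\<exists>n. factors_in (vars_in {}) n p" if "p \<in> vars_in {}" "p \<noteq> 0" for p :: "('i, 'a) mpoly"
  proof -
    from that(1) have "\<exists>c. p = mconst c" by (rule vars_in_empty)
    then obtain c where "p = mconst c" ..
    moreover from this have "c \<noteq> 0" using that by (auto simp: mconst.hom_zero)
    ultimately have "1 = p * mconst (inverse c)"
      by (simp add: mconst.hom_one flip: mconst.hom_mult)
    then have "dvd_in (vars_in {}) p 1"
      unfolding dvd_in_def using mconst_vars_in by blast
    then show ?thesis using that factors_in.unit by blast
  qed
  then show ?case
    unfolding ufd_def using subdomain_vars_in by blast
next
  case (insert j V)
  let ?A = "vars_in V :: ('i, 'a) mpoly set"
  interpret ufd_locale ?A
    using insert.IH by unfold_locales (auto simp: ufd_def)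
  let ?\<phi> = "\<lambda>f. poly f (mvar j :: ('i, 'a) mpoly)"
  have "inj_on ?\<phi> (polys_over ?A)"
  proof (rule inj_onI)
    fix f g assume fg: "f \<in> polys_over ?A" "g \<in> polys_over ?A" "?\<phi> f = ?\<phi> g"
    then have "f - g \<in> polys_over ?A" by blast
    then have "f - g = 0"
      using insert.hyps fg(3) by (intro poly_mvar_eq_0[of _ V j]) (auto simp: polys_over_def)
    then show "f = g" by simp
  qed
  moreover have "?\<phi> ` polys_over ?A = vars_in (insert j V)"
  proof (intro equalityI subsetI)
    fix p assume "p \<in> ?\<phi> ` polys_over ?A"
    then show "p \<in> vars_in (insert j V)"
      by (auto simp: polys_over_def intro: poly_mvar_vars_in)
  next
    fix p :: "('i, 'a) mpoly" assume "p \<in> vars_in (insert j V)"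
    then show "p \<in> ?\<phi> ` polys_over ?A"
      using vars_in_insert_poly[of p j V] by (auto simp: polys_over_def)
  qed
  ultimately have "bij_betw ?\<phi> (polys_over ?A) (vars_in (insert j V))"
    by (simp add: bij_betw_def)
  then show ?case
    by (rule ufd_iso[OF ufd_polys_over]) auto
qed

text \<open>Over a domain two factors of 1 have degree 0 in the variable split off, so both already
  lie in the smaller ring; descend until no variable is left.\<close>

lemma mpoly_unit_const:
  fixes p q :: "('i, 'a :: field) mpoly"
  assumes "p * q = 1"
  shows "\<exists>c. p = mconst c"
proof -
  obtain V W where "finite V" "p \<in> vars_in V" "finite W" "q \<in> vars_in W"
    using finite_vars by metis
  then have "finite (V \<union> W)" "p \<in> vars_in (V \<union> W)" "q \<in> vars_in (V \<union> W)"
    using vars_in_mono[of V "V \<union> W"] vars_in_mono[of W "V \<union> W"] by auto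
  then show ?thesis
    using assms
  proof (induction "V \<union> W" arbitrary: V W p q rule: finite_induct)
    case empty
    then show ?case using vars_in_empty by metis
  next
    case (insert j U)
    obtain f g where fg: "\<forall>i. coeff f i \<in> vars_in U" "poly f (mvar j) = p"
        "\<forall>i. coeff g i \<in> vars_in U" "poly g (mvar j) = q"
      using vars_in_insert_poly[of _ j U] insert.prems insert.hyps by metis
    interpret subdomain_locale "vars_in U :: ('i, 'a) mpoly set"
      by unfold_locales (rule subdomain_vars_in)
    have "coeff (f * g - 1) i \<in> vars_in U" for i
      using fg by (auto simp: coeff_mult intro!: diff_closed sum_closed)
    moreover have "poly (f * g - 1) (mvar j) = 0"
      using fg insert.prems by simp
    ultimately have eq: "f * g = 1"
      using poly_mvar_eq_0[of "f * g - 1" U j] insert.hyps by simp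
    then have "f \<noteq> 0" "g \<noteq> 0" by auto
    then have "degree f + degree g = 0"
      using degree_mult_eq[of f g] eq by simp
    then obtain a b where ab: "f = [:a:]" "g = [:b:]"
      by (metis add_is_0 degree_eq_zeroE)
    then have "a * b = 1" using eq by (simp add: one_pCons mult.commute)
    moreover have "a \<in> vars_in U" "b \<in> vars_in U"
      using ab fg(1,3) by (auto dest: spec[of _ 0])
    ultimately have "\<exists>c. a = mconst c"
      using insert.hyps(3)[of U U a b] by simp
    then show ?case using fg ab by simp
  qed
qed

section \<open>Roots of unity\<close>

lemma roots_of_unity_powers:
  fixes \<zeta> :: "'a :: field"
  assumes "primitive_root_of_unity m \<zeta>" "c ^ m = 1"
  shows "\<exists>j<m. c = \<zeta> ^ j"
proof -
  have m: "m > 0" "\<zeta> ^ m = 1" and min: "\<And>j. 0 < j \<Longrightarrow> j < m \<Longrightarrow> \<zeta> ^ j \<noteq> 1"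
    using assms by (auto simp: primitive_root_of_unity_def)
  have nz: "\<zeta> \<noteq> 0" using m by (metis power_0_left zero_neq_one gr0_implies_Suc power_Suc mult_zero_left)
  let ?p = "monom 1 m - 1 :: 'a poly"
  let ?R = "{x. poly ?p x = 0}"
  have R: "?R = {x. x ^ m = 1}" by (simp add: poly_monom)
  have deg: "degree ?p = m" "?p \<noteq> 0"
  proof -
    have "degree (monom 1 m + (- 1) :: 'a poly) = degree (monom 1 m :: 'a poly)"
      using m by (intro degree_add_eq_left) (simp add: degree_monom_eq)
    then show "degree ?p = m" by (simp add: degree_monom_eq)
    then show "?p \<noteq> 0" using m by auto
  qed
  have inj: "inj_on (\<lambda>j. \<zeta> ^ j) {..<m}"
  proof -
    have False if "i < j" "j < m" "\<zeta> ^ i = \<zeta> ^ j" for i j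
    proof -
      have "\<zeta> ^ j = \<zeta> ^ i * \<zeta> ^ (j - i)" using that(1) by (simp flip: power_add)
      then have "\<zeta> ^ (j - i) = 1" using that nz by simp
      then show False using min[of "j - i"] that by simp
    qed
    then show ?thesis
      by (intro inj_onI) (metis lessThan_iff linorder_neqE_nat)
  qed
  \<comment> \<open>Since x^m - 1 has at most m roots, the m distinct powers leave room for no
    other.\<close>
  have "(\<lambda>j. \<zeta> ^ j) ` {..<m} \<subseteq> ?R"
    unfolding R using m by (auto simp: power_mult[symmetric] mult.commute[of _ m]) (simp add: power_mult)
  moreover have "finite ?R" using poly_roots_finite deg by blast
  moreover have "card ?R \<le> m" using card_poly_roots_bound[of ?p] deg by simp
  moreover have "card ((\<lambda>j. \<zeta> ^ j) ` {..<m}) = m" using inj by (simp add: card_image)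
  ultimately have "(\<lambda>j. \<zeta> ^ j) ` {..<m} = ?R"
    by (metis card_mono card_subset_eq le_antisym)
  then show ?thesis using assms(2) R by auto
qed

lemma primitive_root_power_eq_1:
  assumes "primitive_root_of_unity m \<zeta>" "\<zeta> ^ j = 1"
  shows "m dvd j"
proof (rule ccontr)
  assume "\<not> m dvd j"
  then have j: "0 < j mod m" "j mod m < m"
    using assms by (auto simp: primitive_root_of_unity_def mod_greater_zero_iff_not_dvd)
  have "\<zeta> ^ j = (\<zeta> ^ m) ^ (j div m) * \<zeta> ^ (j mod m)"
    by (simp flip: power_mult power_add)
  then show False
    using assms j by (auto simp: primitive_root_of_unity_def)
qed

text \<open>On powers of \<zeta> the map e is inversion, so it fixes only 1 and -1 among them, and l
  does not negate these. Otherwise c has order 2^N with N > n; then d = c^(2^(N - n)) has order 2^n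
  >= 4 but is a power of \<zeta> fixed by e, so d * d = 1.\<close>

lemma no_fixed_anti_fixed_root_of_unity:
  fixes \<zeta> :: "'a :: field_char_0"
  assumes \<zeta>: "primitive_root_of_unity (2 ^ n) \<zeta>" "n \<ge> 2" and e: "coeff_hom e" "e \<zeta> = inverse \<zeta>"
    and l: "coeff_hom l" "l \<zeta> = - \<zeta>" and c: "c ^ (2 ^ r) = 1" "e c = c" "l c = - c"
  shows False
proof -
  have nz: "\<zeta> \<noteq> 0"
    using \<zeta>(1) by (auto simp: primitive_root_of_unity_def zero_power)
  have e_pow: "e (\<zeta> ^ j) = inverse (\<zeta> ^ j)" for j
    by (simp add: coeff_hom_power[OF e(1)] e(2) power_inverse)
  show False
  proof (cases "c ^ (2 ^ n) = 1")
    case True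
    then obtain j where "c = \<zeta> ^ j" using roots_of_unity_powers[OF \<zeta>(1)] by blast
    then have "c = inverse c" "c \<noteq> 0" using c(2) e_pow[of j] nz by auto
    then have "c * c = 1" by (metis right_inverse)
    then have "c = 1 \<or> c = - 1" by (simp add: square_eq_1_iff)
    then have "l c = c" using l(1) by (auto simp: coeff_hom.hom_one coeff_hom_minus)
    then have "c = 0" using c(3) by simp
    then show False using c(1) by (simp add: power_0_left split: if_splits)
  next
    case False
    define N where "N = (LEAST k. c ^ (2 ^ k) = 1)"
    have N: "c ^ (2 ^ N) = 1" "\<And>k. k < N \<Longrightarrow> c ^ (2 ^ k) \<noteq> 1"
      unfolding N_def using LeastI[of "\<lambda>k. c ^ (2 ^ k) = 1", OF c(1)] not_less_Least by blast+
    have Nn: "n < N"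
    proof (rule ccontr)
      assume "\<not> n < N"
      then have "(2::nat) ^ n = 2 ^ N * 2 ^ (n - N)" by (simp flip: power_add)
      then have "c ^ (2 ^ n) = (c ^ (2 ^ N)) ^ (2 ^ (n - N))" by (simp add: power_mult)
      then show False using False N(1) by simp
    qed
    define d where "d = c ^ (2 ^ (N - n))"
    have "d ^ (2 ^ n) = 1"
      using N(1) Nn by (simp add: d_def flip: power_mult power_add)
    then obtain j where j: "d = \<zeta> ^ j" using roots_of_unity_powers[OF \<zeta>(1)] by blast
    have "e d = d" using c(2) by (simp add: d_def coeff_hom_power[OF e(1)])
    then have "d = inverse d" "d \<noteq> 0" using j e_pow[of j] nz by auto
    then have "d * d = 1" by (metis right_inverse)
    then have "c ^ (2 ^ (N - n) * 2) = 1" unfolding d_def by (simp add: power2_eq_square power_mult)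
    then have "c ^ (2 ^ (N - n + 1)) = 1" by (simp add: mult.commute)
    moreover have "N - n + 1 < N" using Nn \<zeta>(2) by linarith
    ultimately show False using N(2) by blast
  qed
qed

section \<open>Coefficient maps and permutations of the variables\<close>

definition mmap :: "('a \<Rightarrow> 'b) \<Rightarrow> ('i, 'a :: comm_ring_1) mpoly \<Rightarrow> ('i, 'b :: comm_ring_1) mpoly" where
  "mmap a = meval (mconst \<circ> a) mvar"

lemma mcoeff_mmap: "coeff_hom a \<Longrightarrow> mcoeff (mmap a p) m = a (mcoeff p m)"
  unfolding mmap_def by (rule mcoeff_meval_mconst)

lemma coeff_hom_mmap: "coeff_hom a \<Longrightarrow> coeff_hom (mmap a)"
  unfolding mmap_def by (intro coeff_hom_meval coeff_hom_comp mconst.coeff_hom_axioms)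

lemma mmap_vars_in: "coeff_hom a \<Longrightarrow> p \<in> vars_in V \<Longrightarrow> mmap a p \<in> vars_in V"
  unfolding vars_in_def by (simp add: mcoeff_mmap) (metis coeff_hom.hom_zero)

lemma mmap_mmap:
  assumes "coeff_hom a" "coeff_hom b" "\<And>x. a (b x) = x"
  shows "mmap a (mmap b p) = p"
  by (rule mpoly_eqI) (simp add: mcoeff_mmap assms)

lemma coeff_hom_mrename: "coeff_hom (mrename f)"
  by (simp add: coeff_hom_def mrename_simps)

lemma mrename_vars_in:
  assumes "p \<in> vars_in V" "f ` V \<subseteq> W"
  shows "mrename f p \<in> vars_in W"
  using assms(1)
  by (induction rule: vars_in_induct)
     (use assms(2) in \<open>auto simp: mrename_simps add_vars_in mult_vars_in intro!: mvar_vars_in\<close>)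

lemma mrename_mmap:
  assumes "coeff_hom a"
  shows "mrename f (mmap a p) = mmap a (mrename f p)"
  unfolding mmap_def mrename_def
  by (subst (1 2) meval_hom)
     (use assms in \<open>simp_all add: comp_def mconst.meval_const mconst.meval_var coeff_hom_meval
        mconst.coeff_hom_axioms coeff_hom.meval_const[OF coeff_hom_comp[OF mconst.coeff_hom_axioms assms], unfolded comp_def]
        coeff_hom.meval_var[OF coeff_hom_comp[OF mconst.coeff_hom_axioms assms], unfolded comp_def]
        coeff_hom_comp[OF mconst.coeff_hom_axioms assms, unfolded comp_def]\<close>)

text \<open>A coefficient map and a renaming of the variables in one operation: Galois automorphisms
  and the action of the group are both instances and can be composed.\<close>

definition rf_map :: "('a :: field \<Rightarrow> 'b :: field) \<Rightarrow> ('i \<Rightarrow> 'j) \<Rightarrow> ('i, 'a) ratfun \<Rightarrow> ('j, 'b) ratfun" where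
  "rf_map a \<pi> = rf_eval (rf_const \<circ> a) (rf_var \<circ> \<pi>)"

context
  fixes a :: "'a :: field \<Rightarrow> 'b :: field" and \<pi> :: "'i \<Rightarrow> 'j"
  assumes a: "coeff_hom a" and \<pi>: "bij \<pi>"
begin

interpretation inj_eval "rf_const \<circ> a" "(rf_var :: 'j \<Rightarrow> ('j, 'b) ratfun) \<circ> \<pi>"
  by (rule inj_eval_perm[OF a \<pi>])

lemma coeff_hom_rf_map: "coeff_hom (rf_map a \<pi>)"
  unfolding rf_map_def by (rule coeff_hom_rf_eval)

lemma rf_map_const: "rf_map a \<pi> (rf_const c) = rf_const (a c)"
  using rf_eval_const[of c] by (simp add: rf_map_def rf_const_def)

lemma rf_map_var: "rf_map a \<pi> (rf_var i) = rf_var (\<pi> i)"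
  using rf_eval_var[of i] by (simp add: rf_map_def rf_var_def)

lemma rf_map_to_fract: "rf_map a \<pi> (to_fract p) = to_fract (mrename \<pi> (mmap a p))"
proof -
  have "(rf_const :: 'b \<Rightarrow> ('j, 'b) ratfun) \<circ> a = to_fract \<circ> (mconst \<circ> a)"
      "(rf_var :: 'j \<Rightarrow> ('j, 'b) ratfun) \<circ> \<pi> = to_fract \<circ> (mvar \<circ> \<pi>)"
    by (auto simp: rf_const_def rf_var_def)
  then have "meval ((rf_const :: 'b \<Rightarrow> ('j, 'b) ratfun) \<circ> a) (rf_var \<circ> \<pi>) p
      = to_fract (meval (mconst \<circ> a) (mvar \<circ> \<pi>) p)"
    by (simp only: meval_hom[OF coeff_hom_to_fract])
  then have "rf_map a \<pi> (to_fract p) = to_fract (meval (mconst \<circ> a) (mvar \<circ> \<pi>) p)"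
    unfolding rf_map_def rf_eval_to_fract .
  also have "meval (mconst \<circ> a) (mvar \<circ> \<pi>) p = mrename \<pi> (mmap a p)"
    unfolding mmap_def meval_hom[OF coeff_hom_mrename] by (simp add: comp_def mrename_simps)
  finally show ?thesis .
qed

lemma rf_map_Fract:
  assumes "q \<noteq> 0"
  shows "rf_map a \<pi> (Fract p q) = Fract (mrename \<pi> (mmap a p)) (mrename \<pi> (mmap a q))"
proof -
  have "Fract p q = to_fract p / to_fract q"
    using assms by (simp add: to_fract_def divide_fract)
  moreover have "mrename \<pi> (mmap a q) \<noteq> 0"
    using rf_map_to_fract[of q] coeff_hom_eq_0_iff[OF coeff_hom_rf_map] assms by force
  ultimately show ?thesis
    by (simp add: coeff_hom_divide[OF coeff_hom_rf_map] rf_map_to_fract) (simp add: to_fract_def divide_fract)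
qed

end

text \<open>Write \<open>u = P / Q\<close> in lowest terms. Then \<open>P\<close> is multiplied by a root of unity \<open>\<kappa>\<close> under the
  permutation, \<open>\<kappa>\<close> is fixed by \<open>e\<close> and negated by \<open>l\<close>, and there is no such root of unity.\<close>

theorem no_twisted_unit:
  fixes \<zeta> :: "'a :: field_char_0" and u :: "('i, 'a) ratfun"
  assumes \<zeta>: "primitive_root_of_unity (2 ^ n) \<zeta>" "n \<ge> 2"
    and e: "coeff_hom e" "coeff_hom e'" "\<And>x. e (e' x) = x" "\<And>x. e' (e x) = x" "e \<zeta> = inverse \<zeta>"
    and l: "coeff_hom l" "coeff_hom l'" "\<And>x. l (l' x) = x" "\<And>x. l' (l x) = x" "l \<zeta> = - \<zeta>"
    and \<pi>: "bij \<pi>" "\<pi> ^^ (2 ^ r) = (\<lambda>i. i)"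
    and u: "u * rf_map l (\<lambda>i. i) u = 1" "rf_map (\<lambda>c. c) \<pi> u = - u" "rf_map e (\<lambda>i. i) u = u"
  shows False
proof -
  obtain a1 b1 where ab1: "b1 \<noteq> 0" "u = Fract a1 b1" by (cases u) auto
  obtain V0 where V0: "finite V0" "a1 \<in> vars_in V0" "b1 \<in> vars_in V0"
  proof -
    obtain V W where "finite V" "a1 \<in> vars_in V" "finite W" "b1 \<in> vars_in W"
      using finite_vars by metis
    then show thesis
      using that[of "V \<union> W"] vars_in_mono[of V "V \<union> W"] vars_in_mono[of W "V \<union> W"] by auto
  qed
  define M :: nat where "M = 2 ^ r"
  have M: "M > 0" by (simp add: M_def)
  \<comment> \<open>The orbit of the variables that occur in u is finite, so the factorisation takes
    place in a ring preserved by the permutation.\<close>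
  define V where "V = (\<Union>k<M. (\<pi> ^^ k) ` V0)"
  have "finite V" using V0 by (simp add: V_def)
  have "V0 \<subseteq> V" unfolding V_def using M by (auto intro!: bexI[of _ 0])
  have stable: "\<pi> ` V \<subseteq> V"
  proof
    fix y assume "y \<in> \<pi> ` V"
    then obtain k x where k: "k < M" "x \<in> V0" "y = (\<pi> ^^ Suc k) x" unfolding V_def by auto
    show "y \<in> V"
    proof (cases "Suc k < M")
      case True
      then show ?thesis using k unfolding V_def by blast
    next
      case False
      then have "Suc k = M" using k by simp
      then have "y = (\<pi> ^^ 0) x" using k \<pi>(2) by (simp add: M_def)
      then show ?thesis using k M unfolding V_def by blast
    qed
  qed
  let ?R = "vars_in V :: ('i, 'a) mpoly set"
  interpret ufd_locale ?R
    using ufd_vars_in[OF \<open>finite V\<close>, where 'a = 'a] by unfold_locales (auto simp: ufd_def)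
  have "a1 \<in> ?R" "b1 \<in> ?R" using V0 vars_in_mono[OF \<open>V0 \<subseteq> V\<close>] by auto
  then obtain a b where ab: "a \<in> ?R" "b \<in> ?R" "b \<noteq> 0" "a1 * b = a * b1"
    and red: "\<And>a' b'. a' \<in> ?R \<Longrightarrow> b' \<in> ?R \<Longrightarrow> a' * b = a * b' \<Longrightarrow> \<exists>t\<in>?R. a' = t * a \<and> b' = t * b"
    using lowest_terms[of a1 b1] ab1(1) by blast
  have uab: "u = Fract a b" using ab ab1 by (simp add: eq_fract)
  have "u \<noteq> 0" using u(1) by auto
  then have a0: "a \<noteq> 0" using uab by (auto simp: Zero_fract_def eq_fract)
  define S where "S = (mrename \<pi> :: ('i, 'a) mpoly \<Rightarrow> _)"
  have id: "mmap (\<lambda>c. c) p = p" "mrename (\<lambda>i. i) p = p" for p :: "('i, 'a) mpoly"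
    by (simp_all add: mrename_id mpoly_eqI mcoeff_mmap coeff_hom_id)
  have S: "coeff_hom S" unfolding S_def by (rule coeff_hom_mrename)
  have SR: "S p \<in> ?R" if "p \<in> ?R" for p
    unfolding S_def using mrename_vars_in[OF that stable] .
  have eq_S: "S a * b = - a * S b"
  proof -
    have "S b \<noteq> 0"
      using meval_perm_eq_0[OF coeff_hom_id _ \<pi>(1), of b] ab(3)
      by (auto simp: S_def mrename_def comp_def)
    then show ?thesis
      using u(2) ab(3) unfolding uab rf_map_Fract[OF coeff_hom_id \<pi>(1) ab(3)] id
      by (simp add: eq_fract S_def)
  qed
  have mmap_nz: "mmap f b \<noteq> 0" if "coeff_hom f" for f :: "'a \<Rightarrow> 'a"
    using ab(3) that by (metis coeff_hom_eq_0_iff mcoeff_mmap mcoeff_simps(1) mpoly_eqI)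
  have eq_l: "a * mmap l a = b * mmap l b"
    using u(1) ab(3) mmap_nz[OF l(1)] unfolding uab rf_map_Fract[OF l(1) bij_id[unfolded id_def] ab(3)] id
    by (simp add: One_fract_def eq_fract)
  have eq_e: "mmap e a * b = a * mmap e b"
    using u(3) ab(3) mmap_nz[OF e(1)] unfolding uab rf_map_Fract[OF e(1) bij_id[unfolded id_def] ab(3)] id
    by (simp add: eq_fract)
  note hl = coeff_hom_mmap[OF l(1)] and hl' = coeff_hom_mmap[OF l(2)]
  note he = coeff_hom_mmap[OF e(1)] and he' = coeff_hom_mmap[OF e(2)]
  \<comment> \<open>Both a / b and S a / (- S b) represent u, so S a and - S b are the same multiple
    of a and b.\<close>
  obtain \<kappa> where \<kappa>: "\<kappa> \<in> ?R" "S a = \<kappa> * a" "S b = - (\<kappa> * b)"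
  proof -
    have "S a * b = a * (- S b)" using eq_S by simp
    then obtain t where "t \<in> ?R" "S a = t * a" "- S b = t * b"
      using red[of "S a" "- S b"] SR ab by auto
    then show thesis using that[of t] by (metis add.inverse_inverse)
  qed
  \<comment> \<open>Iterating S up to its period M exhibits an inverse of \<kappa>, which is
    therefore a constant.\<close>
  have "\<exists>t\<in>?R. (S ^^ j) a = t * a" for j
  proof (induction j)
    case 0
    show ?case by (auto intro!: bexI[of _ 1])
  next
    case (Suc j)
    then obtain t where "t \<in> ?R" "(S ^^ j) a = t * a" by blast
    then show ?case
      using \<kappa> SR by (auto simp: coeff_hom.hom_mult[OF S] intro!: bexI[of _ "S t * \<kappa>"])
  qed
  moreover have S_M: "(S ^^ M) p = p" for p
  proof -
    have "(S ^^ j) p = mrename (\<pi> ^^ j) p" for j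
      by (induction j) (simp_all add: id_def mrename_id S_def mrename_mrename comp_def)
    then show ?thesis using \<pi>(2) by (simp add: M_def mrename_id)
  qed
  ultimately obtain t where "t \<in> ?R" "(S ^^ (M - 1)) a = t * a" by blast
  moreover have "S ((S ^^ (M - 1)) a) = a"
    using S_M[of a] M by (metis Suc_diff_1 funpow.simps(2) comp_apply)
  ultimately have "S t * \<kappa> * a = 1 * a"
    using \<kappa>(2) by (simp add: coeff_hom.hom_mult[OF S] mult.assoc)
  then have "\<kappa> * S t = 1" using a0 by (subst (asm) mult_cancel_right) (simp add: mult.commute)
  then obtain c where c: "\<kappa> = mconst c" using mpoly_unit_const by blast
  have S_const: "S (mconst x) = mconst x" for x by (simp add: S_def mrename_simps)
  have "(S ^^ j) a = mconst (c ^ j) * a" for j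
    by (induction j) (simp_all add: mconst.hom_one coeff_hom.hom_mult[OF S] S_const \<kappa>(2) c mconst.hom_mult ac_simps)
  then have "mconst (c ^ M) * a = mconst 1 * a" using S_M[of a] by (simp add: mconst.hom_one)
  then have "mconst (c ^ M) = (mconst 1 :: ('i, 'a) mpoly)" using a0 by (subst (asm) mult_cancel_right) simp
  then have cM: "c ^ (2 ^ r) = 1"
    by (simp add: M_def mconst_eq_iff)
  have mmap_const: "mmap f (mconst x) = mconst (f x)" if "coeff_hom f" for f :: "'a \<Rightarrow> 'a" and x
    using coeff_hom.meval_const[OF coeff_hom_comp[OF mconst.coeff_hom_axioms that]]
    by (simp add: mmap_def)
  have S_mmap: "S (mmap f p) = mmap f (S p)" if "coeff_hom f" for f :: "'a \<Rightarrow> 'a" and p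
    unfolding S_def by (rule mrename_mmap[OF that])
  \<comment> \<open>As e fixes u, it multiplies a by a unit, a constant x. Computing S (e a) in the
    two possible orders gives x * c = e c * x.\<close>
  have "e c = c"
  proof -
    obtain t where t: "t \<in> ?R" "mmap e a = t * a"
      using red[of "mmap e a" "mmap e b"] eq_e mmap_vars_in[OF e(1)] ab by blast
    have "mmap e' (mmap e a * b) = mmap e' (a * mmap e b)" using eq_e by simp
    then have "mmap e' a * b = a * mmap e' b"
      by (simp add: coeff_hom.hom_mult[OF he'] mmap_mmap[OF e(2,1,4)])
    then obtain s where s: "s \<in> ?R" "mmap e' a = s * a"
      using red[of "mmap e' a" "mmap e' b"] mmap_vars_in[OF e(2)] ab by blast
    have "a = mmap e (s * a)" using s mmap_mmap[OF e(1,2,3), of a] by simp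
    then have "(t * mmap e s) * a = 1 * a" by (simp add: coeff_hom.hom_mult[OF he] t ac_simps)
    then have "t * mmap e s = 1" using a0 by (subst (asm) mult_cancel_right) simp
    then obtain x where x: "t = mconst x" using mpoly_unit_const by blast
    have "x \<noteq> 0" using \<open>t * mmap e s = 1\<close> x by (auto simp: mconst.hom_zero)
    have "S (mmap e a) = mconst (x * c) * a"
      by (simp add: t x coeff_hom.hom_mult[OF S] S_const \<kappa>(2) c mconst.hom_mult)
    moreover have "S (mmap e a) = mconst (e c * x) * a"
      unfolding S_mmap[OF e(1)] \<kappa>(2) by (simp add: c coeff_hom.hom_mult[OF he] mmap_const[OF e(1)] t x mconst.hom_mult)
    ultimately have "mconst (x * c) = (mconst (e c * x) :: ('i, 'a) mpoly)"
      using a0 by simp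
    then have "x * c = e c * x" by (simp only: mconst_eq_iff)
    then show ?thesis using \<open>x \<noteq> 0\<close> by simp
  qed
  \<comment> \<open>By u * l u = 1, the map l exchanges numerator and denominator up to a constant;
    the sign is the difference between S a = \<kappa> * a and S b = - (\<kappa> * b).\<close>
  moreover have "l c = - c"
  proof -
    have "mmap l b * b = a * mmap l a" using eq_l by (simp add: mult.commute)
    then obtain t where t: "t \<in> ?R" "mmap l b = t * a" "mmap l a = t * b"
      using red[of "mmap l b" "mmap l a"] mmap_vars_in[OF l(1)] ab by blast
    have "mmap l' (a * mmap l a) = mmap l' (b * mmap l b)" using eq_l by simp
    then have "mmap l' b * b = a * mmap l' a"
      by (simp add: coeff_hom.hom_mult[OF hl'] mmap_mmap[OF l(2,1,4)] mult.commute)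
    then obtain s where s: "s \<in> ?R" "mmap l' b = s * a"
      using red[of "mmap l' b" "mmap l' a"] mmap_vars_in[OF l(2)] ab by blast
    have "b = mmap l (s * a)" using s mmap_mmap[OF l(1,2,3), of b] by simp
    then have "(t * mmap l s) * b = 1 * b" by (simp add: coeff_hom.hom_mult[OF hl] t ac_simps)
    then have "t * mmap l s = 1" using ab(3) by (subst (asm) mult_cancel_right) simp
    then obtain x where x: "t = mconst x" using mpoly_unit_const by blast
    have "x \<noteq> 0" using \<open>t * mmap l s = 1\<close> x by (auto simp: mconst.hom_zero)
    have "S (mmap l b) = mconst (x * c) * a"
      by (simp add: t x coeff_hom.hom_mult[OF S] S_const \<kappa>(2) c mconst.hom_mult)
    moreover have "S (mmap l b) = mconst (- (l c * x)) * a"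
      unfolding S_mmap[OF l(1)] \<kappa>(3) by (simp add: c coeff_hom.hom_mult[OF hl] coeff_hom_minus[OF hl]
          mmap_const[OF l(1)] t x mconst.hom_mult coeff_hom_minus[OF mconst.coeff_hom_axioms])
    ultimately have "mconst (x * c) = (mconst (- (l c * x)) :: ('i, 'a) mpoly)"
      using a0 by simp
    then have "x * c = - (l c * x)" by (simp only: mconst_eq_iff)
    then have "x * (l c + c) = 0" by (simp add: algebra_simps)
    then show ?thesis using \<open>x \<noteq> 0\<close> by (simp add: eq_neg_iff_add_eq_0)
  qed
  ultimately show False
    using no_fixed_anti_fixed_root_of_unity[OF \<zeta> e(1,5) l(1,5) cM] by blast
qed

section \<open>Automorphisms of fields\<close>

definition subfld :: "'e :: field set \<Rightarrow> bool" where
  "subfld K \<longleftrightarrow> subdomain K \<and> (\<forall>x\<in>K. inverse x \<in> K)"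

definition hom_on :: "'e :: field set \<Rightarrow> ('e \<Rightarrow> 'e) \<Rightarrow> bool" where
  "hom_on K f \<longleftrightarrow> f 1 = 1 \<and> (\<forall>x\<in>K. \<forall>y\<in>K. f (x + y) = f x + f y \<and> f (x * y) = f x * f y)"

text \<open>Serves two purposes: extending automorphisms from subfields, and specialising along a
  line, where the domain consists of the elements that can be restricted to the line.\<close>

locale partial_hom = subdomain_locale K for K :: "'a :: idom set" +
  fixes f :: "'a \<Rightarrow> 'b :: idom"
  assumes f_1: "f 1 = 1"
    and f_add: "x \<in> K \<Longrightarrow> y \<in> K \<Longrightarrow> f (x + y) = f x + f y"
    and f_mult: "x \<in> K \<Longrightarrow> y \<in> K \<Longrightarrow> f (x * y) = f x * f y"
begin

lemma f_0: "f 0 = 0"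
  using f_add[of 0 0] closed(2) by (metis add.right_neutral add_left_cancel)

lemma f_minus: "x \<in> K \<Longrightarrow> f (- x) = - f x"
  using f_add[of x "- x"] f_0 by (simp add: eq_neg_iff_add_eq_0 add.commute)

lemma f_diff: "x \<in> K \<Longrightarrow> y \<in> K \<Longrightarrow> f (x - y) = f x - f y"
  using f_add[of x "- y"] f_minus[of y] by simp

lemma f_sum: "(\<And>x. x \<in> S \<Longrightarrow> h x \<in> K) \<Longrightarrow> f (sum h S) = (\<Sum>x\<in>S. f (h x))"
  by (induction S rule: infinite_finite_induct) (auto simp: f_0 f_add sum_closed)

lemma map_add: "p \<in> polys_over K \<Longrightarrow> q \<in> polys_over K \<Longrightarrow> map_poly f (p + q) = map_poly f p + map_poly f q"
  by (rule poly_eqI) (auto simp: coeff_map_poly f_0 f_add polys_over_def)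

lemma map_diff: "p \<in> polys_over K \<Longrightarrow> q \<in> polys_over K \<Longrightarrow> map_poly f (p - q) = map_poly f p - map_poly f q"
  by (rule poly_eqI) (auto simp: coeff_map_poly f_0 f_diff polys_over_def)

lemma map_mult: "p \<in> polys_over K \<Longrightarrow> q \<in> polys_over K \<Longrightarrow> map_poly f (p * q) = map_poly f p * map_poly f q"
  by (rule poly_eqI) (auto simp: coeff_map_poly f_0 coeff_mult f_sum f_mult polys_over_def)

lemma map_const: "map_poly f [:c:] = [:f c:]"
  by (rule poly_eqI) (auto simp: coeff_map_poly f_0 coeff_pCons split: nat.split)

end

locale subfld_hom =
  fixes K :: "'e :: field set" and f :: "'e \<Rightarrow> 'e"
  assumes K: "subfld K" and f: "hom_on K f"
begin

sublocale ufd_locale K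
proof
  show "subdomain K" using K by (simp add: subfld_def)
  fix a assume "a \<in> K" "a \<noteq> 0"
  then have "dvd_in K a 1"
    unfolding dvd_in_def using K by (intro bexI[of _ "inverse a"]) (auto simp: subfld_def)
  then show "\<exists>n. factors_in K n a" using \<open>a \<in> K\<close> factors_in.unit by blast
qed

sublocale partial_hom K f
  using f by unfold_locales (auto simp: hom_on_def)

lemma inverse_closed: "x \<in> K \<Longrightarrow> inverse x \<in> K"
  using K by (simp add: subfld_def)

lemma f_eq_0_iff:
  assumes "x \<in> K"
  shows "f x = 0 \<longleftrightarrow> x = 0"
proof
  assume "f x = 0"
  show "x = 0"
  proof (rule ccontr)
    assume "x \<noteq> 0"
    then have "f x * f (inverse x) = 1"
      using assms inverse_closed[OF assms] f_1 by (simp flip: f_mult)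
    then show False using \<open>f x = 0\<close> by simp
  qed
qed (simp add: f_0)

end

section \<open>Simple algebraic extensions\<close>

lemma division_over:
  assumes "subfld K" "p \<in> polys_over K" "p \<noteq> 0" "q \<in> polys_over K"
  shows "\<exists>s r. s \<in> polys_over K \<and> r \<in> polys_over K \<and> q = p * s + r \<and> (r = 0 \<or> degree r < degree p)"
proof -
  interpret subfld_hom K "\<lambda>x. x"
    by unfold_locales (auto simp: assms hom_on_def)
  obtain e s r where e: "e \<in> K" "e \<noteq> 0" "s \<in> polys_over K" "r \<in> polys_over K" "smult e q = p * s + r"
      "r = 0 \<or> degree r < degree p"
    using pseudo_division[OF assms(2,3,4)] by blast
  have "q = smult (inverse e) (smult e q)" using e(2) by simp
  also have "\<dots> = p * smult (inverse e) s + smult (inverse e) r"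
    unfolding e(5) by (simp add: smult_add_right)
  finally show ?thesis
    using e inverse_closed[OF e(1)] by (intro exI[of _ "smult (inverse e) s"] exI[of _ "smult (inverse e) r"])
      (auto intro: smult_polys_over)
qed

text \<open>Not normalised to be monic; the divisibility clause is what makes extensions of
  homomorphisms well defined.\<close>

definition min_poly_over :: "'e :: field set \<Rightarrow> 'e \<Rightarrow> 'e poly \<Rightarrow> bool" where
  "min_poly_over K b p \<longleftrightarrow> p \<in> polys_over K \<and> p \<noteq> 0 \<and> poly p b = 0 \<and>
     (\<forall>q\<in>polys_over K. poly q b = 0 \<longrightarrow> (\<exists>s\<in>polys_over K. q = p * s))"

lemma min_poly_exists:
  assumes "subfld K" "q \<in> polys_over K" "q \<noteq> 0" "poly q b = 0"
  shows "\<exists>p. min_poly_over K b p"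
proof -
  let ?S = "\<lambda>p. p \<in> polys_over K \<and> p \<noteq> 0 \<and> poly p b = 0"
  define p where "p = arg_min degree ?S"
  have p: "?S p" and min: "\<And>r. ?S r \<Longrightarrow> degree p \<le> degree r"
    unfolding p_def using arg_min_natI[of ?S q degree] arg_min_nat_le[of ?S _ degree] assms by auto
  have "\<exists>s\<in>polys_over K. q = p * s" if q: "q \<in> polys_over K" "poly q b = 0" for q
  proof -
    obtain s r where s: "s \<in> polys_over K" "r \<in> polys_over K" "q = p * s + r" "r = 0 \<or> degree r < degree p"
      using division_over[OF assms(1)] p q by blast
    then have "poly r b = 0" using p q by simp
    then have "r = 0" using min[of r] s by force
    then show ?thesis using s by auto
  qed
  then show ?thesis unfolding min_poly_over_def using p by blast
qed

definition simple_ext :: "'e :: field set \<Rightarrow> 'e \<Rightarrow> 'e set" where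
  "simple_ext K b = {poly q b |q. q \<in> polys_over K}"

context subfld_hom
begin

lemma simple_ext_subset: "K \<subseteq> simple_ext K b" "b \<in> simple_ext K b"
proof -
  have "c \<in> simple_ext K b" if "c \<in> K" for c
    unfolding simple_ext_def using that polys_over_closed(4)
    by (auto intro!: exI[of _ "[:c:]"])
  then show "K \<subseteq> simple_ext K b" by blast
  have "monom 1 1 \<in> polys_over K" by (intro monom_polys_over) auto
  then show "b \<in> simple_ext K b"
    unfolding simple_ext_def by (force simp: poly_monom intro!: exI[of _ "monom 1 1"])
qed

lemma subdomain_simple_ext: "subdomain (simple_ext K b)"
  unfolding subdomain_def simple_ext_def
proof (intro conjI ballI)
  show "1 \<in> {poly q b |q. q \<in> polys_over K}" by (force intro: exI[of _ 1])
  fix x y assume "x \<in> {poly q b |q. q \<in> polys_over K}" "y \<in> {poly q b |q. q \<in> polys_over K}"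
  then obtain p q where pq: "x = poly p b" "y = poly q b" "p \<in> polys_over K" "q \<in> polys_over K" by blast
  have "x + y = poly (p + q) b" "x * y = poly (p * q) b" "- x = poly (- p) b"
    by (simp_all add: pq)
  moreover have "p + q \<in> polys_over K" "p * q \<in> polys_over K" "- p \<in> polys_over K"
    using pq by auto
  ultimately show "x + y \<in> {poly q b |q. q \<in> polys_over K}" "x * y \<in> {poly q b |q. q \<in> polys_over K}"
    "- x \<in> {poly q b |q. q \<in> polys_over K}"
    by blast+
qed

lemma subfld_simple_ext:
  assumes "min_poly_over K b p"
  shows "subfld (simple_ext K b)"
  unfolding subfld_def
proof (intro conjI ballI)
  show "subdomain (simple_ext K b)" by (rule subdomain_simple_ext)
  fix x assume "x \<in> simple_ext K b"
  then obtain q where q: "q \<in> polys_over K" "x = poly q b" unfolding simple_ext_def by blast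
  show "inverse x \<in> simple_ext K b"
  proof (cases "x = 0")
    case True
    then show ?thesis using simple_ext_subset(1) closed(2) by auto
  next
    case False
    \<comment> \<open>A nonzero combination of \<open>p\<close> and \<open>q\<close> of least degree is constant.\<close>
    let ?S = "\<lambda>r. r \<in> polys_over K \<and> r \<noteq> 0 \<and> (\<exists>u\<in>polys_over K. \<exists>v\<in>polys_over K. r = u * p + v * q)"
    have p: "p \<in> polys_over K" "p \<noteq> 0" "poly p b = 0" using assms by (auto simp: min_poly_over_def)
    have "p = 1 * p + 0 * q" by simp
    then have "?S p" using p P.closed(1,2) by blast
    define r where "r = arg_min degree ?S"
    have "?S r" and min: "\<And>t. ?S t \<Longrightarrow> degree r \<le> degree t"
      unfolding r_def using arg_min_natI[of ?S p degree] arg_min_nat_le[of ?S _ degree] \<open>?S p\<close> by auto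
    then obtain u v where uv: "u \<in> polys_over K" "v \<in> polys_over K" "r = u * p + v * q" "r \<in> polys_over K" "r \<noteq> 0"
      by blast
    have div: "\<exists>s\<in>polys_over K. t = r * s"
      if t: "t \<in> polys_over K" "u' \<in> polys_over K" "v' \<in> polys_over K" "t = u' * p + v' * q" for t u' v'
    proof -
      obtain s w where s: "s \<in> polys_over K" "w \<in> polys_over K" "t = r * s + w" "w = 0 \<or> degree w < degree r"
        using division_over[OF K uv(4,5) t(1)] by blast
      have "w = (u' - s * u) * p + (v' - s * v) * q" using s(3) t(4) uv(3) by (simp add: algebra_simps)
      moreover have "u' - s * u \<in> polys_over K" "v' - s * v \<in> polys_over K" using s uv t by auto
      ultimately have "w = 0" using min[of w] s(2,4) by force
      then show ?thesis using s by auto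
    qed
    have "p = 1 * p + 0 * q" by simp
    then obtain s where s: "s \<in> polys_over K" "p = r * s"
      using div[of p 1 0] p by auto
    obtain t where t: "t \<in> polys_over K" "q = r * t"
      using div[of q 0 1] q by auto
    have "poly r b \<noteq> 0" using t q False by auto
    then have "poly s b = 0" using s p by auto
    \<comment> \<open>Since r does not vanish at b, its cofactor s in p does; hence p divides s, and
      r divides 1.\<close>
    then obtain s' where "s = p * s'" using s assms unfolding min_poly_over_def by blast
    then have "p * (r * s') = p * 1" using s by (simp add: ac_simps)
    then have "r * s' = 1" using p(2) by (subst (asm) mult_cancel_left) simp
    then have "degree r = 0"
      by (metis degree_1 degree_mult_eq_0 mult_zero_left zero_neq_one mult_zero_right)
    then obtain c where c: "r = [:c:]" by (rule degree_eq_zeroE)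
    then have "c \<in> K" "c \<noteq> 0" using uv const_polys_over_iff by auto
    have "c = poly v b * x" using arg_cong[OF uv(3), of "\<lambda>r. poly r b"] c p q by simp
    then have "inverse x = poly (smult (inverse c) v) b"
      using \<open>c \<noteq> 0\<close> by (auto simp: field_simps)
    then show ?thesis
      unfolding simple_ext_def using uv(2) inverse_closed[OF \<open>c \<in> K\<close>] smult_polys_over by blast
  qed
qed

text \<open>Two polynomials with equal value at b differ by a multiple of p, whose image under f
  vanishes at b'. So the value assigned does not depend on the polynomial chosen.\<close>

lemma extend_simple:
  assumes p: "min_poly_over K b p" and b': "poly (map_poly f p) b' = 0"
  shows "\<exists>g. hom_on (simple_ext K b) g \<and> (\<forall>x\<in>K. g x = f x) \<and> g b = b' \<and>
    (\<forall>q\<in>polys_over K. g (poly q b) = poly (map_poly f q) b')"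
proof -
  define g where "g x = poly (map_poly f (SOME q. q \<in> polys_over K \<and> poly q b = x)) b'" for x
  have g: "g (poly q b) = poly (map_poly f q) b'" if q: "q \<in> polys_over K" for q
  proof -
    define q' where "q' = (SOME q'. q' \<in> polys_over K \<and> poly q' b = poly q b)"
    have q': "q' \<in> polys_over K" "poly q' b = poly q b"
      unfolding q'_def using someI[of "\<lambda>q'. q' \<in> polys_over K \<and> poly q' b = poly q b" q] q by auto
    then have "poly (q' - q) b = 0" "q' - q \<in> polys_over K" using q by auto
    then obtain s where s: "s \<in> polys_over K" "q' - q = p * s"
      using p unfolding min_poly_over_def by blast
    have "map_poly f q' - map_poly f q = map_poly f p * map_poly f s"
      using q q' s p by (simp flip: map_diff map_mult add: min_poly_over_def)
    then have "poly (map_poly f q' - map_poly f q) b' = 0" using b' by simp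
    then show ?thesis by (simp add: g_def q'_def)
  qed
  have "g 1 = 1" using g[of 1] by (simp add: map_poly_1' f_1)
  moreover have "g (x + y) = g x + g y \<and> g (x * y) = g x * g y"
    if xy: "x \<in> simple_ext K b" "y \<in> simple_ext K b" for x y
  proof -
    obtain q r where "q \<in> polys_over K" "x = poly q b" "r \<in> polys_over K" "y = poly r b"
      using xy unfolding simple_ext_def by blast
    then show ?thesis
      using g[of "q + r"] g[of "q * r"] g[of q] g[of r] by (simp add: map_add map_mult)
  qed
  ultimately have "hom_on (simple_ext K b) g" unfolding hom_on_def by blast
  moreover have "g x = f x" if "x \<in> K" for x
    using g[of "[:x:]"] that by (simp add: map_const polys_over_closed)
  moreover have "g b = b'"
    using g[of "monom 1 1"] by (simp add: monom_polys_over map_poly_monom f_0 f_1 poly_monom)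
  ultimately show ?thesis using g by blast
qed

end

subsection \<open>Extension to the algebraic closure\<close>

text \<open>Partial homomorphisms are represented by their graphs, which are closed under unions of chains.\<close>

definition hom_graph :: "('e :: field \<times> 'e) set \<Rightarrow> bool" where
  "hom_graph \<Gamma> \<longleftrightarrow> (1, 1) \<in> \<Gamma> \<and>
     (\<forall>x x' y y'. (x, x') \<in> \<Gamma> \<longrightarrow> (y, y') \<in> \<Gamma> \<longrightarrow>
        (x + y, x' + y') \<in> \<Gamma> \<and> (x * y, x' * y') \<in> \<Gamma>) \<and>
     (\<forall>x x'. (x, x') \<in> \<Gamma> \<longrightarrow>
        (- x, - x') \<in> \<Gamma> \<and> (inverse x, inverse x') \<in> \<Gamma> \<and> (x = 0 \<longrightarrow> x' = 0))"

lemma hom_graphD: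
  assumes "hom_graph \<Gamma>" "(x, x') \<in> \<Gamma>"
  shows "(y, y') \<in> \<Gamma> \<Longrightarrow> (x + y, x' + y') \<in> \<Gamma>" "(y, y') \<in> \<Gamma> \<Longrightarrow> (x * y, x' * y') \<in> \<Gamma>"
    "(- x, - x') \<in> \<Gamma>" "(inverse x, inverse x') \<in> \<Gamma>" "x = 0 \<Longrightarrow> x' = 0"
  using assms unfolding hom_graph_def by metis+

lemma hom_graph_single_valued:
  assumes "hom_graph \<Gamma>" "(x, y) \<in> \<Gamma>" "(x, z) \<in> \<Gamma>"
  shows "y = z"
proof -
  have "(- x, - z) \<in> \<Gamma>" by (rule hom_graphD(3)[OF assms(1,3)])
  then have "(x + - x, y + - z) \<in> \<Gamma>" by (rule hom_graphD(1)[OF assms(1,2)])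
  then have "y + - z = 0" by (rule hom_graphD(5)[OF assms(1)]) simp
  then show ?thesis by simp
qed

lemma hom_graph_of_hom_on:
  assumes "subfld K" "hom_on K f"
  shows "hom_graph ((\<lambda>x. (x, f x)) ` K)"
proof -
  interpret subfld_hom K f by unfold_locales (fact assms)+
  have "f (inverse x) = inverse (f x)" if "x \<in> K" for x
  proof (cases "x = 0")
    case False
    then have "f x * f (inverse x) = 1"
      using that inverse_closed f_1 by (simp flip: f_mult)
    then show ?thesis by (simp add: inverse_unique)
  qed (simp add: f_0)
  then show ?thesis
    unfolding hom_graph_def using f_1 f_0 inverse_closed by (auto simp: image_iff f_add f_mult f_minus)
qed

lemma hom_on_of_hom_graph:
  assumes "hom_graph \<Gamma>"
  shows "\<exists>f. subfld (Domain \<Gamma>) \<and> hom_on (Domain \<Gamma>) f \<and> (\<forall>x y. (x, y) \<in> \<Gamma> \<longrightarrow> y = f x)"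
proof -
  define f where "f x = (THE y. (x, y) \<in> \<Gamma>)" for x
  have f: "f x = y" if "(x, y) \<in> \<Gamma>" for x y
    unfolding f_def using that hom_graph_single_valued[OF assms] by blast
  then have graph: "(x, f x) \<in> \<Gamma>" if "x \<in> Domain \<Gamma>" for x using that by auto
  have "subdomain (Domain \<Gamma>)"
    unfolding subdomain_def
  proof (intro conjI ballI)
    show "1 \<in> Domain \<Gamma>" using assms unfolding hom_graph_def by blast
    fix x y assume "x \<in> Domain \<Gamma>" "y \<in> Domain \<Gamma>"
    then have xy: "(x, f x) \<in> \<Gamma>" "(y, f y) \<in> \<Gamma>" using graph by auto
    have "(x + y, f x + f y) \<in> \<Gamma>" by (rule hom_graphD(1)[OF assms xy])
    then show "x + y \<in> Domain \<Gamma>" by blast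
    have "(x * y, f x * f y) \<in> \<Gamma>" by (rule hom_graphD(2)[OF assms xy])
    then show "x * y \<in> Domain \<Gamma>" by blast
    have "(- x, - f x) \<in> \<Gamma>" by (rule hom_graphD(3)[OF assms xy(1)])
    then show "- x \<in> Domain \<Gamma>" by blast
  qed
  moreover have "inverse x \<in> Domain \<Gamma>" if "x \<in> Domain \<Gamma>" for x
  proof -
    have "(inverse x, inverse (f x)) \<in> \<Gamma>"
      by (rule hom_graphD(4)[OF assms graph[OF that]])
    then show ?thesis by blast
  qed
  moreover have "hom_on (Domain \<Gamma>) f"
    unfolding hom_on_def
  proof (intro conjI ballI)
    show "f 1 = 1" using assms by (intro f) (simp add: hom_graph_def)
    fix x y assume "x \<in> Domain \<Gamma>" "y \<in> Domain \<Gamma>"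
    then have xy: "(x, f x) \<in> \<Gamma>" "(y, f y) \<in> \<Gamma>" using graph by auto
    show "f (x + y) = f x + f y" "f (x * y) = f x * f y"
      using hom_graphD(1,2)[OF assms xy] by (auto intro: f)
  qed
  moreover have "y = f x" if "(x, y) \<in> \<Gamma>" for x y
    using f[OF that] by simp
  ultimately show ?thesis unfolding subfld_def by blast
qed

text \<open>Zorn's lemma gives a maximal extension. For any b, the image of its minimal polynomial
  has a root in the algebraically closed field, and the extension that sends b to this root must
  coincide with the maximal one.\<close>

theorem extend_to_closure:
  fixes K :: "'k :: field alg_closure set"
  assumes "subfld K" "range to_ac \<subseteq> K" "hom_on K f"
  shows "\<exists>g. coeff_hom g \<and> (\<forall>x\<in>K. g x = f x)"
proof -
  let ?\<Gamma>0 = "(\<lambda>x. (x, f x)) ` K"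
  let ?A = "{\<Gamma>. hom_graph \<Gamma> \<and> ?\<Gamma>0 \<subseteq> \<Gamma>}"
  have "\<exists>M\<in>?A. \<forall>X\<in>?A. M \<subseteq> X \<longrightarrow> X = M"
  proof (rule subset_Zorn_nonempty)
    show "?A \<noteq> {}" using hom_graph_of_hom_on[OF assms(1,3)] by blast
    fix C assume C: "C \<noteq> {}" "subset.chain ?A C"
    have pair: "\<exists>\<Gamma>\<in>C. a \<in> \<Gamma> \<and> b \<in> \<Gamma>" if "a \<in> \<Union>C" "b \<in> \<Union>C" for a b
    proof -
      note ab = that
      obtain X Y where XY: "X \<in> C" "a \<in> X" "Y \<in> C" "b \<in> Y" using ab by blast
      then have "X \<subseteq> Y \<or> Y \<subseteq> X" using C(2) unfolding subset_chain_def by blast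
      then show ?thesis using XY by blast
    qed
    have hg: "hom_graph \<Gamma>" "?\<Gamma>0 \<subseteq> \<Gamma>" if "\<Gamma> \<in> C" for \<Gamma>
      using that C(2) unfolding subset_chain_def by blast+
    have "hom_graph (\<Union>C)"
      unfolding hom_graph_def
    proof (intro conjI allI impI)
      obtain \<Gamma> where "\<Gamma> \<in> C" using C(1) by blast
      moreover from this have "(1, 1) \<in> \<Gamma>" using hg(1) by (simp add: hom_graph_def)
      ultimately show "(1, 1) \<in> \<Union>C" by blast
    next
      fix x x' y y' assume "(x, x') \<in> \<Union>C" "(y, y') \<in> \<Union>C"
      then obtain \<Gamma> where \<Gamma>: "\<Gamma> \<in> C" "(x, x') \<in> \<Gamma>" "(y, y') \<in> \<Gamma>" using pair by blast
      then show "(x + y, x' + y') \<in> \<Union>C" "(x * y, x' * y') \<in> \<Union>C"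
        using hom_graphD(1,2)[OF hg(1)[OF \<Gamma>(1)] \<Gamma>(2,3)] by blast+
    next
      fix x x' assume "(x, x') \<in> \<Union>C"
      then obtain \<Gamma> where \<Gamma>: "\<Gamma> \<in> C" "(x, x') \<in> \<Gamma>" by blast
      then show "(- x, - x') \<in> \<Union>C" "(inverse x, inverse x') \<in> \<Union>C" "x = 0 \<Longrightarrow> x' = 0"
        using hom_graphD(3,4,5)[OF hg(1)[OF \<Gamma>(1)] \<Gamma>(2)] by blast+
    qed
    then show "\<Union>C \<in> ?A" using C(1) hg(2) by blast
  qed
  then obtain M where M: "hom_graph M" "?\<Gamma>0 \<subseteq> M"
    and max: "\<And>X. hom_graph X \<Longrightarrow> M \<subseteq> X \<Longrightarrow> X = M" by auto
  obtain g where g: "subfld (Domain M)" "hom_on (Domain M) g" "\<And>x y. (x, y) \<in> M \<Longrightarrow> y = g x"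
    using hom_on_of_hom_graph[OF M(1)] by blast
  interpret subfld_hom "Domain M" g by unfold_locales (fact g(1,2))+
  have K: "K \<subseteq> Domain M" using M(2) by auto
  have "b \<in> Domain M" for b
  proof -
    obtain q :: "'k poly" where q: "q \<noteq> 0" "poly (map_poly to_ac q) b = 0"
      by (rule alg_closure_algebraic)
    have "map_poly to_ac q \<noteq> 0" using q(1) by (auto simp: poly_eq_iff coeff_map_poly)
    moreover have "map_poly to_ac q \<in> polys_over (Domain M)"
      using assms(2) K by (auto simp: polys_over_def coeff_map_poly)
    ultimately obtain p where p: "min_poly_over (Domain M) b p"
      using min_poly_exists[OF g(1)] q(2) by blast
    have "degree p > 0"
    proof (rule ccontr)
      assume "\<not> degree p > 0"
      then obtain c where "p = [:c:]" by (auto elim: degree_eq_zeroE)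
      then show False using p by (auto simp: min_poly_over_def)
    qed
    moreover have "degree (map_poly g p) = degree p"
    proof (rule map_poly_degree_eq)
      have "lead_coeff p \<in> Domain M" "lead_coeff p \<noteq> 0"
        using p lead_coeff_in by (auto simp: min_poly_over_def)
      then show "g (lead_coeff p) \<noteq> 0" using f_eq_0_iff by blast
    qed
    ultimately obtain b' where "poly (map_poly g p) b' = 0"
      using alg_closed_imp_poly_has_root[of "map_poly g p"] by auto
    then obtain g' where g': "hom_on (simple_ext (Domain M) b) g'" "\<forall>x\<in>Domain M. g' x = g x"
      using extend_simple[OF p] by blast
    let ?X = "(\<lambda>x. (x, g' x)) ` simple_ext (Domain M) b"
    have "hom_graph ?X" by (rule hom_graph_of_hom_on[OF subfld_simple_ext[OF p] g'(1)])
    moreover have "M \<subseteq> ?X"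
    proof
      fix z assume "z \<in> M"
      moreover obtain x y where z: "z = (x, y)" by (cases z)
      ultimately have "x \<in> Domain M" "y = g x" using g(3) by auto
      then have "z = (x, g' x)" "x \<in> simple_ext (Domain M) b"
        using g'(2) simple_ext_subset(1)[of b] z by auto
      then show "z \<in> ?X" by (rule image_eqI)
    qed
    ultimately have "?X = M" using max by blast
    moreover have "(b, g' b) \<in> ?X" using simple_ext_subset(2)[of b] by simp
    ultimately show "b \<in> Domain M" by auto
  qed
  then have "coeff_hom g" using g(2) unfolding coeff_hom_def hom_on_def by blast
  moreover have "g x = f x" if "x \<in> K" for x
  proof -
    have "(x, f x) \<in> M" using M(2) that by blast
    then show ?thesis using g(3) by simp
  qed
  ultimately show ?thesis by blast
qed

text \<open>Every element is a root of a polynomial over the base field, and an injective map over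
  the base field permutes its finitely many roots.\<close>

lemma closure_hom_surj:
  fixes g :: "'k :: field alg_closure \<Rightarrow> 'k alg_closure"
  assumes "coeff_hom g" "\<And>c. g (to_ac c) = to_ac c"
  shows "bij g"
proof -
  have inj: "inj g" by (rule coeff_hom_inj[OF assms(1)])
  have "\<exists>x. y = g x" for y
  proof -
    obtain q :: "'k poly" where q: "q \<noteq> 0" "poly (map_poly to_ac q) y = 0"
      by (rule alg_closure_algebraic)
    let ?q = "map_poly to_ac q" and ?R = "{x. poly (map_poly to_ac q) x = 0}"
    have "map_poly g ?q = ?q"
      by (rule poly_eqI) (simp add: coeff_map_poly coeff_hom.hom_zero[OF assms(1)] assms(2))
    then have "poly ?q (g x) = 0" if "poly ?q x = 0" for x
      using coeff_hom_poly_map[OF assms(1), of ?q x] coeff_hom.hom_zero[OF assms(1)] that by simp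
    then have "g ` ?R \<subseteq> ?R" by blast
    moreover have "finite ?R" using q(1) by (intro poly_roots_finite) (auto simp: poly_eq_iff coeff_map_poly)
    ultimately have "g ` ?R = ?R"
      using inj by (intro card_subset_eq) (auto simp: card_image inj_on_subset)
    then show ?thesis using q(2) by blast
  qed
  then show ?thesis using inj unfolding bij_def surj_def by blast
qed

lemma coeff_hom_inv_into:
  assumes "coeff_hom g" "bij g"
  shows "coeff_hom (inv_into UNIV g)"
  unfolding coeff_hom_def
proof (intro conjI allI)
  have i: "inv_into UNIV g y = x \<longleftrightarrow> y = g x" for x y
    using assms(2) by (metis bij_inv_eq_iff)
  have r: "g (inv_into UNIV g y) = y" for y
    using assms(2) by (simp add: bij_is_surj surj_f_inv_f)
  show "inv_into UNIV g (a + b) = inv_into UNIV g a + inv_into UNIV g b"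
    "inv_into UNIV g (a * b) = inv_into UNIV g a * inv_into UNIV g b" "inv_into UNIV g 1 = 1" for a b
    unfolding i by (simp_all add: coeff_hom.hom_add[OF assms(1)] coeff_hom.hom_mult[OF assms(1)]
        coeff_hom.hom_one[OF assms(1)] r)
qed

section \<open>Cyclotomic extensions\<close>

text \<open>Take h of maximal order and induct on the order of g. The square of g is some h^i,
  maximality forces i = 2 * j, and g * h^(-j) is trivial or the only involution, which is itself a
  power of h.\<close>

lemma (in comm_group) cyclic_if_one_involution:
  assumes exp: "\<And>x. x \<in> carrier G \<Longrightarrow> x [^] (2 ^ n :: nat) = \<one>"
    and inv: "\<And>x. x \<in> carrier G \<Longrightarrow> x \<otimes> x = \<one> \<Longrightarrow> x = \<one> \<or> x = t"
  shows "cyclic_group G"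
proof -
  \<comment> \<open>The order of x is 2 to the power \<open>lvl x\<close>.\<close>
  define lvl where "lvl x = (LEAST k. x [^] (2 ^ k :: nat) = \<one>)" for x
  have lvl: "x [^] (2 ^ lvl x :: nat) = \<one>" "lvl x \<le> n" if "x \<in> carrier G" for x
    unfolding lvl_def using exp[OF that] by (auto intro: LeastI Least_le)
  have lvl_le: "lvl x \<le> k" if "x [^] (2 ^ k :: nat) = \<one>" for x k
    unfolding lvl_def using that by (rule Least_le)
  define h where "h = arg_min (\<lambda>x. n - lvl x) (\<lambda>x. x \<in> carrier G)"
  have h: "h \<in> carrier G" and "\<And>x. x \<in> carrier G \<Longrightarrow> n - lvl h \<le> n - lvl x"
    unfolding h_def
    using arg_min_natI[of "\<lambda>x. x \<in> carrier G" \<one> "\<lambda>x. n - lvl x"]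
      arg_min_nat_le[of "\<lambda>x. x \<in> carrier G" _ "\<lambda>x. n - lvl x"] by auto
  then have max: "lvl x \<le> lvl h" if "x \<in> carrier G" for x
    using lvl(2)[OF h] lvl(2)[OF that] that by force
  have "\<exists>i::nat. g = h [^] i" if "g \<in> carrier G" for g
    using that
  proof (induction "lvl g" arbitrary: g)
    case 0
    then have "g = \<one>" using lvl(1)[of g] by simp
    then show ?case by (intro exI[of _ 0]) simp
  next
    case (Suc k)
    have g: "g \<in> carrier G" by fact
    have g2: "(g \<otimes> g) [^] (2 ^ j :: nat) = g [^] (2 ^ Suc j :: nat)" for j :: nat
      using g by (simp add: nat_pow_distrib nat_pow_mult mult_2)
    have "lvl (g \<otimes> g) \<le> k"
      using lvl(1)[OF g] g2[of k] Suc.hyps(2) by (intro lvl_le) simp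
    moreover have "Suc k \<le> Suc (lvl (g \<otimes> g))"
      using lvl(1)[of "g \<otimes> g"] g2 g Suc.hyps(2) lvl_le by (metis m_closed)
    ultimately have lvl2: "k = lvl (g \<otimes> g)" by simp
    then obtain i :: nat where i: "g \<otimes> g = h [^] i" using Suc.hyps(1) g by blast
    \<comment> \<open>For odd i the element y would be killed both by i and by a power of 2, hence
      trivial, and h would have smaller order than g.\<close>
    have even: "even i"
    proof (rule ccontr)
      assume "odd i"
      define y where "y = h [^] (2 ^ k :: nat)"
      have y: "y \<in> carrier G" using h by (simp add: y_def)
      have "y [^] i = (h [^] i) [^] (2 ^ k :: nat)"
        using h by (simp add: y_def nat_pow_pow mult.commute)
      also have "\<dots> = \<one>" using lvl(1)[of "g \<otimes> g"] g h lvl2 i by simp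
      finally have yi: "y [^] i = \<one>" .
      have yn: "y [^] (2 ^ n :: nat) = \<one>" using exp[OF y] .
      have "y = \<one>"
      proof (cases "n = 0")
        case True
        then show ?thesis using yn y by simp
      next
        case False
        then obtain u v where uv: "i * u = 2 ^ n * v + 1"
          using coprime_bezout_strong[of i "2 ^ n"] \<open>odd i\<close> by auto
        have "y = y [^] (2 ^ n * v + 1)"
          using y yn by (simp add: nat_pow_mult[symmetric] nat_pow_pow[symmetric])
        also have "\<dots> = (y [^] i) [^] u" using y by (simp add: uv nat_pow_pow)
        finally show ?thesis using yi by simp
      qed
      then have "lvl h \<le> k" unfolding y_def by (rule lvl_le)
      then show False using max[OF g] Suc.hyps(2) by simp
    qed
    then obtain j where j: "i = 2 * j" by blast
    define y where "y = g \<otimes> inv (h [^] j)"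
    have y: "y \<in> carrier G" using g h by (simp add: y_def)
    have gy: "g = y \<otimes> h [^] j" using g h by (simp add: y_def m_assoc)
    have "y \<otimes> y = (g \<otimes> g) \<otimes> inv (h [^] j \<otimes> h [^] j)"
      using g h by (simp add: y_def inv_mult_group m_ac)
    also have "h [^] j \<otimes> h [^] j = h [^] i" using h by (simp add: nat_pow_mult j mult_2)
    finally have "y \<otimes> y = \<one>" using i h by simp
    then consider "y = \<one>" | "y \<noteq> \<one>" "y = t" using inv[OF y] by blast
    then show ?case
    proof cases
      case 1
      then show ?thesis using gy h by auto
    next
      case 2
      \<comment> \<open>The involution among the powers of h.\<close>
      define u where "u = h [^] (2 ^ (lvl h - 1) :: nat)"
      have u: "u \<in> carrier G" using h by (simp add: u_def)
      have pos: "lvl h > 0" using max[OF g] Suc.hyps(2) by simp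
      then have "u \<otimes> u = h [^] (2 ^ lvl h :: nat)"
        using h by (cases "lvl h") (simp_all add: u_def nat_pow_mult mult_2)
      then have "u \<otimes> u = \<one>" using lvl(1)[OF h] by simp
      moreover have "u \<noteq> \<one>"
        using lvl_le[of h "lvl h - 1"] pos unfolding u_def by auto
      ultimately have "u = y" using inv[OF u] 2 by blast
      then have "g = h [^] (2 ^ (lvl h - 1) + j)" using gy h nat_pow_mult[OF h] unfolding u_def by metis
      then show ?thesis by blast
    qed
  qed
  then have "carrier G \<subseteq> range (\<lambda>n::int. h [^] n)"
    by (metis int_pow_int rangeI subsetI)
  moreover have "range (\<lambda>n::int. h [^] n) \<subseteq> carrier G" using h by auto
  ultimately show ?thesis
    unfolding cyclic_group using h by blast
qed

lemma subfld_adjoin: "subfld (adjoin K S)"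
  unfolding subfld_def subdomain_def
proof (intro conjI ballI)
  have 1: "1 + - 1 \<in> adjoin K S" by (intro adjoin_closed)
  fix x assume "x \<in> adjoin K S"
  then show "inverse x \<in> adjoin K S"
    using 1 adjoin_closed(7) by (cases "x = 0") auto
qed (auto intro: adjoin_closed)

lemma subfield_adjoin: "subfield (adjoin K S) ring_of_type_algebra"
  for K :: "'e :: field set"
proof -
  interpret R: field "ring_of_type_algebra :: 'e ring" ..
  show ?thesis unfolding adjoin_def by (rule R.generate_field_is_subfield) simp
qed

lemma adjoin_subset:
  assumes "subfld E" "K \<subseteq> E" "S \<subseteq> E"
  shows "adjoin K S \<subseteq> E"
proof
  interpret subdomain_locale E using assms(1) by unfold_locales (simp add: subfld_def)
  fix x assume "x \<in> adjoin K S"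
  then show "x \<in> E"
    by (induction rule: adjoin_induct) (use assms in \<open>auto simp: subfld_def\<close>)
qed

lemma subfld_range_to_ac: "subfld (range to_ac)"
proof -
  have "to_ac a + to_ac b \<in> range to_ac" "to_ac a * to_ac b \<in> range to_ac" "- to_ac a \<in> range to_ac"
    "inverse (to_ac a) \<in> range to_ac" "1 \<in> range to_ac" for a b :: 'a
    by (metis to_ac_add rangeI, metis to_ac_mult rangeI, metis to_ac_minus rangeI,
        metis to_ac_inverse rangeI, metis to_ac_1 rangeI)
  then show ?thesis unfolding subfld_def subdomain_def by blast
qed

lemma hom_on_id: "hom_on K (\<lambda>x. x)"
  by (simp add: hom_on_def)

text \<open>Each squaring contributes the even factor j^(2^k) + 1. Used for the exponent of the
  Galois group and for making the order of a group element a power of 2.\<close>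

lemma odd_power_mod: "odd j \<Longrightarrow> (2::nat) ^ k dvd j ^ (2 ^ k) - 1"
proof (induction k)
  case (Suc k)
  have "x ^ 2 - 1 = (x - 1) * (x + 1)" for x :: nat
    by (cases x) (simp_all add: power2_eq_square)
  moreover have "j ^ 2 ^ Suc k = (j ^ 2 ^ k) ^ 2"
    by (simp add: mult.commute flip: power_mult)
  ultimately have "j ^ 2 ^ Suc k - 1 = (j ^ 2 ^ k - 1) * (j ^ 2 ^ k + 1)"
    by simp
  moreover have "2 dvd j ^ 2 ^ k + 1" using Suc.prems by simp
  moreover have "2 ^ k dvd j ^ 2 ^ k - 1" using Suc by blast
  ultimately show ?case by (simp only: power_Suc2 mult_dvd_mono)
qed simp

locale cyclotomic =
  fixes n :: nat and \<zeta> :: "'k :: field_char_0 alg_closure"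
  assumes n: "n \<ge> 2" and \<zeta>: "primitive_root_of_unity (2 ^ n) \<zeta>"
begin

abbreviation "K \<equiv> range (to_ac :: 'k \<Rightarrow> 'k alg_closure)"
abbreviation "L \<equiv> adjoin K {\<zeta>}"
abbreviation "A \<equiv> aut_group K L"

sublocale K: subfld_hom K "\<lambda>x. x"
  by unfold_locales (rule subfld_range_to_ac, rule hom_on_id)

sublocale L: subfld_hom L "\<lambda>x. x"
  by unfold_locales (rule subfld_adjoin, rule hom_on_id)

lemma K_subset_L: "K \<subseteq> L" and \<zeta>_in_L: "\<zeta> \<in> L"
  by (auto intro: adjoin_closed)

lemma \<zeta>_nz: "\<zeta> \<noteq> 0"
  using \<zeta> by (auto simp: primitive_root_of_unity_def zero_power)

lemma \<zeta>_half: "\<zeta> ^ (2 ^ (n - 1)) = - 1"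
proof -
  have "(\<zeta> ^ (2 ^ (n - 1))) ^ 2 = \<zeta> ^ (2 ^ n)"
    using n by (cases n) (simp_all flip: power_mult add: mult.commute)
  then have "\<zeta> ^ (2 ^ (n - 1)) = 1 \<or> \<zeta> ^ (2 ^ (n - 1)) = - 1"
    using \<zeta> by (simp add: primitive_root_of_unity_def power2_eq_1_iff)
  moreover have "\<zeta> ^ (2 ^ (n - 1)) \<noteq> 1"
    using \<zeta> n by (simp add: primitive_root_of_unity_def)
  ultimately show ?thesis by blast
qed

lemma poly_in_L: "q \<in> polys_over K \<Longrightarrow> x \<in> L \<Longrightarrow> poly q x \<in> L"
  unfolding poly_altdef using K_subset_L
  by (intro L.sum_closed L.closed(4) L.power_closed) (auto simp: polys_over_def)

lemma root_of_unity_poly: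
  defines "f \<equiv> monom 1 (2 ^ n) - 1"
  shows "f \<in> polys_over K" "f \<noteq> 0" "poly f x = x ^ (2 ^ n) - 1" "degree f = 2 ^ n"
proof -
  have deg: "degree f = 2 ^ n"
  proof -
    have "degree (monom 1 (2 ^ n) + (- 1) :: 'k alg_closure poly) = degree (monom 1 (2 ^ n) :: 'k alg_closure poly)"
      by (intro degree_add_eq_left) (simp add: degree_monom_eq)
    then show ?thesis by (simp add: f_def degree_monom_eq)
  qed
  show "f \<in> polys_over K"
    unfolding f_def by (intro K.P.diff_closed K.monom_polys_over K.P.closed(1) K.closed(1))
  show "f \<noteq> 0" using deg by auto
  show "poly f x = x ^ (2 ^ n) - 1" by (simp add: f_def poly_monom)
  show "degree f = 2 ^ n" by (rule deg)
qed

lemma min_poly_\<zeta>: "\<exists>p. min_poly_over K \<zeta> p"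
  using min_poly_exists[OF subfld_range_to_ac root_of_unity_poly(1,2)] root_of_unity_poly(3)[of \<zeta>] \<zeta>
  by (simp add: primitive_root_of_unity_def)

lemma L_eq: "L = simple_ext K \<zeta>"
proof
  obtain p where "min_poly_over K \<zeta> p" using min_poly_\<zeta> by blast
  then show "L \<subseteq> simple_ext K \<zeta>"
    using K.simple_ext_subset[of \<zeta>] by (intro adjoin_subset K.subfld_simple_ext) auto
  show "simple_ext K \<zeta> \<subseteq> L"
    unfolding simple_ext_def using poly_in_L \<zeta>_in_L by blast
qed

lemma aut_iff: "\<sigma> \<in> carrier A \<longleftrightarrow> \<sigma> \<in> Bij L \<and> hom_on L \<sigma> \<and> (\<forall>x\<in>K. \<sigma> x = x)"
  unfolding aut_group_def hom_on_def by (auto simp: image_iff) (metis to_ac_1)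

text \<open>The image of \<zeta> is again a primitive root of unity of the same order, so it and
  \<zeta> are powers of each other and generate the same field.\<close>

lemma restrict_in_aut:
  assumes G: "coeff_hom G" "\<And>c. G (to_ac c) = to_ac c"
  shows "restrict G L \<in> carrier A"
proof -
  have fixK: "map_poly G q = q" if "q \<in> polys_over K" for q
  proof (rule poly_eqI)
    fix i
    obtain c where "coeff q i = to_ac c" using \<open>q \<in> polys_over K\<close> by (auto simp: polys_over_def)
    then show "coeff (map_poly G q) i = coeff q i"
      using coeff_hom.hom_zero[OF G(1)] G(2) by (simp add: coeff_map_poly)
  qed
  have "(G \<zeta>) ^ j = 1 \<longleftrightarrow> \<zeta> ^ j = 1" for j
    using coeff_hom_eq_0_iff[OF G(1), of "\<zeta> ^ j - 1"]
    by (simp add: coeff_hom_diff[OF G(1)] coeff_hom_power[OF G(1)] coeff_hom.hom_one[OF G(1)])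
  then have prim: "primitive_root_of_unity (2 ^ n) (G \<zeta>)"
    using \<zeta> by (simp add: primitive_root_of_unity_def)
  obtain j where "G \<zeta> = \<zeta> ^ j"
    using roots_of_unity_powers[OF \<zeta>, of "G \<zeta>"] prim by (auto simp: primitive_root_of_unity_def)
  then have G\<zeta>: "G \<zeta> \<in> L" using \<zeta>_in_L by simp
  obtain i where i: "\<zeta> = (G \<zeta>) ^ i"
    using roots_of_unity_powers[OF prim, of \<zeta>] \<zeta> by (auto simp: primitive_root_of_unity_def)
  have "G x \<in> L" if x: "x \<in> L" for x
  proof -
    obtain q where q: "q \<in> polys_over K" "x = poly q \<zeta>"
      using x unfolding L_eq simple_ext_def by blast
    then show ?thesis
      using coeff_hom_poly_map[OF G(1), of q \<zeta>] fixK poly_in_L[OF q(1) G\<zeta>] by simp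
  qed
  moreover have "\<exists>y\<in>L. x = G y" if x: "x \<in> L" for x
  proof -
    obtain q where q: "q \<in> polys_over K" "x = poly q \<zeta>"
      using x unfolding L_eq simple_ext_def by blast
    have "G (poly q (\<zeta> ^ i)) = poly q ((G \<zeta>) ^ i)"
      using coeff_hom_poly_map[OF G(1), of q "\<zeta> ^ i"] fixK q(1) by (simp add: coeff_hom_power[OF G(1)])
    then have "G (poly q (\<zeta> ^ i)) = x" using q(2) i by simp
    moreover have "poly q (\<zeta> ^ i) \<in> L" using poly_in_L[OF q(1)] \<zeta>_in_L by simp
    ultimately show ?thesis by blast
  qed
  ultimately have "G ` L = L" by blast
  then have "bij_betw G L L"
    using inj_on_subset[OF coeff_hom_inj[OF G(1)] subset_UNIV] by (simp add: bij_betw_def)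
  then have "restrict G L \<in> Bij L" by (auto simp: Bij_def cong: bij_betw_cong)
  moreover have "hom_on L (restrict G L)"
    unfolding hom_on_def
    using G(1) L.closed by (auto simp: coeff_hom_def)
  ultimately show ?thesis
    unfolding aut_iff using G(2) K_subset_L by auto
qed

text \<open>Members of the automorphism group live on L only; extending them to the closure makes
  the rules for total homomorphisms available.\<close>

lemma aut_extend:
  assumes "\<sigma> \<in> carrier A"
  shows "\<exists>G. coeff_hom G \<and> (\<forall>c. G (to_ac c) = to_ac c) \<and> (\<forall>x\<in>L. G x = \<sigma> x)"
proof -
  obtain G where "coeff_hom G" "\<forall>x\<in>L. G x = \<sigma> x"
    using extend_to_closure[OF subfld_adjoin K_subset_L, of \<sigma>] assms unfolding aut_iff by blast
  moreover from this have "G (to_ac c) = to_ac c" for c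
    using assms subsetD[OF K_subset_L rangeI[of to_ac c]] unfolding aut_iff by simp
  ultimately show ?thesis by blast
qed

lemma aut_eqI: "\<sigma> \<in> carrier A \<Longrightarrow> \<tau> \<in> carrier A \<Longrightarrow> \<sigma> \<zeta> = \<tau> \<zeta> \<Longrightarrow> \<sigma> = \<tau>"
  by (rule aut_group_cong) auto

lemma aut_mult:
  assumes "\<sigma> \<in> carrier A" "\<tau> \<in> carrier A"
  shows "\<sigma> \<otimes>\<^bsub>A\<^esub> \<tau> = compose L \<sigma> \<tau>" "\<sigma> \<otimes>\<^bsub>A\<^esub> \<tau> \<in> carrier A"
proof -
  show eq: "\<sigma> \<otimes>\<^bsub>A\<^esub> \<tau> = compose L \<sigma> \<tau>"
    using assms unfolding aut_iff by (simp add: aut_group_def BijGroup_def)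
  obtain G H where G: "coeff_hom G" "\<And>c. G (to_ac c) = to_ac c" "\<And>x. x \<in> L \<Longrightarrow> G x = \<sigma> x"
    and H: "coeff_hom H" "\<And>c. H (to_ac c) = to_ac c" "\<And>x. x \<in> L \<Longrightarrow> H x = \<tau> x"
    using aut_extend assms by metis
  have "\<tau> x \<in> L" if "x \<in> L" for x
    using assms(2) that unfolding aut_iff Bij_def bij_betw_def by blast
  then have "compose L \<sigma> \<tau> = restrict (G \<circ> H) L"
    unfolding compose_def by (intro restrict_ext) (simp add: G(3) H(3))
  then show "\<sigma> \<otimes>\<^bsub>A\<^esub> \<tau> \<in> carrier A"
    unfolding eq using restrict_in_aut[OF coeff_hom_comp[OF G(1) H(1)]] G(2) H(2) by simp
qed

lemma aut_one: "\<one>\<^bsub>A\<^esub> = restrict (\<lambda>x. x) L"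
  by (simp add: aut_group_def BijGroup_def)

lemma aut_apply_\<zeta>:
  assumes "\<sigma> \<in> carrier A" "\<tau> \<in> carrier A"
  shows "(\<sigma> \<otimes>\<^bsub>A\<^esub> \<tau>) \<zeta> = \<sigma> (\<tau> \<zeta>)"
  using \<zeta>_in_L by (simp add: aut_mult[OF assms] compose_def)

lemma aut_power_\<zeta>:
  assumes "\<sigma> \<in> carrier A"
  shows "\<sigma> (\<zeta> ^ j) = \<sigma> \<zeta> ^ j" "\<sigma> (- (\<zeta> ^ j)) = - (\<sigma> \<zeta> ^ j)" "\<sigma> (inverse \<zeta>) = inverse (\<sigma> \<zeta>)"
    "\<sigma> (- inverse \<zeta>) = - inverse (\<sigma> \<zeta>)"
proof -
  obtain G where G: "coeff_hom G" "\<And>x. x \<in> L \<Longrightarrow> G x = \<sigma> x" using aut_extend assms by blast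
  have in_L: "\<zeta> ^ j \<in> L" "- (\<zeta> ^ j) \<in> L" "inverse \<zeta> \<in> L" "- inverse \<zeta> \<in> L"
    using \<zeta>_in_L L.inverse_closed by auto
  show "\<sigma> (\<zeta> ^ j) = \<sigma> \<zeta> ^ j" "\<sigma> (- (\<zeta> ^ j)) = - (\<sigma> \<zeta> ^ j)" "\<sigma> (inverse \<zeta>) = inverse (\<sigma> \<zeta>)"
    "\<sigma> (- inverse \<zeta>) = - inverse (\<sigma> \<zeta>)"
    using in_L \<zeta>_in_L
    by (simp_all add: coeff_hom_power[OF G(1)] coeff_hom_minus[OF G(1)] coeff_hom_inverse[OF G(1)] flip: G(2))
qed

lemma aut_\<zeta>_root:
  assumes "\<sigma> \<in> carrier A"
  shows "\<exists>j. \<sigma> \<zeta> = \<zeta> ^ j"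
proof -
  have "\<sigma> \<zeta> ^ (2 ^ n) = \<sigma> 1"
    using aut_power_\<zeta>(1)[OF assms, of "2 ^ n"] \<zeta> by (simp add: primitive_root_of_unity_def)
  also have "\<sigma> 1 = 1" using assms unfolding aut_iff hom_on_def by blast
  finally show ?thesis using roots_of_unity_powers[OF \<zeta>] by blast
qed

text \<open>An automorphism is determined by the exponent j with \<zeta> sent to \<zeta>^j, and
  composition multiplies exponents; this gives commutativity in particular.\<close>

lemma group_A: "comm_group A"
proof (rule comm_groupI)
  show "\<sigma> \<otimes>\<^bsub>A\<^esub> \<tau> \<in> carrier A" if "\<sigma> \<in> carrier A" "\<tau> \<in> carrier A" for \<sigma> \<tau>
    using aut_mult that by blast
  show one: "\<one>\<^bsub>A\<^esub> \<in> carrier A"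
    unfolding aut_one using restrict_in_aut[OF coeff_hom_id] by simp
  show comm: "\<sigma> \<otimes>\<^bsub>A\<^esub> \<tau> = \<tau> \<otimes>\<^bsub>A\<^esub> \<sigma>" if st: "\<sigma> \<in> carrier A" "\<tau> \<in> carrier A" for \<sigma> \<tau>
  proof -
    obtain i j where ij: "\<sigma> \<zeta> = \<zeta> ^ i" "\<tau> \<zeta> = \<zeta> ^ j" using aut_\<zeta>_root st by meson
    have "(\<sigma> \<otimes>\<^bsub>A\<^esub> \<tau>) \<zeta> = (\<tau> \<otimes>\<^bsub>A\<^esub> \<sigma>) \<zeta>"
      using st by (simp add: aut_apply_\<zeta> ij aut_power_\<zeta> mult.commute flip: power_mult)
    then show ?thesis using st by (intro aut_eqI aut_mult(2))
  qed
  show "\<sigma> \<otimes>\<^bsub>A\<^esub> \<tau> \<otimes>\<^bsub>A\<^esub> \<rho> = \<sigma> \<otimes>\<^bsub>A\<^esub> (\<tau> \<otimes>\<^bsub>A\<^esub> \<rho>)"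
    if st: "\<sigma> \<in> carrier A" "\<tau> \<in> carrier A" "\<rho> \<in> carrier A" for \<sigma> \<tau> \<rho>
  proof -
    obtain i where i: "\<rho> \<zeta> = \<zeta> ^ i" using aut_\<zeta>_root st by meson
    obtain j where j: "\<tau> \<zeta> = \<zeta> ^ j" using aut_\<zeta>_root st by meson
    note m = aut_mult(2)[OF st(1,2)] aut_mult(2)[OF st(2,3)]
    have "(\<sigma> \<otimes>\<^bsub>A\<^esub> \<tau> \<otimes>\<^bsub>A\<^esub> \<rho>) \<zeta> = (\<sigma> (\<tau> \<zeta>)) ^ i"
      using st m by (simp add: aut_apply_\<zeta> i aut_power_\<zeta>)
    moreover have "(\<sigma> \<otimes>\<^bsub>A\<^esub> (\<tau> \<otimes>\<^bsub>A\<^esub> \<rho>)) \<zeta> = (\<sigma> (\<tau> \<zeta>)) ^ i"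
      using st m by (simp add: aut_apply_\<zeta> i j aut_power_\<zeta> flip: power_mult)
    ultimately show ?thesis using st m by (intro aut_eqI aut_mult(2)) simp_all
  qed
  show "\<one>\<^bsub>A\<^esub> \<otimes>\<^bsub>A\<^esub> \<sigma> = \<sigma>" if s: "\<sigma> \<in> carrier A" for \<sigma>
  proof -
    obtain j where j: "\<sigma> \<zeta> = \<zeta> ^ j" using aut_\<zeta>_root s by meson
    then have "(\<one>\<^bsub>A\<^esub> \<otimes>\<^bsub>A\<^esub> \<sigma>) \<zeta> = \<sigma> \<zeta>"
      using aut_apply_\<zeta>[OF one s] \<zeta>_in_L by (simp add: aut_one)
    then show ?thesis using s one by (intro aut_eqI aut_mult(2))
  qed
  show "\<exists>\<tau>\<in>carrier A. \<tau> \<otimes>\<^bsub>A\<^esub> \<sigma> = \<one>\<^bsub>A\<^esub>" if s: "\<sigma> \<in> carrier A" for \<sigma>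
  proof -
    obtain G where G: "coeff_hom G" "\<And>c. G (to_ac c) = to_ac c" "\<And>x. x \<in> L \<Longrightarrow> G x = \<sigma> x"
      using aut_extend s by blast
    have bij: "bij G" by (rule closure_hom_surj[OF G(1,2)])
    have inv: "inv_into UNIV G (G x) = x" for x using bij by (simp add: bij_is_inj)
    have "inv_into UNIV G (to_ac c) = to_ac c" for c using inv[of "to_ac c"] G(2) by simp
    then have \<tau>: "restrict (inv_into UNIV G) L \<in> carrier A"
      by (intro restrict_in_aut coeff_hom_inv_into G(1) bij)
    obtain j where j: "\<sigma> \<zeta> = \<zeta> ^ j" using aut_\<zeta>_root s by meson
    have "\<sigma> \<zeta> \<in> L" using j \<zeta>_in_L by simp
    then have "(restrict (inv_into UNIV G) L \<otimes>\<^bsub>A\<^esub> \<sigma>) \<zeta> = \<zeta>"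
      using aut_apply_\<zeta>[OF \<tau> s] inv[of \<zeta>] G(3)[OF \<zeta>_in_L] by simp
    then have "restrict (inv_into UNIV G) L \<otimes>\<^bsub>A\<^esub> \<sigma> = \<one>\<^bsub>A\<^esub>"
      using one \<zeta>_in_L by (intro aut_eqI aut_mult(2) \<tau> s) (simp_all add: aut_one)
    then show ?thesis using \<tau> by blast
  qed
qed

text \<open>An element fixed by all automorphisms is a polynomial in \<open>\<zeta>\<close> of small degree that takes the
  same value at all roots of the minimal polynomial; these are simple.\<close>

lemma galois: "galois_extension K L"
  unfolding galois_extension_def algebraic_extension_def
proof (intro conjI ballI)
  have "K = adjoin K {}"
    using adjoin_subset[OF subfld_range_to_ac, of K "{}"] adjoin_closed(2) by blast
  then show "subfield K ring_of_type_algebra" using subfield_adjoin by metis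
  show "subfield L ring_of_type_algebra" by (rule subfield_adjoin)
  show "K \<subseteq> L" by (rule K_subset_L)
  show "\<exists>p. p \<noteq> 0 \<and> (\<forall>i. coeff p i \<in> K) \<and> poly p x = 0" for x
  proof -
    obtain q :: "'k poly" where "q \<noteq> 0" "poly (map_poly to_ac q) x = 0"
      by (rule alg_closure_algebraic)
    then show ?thesis
      by (intro exI[of _ "map_poly to_ac q"]) (auto simp: poly_eq_iff coeff_map_poly)
  qed
  have "x \<in> K" if x: "x \<in> L" "\<And>\<sigma>. \<sigma> \<in> carrier A \<Longrightarrow> \<sigma> x = x" for x
  proof -
    obtain p where p: "min_poly_over K \<zeta> p" using min_poly_\<zeta> by blast
    then have p': "p \<in> polys_over K" "p \<noteq> 0" "poly p \<zeta> = 0" by (auto simp: min_poly_over_def)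
    obtain q0 where q0: "q0 \<in> polys_over K" "x = poly q0 \<zeta>"
      using x(1) unfolding L_eq simple_ext_def by blast
    obtain s q where q: "q \<in> polys_over K" "q0 = p * s + q" "q = 0 \<or> degree q < degree p"
      using division_over[OF subfld_range_to_ac p'(1,2) q0(1)] by blast
    have xq: "x = poly q \<zeta>" using q0 q p' by simp
    \<comment> \<open>Sending \<zeta> to the root z defines an automorphism, and it fixes x.\<close>
    have roots: "poly q z = x" if z: "poly p z = 0" for z
    proof -
      have "map_poly (\<lambda>x. x) p = p" by (simp add: map_poly_id')
      then obtain g where g: "hom_on L g" "\<forall>x\<in>K. g x = x" "\<forall>q\<in>polys_over K. g (poly q \<zeta>) = poly (map_poly (\<lambda>x. x) q) z"
        using K.extend_simple[OF p, of z] z unfolding L_eq by auto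
      then obtain G where G: "coeff_hom G" "\<forall>x\<in>L. G x = g x"
        using extend_to_closure[OF subfld_adjoin K_subset_L, of g] by blast
      then have "restrict G L \<in> carrier A"
        using g(2) subsetD[OF K_subset_L rangeI[of to_ac]] by (intro restrict_in_aut) simp_all
      then have "G x = x" using x by force
      then show ?thesis using g(3) q(1) G(2) x(1) xq by (simp add: map_poly_id')
    qed
    define f :: "'k alg_closure poly" where "f = monom 1 (2 ^ n) - 1"
    note f = root_of_unity_poly[folded f_def]
    obtain t where t: "f = p * t"
      using p f(1) f(3)[of \<zeta>] \<zeta> unfolding min_poly_over_def primitive_root_of_unity_def by auto
    have nz: "t \<noteq> 0" using t f(2) by auto
    \<comment> \<open>Separability by counting: x^(2^n) - 1 = p * t has 2^n distinct roots, at most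
      \<open>degree t\<close> of them roots of t, so p has \<open>degree p\<close> distinct
      roots.\<close>
    have "inj_on (\<lambda>j. \<zeta> ^ j) {..<2 ^ n}"
    proof (intro inj_onI)
      have False if "i < j" "j < 2 ^ n" "\<zeta> ^ i = \<zeta> ^ j" for i j :: nat
      proof -
        have "\<zeta> ^ i * \<zeta> ^ (j - i) = \<zeta> ^ i * 1" using that(1,3) by (simp flip: power_add that(3))
        then have "\<zeta> ^ (j - i) = 1" using \<zeta>_nz by simp
        then show False using primitive_root_power_eq_1[OF \<zeta>, of "j - i"] that
          by (auto dest!: dvd_imp_le)
      qed
      then show "i = j" if "i \<in> {..<2 ^ n}" "j \<in> {..<2 ^ n}" "\<zeta> ^ i = \<zeta> ^ j" for i j :: nat
        using that by (metis lessThan_iff linorder_neqE_nat)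
    qed
    then have "2 ^ n = card ((\<lambda>j. \<zeta> ^ j) ` {..<2 ^ n :: nat})" by (simp add: card_image)
    also have "\<dots> \<le> card ({z. poly p z = 0} \<union> {z. poly t z = 0})"
    proof (rule card_mono)
      show "finite ({z. poly p z = 0} \<union> {z. poly t z = 0})"
        using p'(2) nz by (simp add: poly_roots_finite)
      have "poly f (\<zeta> ^ j) = 0" for j
        using \<zeta> by (simp add: f(3) primitive_root_of_unity_def power_mult[symmetric] mult.commute[of j])
          (simp add: power_mult)
      then show "(\<lambda>j. \<zeta> ^ j) ` {..<2 ^ n :: nat} \<subseteq> {z. poly p z = 0} \<union> {z. poly t z = 0}"
        unfolding t by auto
    qed
    also have "\<dots> \<le> card {z. poly p z = 0} + card {z. poly t z = 0}" by (rule card_Un_le)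
    also have "\<dots> \<le> card {z. poly p z = 0} + degree t" using card_poly_roots_bound[OF nz] by simp
    finally have many: "degree p \<le> card {z. poly p z = 0}"
      using f(4) degree_mult_eq[OF p'(2) nz] t by simp
    have pos: "degree p > 0"
    proof (rule ccontr)
      assume "\<not> degree p > 0"
      then obtain c where "p = [:c:]" by (auto elim: degree_eq_zeroE)
      then show False using p' by auto
    qed
    have "q - [:x:] = 0"
    proof (rule ccontr)
      assume nz: "q - [:x:] \<noteq> 0"
      have "{z. poly p z = 0} \<subseteq> {z. poly (q - [:x:]) z = 0}" using roots by auto
      then have "card {z. poly p z = 0} \<le> card {z. poly (q - [:x:]) z = 0}"
        by (intro card_mono poly_roots_finite nz)
      also have "\<dots> \<le> degree (q - [:x:])" by (rule card_poly_roots_bound[OF nz])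
      also have "\<dots> < degree p" using q(3) pos by (intro degree_diff_less) auto
      finally show False using many by simp
    qed
    then have "[:x:] \<in> polys_over K" using q(1) by simp
    then show "x \<in> K" using K.const_polys_over_iff by simp
  qed
  moreover have "\<sigma> x = x" if "x \<in> K" "\<sigma> \<in> carrier A" for x \<sigma>
    using that unfolding aut_iff by blast
  ultimately show "{x \<in> L. \<forall>\<sigma>\<in>carrier A. \<sigma> x = x} = K" using K_subset_L by blast
qed

text \<open>With j = 2 * i + 1 the hypothesis says that 2^(n - 2) divides i * (i + 1), and one of
  two consecutive numbers is odd.\<close>

lemma square_one_mod:
  assumes "odd j" "(2::nat) ^ n dvd j ^ 2 - 1"
  shows "2 ^ (n - 1) dvd j - 1 \<or> 2 ^ (n - 1) dvd j + 1"
proof -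
  obtain i where i: "j = 2 * i + 1" using assms(1) by (rule oddE)
  obtain k where k: "n = Suc (Suc k)" using n by (metis add_2_eq_Suc le_Suc_ex)
  have "j ^ 2 - 1 = 4 * (i * (i + 1))" by (simp add: i power2_eq_square)
  moreover have "(2::nat) ^ n = 4 * 2 ^ (n - 2)"
    by (simp add: k)
  ultimately have "4 * 2 ^ (n - 2) dvd 4 * (i * (i + 1))" using assms(2) by metis
  then have "2 ^ (n - 2) dvd i * (i + 1)" by (rule dvd_mult_cancel) simp
  then have "2 ^ (n - 2) dvd i \<or> 2 ^ (n - 2) dvd i + 1"
  proof (cases "even i")
    case True
    then have "coprime (2 ^ (n - 2)) (i + 1)" by simp
    then show ?thesis using \<open>2 ^ (n - 2) dvd i * (i + 1)\<close> coprime_dvd_mult_left_iff by blast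
  next
    case False
    then have "coprime (2 ^ (n - 2)) i" by simp
    then show ?thesis using \<open>2 ^ (n - 2) dvd i * (i + 1)\<close> coprime_dvd_mult_right_iff by blast
  qed
  then have "2 * 2 ^ (n - 2) dvd 2 * i \<or> 2 * 2 ^ (n - 2) dvd 2 * (i + 1)"
    by (metis mult_dvd_mono dvd_refl)
  moreover have "(2::nat) * 2 ^ (n - 2) = 2 ^ (n - 1)"
    by (simp add: k)
  ultimately show ?thesis by (simp add: i)
qed

text \<open>An even exponent would send \<zeta>^(2^(n - 1)) = -1 to 1.\<close>

lemma aut_odd:
  assumes "\<sigma> \<in> carrier A" "\<sigma> \<zeta> = \<zeta> ^ j"
  shows "odd j"
proof
  assume "even j"
  then obtain i where i: "j = 2 * i" by blast
  have 1: "\<sigma> 1 = 1" using assms unfolding aut_iff hom_on_def by blast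
  have "\<sigma> (\<zeta> ^ 2 ^ (n - 1)) = (\<zeta> ^ j) ^ 2 ^ (n - 1)"
    using aut_power_\<zeta>(1)[OF assms(1), of "2 ^ (n - 1)"] assms(2) by simp
  also have "\<dots> = (\<zeta> ^ (2 * 2 ^ (n - 1))) ^ i" unfolding i by (simp add: ac_simps flip: power_mult)
  also have "2 * 2 ^ (n - 1) = (2::nat) ^ n" using n by (simp flip: power_Suc)
  finally have "\<sigma> (\<zeta> ^ 2 ^ (n - 1)) = \<sigma> 1" using \<zeta> 1 by (simp add: primitive_root_of_unity_def)
  moreover have "inj_on \<sigma> L" using assms(1) unfolding aut_iff Bij_def bij_betw_def by blast
  ultimately have "\<zeta> ^ 2 ^ (n - 1) = 1" using \<zeta>_in_L by (auto dest: inj_onD)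
  then show False using \<zeta>_half by simp
qed

lemma aut_power_apply:
  assumes "\<sigma> \<in> carrier A" "\<sigma> \<zeta> = \<zeta> ^ j"
  shows "(\<sigma> [^]\<^bsub>A\<^esub> (k::nat)) \<zeta> = \<zeta> ^ (j ^ k)"
proof -
  interpret A: comm_group A by (rule group_A)
  show ?thesis
  proof (induction k)
    case 0
    show ?case using \<zeta>_in_L by (simp add: aut_one)
  next
    case (Suc k)
    have "\<sigma> [^]\<^bsub>A\<^esub> k \<in> carrier A" using assms(1) by simp
    then show ?case
      using Suc assms
      by (simp add: aut_apply_\<zeta> aut_power_\<zeta>(1)) (simp add: mult.commute flip: power_mult)
  qed
qed

text \<open>By \<open>square_one_mod\<close> an involution sends \<zeta> to -\<zeta>, 1/\<zeta> or
  -1/\<zeta>. A noncyclic abelian group of 2-power exponent has two different involutions, and the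
  product of any two candidates is the third, so all three occur.\<close>

theorem noncyclic_automorphisms:
  assumes "\<not> cyclic_extension K L"
  shows "\<exists>\<epsilon>\<in>carrier A. \<epsilon> \<zeta> = inverse \<zeta>" "\<exists>\<epsilon>\<in>carrier A. \<epsilon> \<zeta> = - \<zeta>"
proof -
  interpret A: comm_group A by (rule group_A)
  have exp: "\<sigma> [^]\<^bsub>A\<^esub> (2 ^ n :: nat) = \<one>\<^bsub>A\<^esub>" if s: "\<sigma> \<in> carrier A" for \<sigma>
  proof -
    obtain j where j: "\<sigma> \<zeta> = \<zeta> ^ j" using aut_\<zeta>_root s by blast
    then have "odd j" by (rule aut_odd[OF s])
    then obtain c where "j ^ 2 ^ n - 1 = 2 ^ n * c" using odd_power_mod by blast
    moreover have "j ^ 2 ^ n > 0" using \<open>odd j\<close> by (simp add: odd_pos)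
    ultimately have "j ^ 2 ^ n = 2 ^ n * c + 1" by (metis Suc_eq_plus1 Suc_diff_1)
    then have "\<zeta> ^ (j ^ 2 ^ n) = \<zeta>"
      using \<zeta> by (simp add: power_mult primitive_root_of_unity_def)
    then show ?thesis
      using s aut_power_apply[OF s j, of "2 ^ n"] \<zeta>_in_L
      by (intro aut_eqI A.nat_pow_closed A.one_closed) (simp_all add: aut_one)
  qed
  have invol: "\<sigma> = \<one>\<^bsub>A\<^esub> \<or> \<sigma> \<zeta> = - \<zeta> \<or> \<sigma> \<zeta> = inverse \<zeta> \<or> \<sigma> \<zeta> = - inverse \<zeta>"
    if s: "\<sigma> \<in> carrier A" "\<sigma> \<otimes>\<^bsub>A\<^esub> \<sigma> = \<one>\<^bsub>A\<^esub>" for \<sigma>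
  proof -
    obtain j where j: "\<sigma> \<zeta> = \<zeta> ^ j" using aut_\<zeta>_root s by blast
    then have "odd j" by (rule aut_odd[OF s(1)])
    have "\<zeta> ^ (j ^ 2) = \<zeta>"
      using aut_apply_\<zeta>[OF s(1,1)] s(2) \<zeta>_in_L
      by (simp add: aut_one j aut_power_\<zeta>[OF s(1)] power2_eq_square power_mult)
    moreover have "j ^ 2 > 0" using \<open>odd j\<close> by (simp add: odd_pos)
    then have "\<zeta> ^ (j ^ 2) = \<zeta> * \<zeta> ^ (j ^ 2 - 1)" by (metis Suc_diff_1 power_Suc)
    ultimately have "\<zeta> ^ (j ^ 2 - 1) = 1" using \<zeta>_nz by simp
    then have "2 ^ n dvd j ^ 2 - 1" by (rule primitive_root_power_eq_1[OF \<zeta>])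
    then consider c where "j - 1 = 2 ^ (n - 1) * c" | c where "j + 1 = 2 ^ (n - 1) * c"
      using square_one_mod[OF \<open>odd j\<close>] by (auto elim!: dvdE)
    then show ?thesis
    proof cases
      case (1 c)
      have "\<zeta> ^ j = \<zeta> * \<zeta> ^ (j - 1)" using \<open>odd j\<close> by (metis odd_pos Suc_diff_1 power_Suc)
      also have "\<zeta> ^ (j - 1) = (- 1) ^ c" by (simp only: 1 power_mult \<zeta>_half)
      finally have "\<sigma> \<zeta> = \<zeta> \<or> \<sigma> \<zeta> = - \<zeta>" using j by (cases "even c") auto
      then show ?thesis
        using aut_eqI[OF s(1) A.one_closed] \<zeta>_in_L by (auto simp: aut_one)
    next
      case (2 c)
      have "\<zeta> * \<zeta> ^ j = \<zeta> ^ (j + 1)" by simp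
      also have "\<dots> = (- 1) ^ c" by (simp only: 2 power_mult \<zeta>_half)
      finally have "\<zeta> * \<zeta> ^ j = (- 1) ^ c" .
      then have "\<zeta> * \<sigma> \<zeta> = 1 \<or> \<zeta> * \<sigma> \<zeta> = - 1" using j by (cases "even c") auto
      then have "\<sigma> \<zeta> = inverse \<zeta> \<or> \<sigma> \<zeta> = - inverse \<zeta>"
        using \<zeta>_nz by (metis inverse_unique minus_mult_right minus_minus)
      then show ?thesis by blast
    qed
  qed
  have both: "(\<exists>\<epsilon>\<in>carrier A. \<epsilon> \<zeta> = inverse \<zeta>) \<and> (\<exists>\<epsilon>\<in>carrier A. \<epsilon> \<zeta> = - \<zeta>)"
  proof (rule ccontr)
    assume neg: "\<not> ?thesis"
    \<comment> \<open>Two different involutions and their product would realise both automorphisms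
      whose joint existence is denied.\<close>
    have unique: "\<sigma> = \<tau>"
      if st: "\<sigma> \<in> carrier A" "\<tau> \<in> carrier A" "\<sigma> \<otimes>\<^bsub>A\<^esub> \<sigma> = \<one>\<^bsub>A\<^esub>" "\<tau> \<otimes>\<^bsub>A\<^esub> \<tau> = \<one>\<^bsub>A\<^esub>"
        "\<sigma> \<noteq> \<one>\<^bsub>A\<^esub>" "\<tau> \<noteq> \<one>\<^bsub>A\<^esub>" for \<sigma> \<tau>
    proof (rule ccontr)
      assume "\<sigma> \<noteq> \<tau>"
      then have ne: "\<sigma> \<zeta> \<noteq> \<tau> \<zeta>" using aut_eqI st by blast
      have prod: "\<sigma> \<otimes>\<^bsub>A\<^esub> \<tau> \<in> carrier A" "(\<sigma> \<otimes>\<^bsub>A\<^esub> \<tau>) \<zeta> = \<sigma> (\<tau> \<zeta>)"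
        using st aut_apply_\<zeta> by auto
      have minus: "\<sigma> (- \<zeta>) = - \<sigma> \<zeta>" using aut_power_\<zeta>(2)[OF st(1), of 1] by simp
      have "\<sigma> \<zeta> = - \<zeta> \<or> \<sigma> \<zeta> = inverse \<zeta> \<or> \<sigma> \<zeta> = - inverse \<zeta>"
        "\<tau> \<zeta> = - \<zeta> \<or> \<tau> \<zeta> = inverse \<zeta> \<or> \<tau> \<zeta> = - inverse \<zeta>"
        using invol st by blast+
      moreover note aut_power_\<zeta>(3,4)[OF st(1)] minus
      ultimately have "(\<sigma> \<zeta> = - \<zeta> \<or> \<tau> \<zeta> = - \<zeta> \<or> \<sigma> (\<tau> \<zeta>) = - \<zeta>) \<and>
          (\<sigma> \<zeta> = inverse \<zeta> \<or> \<tau> \<zeta> = inverse \<zeta> \<or> \<sigma> (\<tau> \<zeta>) = inverse \<zeta>)"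
        using ne by (elim disjE) simp_all
      then show False using neg prod st by metis
    qed
    have "\<exists>t. \<forall>\<sigma>\<in>carrier A. \<sigma> \<otimes>\<^bsub>A\<^esub> \<sigma> = \<one>\<^bsub>A\<^esub> \<longrightarrow> \<sigma> = \<one>\<^bsub>A\<^esub> \<or> \<sigma> = t"
    proof (cases "\<exists>\<tau>\<in>carrier A. \<tau> \<otimes>\<^bsub>A\<^esub> \<tau> = \<one>\<^bsub>A\<^esub> \<and> \<tau> \<noteq> \<one>\<^bsub>A\<^esub>")
      case True
      then show ?thesis using unique by metis
    qed blast
    then have "cyclic_group A" using A.cyclic_if_one_involution[of n] exp by blast
    then show False using assms galois by (simp add: cyclic_extension_def)
  qed
  then show "\<exists>\<epsilon>\<in>carrier A. \<epsilon> \<zeta> = inverse \<zeta>" "\<exists>\<epsilon>\<in>carrier A. \<epsilon> \<zeta> = - \<zeta>" by blast+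
qed

end

lemma noncyclic_closure_automorphisms:
  fixes \<zeta> :: "'k :: field_char_0 alg_closure"
  assumes "n \<ge> 2" "primitive_root_of_unity (2 ^ n) \<zeta>"
    and "\<not> cyclic_extension (range to_ac) (adjoin (range to_ac) {\<zeta>})"
  shows "\<exists>e. coeff_hom e \<and> bij e \<and> (\<forall>c. e (to_ac c) = to_ac c) \<and> e \<zeta> = inverse \<zeta>"
    and "\<exists>l. coeff_hom l \<and> bij l \<and> (\<forall>c. l (to_ac c) = to_ac c) \<and> l \<zeta> = - \<zeta>"
proof -
  interpret cyclotomic n \<zeta> by unfold_locales (fact assms(1,2))+
  have "\<exists>G. coeff_hom G \<and> bij G \<and> (\<forall>c. G (to_ac c) = to_ac c) \<and> G \<zeta> = \<sigma> \<zeta>"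
    if "\<sigma> \<in> carrier A" for \<sigma>
    using aut_extend[OF that] closure_hom_surj \<zeta>_in_L by metis
  then show "\<exists>e. coeff_hom e \<and> bij e \<and> (\<forall>c. e (to_ac c) = to_ac c) \<and> e \<zeta> = inverse \<zeta>"
    "\<exists>l. coeff_hom l \<and> bij l \<and> (\<forall>c. l (to_ac c) = to_ac c) \<and> l \<zeta> = - \<zeta>"
    using noncyclic_automorphisms[OF assms(3)] by metis+
qed

section \<open>Invariant polynomials in one variable\<close>

text \<open>The multiplicity of p in f. For irreducible p and nonzero f the degree of f bounds k, so
  the maximum exists.\<close>

definition vp :: "'f :: field poly \<Rightarrow> 'f poly \<Rightarrow> nat" where
  "vp p f = (GREATEST k. p ^ k dvd f)"

lemma irreducible_degree_pos:
  fixes p :: "'f :: field poly"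
  assumes "irreducible p"
  shows "degree p > 0"
  using assms by (auto simp: irreducible_def is_unit_iff_degree)

lemma power_dvd_iff_le_vp:
  fixes p :: "'f :: field poly"
  assumes p: "irreducible p" and "f \<noteq> 0"
  shows "p ^ k dvd f \<longleftrightarrow> k \<le> vp p f"
proof -
  have bound: "k \<le> degree f" if "p ^ k dvd f" for k
  proof -
    have "k \<le> k * degree p" using irreducible_degree_pos[OF p] by simp
    also have "\<dots> = degree (p ^ k)" using p by (subst degree_power_eq) auto
    also have "\<dots> \<le> degree f" using that assms(2) by (rule dvd_imp_degree_le)
    finally show ?thesis .
  qed
  have "p ^ vp p f dvd f"
    unfolding vp_def by (rule GreatestI_nat[of _ 0 "degree f"]) (use bound in auto)
  moreover have "k \<le> vp p f" if "p ^ k dvd f" for k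
    unfolding vp_def by (rule Greatest_le_nat[of _ _ "degree f"]) (use bound that in auto)
  ultimately show ?thesis using le_imp_power_dvd dvd_trans by blast
qed

lemma vp_decompose:
  fixes p :: "'f :: field poly"
  assumes "irreducible p" "f \<noteq> 0"
  obtains g where "f = p ^ vp p f * g" "\<not> p dvd g"
proof -
  obtain g where g: "f = p ^ vp p f * g"
    using power_dvd_iff_le_vp[OF assms] by (auto elim!: dvdE)
  have "\<not> p dvd g"
  proof
    assume "p dvd g"
    then have "p ^ vp p f * p dvd p ^ vp p f * g" by (intro mult_dvd_mono) auto
    then have "p ^ Suc (vp p f) dvd f" by (metis g power_Suc2)
    then show False using power_dvd_iff_le_vp[OF assms, of "Suc (vp p f)"] by simp
  qed
  then show thesis using that g by blast
qed

lemma vp_eqI: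
  fixes p :: "'f :: field poly"
  assumes "irreducible p" "f = p ^ a * g" "\<not> p dvd g"
  shows "vp p f = a"
proof -
  have nz: "p \<noteq> 0" "g \<noteq> 0" using assms by auto
  then have f: "f \<noteq> 0" using assms(2) by simp
  have "p ^ a dvd f" using assms(2) by (rule dvdI)
  then have "a \<le> vp p f" using power_dvd_iff_le_vp[OF assms(1) f] by blast
  moreover have "\<not> Suc a \<le> vp p f"
  proof
    assume "Suc a \<le> vp p f"
    then have "p ^ Suc a dvd f" using power_dvd_iff_le_vp[OF assms(1) f] by blast
    then have "p ^ a * p dvd p ^ a * g" by (metis assms(2) power_Suc2)
    then show False using nz assms(3) by simp
  qed
  ultimately show ?thesis by simp
qed

lemma vp_mult:
  fixes p :: "'f :: field poly"
  assumes p: "irreducible p" and "f \<noteq> 0" "g \<noteq> 0"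
  shows "vp p (f * g) = vp p f + vp p g"
proof -
  obtain f' where f': "f = p ^ vp p f * f'" "\<not> p dvd f'" by (rule vp_decompose[OF p assms(2)])
  obtain g' where g': "g = p ^ vp p g * g'" "\<not> p dvd g'" by (rule vp_decompose[OF p assms(3)])
  have "f * g = (p ^ vp p f * f') * (p ^ vp p g * g')" using f'(1) g'(1) by metis
  then have "f * g = p ^ (vp p f + vp p g) * (f' * g')" by (simp add: power_add ac_simps)
  moreover have "\<not> p dvd f' * g'"
    using f'(2) g'(2) field_poly_irreducible_imp_prime[OF p] by (simp add: prime_elem_dvd_mult_iff)
  ultimately show ?thesis using vp_eqI[OF p] by blast
qed

lemma vp_power:
  fixes p :: "'f :: field poly"
  assumes p: "irreducible p" and "f \<noteq> 0"
  shows "vp p (f ^ k) = k * vp p f"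
proof (induction k)
  case 0
  have "\<not> p dvd 1" using p by (rule irreducible_not_unit)
  then show ?case using vp_eqI[OF p, of 1 0 1] by simp
next
  case (Suc k)
  then show ?case using vp_mult[OF p, of f "f ^ k"] assms by simp
qed

lemma monic_irreducible_dvd_eq:
  fixes p :: "'f :: field poly"
  assumes "irreducible p" "lead_coeff p = 1" "irreducible q" "lead_coeff q = 1" "p dvd q"
  shows "p = q"
proof -
  obtain r where r: "q = p * r" using assms(5) by blast
  then have "is_unit r" using assms(1,3) irreducibleD[OF assms(3) r] by (auto simp: irreducible_def)
  then obtain c where "r = [:c:]" by (auto simp: is_unit_poly_iff)
  moreover from this have "c = 1" using r assms(2,4) lead_coeff_mult[of p r] by simp
  ultimately show ?thesis using r by simp
qed

text \<open>Distinct monic irreducible polynomials do not divide each other, so dividing out q^k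
  leaves the multiplicities of the others unchanged.\<close>

lemma prod_irreducibles_power_dvd:
  fixes D :: "'f :: field poly"
  assumes "finite S" "D \<noteq> 0"
    and "\<And>q. q \<in> S \<Longrightarrow> irreducible q \<and> lead_coeff q = 1 \<and> q ^ k dvd D"
  shows "(\<Prod>S) ^ k dvd D"
  using assms
proof (induction S arbitrary: D rule: finite_induct)
  case (insert q S)
  obtain D1 where D1: "D = q ^ k * D1" using insert.prems by blast
  have q: "irreducible q" "lead_coeff q = 1" using insert.prems by auto
  then have nz: "D1 \<noteq> 0" "q \<noteq> 0" using insert.prems(1) D1 by auto
  have "(\<Prod>S) ^ k dvd D1"
  proof (rule insert.IH[OF nz(1)])
    fix r assume r: "r \<in> S"
    then have ir: "irreducible r" "lead_coeff r = 1" "r ^ k dvd D" using insert.prems by auto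
    have "\<not> r dvd q" using monic_irreducible_dvd_eq[OF ir(1,2) q] r insert.hyps by blast
    then have "vp r q = 0" using vp_eqI[OF ir(1), of q 0 q] by simp
    then have "vp r D = vp r D1"
      using vp_mult[OF ir(1), of "q ^ k" D1] vp_power[OF ir(1) nz(2)] nz D1 by simp
    then show "irreducible r \<and> lead_coeff r = 1 \<and> r ^ k dvd D1"
      using ir power_dvd_iff_le_vp[OF ir(1)] insert.prems(1) nz(1) by metis
  qed
  then show ?case
    using insert.hyps D1 by (simp add: power_mult_distrib mult_dvd_mono)
qed simp

lemma irreducible_dvd_prod:
  fixes q :: "'f :: field poly"
  assumes "finite S" "irreducible q" "q dvd \<Prod>S"
  shows "\<exists>r\<in>S. q dvd r"
  using assms
proof (induction S rule: finite_induct)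
  case empty
  then show ?case using irreducible_not_unit by auto
next
  case (insert r S)
  then show ?case
    using field_poly_irreducible_imp_prime[OF insert.prems(1)] by (auto simp: prime_elem_dvd_mult_iff)
qed

text \<open>A product of more than \<open>degree D\<close> such divisors would divide D and have
  larger degree.\<close>

lemma finite_monic_irreducible_divisors:
  fixes D :: "'f :: field poly"
  assumes "D \<noteq> 0"
  shows "finite {q. irreducible q \<and> lead_coeff q = 1 \<and> q dvd D}"
proof (rule ccontr)
  assume "infinite {q. irreducible q \<and> lead_coeff q = 1 \<and> q dvd D}"
  then obtain S where S: "finite S" "card S = Suc (degree D)"
      "S \<subseteq> {q. irreducible q \<and> lead_coeff q = 1 \<and> q dvd D}"
    using infinite_arbitrarily_large by blast
  then have "(\<Prod>S) ^ 1 dvd D" using assms by (intro prod_irreducibles_power_dvd) auto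
  then have "degree (\<Prod>S) \<le> degree D" using assms by (intro dvd_imp_degree_le) auto
  moreover have "degree (\<Prod>S) = (\<Sum>q\<in>S. degree q)"
    using S by (intro degree_prod_eq_sum_degree) auto
  moreover have "(\<Sum>q\<in>S. degree q) \<ge> (\<Sum>q\<in>S. 1)"
    using S irreducible_degree_pos by (intro sum_mono) (auto simp: Suc_le_eq)
  ultimately show False using S by simp
qed

lemma monic_irreducible_divisor_exists:
  fixes D :: "'f :: field poly"
  assumes "degree D > 0"
  shows "\<exists>q. irreducible q \<and> lead_coeff q = 1 \<and> q dvd D"
proof -
  let ?S = "\<lambda>q. q dvd D \<and> degree q > 0"
  define p where "p = arg_min degree ?S"
  have p: "?S p" and min: "\<And>q. ?S q \<Longrightarrow> degree p \<le> degree q"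
    unfolding p_def using arg_min_natI[of ?S D degree] arg_min_nat_le[of ?S _ degree] assms by auto
  have p0: "p \<noteq> 0" using p by auto
  define q where "q = smult (inverse (lead_coeff p)) p"
  have q: "lead_coeff q = 1" "q dvd D" "degree q = degree p"
    using p p0 by (auto simp: q_def smult_dvd_iff)
  have "irreducible q"
  proof (rule irreducibleI)
    show "q \<noteq> 0" using q by auto
    show "\<not> is_unit q" using q p by (simp add: is_unit_iff_degree p0 \<open>q \<noteq> 0\<close>)
    fix a b assume ab: "q = a * b"
    then have nz: "a \<noteq> 0" "b \<noteq> 0" using \<open>q \<noteq> 0\<close> by auto
    then have deg: "degree q = degree a + degree b" using ab by (simp add: degree_mult_eq)
    have "a dvd D" "b dvd D" using q(2) ab by (auto intro: dvd_trans)
    then have "degree a = 0 \<or> degree b = 0"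
      using min[of a] min[of b] deg q(3) by force
    then show "is_unit a \<or> is_unit b" using nz by (simp add: is_unit_iff_degree)
  qed
  then show ?thesis using q by blast
qed

text \<open>A group of ring automorphisms with a subgroup \<open>A\<^sub>c\<close> of index two and a representative \<open>l\<close> of its
  nontrivial coset.\<close>

locale automorphisms =
  fixes A Ac :: "('f :: field \<Rightarrow> 'f) set" and l :: "'f \<Rightarrow> 'f"
  assumes hom: "\<alpha> \<in> A \<Longrightarrow> coeff_hom \<alpha>"
    and id_in: "(\<lambda>x. x) \<in> Ac" and Ac_subset: "Ac \<subseteq> A" and l: "l \<in> A" "l \<notin> Ac"
    and comp: "\<alpha> \<in> A \<Longrightarrow> \<beta> \<in> A \<Longrightarrow> \<alpha> \<circ> \<beta> \<in> A"
    and comp_Ac: "\<alpha> \<in> A \<Longrightarrow> \<beta> \<in> A \<Longrightarrow> \<alpha> \<circ> \<beta> \<in> Ac \<longleftrightarrow> (\<alpha> \<in> Ac \<longleftrightarrow> \<beta> \<in> Ac)"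
    and inverse: "\<alpha> \<in> A \<Longrightarrow> \<exists>\<beta>\<in>A. \<beta> \<circ> \<alpha> = (\<lambda>x. x) \<and> \<alpha> \<circ> \<beta> = (\<lambda>x. x)"
begin

lemma map_comp: "\<alpha> \<in> A \<Longrightarrow> \<beta> \<in> A \<Longrightarrow> map_poly \<alpha> (map_poly \<beta> p) = map_poly (\<alpha> \<circ> \<beta>) p"
  by (intro map_poly_comp_coeff_hom hom)

lemma map_hom: "\<alpha> \<in> A \<Longrightarrow> coeff_hom (map_poly \<alpha>)"
  by (intro coeff_hom_map_poly hom)

lemma map_smult: "\<alpha> \<in> A \<Longrightarrow> map_poly \<alpha> (smult c p) = smult (\<alpha> c) (map_poly \<alpha> p)"
  by (rule poly_eqI)
     (simp add: coeff_map_poly coeff_hom.hom_zero[OF hom] coeff_hom.hom_mult[OF hom])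

lemma map_degree: "\<alpha> \<in> A \<Longrightarrow> degree (map_poly \<alpha> p) = degree p"
  using coeff_hom_eq_0_iff[OF hom] by (intro degree_map_poly) auto

lemma map_lead: "\<alpha> \<in> A \<Longrightarrow> lead_coeff (map_poly \<alpha> p) = \<alpha> (lead_coeff p)"
  using coeff_hom.hom_zero[OF hom] by (simp add: map_degree coeff_map_poly)

lemma map_dvd:
  assumes "\<alpha> \<in> A" "p dvd q"
  shows "map_poly \<alpha> p dvd map_poly \<alpha> q"
  using assms(2) by (auto simp: coeff_hom.hom_mult[OF map_hom[OF assms(1)]])

lemma map_inverse:
  assumes "\<alpha> \<in> A"
  obtains \<beta> where "\<beta> \<in> A" "\<And>p. map_poly \<beta> (map_poly \<alpha> p) = p" "\<And>p. map_poly \<alpha> (map_poly \<beta> p) = p"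
    "\<beta> \<in> Ac \<longleftrightarrow> \<alpha> \<in> Ac"
proof -
  obtain \<beta> where \<beta>: "\<beta> \<in> A" "\<beta> \<circ> \<alpha> = (\<lambda>x. x)" "\<alpha> \<circ> \<beta> = (\<lambda>x. x)" using inverse assms by blast
  then show thesis
    using that[of \<beta>] assms comp_Ac[of \<beta> \<alpha>] id_in by (simp add: map_comp)
qed

lemma map_irreducible:
  assumes \<alpha>: "\<alpha> \<in> A" and p: "irreducible p"
  shows "irreducible (map_poly \<alpha> p)"
proof -
  obtain \<beta> where \<beta>: "\<beta> \<in> A" "\<And>p. map_poly \<beta> (map_poly \<alpha> p) = p" "\<And>p. map_poly \<alpha> (map_poly \<beta> p) = p"
    using map_inverse[OF \<alpha>] by blast
  have unit: "is_unit (map_poly \<gamma> q) \<longleftrightarrow> is_unit q" if "\<gamma> \<in> A" for \<gamma> q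
  proof (cases "q = 0")
    case False
    then have "map_poly \<gamma> q \<noteq> 0" using map_lead[OF that, of q] coeff_hom_eq_0_iff[OF hom[OF that]] by auto
    then show ?thesis using False map_degree[OF that] by (simp add: is_unit_iff_degree)
  qed simp
  show ?thesis
  proof (rule irreducibleI)
    show "map_poly \<alpha> p \<noteq> 0" using \<beta>(2)[of p] p by auto
    show "\<not> is_unit (map_poly \<alpha> p)" using unit[OF \<alpha>] p by (auto simp: irreducible_def)
    fix a b assume "map_poly \<alpha> p = a * b"
    then have "p = map_poly \<beta> a * map_poly \<beta> b"
      using \<beta>(2)[of p] by (simp add: coeff_hom.hom_mult[OF map_hom[OF \<beta>(1)]])
    then have "is_unit (map_poly \<beta> a) \<or> is_unit (map_poly \<beta> b)" by (rule irreducibleD[OF p])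
    then show "is_unit a \<or> is_unit b" using unit[OF \<beta>(1)] by simp
  qed
qed

lemma map_prod: "\<alpha> \<in> A \<Longrightarrow> map_poly \<alpha> (\<Prod>S) = \<Prod>(map_poly \<alpha> ` S)"
proof -
  assume \<alpha>: "\<alpha> \<in> A"
  obtain \<beta> where "\<And>p. map_poly \<beta> (map_poly \<alpha> p) = p" using map_inverse[OF \<alpha>] by blast
  then have "inj_on (map_poly \<alpha>) S" by (metis inj_onI)
  then show ?thesis by (simp add: coeff_hom_prod[OF map_hom[OF \<alpha>]] prod.reindex)
qed

text \<open>Take the orbit of a monic irreducible divisor p. If something outside \<open>Ac\<close>
  fixes p, then p occurs to an even power and the square of the orbit product can be divided out.
  Otherwise the stabiliser of p lies in \<open>Ac\<close>, the orbit consists of two halves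
  exchanged by l, and the orbit product has the form Z1 * l Z1. The quotient has smaller
  degree.\<close>

theorem decompose:
  assumes "D \<noteq> 0" "\<And>\<alpha>. \<alpha> \<in> A \<Longrightarrow> map_poly \<alpha> D = D"
    and "\<And>p \<alpha>. irreducible p \<Longrightarrow> \<alpha> \<in> A \<Longrightarrow> \<alpha> \<notin> Ac \<Longrightarrow> map_poly \<alpha> p = p \<Longrightarrow> even (vp p D)"
  shows "\<exists>c S Z. D = smult c (S ^ 2 * (Z * map_poly l Z)) \<and> (\<forall>\<alpha>\<in>A. \<alpha> c = c \<and> map_poly \<alpha> S = S) \<and>
    (\<forall>\<alpha>\<in>Ac. map_poly \<alpha> Z = Z)"
  using assms
proof (induction "degree D" arbitrary: D rule: less_induct)
  case less
  show ?case
  proof (cases "degree D = 0")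
    case True
    then obtain c where c: "D = [:c:]" by (rule degree_eq_zeroE)
    have "\<alpha> c = c" if "\<alpha> \<in> A" for \<alpha>
      using less.prems(2)[OF that] c coeff_hom.hom_zero[OF hom[OF that]]
      by (auto simp: map_poly_pCons)
    moreover have "map_poly \<alpha> 1 = 1" if "\<alpha> \<in> A" for \<alpha>
      using coeff_hom.hom_one[OF map_hom[OF that]] .
    ultimately show ?thesis
      using c l Ac_subset by (intro exI[of _ c] exI[of _ 1]) (auto simp: one_pCons[symmetric])
  next
    case False
    then obtain p where p: "irreducible p" "lead_coeff p = 1" "p dvd D"
      using monic_irreducible_divisor_exists[of D] by auto
    define Orb where "Orb B = (\<lambda>\<alpha>. map_poly \<alpha> p) ` B" for B :: "('f \<Rightarrow> 'f) set"
    have orb: "irreducible q \<and> lead_coeff q = 1" if "q \<in> Orb A" for q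
      using that p map_irreducible map_lead coeff_hom.hom_one[OF hom] unfolding Orb_def by auto
    have dvd: "q ^ k dvd D" if q: "q \<in> Orb A" "p ^ k dvd D" for q k
    proof -
      obtain \<alpha> where "\<alpha> \<in> A" "q = map_poly \<alpha> p" using q(1) unfolding Orb_def by blast
      then show ?thesis
        using map_dvd[OF _ q(2), of \<alpha>] less.prems(2) by (simp add: coeff_hom_power[OF map_hom])
    qed
    have fin: "finite (Orb A)"
      by (rule finite_subset[OF _ finite_monic_irreducible_divisors[OF less.prems(1)]])
        (use orb dvd[of _ 1] p in auto)
    have Orb_map: "map_poly \<beta> ` Orb B = Orb C"
      if \<beta>: "\<beta> \<in> A" "B \<subseteq> A" "C \<subseteq> A" "\<And>\<alpha>. \<alpha> \<in> A \<Longrightarrow> \<beta> \<circ> \<alpha> \<in> C \<longleftrightarrow> \<alpha> \<in> B" for \<beta> B C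
    proof
      show "map_poly \<beta> ` Orb B \<subseteq> Orb C"
      proof
        fix q assume "q \<in> map_poly \<beta> ` Orb B"
        then obtain \<alpha> where \<alpha>: "\<alpha> \<in> B" "q = map_poly \<beta> (map_poly \<alpha> p)" unfolding Orb_def by blast
        moreover from this have "\<alpha> \<in> A" using \<beta>(2) by blast
        ultimately have "\<beta> \<circ> \<alpha> \<in> C" "q = map_poly (\<beta> \<circ> \<alpha>) p"
          using \<beta>(1,4) by (auto simp: map_comp)
        then show "q \<in> Orb C" unfolding Orb_def by blast
      qed
      show "Orb C \<subseteq> map_poly \<beta> ` Orb B"
      proof
        fix q assume "q \<in> Orb C"
        then obtain \<alpha> where \<alpha>: "\<alpha> \<in> C" "q = map_poly \<alpha> p" unfolding Orb_def by blast
        obtain \<gamma> where \<gamma>: "\<gamma> \<in> A" "\<gamma> \<circ> \<beta> = (\<lambda>x. x)" "\<beta> \<circ> \<gamma> = (\<lambda>x. x)" using inverse \<beta>(1) by blast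
        have "\<beta> \<circ> (\<gamma> \<circ> \<alpha>) = \<alpha>" using \<gamma>(3) by (simp add: o_assoc) (simp add: comp_def)
        moreover have "\<alpha> \<in> A" using \<alpha> \<beta>(3) by blast
        moreover from this have "\<gamma> \<circ> \<alpha> \<in> A" using comp \<gamma>(1) by blast
        ultimately have "\<gamma> \<circ> \<alpha> \<in> B" "q = map_poly \<beta> (map_poly (\<gamma> \<circ> \<alpha>) p)"
          using \<beta>(4)[of "\<gamma> \<circ> \<alpha>"] \<alpha> map_comp[OF \<beta>(1), of "\<gamma> \<circ> \<alpha>" p] by auto
        then show "q \<in> map_poly \<beta> ` Orb B" unfolding Orb_def by blast
      qed
    qed
    have Orb_A: "map_poly \<beta> ` Orb A = Orb A" if "\<beta> \<in> A" for \<beta>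
    proof (rule Orb_map[OF that])
      show "\<beta> \<circ> \<alpha> \<in> A \<longleftrightarrow> \<alpha> \<in> A" if "\<alpha> \<in> A" for \<alpha> using comp \<open>\<beta> \<in> A\<close> that by blast
    qed auto
    have Orb_Ac: "map_poly \<beta> ` Orb Ac = Orb Ac" if "\<beta> \<in> Ac" for \<beta>
      by (rule Orb_map) (use that Ac_subset comp_Ac in auto)
    have nz: "\<Prod>(Orb A) \<noteq> 0" using fin orb[of 0] by auto
    have pos: "degree (\<Prod>(Orb A)) > 0"
    proof -
      have "map_poly (\<lambda>x. x) p \<in> Orb A" unfolding Orb_def using id_in Ac_subset by blast
      then have "p dvd \<Prod>(Orb A)" using dvd_prodI[OF fin, of p "\<lambda>q. q"] by simp
      then show ?thesis
        using dvd_imp_degree_le[OF _ nz, of p] irreducible_degree_pos[OF p(1)] by simp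
    qed
    \<comment> \<open>An invariant factor with even multiplicity at the stable primes can be removed
      without losing the hypotheses.\<close>
    have rest: "\<exists>c S Z. D' = smult c (S ^ 2 * (Z * map_poly l Z)) \<and>
        (\<forall>\<alpha>\<in>A. \<alpha> c = c \<and> map_poly \<alpha> S = S) \<and> (\<forall>\<alpha>\<in>Ac. map_poly \<alpha> Z = Z)"
      if D': "D = E * D'" "\<And>\<alpha>. \<alpha> \<in> A \<Longrightarrow> map_poly \<alpha> E = E" "degree E > 0"
        and even: "\<And>p \<alpha>. irreducible p \<Longrightarrow> \<alpha> \<in> A \<Longrightarrow> \<alpha> \<notin> Ac \<Longrightarrow> map_poly \<alpha> p = p \<Longrightarrow> even (vp p E)" for E D'
    proof (rule less.hyps)
      have nz: "E \<noteq> 0" "D' \<noteq> 0" using D'(1) less.prems(1) by auto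
      then show "D' \<noteq> 0" by blast
      show "degree D' < degree D" using D'(1,3) nz by (simp add: degree_mult_eq)
      show "map_poly \<alpha> D' = D'" if "\<alpha> \<in> A" for \<alpha>
      proof -
        have "E * map_poly \<alpha> D' = E * D'"
          using less.prems(2)[OF that] D'(2)[OF that] unfolding D'(1) by (simp add: coeff_hom.hom_mult[OF map_hom[OF that]])
        then show ?thesis using nz by simp
      qed
      show "even (vp q D')" if q: "irreducible q" "\<alpha> \<in> A" "\<alpha> \<notin> Ac" "map_poly \<alpha> q = q" for q \<alpha>
        using less.prems(3)[OF q] even[OF q] vp_mult[OF q(1) nz] unfolding D'(1) by simp
    qed
    show ?thesis
    proof (cases "\<exists>\<alpha>\<in>A. \<alpha> \<notin> Ac \<and> map_poly \<alpha> p = p")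
      case True
      then have "even (vp p D)" using less.prems(3)[OF p(1)] by blast
      moreover have "vp p D \<ge> 1" using power_dvd_iff_le_vp[OF p(1) less.prems(1), of 1] p(3) by simp
      ultimately have "2 \<le> vp p D" by (cases "vp p D = 1") auto
      then have "p ^ 2 dvd D" using power_dvd_iff_le_vp[OF p(1) less.prems(1)] by blast
      then have "(\<Prod>(Orb A)) ^ 2 dvd D"
        using orb dvd by (intro prod_irreducibles_power_dvd fin less.prems) auto
      then obtain D' where D': "D = (\<Prod>(Orb A)) ^ 2 * D'" by blast
      have fixed: "map_poly \<alpha> (\<Prod>(Orb A)) = \<Prod>(Orb A)" if "\<alpha> \<in> A" for \<alpha>
        using map_prod[OF that] Orb_A[OF that] by simp
      have "\<exists>c S Z. D' = smult c (S ^ 2 * (Z * map_poly l Z)) \<and>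
        (\<forall>\<alpha>\<in>A. \<alpha> c = c \<and> map_poly \<alpha> S = S) \<and> (\<forall>\<alpha>\<in>Ac. map_poly \<alpha> Z = Z)"
      proof (rule rest[OF D'])
        show "map_poly \<alpha> ((\<Prod>(Orb A)) ^ 2) = (\<Prod>(Orb A)) ^ 2" if "\<alpha> \<in> A" for \<alpha>
          using fixed[OF that] by (simp add: coeff_hom_power[OF map_hom[OF that]])
        show "degree ((\<Prod>(Orb A)) ^ 2) > 0" using pos nz by (simp add: degree_power_eq)
        show "even (vp q ((\<Prod>(Orb A)) ^ 2))" if "irreducible q" for q
          using vp_power[OF that nz] by simp
      qed
      then obtain c S Z where csz: "D' = smult c (S ^ 2 * (Z * map_poly l Z))"
        "\<forall>\<alpha>\<in>A. \<alpha> c = c \<and> map_poly \<alpha> S = S" "\<forall>\<alpha>\<in>Ac. map_poly \<alpha> Z = Z" by blast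
      then have "D = smult c ((\<Prod>(Orb A) * S) ^ 2 * (Z * map_poly l Z))"
        using D' by (simp add: power_mult_distrib ac_simps)
      moreover have "map_poly \<alpha> (\<Prod>(Orb A) * S) = \<Prod>(Orb A) * S" if "\<alpha> \<in> A" for \<alpha>
        using fixed[OF that] csz that by (simp add: coeff_hom.hom_mult[OF map_hom[OF that]])
      ultimately show ?thesis using csz by blast
    next
      case False
      have disj: "Orb Ac \<inter> map_poly l ` Orb Ac = {}"
      proof (rule ccontr)
        assume "Orb Ac \<inter> map_poly l ` Orb Ac \<noteq> {}"
        then obtain \<alpha> \<beta> where ab: "\<alpha> \<in> Ac" "\<beta> \<in> Ac" "map_poly \<alpha> p = map_poly l (map_poly \<beta> p)"
          unfolding Orb_def by blast
        then have inA: "\<alpha> \<in> A" "\<beta> \<in> A" "l \<circ> \<beta> \<in> A" using Ac_subset l comp by auto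
        obtain \<gamma> where \<gamma>: "\<gamma> \<in> A" "\<And>q. map_poly \<gamma> (map_poly \<alpha> q) = q" "\<gamma> \<in> Ac \<longleftrightarrow> \<alpha> \<in> Ac"
          using map_inverse[OF inA(1)] by metis
        have "map_poly (\<gamma> \<circ> (l \<circ> \<beta>)) p = p"
          using \<gamma>(2)[of p] ab(3) inA \<gamma>(1) l(1) by (simp flip: map_comp)
        moreover have "\<gamma> \<circ> (l \<circ> \<beta>) \<in> A" "\<gamma> \<circ> (l \<circ> \<beta>) \<notin> Ac"
          using comp \<gamma> inA comp_Ac l ab by auto
        ultimately show False using False by blast
      qed
      have union: "Orb A = Orb Ac \<union> map_poly l ` Orb Ac"
      proof -
        have "map_poly l ` Orb Ac = Orb (A - Ac)"
          by (rule Orb_map) (use l Ac_subset comp comp_Ac in auto)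
        then show ?thesis using Ac_subset unfolding Orb_def by blast
      qed
      define Z1 where "Z1 = \<Prod>(Orb Ac)"
      have prod: "\<Prod>(Orb A) = Z1 * map_poly l Z1"
        unfolding Z1_def map_prod[OF l(1)] union
        using fin union disj by (intro prod.union_disjoint) auto
      have Z1: "map_poly \<alpha> Z1 = Z1" if "\<alpha> \<in> Ac" for \<alpha>
        unfolding Z1_def using map_prod Orb_Ac[OF that] that Ac_subset by auto
      have "(\<Prod>(Orb A)) ^ 1 dvd D"
        using orb dvd[of _ 1] p(3) by (intro prod_irreducibles_power_dvd fin less.prems) auto
      then obtain D' where D': "D = \<Prod>(Orb A) * D'" by auto
      have "\<exists>c S Z. D' = smult c (S ^ 2 * (Z * map_poly l Z)) \<and>
        (\<forall>\<alpha>\<in>A. \<alpha> c = c \<and> map_poly \<alpha> S = S) \<and> (\<forall>\<alpha>\<in>Ac. map_poly \<alpha> Z = Z)"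
      proof (rule rest[OF D'])
        show "map_poly \<alpha> (\<Prod>(Orb A)) = \<Prod>(Orb A)" if "\<alpha> \<in> A" for \<alpha>
          using map_prod[OF that] Orb_A[OF that] by simp
        show "degree (\<Prod>(Orb A)) > 0" by (rule pos)
        \<comment> \<open>If q divided the orbit product, it would be a constant times some member
          of the orbit, and a conjugate of \<alpha>, still outside \<open>Ac\<close>, would fix
          p.\<close>
        show "even (vp q (\<Prod>(Orb A)))" if q: "irreducible q" "\<alpha> \<in> A" "\<alpha> \<notin> Ac" "map_poly \<alpha> q = q" for q \<alpha>
        proof -
          have "\<not> q dvd \<Prod>(Orb A)"
          proof
            assume "q dvd \<Prod>(Orb A)"
            then obtain r where r: "r \<in> Orb A" "q dvd r"
              using irreducible_dvd_prod[OF fin q(1)] by blast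
            obtain \<beta> where \<beta>: "\<beta> \<in> A" "r = map_poly \<beta> p" using r(1) unfolding Orb_def by blast
            obtain \<gamma> where \<gamma>: "\<gamma> \<in> A" "\<And>q. map_poly \<gamma> (map_poly \<beta> q) = q" "\<gamma> \<in> Ac \<longleftrightarrow> \<beta> \<in> Ac"
              using map_inverse[OF \<beta>(1)] by metis
            obtain t where t: "r = q * t" using r(2) by blast
            then have "is_unit t" using orb[OF r(1)] q(1) irreducibleD[of r q t] by (auto simp: irreducible_def)
            then obtain u where u: "t = [:u:]" by (auto simp: is_unit_poly_iff)
            have ru: "r = smult u q" using t u by simp
            \<comment> \<open>Since r is monic and q is fixed, comparing leading coefficients shows
              that \<alpha> fixes the constant between them.\<close>
            have "map_poly \<alpha> r = r"
            proof -
              have "map_poly \<alpha> r = smult (\<alpha> u) q"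
                unfolding ru using map_smult[OF q(2)] q(4) by simp
              moreover have "lead_coeff (map_poly \<alpha> r) = 1"
                using orb[OF r(1)] map_lead[OF q(2)] coeff_hom.hom_one[OF hom[OF q(2)]] by simp
              moreover have "lead_coeff r = 1" using orb[OF r(1)] by blast
              ultimately have "\<alpha> u * lead_coeff q = 1" "u * lead_coeff q = 1"
                using lead_coeff_smult[of "\<alpha> u" q] lead_coeff_smult[of u q] ru by metis+
              then have "\<alpha> u = u" by (metis mult_cancel_right mult_zero_right zero_neq_one)
              then show ?thesis using \<open>map_poly \<alpha> r = smult (\<alpha> u) q\<close> ru by simp
            qed
            then have "map_poly (\<gamma> \<circ> (\<alpha> \<circ> \<beta>)) p = p"
              using map_comp[OF \<gamma>(1) comp[OF q(2) \<beta>(1)], of p] map_comp[OF q(2) \<beta>(1), of p] \<gamma>(2)[of p] \<beta>(2)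
              by simp
            moreover have "\<gamma> \<circ> (\<alpha> \<circ> \<beta>) \<in> A" "\<gamma> \<circ> (\<alpha> \<circ> \<beta>) \<notin> Ac"
              using comp \<gamma> \<beta> comp_Ac q by auto
            ultimately show False using False by blast
          qed
          then have "vp q (\<Prod>(Orb A)) = 0" using vp_eqI[OF q(1), of "\<Prod>(Orb A)" 0 "\<Prod>(Orb A)"] by simp
          then show ?thesis by simp
        qed
      qed
      then obtain c S Z where csz: "D' = smult c (S ^ 2 * (Z * map_poly l Z))"
        "\<forall>\<alpha>\<in>A. \<alpha> c = c \<and> map_poly \<alpha> S = S" "\<forall>\<alpha>\<in>Ac. map_poly \<alpha> Z = Z" by blast
      then have "D = smult c (S ^ 2 * ((Z1 * Z) * map_poly l (Z1 * Z)))"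
        using D' prod by (simp add: coeff_hom.hom_mult[OF map_hom[OF l(1)]] ac_simps)
      moreover have "map_poly \<alpha> (Z1 * Z) = Z1 * Z" if "\<alpha> \<in> Ac" for \<alpha>
        using Z1[OF that] csz that subsetD[OF Ac_subset that] by (simp add: coeff_hom.hom_mult[OF map_hom])
      ultimately show ?thesis using csz by blast
    qed
  qed
qed

end

section \<open>Kummer generators of cyclic extensions\<close>

text \<open>Multiplying the resolvent by x moves every index on by one; the term that wraps around
  produces the multiple of x^m - 1.\<close>

lemma cyclic_sum_shift:
  fixes X :: "nat \<Rightarrow> 'a :: comm_ring_1"
  assumes "m > 0" "\<And>j. X (j + m) = X j"
  shows "(\<Sum>j<m. X (j + Suc c) * x ^ (m - j)) = x * (\<Sum>j<m. X (j + c) * x ^ (m - j)) - X c * x * (x ^ m - 1)"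
proof -
  obtain k where k: "m = Suc k" using assms(1) by (cases m) auto
  have "x * (\<Sum>j<m. X (j + c) * x ^ (m - j)) = X c * x ^ Suc m + (\<Sum>j<k. x * (X (Suc j + c) * x ^ (m - Suc j)))"
    unfolding k sum.lessThan_Suc_shift by (simp add: distrib_left sum_distrib_left ac_simps)
  also have "(\<Sum>j<k. x * (X (Suc j + c) * x ^ (m - Suc j))) = (\<Sum>j<k. X (j + Suc c) * x ^ (m - j))"
  proof (rule sum.cong)
    fix j assume "j \<in> {..<k}"
    then have "m - j = Suc (m - Suc j)" using k by simp
    then show "x * (X (Suc j + c) * x ^ (m - Suc j)) = X (j + Suc c) * x ^ (m - j)"
      by (simp add: ac_simps)
  qed simp
  finally have 1: "x * (\<Sum>j<m. X (j + c) * x ^ (m - j)) = X c * x ^ Suc m + (\<Sum>j<k. X (j + Suc c) * x ^ (m - j))" .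
  have "X (k + Suc c) = X c" using assms(2)[of c] k by (simp add: add.commute)
  then have "(\<Sum>j<m. X (j + Suc c) * x ^ (m - j)) = (\<Sum>j<k. X (j + Suc c) * x ^ (m - j)) + X c * x"
    unfolding k by simp
  then show ?thesis using 1 by (simp add: algebra_simps)
qed

text \<open>Applied with d = \<open>\<Phi>\<close> to the resolvents, and with d = 0 and x = -1 to
  \<open>\<delta>\<close>.\<close>

lemma cyclic_sum_shift_dvd:
  fixes X :: "nat \<Rightarrow> 'a :: comm_ring_1"
  assumes "m > 0" "\<And>j. X (j + m) = X j" "d dvd x ^ m - 1"
  shows "d dvd (\<Sum>j<m. X (j + c) * x ^ (m - j)) - x ^ c * (\<Sum>j<m. X j * x ^ (m - j))"
proof (induction c)
  case (Suc c)
  let ?Y = "\<lambda>c. \<Sum>j<m. X (j + c) * x ^ (m - j)"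
  have "?Y (Suc c) - x ^ Suc c * ?Y 0 = x * (?Y c - x ^ c * ?Y 0) - X c * x * (x ^ m - 1)"
    unfolding cyclic_sum_shift[of m X, OF assms(1,2)] by (simp add: algebra_simps)
  then show ?case using Suc assms(3) by simp
qed simp

lemma coeff_hom_pcompose: "coeff_hom (\<lambda>p :: 'a :: comm_ring_1 poly. p \<circ>\<^sub>p q)"
  by (simp add: coeff_hom_def pcompose_add pcompose_mult pcompose_1)

text \<open>T plays the role of a group that acts on B through a cyclic quotient of order m, and X
  that of a family which it shifts cyclically.\<close>

locale kummer =
  fixes n m :: nat and B :: "'e :: field set" and T :: "('e \<Rightarrow> 'e) set" and X :: "nat \<Rightarrow> 'e"
  assumes n: "n \<ge> 3" and m: "m = 2 ^ n" and B: "subfld B"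
    and T: "t \<in> T \<Longrightarrow> coeff_hom t"
    and X_T: "t \<in> T \<Longrightarrow> \<exists>c. \<forall>j. t (X j) = X (j + c)"
    and X_B: "X j \<in> B" and X_period: "X (j + m) = X j"
begin

definition L :: "'e set" where "L = {x \<in> B. \<forall>t\<in>T. t x = x}"

lemma m_pos: "m > 0" and m_even: "even m" and half: "2 * (m div 2) = m"
  using n by (auto simp: m)

lemma subfld_L: "subfld L"
proof -
  interpret subdomain_locale B using B by unfold_locales (simp add: subfld_def)
  show ?thesis
    using B unfolding subfld_def subdomain_def L_def
    by (auto simp: coeff_hom.hom_one[OF T] coeff_hom.hom_add[OF T] coeff_hom.hom_mult[OF T]
        coeff_hom_minus[OF T] coeff_hom_inverse[OF T])
qed

sublocale B: subfld_hom B "\<lambda>x. x" by unfold_locales (rule B, rule hom_on_id)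
sublocale L: subfld_hom L "\<lambda>x. x" by unfold_locales (rule subfld_L, rule hom_on_id)

text \<open>The cyclotomic polynomial of order m = 2^n. Calculating modulo it replaces the
  adjunction of \<zeta>, whose degree over L is not known.\<close>

definition \<Phi> :: "'e poly" where "\<Phi> = monom 1 (m div 2) + 1"

text \<open>The Lagrange resolvent at -1. Shifts by odd amounts change its sign, so when nonzero it
  generates the quadratic subextension of a cyclic extension.\<close>

definition \<delta> :: 'e where "\<delta> = (\<Sum>j<m. X j * (- 1) ^ (m - j))"

text \<open>The Lagrange resolvent at the power x^\<chi> of the indeterminate. The exponent m - j
  stands for -j, which x^m = 1 modulo \<open>\<Phi>\<close> permits, and keeps Y polynomial.\<close>

definition Y :: "nat \<Rightarrow> 'e poly" where "Y \<chi> = (\<Sum>j<m. monom (X j) (\<chi> * (m - j)))"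

lemma half_pos: "m div 2 > 0"
  using half m_pos by (metis gr0I mult_0_right nat_less_le)

lemma deg_\<Phi>: "degree \<Phi> = m div 2"
  unfolding \<Phi>_def using half_pos
  by (subst degree_add_eq_left) (auto simp: degree_monom_eq)

lemma \<Phi>_nz: "\<Phi> \<noteq> 0"
  using deg_\<Phi> half_pos by auto

lemma \<Phi>_L: "\<Phi> \<in> polys_over L"
  unfolding \<Phi>_def by (intro L.P.closed(3) L.monom_polys_over L.closed(1) L.P.closed(1))

lemma map_\<Phi>: "coeff_hom t \<Longrightarrow> map_poly t \<Phi> = \<Phi>"
  unfolding \<Phi>_def
  by (simp add: coeff_hom.hom_add[OF coeff_hom_map_poly] map_poly_monom coeff_hom.hom_zero
      coeff_hom.hom_one coeff_hom.hom_one[OF coeff_hom_map_poly])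

text \<open>For odd \<chi>, y + 1 divides y^\<chi> + 1. With y = x^(m/2) this means that
  substituting x^\<chi> for x respects congruence modulo \<open>\<Phi>\<close>.\<close>

lemma \<Phi>_dvd_pow: "odd \<chi> \<Longrightarrow> \<Phi> dvd monom 1 (\<chi> * (m div 2)) + 1"
proof -
  assume "odd \<chi>"
  have "x + 1 dvd x ^ \<chi> + 1" for x :: "'e poly"
  proof -
    have "x - - 1 dvd x ^ \<chi> - (- 1) ^ \<chi>" by (rule power_diff_sumr2[THEN dvdI])
    then show ?thesis using \<open>odd \<chi>\<close> by simp
  qed
  then show ?thesis by (metis \<Phi>_def monom_power power_one mult.commute)
qed

lemma \<Phi>_dvd_period: "\<Phi> dvd monom 1 (\<chi> * m) - 1"
proof -
  have "monom 1 m - 1 = (monom 1 (m div 2) - 1) * \<Phi>"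
    unfolding \<Phi>_def using half by (simp add: algebra_simps mult_monom flip: mult_2)
  then have "\<Phi> dvd monom 1 m - 1" by simp
  moreover have "monom 1 m - 1 dvd monom 1 m ^ \<chi> - (1 :: 'e poly) ^ \<chi>"
    by (rule power_diff_sumr2[THEN dvdI])
  ultimately show ?thesis by (metis dvd_trans monom_power power_one mult.commute)
qed

definition cong :: "'e poly \<Rightarrow> 'e poly \<Rightarrow> bool" (infix \<open>\<approx>\<close> 50) where "p \<approx> q \<longleftrightarrow> \<Phi> dvd p - q"

lemma cong_refl: "p \<approx> p"
  by (simp add: cong_def)

lemma cong_sym: "p \<approx> q \<Longrightarrow> q \<approx> p"
  unfolding cong_def by (metis dvd_minus_iff minus_diff_eq)

lemma cong_trans [trans]: "p \<approx> q \<Longrightarrow> q \<approx> r \<Longrightarrow> p \<approx> r"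
  unfolding cong_def by (metis diff_add_cancel add_diff_eq dvd_add)

lemma cong_mult: "p \<approx> q \<Longrightarrow> p' \<approx> q' \<Longrightarrow> p * p' \<approx> q * q'"
proof -
  assume "p \<approx> q" "p' \<approx> q'"
  moreover have "p * p' - q * q' = (p - q) * p' + q * (p' - q')" by (simp add: algebra_simps)
  ultimately show ?thesis unfolding cong_def by simp
qed

lemma cong_power: "p \<approx> q \<Longrightarrow> p ^ k \<approx> q ^ k"
  by (induction k) (auto intro: cong_mult cong_refl)

lemma map_cong: "coeff_hom t \<Longrightarrow> p \<approx> q \<Longrightarrow> map_poly t p \<approx> map_poly t q"
  unfolding cong_def
  by (auto simp: coeff_hom_diff[OF coeff_hom_map_poly, symmetric] coeff_hom.hom_mult[OF coeff_hom_map_poly] map_\<Phi>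
      elim!: dvdE)

text \<open>A remainder of degree below that of \<open>\<Phi>\<close> is determined by its residue
  class, so invariance modulo \<open>\<Phi>\<close> becomes invariance of each coefficient of the
  remainder.\<close>

lemma reduce:
  assumes p: "p \<in> polys_over B" and inv: "\<And>t. t \<in> T \<Longrightarrow> map_poly t p \<approx> p"
  shows "\<exists>r. r \<in> polys_over L \<and> p \<approx> r"
proof -
  have "L \<subseteq> B" by (auto simp: L_def)
  then have \<Phi>B: "\<Phi> \<in> polys_over B" using \<Phi>_L by (auto simp: polys_over_def)
  obtain s r where r: "s \<in> polys_over B" "r \<in> polys_over B" "p = \<Phi> * s + r" "r = 0 \<or> degree r < degree \<Phi>"
    using division_over[OF B \<Phi>B \<Phi>_nz p] by blast
  have pr: "p \<approx> r" by (simp add: cong_def r(3))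
  have "map_poly t r = r" if t: "t \<in> T" for t
  proof (rule ccontr)
    assume ne: "map_poly t r \<noteq> r"
    have "map_poly t r \<approx> r"
      using map_cong[OF T[OF t] cong_sym[OF pr]] inv[OF t] pr cong_trans by blast
    then have "\<Phi> dvd map_poly t r - r" by (simp add: cong_def)
    then have "degree \<Phi> \<le> degree (map_poly t r - r)" using ne by (intro dvd_imp_degree_le) auto
    moreover have "degree (map_poly t r) \<le> degree r"
      using coeff_hom.hom_zero[OF T[OF t]] by (intro degree_le) (simp add: coeff_map_poly coeff_eq_0)
    moreover have "r \<noteq> 0" using ne by auto
    ultimately show False using r(4) degree_diff_le[of "map_poly t r" "degree r" r] by simp
  qed
  then have "t (coeff r i) = coeff r i" if "t \<in> T" for t i
    using that coeff_map_poly[of t r i] coeff_hom.hom_zero[OF T[OF that]] by metis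
  then have "r \<in> polys_over L" using r(2) unfolding polys_over_def L_def by auto
  then show ?thesis using pr by blast
qed

text \<open>Division by \<open>\<Phi>\<close> can be done over L, so a congruence becomes an
  identity with all coefficients in L, to which a map defined on L can be applied.\<close>

lemma cong_over_L:
  assumes "p \<in> polys_over L" "q \<in> polys_over L" "p \<approx> q"
  shows "\<exists>r\<in>polys_over L. p = q + \<Phi> * r"
proof -
  have "p - q \<in> polys_over L" using assms by auto
  then obtain s r where r: "s \<in> polys_over L" "r \<in> polys_over L" "p - q = \<Phi> * s + r" "r = 0 \<or> degree r < degree \<Phi>"
    using division_over[OF subfld_L \<Phi>_L \<Phi>_nz] by blast
  have "\<Phi> dvd r"
    using assms(3) unfolding cong_def r(3) by (simp add: dvd_add_right_iff)
  then have "r = 0" using r(4) dvd_imp_degree_le[of \<Phi> r] by linarith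
  then show ?thesis using r(1,3) by (intro bexI[of _ s]) (auto simp: algebra_simps)
qed

lemma Y_B: "Y \<chi> \<in> polys_over B"
  unfolding Y_def by (intro B.P.sum_closed B.monom_polys_over X_B)

lemma map_Y:
  assumes "t \<in> T" "\<forall>j. t (X j) = X (j + c)"
  shows "map_poly t (Y \<chi>) \<approx> monom 1 (\<chi> * c) * Y \<chi>"
proof -
  let ?x = "monom 1 \<chi> :: 'e poly" and ?X = "\<lambda>j. [:X j:]"
  have eq: "monom a (\<chi> * k) = [:a:] * ?x ^ k" for a k
    by (simp add: monom_power smult_monom)
  have mm: "map_poly t (monom a k) = monom (t a) k" for a k
    using map_poly_monom[of t a k] coeff_hom.hom_zero[OF T[OF assms(1)]] by simp
  have "map_poly t (Y \<chi>) = (\<Sum>j<m. ?X (j + c) * ?x ^ (m - j))"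
    unfolding Y_def coeff_hom_sum[OF coeff_hom_map_poly[OF T[OF assms(1)]]]
    by (simp only: mm spec[OF assms(2)]) (simp only: eq)
  moreover have "Y \<chi> = (\<Sum>j<m. ?X j * ?x ^ (m - j))" unfolding Y_def by (simp only: eq)
  moreover have "\<Phi> dvd ?x ^ m - 1" using \<Phi>_dvd_period[of \<chi>] by (simp add: monom_power)
  ultimately show ?thesis
    using cyclic_sum_shift_dvd[of m ?X \<Phi> ?x c] m_pos X_period
    unfolding cong_def by (simp add: monom_power)
qed

lemma T_\<delta>:
  assumes "t \<in> T" "\<forall>j. t (X j) = X (j + c)"
  shows "t \<delta> = (- 1) ^ c * \<delta>"
proof -
  have "t \<delta> = (\<Sum>j<m. X (j + c) * (- 1) ^ (m - j))"
    unfolding \<delta>_def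
    by (simp add: coeff_hom_sum[OF T[OF assms(1)]] coeff_hom.hom_mult[OF T[OF assms(1)]] assms(2)
        coeff_hom_power[OF T[OF assms(1)]] coeff_hom_minus[OF T[OF assms(1)]] coeff_hom.hom_one[OF T[OF assms(1)]])
  moreover have "0 dvd (- 1 :: 'e) ^ m - 1" using m_even by simp
  ultimately show ?thesis
    using cyclic_sum_shift_dvd[of m X 0 "- 1" c] m_pos X_period unfolding \<delta>_def by simp
qed

lemma \<delta>_B: "\<delta> \<in> B"
  unfolding \<delta>_def by (intro B.sum_closed B.closed(4) B.power_closed B.closed(5) B.closed(1) X_B)

lemma monom_half_cong: "monom 1 (c * (m div 2)) \<approx> [:(- 1) ^ c:]"
proof -
  have "monom 1 (m div 2) - [:- 1:] = \<Phi>"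
    unfolding \<Phi>_def by (rule poly_eqI) (auto simp: coeff_pCons split: nat.splits)
  then have "monom 1 (m div 2) \<approx> [:- 1:]" by (simp add: cong_def)
  then have "monom 1 (m div 2) ^ c \<approx> [:- 1:] ^ c" by (rule cong_power)
  moreover have "[:- 1 :: 'e:] ^ c = [:(- 1) ^ c:]" by (induction c) (simp_all add: one_pCons)
  ultimately show ?thesis by (simp add: monom_power mult.commute)
qed

lemma monom_period_cong: "monom 1 (c * m) \<approx> 1"
  unfolding cong_def by (rule \<Phi>_dvd_period)

lemma \<delta>_square_L: "\<delta> ^ 2 \<in> L"
proof -
  have "t (\<delta> ^ 2) = \<delta> ^ 2" if t: "t \<in> T" for t
  proof -
    obtain c where c: "\<forall>j. t (X j) = X (j + c)" using X_T t by blast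
    have "((- 1 :: 'e) ^ c) ^ 2 = 1" by (simp flip: power_mult)
    then show ?thesis
      by (simp add: coeff_hom_power[OF T[OF t]] T_\<delta>[OF t c] power_mult_distrib)
  qed
  then show ?thesis using \<delta>_B unfolding L_def by auto
qed

text \<open>The \<open>m\<close>-th power of the Lagrange resolvent \<open>Y 1\<close> is invariant modulo \<open>\<Phi>\<close>, and so are the
  two products on the right-hand sides below.\<close>

theorem kummer_relations:
  shows "\<exists>\<theta>\<in>polys_over L. \<exists>q\<in>polys_over L. \<exists>r\<in>polys_over L. Y 1 ^ m \<approx> \<theta> \<and> \<theta> * [:\<delta> ^ 2:] = q ^ 2 + \<Phi> * r \<and>
    (\<forall>\<chi>. odd \<chi> \<and> \<chi> \<le> m \<longrightarrow> (\<exists>w\<in>polys_over L. \<exists>r\<in>polys_over L.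
      (\<theta> \<circ>\<^sub>p monom 1 \<chi>) * \<theta> ^ (m - \<chi>) = w ^ m + \<Phi> * r))"
proof -
  have inv1: "map_poly t (Y 1 ^ m) \<approx> Y 1 ^ m" if t: "t \<in> T" for t
  proof -
    obtain c where c: "\<forall>j. t (X j) = X (j + c)" using X_T t by blast
    have "map_poly t (Y 1 ^ m) \<approx> (monom 1 (1 * c) * Y 1) ^ m"
      unfolding coeff_hom_power[OF coeff_hom_map_poly[OF T[OF that]]] by (intro cong_power map_Y that c)
    also have "(monom 1 (1 * c) * Y 1) ^ m = monom 1 (c * m) * Y 1 ^ m"
      by (simp add: power_mult_distrib monom_power)
    also have "monom 1 (c * m) * Y 1 ^ m \<approx> 1 * Y 1 ^ m"
      by (intro cong_mult monom_period_cong cong_refl)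
    finally show ?thesis by simp
  qed
  \<comment> \<open>Half the exponent turns the shift factor x^c into x^(c m/2), which is (-1)^c
    modulo \<open>\<Phi>\<close> and cancels the sign picked up by \<open>\<delta>\<close>.\<close>
  have inv2: "map_poly t (Y 1 ^ (m div 2) * [:\<delta>:]) \<approx> Y 1 ^ (m div 2) * [:\<delta>:]" if t: "t \<in> T" for t
  proof -
    obtain c where c: "\<forall>j. t (X j) = X (j + c)" using X_T t by blast
    note ht = coeff_hom_map_poly[OF T[OF that]]
    have "map_poly t [:\<delta>:] = [:(- 1) ^ c * \<delta>:]"
      using T_\<delta>[OF that c] coeff_hom.hom_zero[OF T[OF that]] by (simp add: map_poly_pCons)
    then have "map_poly t (Y 1 ^ (m div 2) * [:\<delta>:]) \<approx> (monom 1 (1 * c) * Y 1) ^ (m div 2) * [:(- 1) ^ c * \<delta>:]"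
      unfolding coeff_hom.hom_mult[OF ht] coeff_hom_power[OF ht]
      by (intro cong_mult cong_power map_Y that c) (simp add: cong_refl)
    also have "(monom 1 (1 * c) * Y 1) ^ (m div 2) * [:(- 1) ^ c * \<delta>:]
        = monom 1 (c * (m div 2)) * (Y 1 ^ (m div 2) * [:(- 1) ^ c * \<delta>:])"
      by (simp add: power_mult_distrib monom_power)
    also have "\<dots> \<approx> [:(- 1) ^ c:] * (Y 1 ^ (m div 2) * [:(- 1) ^ c * \<delta>:])"
      by (intro cong_mult monom_half_cong cong_refl)
    also have "[:(- 1) ^ c:] * (Y 1 ^ (m div 2) * [:(- 1) ^ c * \<delta>:]) = Y 1 ^ (m div 2) * [:\<delta>:]"
    proof -
      have "(- 1 :: 'e) ^ c * (- 1) ^ c = 1" by (simp flip: power_add mult_2)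
      then have e: "(- 1) ^ c * \<delta> * (- 1) ^ c = \<delta>" by (metis mult.assoc mult.commute mult_1)
      have "[:(- 1) ^ c:] * (P * [:(- 1) ^ c * \<delta>:]) = P * [:(- 1) ^ c * \<delta> * (- 1) ^ c:]" for P
        by simp
      then show ?thesis by (simp only: e)
    qed
    finally show ?thesis .
  qed
  \<comment> \<open>The exponent m - \<chi> is chosen so that the shift factors multiply to x^(c m),
    which is 1 modulo \<open>\<Phi>\<close>.\<close>
  have inv3: "map_poly t (Y \<chi> * Y 1 ^ (m - \<chi>)) \<approx> Y \<chi> * Y 1 ^ (m - \<chi>)" if t: "t \<in> T" "\<chi> \<le> m" for t \<chi>
  proof -
    obtain c where c: "\<forall>j. t (X j) = X (j + c)" using X_T t(1) by blast
    note ht = coeff_hom_map_poly[OF T[OF that(1)]]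
    have "map_poly t (Y \<chi> * Y 1 ^ (m - \<chi>)) \<approx> (monom 1 (\<chi> * c) * Y \<chi>) * (monom 1 (1 * c) * Y 1) ^ (m - \<chi>)"
      unfolding coeff_hom.hom_mult[OF ht] coeff_hom_power[OF ht]
      by (intro cong_mult cong_power map_Y that c)
    also have "(monom 1 (\<chi> * c) * Y \<chi>) * (monom 1 (1 * c) * Y 1) ^ (m - \<chi>)
        = monom 1 (c * m) * (Y \<chi> * Y 1 ^ (m - \<chi>))"
    proof -
      have "\<chi> * c + c * (m - \<chi>) = c * m" using that(2) by (metis add_mult_distrib2 le_add_diff_inverse mult.commute)
      then have "monom 1 (\<chi> * c) * monom 1 (c * (m - \<chi>)) = (monom 1 (c * m) :: 'e poly)"
        by (simp add: mult_monom)
      then show ?thesis by (simp add: power_mult_distrib monom_power ac_simps)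
    qed
    also have "monom 1 (c * m) * (Y \<chi> * Y 1 ^ (m - \<chi>)) \<approx> 1 * (Y \<chi> * Y 1 ^ (m - \<chi>))"
      by (intro cong_mult monom_period_cong cong_refl)
    finally show ?thesis by simp
  qed
  obtain \<theta> where \<theta>: "\<theta> \<in> polys_over L" "Y 1 ^ m \<approx> \<theta>"
    using reduce[OF B.P.power_closed[OF Y_B] inv1] by blast
  obtain q where q: "q \<in> polys_over L" "Y 1 ^ (m div 2) * [:\<delta>:] \<approx> q"
    using reduce[OF B.P.closed(4)[OF B.P.power_closed[OF Y_B] B.polys_over_closed(4)[OF \<delta>_B]] inv2] by blast
  have "\<theta> * [:\<delta> ^ 2:] \<approx> q ^ 2"
  proof -
    have "\<theta> * [:\<delta> ^ 2:] \<approx> Y 1 ^ m * [:\<delta> ^ 2:]" by (intro cong_mult cong_sym[OF \<theta>(2)] cong_refl)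
    also have "Y 1 ^ m * [:\<delta> ^ 2:] = (Y 1 ^ (m div 2) * [:\<delta>:]) ^ 2"
    proof -
      have "Y 1 ^ m = (Y 1 ^ (m div 2)) ^ 2" using half by (simp add: mult.commute flip: power_mult)
      then show ?thesis by (simp add: power_mult_distrib power2_eq_square)
    qed
    also have "(Y 1 ^ (m div 2) * [:\<delta>:]) ^ 2 \<approx> q ^ 2" by (intro cong_power q)
    finally show ?thesis .
  qed
  then obtain r where r: "r \<in> polys_over L" "\<theta> * [:\<delta> ^ 2:] = q ^ 2 + \<Phi> * r"
    using cong_over_L[of "\<theta> * [:\<delta> ^ 2:]" "q ^ 2"] \<theta>(1) q(1) L.polys_over_closed(4)[OF \<delta>_square_L] by blast
  have "\<exists>w\<in>polys_over L. \<exists>r\<in>polys_over L. (\<theta> \<circ>\<^sub>p monom 1 \<chi>) * \<theta> ^ (m - \<chi>) = w ^ m + \<Phi> * r"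
    if \<chi>: "odd \<chi>" "\<chi> \<le> m" for \<chi>
  proof -
    obtain w where w: "w \<in> polys_over L" "Y \<chi> * Y 1 ^ (m - \<chi>) \<approx> w"
      using reduce[OF B.P.closed(4)[OF Y_B B.P.power_closed[OF Y_B]] inv3[OF _ \<chi>(2)]] by blast
    have Y_comp: "Y 1 \<circ>\<^sub>p monom 1 \<chi> = Y \<chi>"
    proof -
      have "monom a k \<circ>\<^sub>p monom 1 \<chi> = monom a (\<chi> * k)" for a :: 'e and k
        by (simp add: monom_altdef pcompose_smult coeff_hom_power[OF coeff_hom_pcompose] pcompose_pCons flip: power_mult)
      then show ?thesis unfolding Y_def pcompose_sum by simp
    qed
    have \<theta>\<chi>: "\<theta> \<circ>\<^sub>p monom 1 \<chi> \<approx> Y \<chi> ^ m"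
    proof -
      obtain s where "Y 1 ^ m - \<theta> = \<Phi> * s" using \<theta>(2) unfolding cong_def by blast
      then have "Y \<chi> ^ m - \<theta> \<circ>\<^sub>p monom 1 \<chi> = (\<Phi> \<circ>\<^sub>p monom 1 \<chi>) * (s \<circ>\<^sub>p monom 1 \<chi>)"
        using Y_comp by (metis pcompose_diff pcompose_mult coeff_hom_power[OF coeff_hom_pcompose])
      moreover have "\<Phi> \<circ>\<^sub>p monom 1 \<chi> = monom 1 (\<chi> * (m div 2)) + 1"
        by (simp add: \<Phi>_def pcompose_add monom_altdef pcompose_smult coeff_hom_power[OF coeff_hom_pcompose] pcompose_pCons pcompose_1 flip: power_mult)
      ultimately show ?thesis
        using \<Phi>_dvd_pow[OF \<chi>(1)] unfolding cong_def by (metis cong_def cong_sym dvd_mult2)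
    qed
    have "(\<theta> \<circ>\<^sub>p monom 1 \<chi>) * \<theta> ^ (m - \<chi>) \<approx> Y \<chi> ^ m * (Y 1 ^ m) ^ (m - \<chi>)"
      by (intro cong_mult \<theta>\<chi> cong_power cong_sym[OF \<theta>(2)])
    also have "Y \<chi> ^ m * (Y 1 ^ m) ^ (m - \<chi>) = (Y \<chi> * Y 1 ^ (m - \<chi>)) ^ m"
      by (simp add: power_mult_distrib mult.commute flip: power_mult)
    also have "(Y \<chi> * Y 1 ^ (m - \<chi>)) ^ m \<approx> w ^ m" by (intro cong_power w)
    finally have cong: "(\<theta> \<circ>\<^sub>p monom 1 \<chi>) * \<theta> ^ (m - \<chi>) \<approx> w ^ m" .
    have "\<theta> \<circ>\<^sub>p monom 1 \<chi> \<in> polys_over L"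
      using \<theta>(1)
    proof (induction \<theta>)
      case (pCons a p)
      then have "a \<in> L" "p \<in> polys_over L"
        by (auto simp: polys_over_def coeff_pCons dest: spec[of _ 0] spec[of _ "Suc i" for i])
      then show ?case using pCons.IH unfolding pcompose_pCons
        by (intro L.P.closed(3,4) L.polys_over_closed(4) L.monom_polys_over L.closed(1)) auto
    qed auto
    then show ?thesis
      using cong_over_L[OF _ _ cong] \<theta>(1) w(1) by (meson L.P.closed(4) L.P.power_closed)
  qed
  then show ?thesis using \<theta> q r by blast
qed

end

section \<open>Lifting along a retraction\<close>

text \<open>The consequence of retract rationality that is needed: \<open>\<Psi>\<close> embeds \<open>L\<close> into a rational function
  field, and the evaluation at the \<open>L\<close>-rational point \<open>\<tau>\<close> is a left inverse of \<open>\<Psi>\<close> on \<open>S\<close>.\<close>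

definition retract_property :: "'i itself \<Rightarrow> ('k :: field \<Rightarrow> 'e :: field) \<Rightarrow> 'e set \<Rightarrow> bool" where
  "retract_property T \<iota> L \<longleftrightarrow> (\<forall>S. finite S \<and> S \<subseteq> L \<longrightarrow>
     (\<exists>(\<Psi> :: 'e \<Rightarrow> ('i, 'k) ratfun) \<tau>. range \<tau> \<subseteq> L \<and> (\<forall>c. \<Psi> (\<iota> c) = rf_const c) \<and>
       (\<forall>x\<in>L. \<forall>y\<in>L. \<Psi> (x + y) = \<Psi> x + \<Psi> y \<and> \<Psi> (x * y) = \<Psi> x * \<Psi> y) \<and>
       (\<forall>x\<in>S. has_val \<iota> \<tau> (\<Psi> x) x)))"

text \<open>This is where n >= 3 enters: m = 8 * k, and d = m - \<chi> + 1 is m/2 or m/2 + 2. The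
  equation compares multiplicities in the relation for m-th powers, where a belongs to \<theta>, b
  to the common denominator and w to the m-th root.\<close>

lemma even_valuation_sum:
  fixes a b d k w :: nat
  assumes "d * a + 8 * k * b = 8 * k * w + d * b" "d = 4 * k \<or> d = 2 * (2 * k + 1)" "k > 0"
  shows "even (a + b)"
  using assms(2)
proof
  assume "d = 4 * k"
  then have "(4 * k) * (a + 2 * b) = (4 * k) * (2 * w + b)" using assms(1) by (simp add: algebra_simps)
  then have "a + 2 * b = 2 * w + b" using assms(3) by simp
  then show ?thesis by presburger
next
  assume "d = 2 * (2 * k + 1)"
  then have "2 * ((2 * k + 1) * a + 4 * k * b) = 2 * (4 * k * w + (2 * k + 1) * b)"
    using assms(1) by (simp add: algebra_simps)
  then have "even ((2 * k + 1) * a + 4 * k * b) = even (4 * k * w + (2 * k + 1) * b)"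
    by (simp only: mult_left_cancel)
  then show ?thesis by simp
qed

context automorphisms
begin

lemma vp_map:
  assumes "\<alpha> \<in> A" "map_poly \<alpha> p = p"
  shows "vp p (map_poly \<alpha> f) = vp p f"
proof -
  obtain \<beta> where \<beta>: "\<beta> \<in> A" "\<And>p. map_poly \<beta> (map_poly \<alpha> p) = p" using map_inverse[OF assms(1)] by blast
  have "map_poly \<beta> p = p" using \<beta>(2)[of p] assms(2) by simp
  then have "p ^ k dvd map_poly \<alpha> f \<longleftrightarrow> p ^ k dvd f" for k
    using map_dvd[OF assms(1), of "p ^ k" f] map_dvd[OF \<beta>(1), of "p ^ k" "map_poly \<alpha> f"] assms \<beta>
    by (auto simp: coeff_hom_power[OF map_hom])
  then show ?thesis unfolding vp_def by simp
qed

end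

lemma (in partial_hom) map_power: "p \<in> polys_over K \<Longrightarrow> map_poly f (p ^ k) = map_poly f p ^ k"
proof (induction k)
  case 0
  then show ?case by (simp add: one_pCons map_const f_1 del: one_poly_eq_simps)
next
  case (Suc k)
  have "p ^ k \<in> polys_over K"
    using Suc.prems by (induction k) (auto simp: polys_over_def coeff_mult f_1 intro!: sum_closed)
  then show ?case using Suc by (simp add: map_mult)
qed

lemma (in partial_hom) map_pcompose_monom:
  "p \<in> polys_over K \<Longrightarrow> map_poly f (p \<circ>\<^sub>p monom 1 \<chi>) = map_poly f p \<circ>\<^sub>p monom 1 \<chi>"
proof (induction p)
  case (pCons a p)
  have ap: "a \<in> K" "p \<in> polys_over K"
    using pCons.prems by (auto simp: polys_over_def coeff_pCons dest: spec[of _ 0] spec[of _ "Suc i" for i])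
  have mono: "monom 1 \<chi> \<in> polys_over K" by (auto simp: polys_over_def)
  have const: "[:a:] \<in> polys_over K" using ap by (auto simp: polys_over_def coeff_pCons split: nat.split)
  have mult: "q * q' \<in> polys_over K" if "q \<in> polys_over K" "q' \<in> polys_over K" for q q'
    using that by (auto simp: polys_over_def coeff_mult intro!: sum_closed)
  have "p \<circ>\<^sub>p monom 1 \<chi> \<in> polys_over K"
    using ap(2)
  proof (induction p)
    case (pCons b p)
    then have "b \<in> K" "p \<in> polys_over K"
      by (auto simp: polys_over_def coeff_pCons dest: spec[of _ 0] spec[of _ "Suc i" for i])
    then show ?case
      using pCons.IH mult[OF mono, of "p \<circ>\<^sub>p monom 1 \<chi>"]
      unfolding pcompose_pCons by (auto simp: polys_over_def coeff_pCons split: nat.split)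
  qed (auto simp: polys_over_def)
  then show ?case
    unfolding pcompose_pCons
    using pCons.IH[OF ap(2)] mult mono const
    by (simp add: map_add map_mult map_const map_poly_monom f_0 f_1 map_poly_pCons pcompose_pCons)
qed simp

text \<open>The map j places L in a field that contains \<zeta>. The images of the Kummer relations
  under the embedding are restricted to a line with a k-point at parameter 0 and \<tau> at parameter
  1. They force even multiplicities at stable primes in a polynomial D that represents
  \<open>\<delta> ^ 2\<close>, so \<open>decompose\<close> applies to D; the conclusion is read off
  from D(1) * D(0).\<close>

theorem (in kummer) lift_along_path:
  fixes \<iota> :: "'k :: field_char_0 \<Rightarrow> 'e" and j :: "'e \<Rightarrow> 'f :: field" and \<zeta> :: 'f
  assumes auto: "automorphisms A Ac l" and \<iota>: "coeff_hom \<iota>" "range \<iota> \<subseteq> L" and j: "coeff_hom j"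
    and fix_L: "\<And>\<alpha> x. \<alpha> \<in> A \<Longrightarrow> x \<in> L \<Longrightarrow> \<alpha> (j x) = j x"
    and \<zeta>: "\<zeta> ^ (m div 2) = - 1"
    and A_\<zeta>: "\<And>\<alpha>. \<alpha> \<in> A \<Longrightarrow> \<alpha> \<notin> Ac \<Longrightarrow> \<alpha> \<zeta> = \<zeta> ^ (m div 2 + 1) \<or> \<alpha> \<zeta> = \<zeta> ^ (m div 2 - 1)"
    and nz: "poly (map_poly j (Y 1)) \<zeta> \<noteq> 0" "\<delta> \<noteq> 0"
    and retract: "retract_property TYPE('i) \<iota> L"
  shows "\<exists>c \<mu> \<omega>. c \<noteq> 0 \<and> j (\<delta> ^ 2) * j (\<iota> c) = \<mu> ^ 2 * (\<omega> * l \<omega>) \<and>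
    (\<forall>\<alpha>\<in>A. \<alpha> \<mu> = \<mu>) \<and> (\<forall>\<alpha>\<in>Ac. \<alpha> \<omega> = \<omega>)"
proof -
  interpret automorphisms A Ac l by (rule auto)
  obtain \<theta> q r where \<theta>: "\<theta> \<in> polys_over L" "q \<in> polys_over L" "r \<in> polys_over L" "Y 1 ^ m \<approx> \<theta>"
      "\<theta> * [:\<delta> ^ 2:] = q ^ 2 + \<Phi> * r"
    and relations: "\<forall>\<chi>. odd \<chi> \<and> \<chi> \<le> m \<longrightarrow> (\<exists>w\<in>polys_over L. \<exists>r\<in>polys_over L.
      (\<theta> \<circ>\<^sub>p monom 1 \<chi>) * \<theta> ^ (m - \<chi>) = w ^ m + \<Phi> * r)"
    using kummer_relations by (elim bexE conjE) (rule that)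
  have rel: "\<exists>w\<in>polys_over L. \<exists>r\<in>polys_over L. (\<theta> \<circ>\<^sub>p monom 1 \<chi>) * \<theta> ^ (m - \<chi>) = w ^ m + \<Phi> * r"
    if "odd \<chi>" "\<chi> \<le> m" for \<chi>
    using relations that by simp
  \<comment> \<open>The powers of \<zeta> with these exponents are -\<zeta> and -1/\<zeta>, the
    images of \<zeta> under members of A outside \<open>Ac\<close>.\<close>
  define \<chi>1 \<chi>2 where "\<chi>1 = m div 2 + 1" and "\<chi>2 = m div 2 - 1"
  obtain k where k: "m = 8 * k" 
  proof -
    have "(2 :: nat) ^ 3 dvd 2 ^ n" by (rule le_imp_power_dvd) (rule n)
    then show thesis using that m by (auto elim: dvdE)
  qed
  have \<chi>12: "odd \<chi>1" "odd \<chi>2" "\<chi>1 \<le> m" "\<chi>2 \<le> m" "Suc (m - \<chi>1) = m div 2" "Suc (m - \<chi>2) = m div 2 + 2"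
    using k m_pos by (auto simp: \<chi>1_def \<chi>2_def)
  obtain w1 r1 where w1: "w1 \<in> polys_over L" "r1 \<in> polys_over L"
      "(\<theta> \<circ>\<^sub>p monom 1 \<chi>1) * \<theta> ^ (m - \<chi>1) = w1 ^ m + \<Phi> * r1"
    using rel[OF \<chi>12(1,3)] by (elim bexE) (rule that)
  obtain w2 r2 where w2: "w2 \<in> polys_over L" "r2 \<in> polys_over L"
      "(\<theta> \<circ>\<^sub>p monom 1 \<chi>2) * \<theta> ^ (m - \<chi>2) = w2 ^ m + \<Phi> * r2"
    using rel[OF \<chi>12(2,4)] by (elim bexE) (rule that)
  \<comment> \<open>Only the coefficients that occur in the relations have to be recovered at
    \<tau>; the element 0 stands for coefficients beyond the degree.\<close>
  define S where "S = {0, \<delta> ^ 2} \<union> (\<Union>p\<in>{\<theta>, q, r, w1, r1, w2, r2}. set (coeffs p))"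
  have "finite S" by (auto simp: S_def)
  have coeff_S: "coeff p i \<in> S" if "p \<in> {\<theta>, q, r, w1, r1, w2, r2}" for p i
  proof (cases "i \<le> degree p \<and> p \<noteq> 0")
    case True
    then show ?thesis using that coeff_in_coeffs[of p i] unfolding S_def by blast
  next
    case False
    then have "coeff p i = 0" by (auto simp: coeff_eq_0)
    then show ?thesis by (simp add: S_def)
  qed
  have coeffs_L: "set (coeffs p) \<subseteq> L" if "p \<in> polys_over L" for p
    using that by (auto simp: polys_over_def coeffs_def)
  have SL: "S \<subseteq> L"
    using coeffs_L[OF \<theta>(1)] coeffs_L[OF \<theta>(2)] coeffs_L[OF \<theta>(3)] coeffs_L[OF w1(1)] coeffs_L[OF w1(2)]
      coeffs_L[OF w2(1)] coeffs_L[OF w2(2)] \<delta>_square_L L.closed(1) unfolding S_def by simp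
  obtain \<Psi> :: "'e \<Rightarrow> ('i, 'k) ratfun" and \<tau> where \<tau>: "range \<tau> \<subseteq> L" and \<Psi>_const: "\<And>c. \<Psi> (\<iota> c) = rf_const c"
    and \<Psi>_add: "\<And>x y. x \<in> L \<Longrightarrow> y \<in> L \<Longrightarrow> \<Psi> (x + y) = \<Psi> x + \<Psi> y"
    and \<Psi>_mult: "\<And>x y. x \<in> L \<Longrightarrow> y \<in> L \<Longrightarrow> \<Psi> (x * y) = \<Psi> x * \<Psi> y"
    and \<Psi>_val: "\<And>x. x \<in> S \<Longrightarrow> has_val \<iota> \<tau> (\<Psi> x) x"
  proof -
    have "\<exists>(\<Psi> :: 'e \<Rightarrow> ('i, 'k) ratfun) \<tau>. range \<tau> \<subseteq> L \<and> (\<forall>c. \<Psi> (\<iota> c) = rf_const c) \<and>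
       (\<forall>x\<in>L. \<forall>y\<in>L. \<Psi> (x + y) = \<Psi> x + \<Psi> y \<and> \<Psi> (x * y) = \<Psi> x * \<Psi> y) \<and>
       (\<forall>x\<in>S. has_val \<iota> \<tau> (\<Psi> x) x)"
      using retract \<open>finite S\<close> SL unfolding retract_property_def by simp
    then show thesis by (elim exE conjE) (rule that, auto)
  qed
  have "\<forall>x\<in>S. \<exists>PQ. snd PQ \<noteq> 0 \<and> \<Psi> x = Fract (fst PQ) (snd PQ) \<and> meval \<iota> \<tau> (snd PQ) \<noteq> 0 \<and>
      x = meval \<iota> \<tau> (fst PQ) / meval \<iota> \<tau> (snd PQ)"
    using \<Psi>_val unfolding has_val_def split_paired_Ex fst_conv snd_conv by simp
  then obtain PQ where PQ: "\<forall>x\<in>S. snd (PQ x) \<noteq> 0 \<and> \<Psi> x = Fract (fst (PQ x)) (snd (PQ x)) \<and>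
      meval \<iota> \<tau> (snd (PQ x)) \<noteq> 0 \<and> x = meval \<iota> \<tau> (fst (PQ x)) / meval \<iota> \<tau> (snd (PQ x))"
    by (rule bchoice[THEN exE])
  define P Q where "P x = fst (PQ x)" and "Q x = snd (PQ x)" for x
  have Q: "Q x \<noteq> 0" "\<Psi> x = Fract (P x) (Q x)" "meval \<iota> \<tau> (Q x) \<noteq> 0"
      "meval \<iota> \<tau> (P x) = x * meval \<iota> \<tau> (Q x)" if "x \<in> S" for x
    using bspec[OF PQ that] by (auto simp: P_def Q_def eq_divide_eq)
  let ?d = "\<delta> ^ 2"
  have dS: "?d \<in> S" "0 \<in> S" and d0: "?d \<noteq> 0" using nz(2) by (auto simp: S_def)
  have Pd: "P ?d \<noteq> 0"
    using Q(3,4)[OF dS(1)] d0 coeff_hom.hom_zero[OF coeff_hom_meval[OF \<iota>(1), of \<tau>]] by auto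
  \<comment> \<open>The k-point avoids the zeros of all denominators and of the numerator of
    \<open>\<delta> ^ 2\<close>, so the values at parameter 0 are defined and the factor in k is
    nonzero.\<close>
  have "P ?d * (\<Prod>x\<in>S. Q x) \<noteq> 0" using Pd Q(1) \<open>finite S\<close> by simp
  then obtain u :: "'i \<Rightarrow> nat" where u: "meval (\<lambda>c. c) (\<lambda>i. of_nat (u i)) (P ?d * (\<Prod>x\<in>S. Q x)) \<noteq> (0 :: 'k)"
    using mpoly_nonroot_nat[OF coeff_hom_id, of "P ?d * (\<Prod>x\<in>S. Q x)"] by blast
  let ?u = "meval (\<lambda>c :: 'k. c) (\<lambda>i. of_nat (u i))"
  have hu: "coeff_hom ?u" by (intro coeff_hom_meval coeff_hom_id)

  \<comment> \<open>The line from the rational point \<open>u\<close> to the point \<open>\<tau>\<close>.\<close>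
  define hp :: "'k \<Rightarrow> 'f poly" where "hp c = [:j (\<iota> c):]" for c
  define path :: "'i \<Rightarrow> 'f poly" where "path i = [:j (\<iota> (of_nat (u i))), j (\<tau> i - \<iota> (of_nat (u i))):]" for i
  define \<pi> where "\<pi> = meval hp path"
  have ji: "coeff_hom (j \<circ> \<iota>)" by (intro coeff_hom_comp j \<iota>)
  have hp: "coeff_hom hp"
    using coeff_hom_comp[OF coeff_hom_const_poly ji] by (simp add: hp_def[abs_def] comp_def)
  have \<pi>: "coeff_hom \<pi>" unfolding \<pi>_def by (intro coeff_hom_meval hp)
  have \<pi>1: "poly (\<pi> p) 1 = j (meval \<iota> \<tau> p)" for p
  proof -
    have "poly (\<pi> p) 1 = meval (j \<circ> \<iota>) (j \<circ> \<tau>) p"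
      unfolding \<pi>_def meval_hom[OF coeff_hom_poly]
      by (simp add: comp_def hp_def[abs_def] path_def[abs_def] coeff_hom_diff[OF j])
    then show ?thesis by (simp add: meval_hom[OF j])
  qed
  have \<pi>0: "poly (\<pi> p) 0 = j (\<iota> (?u p))" for p
  proof -
    have "poly (\<pi> p) 0 = meval ((j \<circ> \<iota>) \<circ> (\<lambda>c. c)) ((j \<circ> \<iota>) \<circ> (\<lambda>i. of_nat (u i))) p"
      unfolding \<pi>_def meval_hom[OF coeff_hom_poly]
      by (simp add: comp_def hp_def[abs_def] path_def[abs_def])
    then show ?thesis by (simp only: meval_hom[OF ji, symmetric]) simp
  qed
  have \<tau>L: "\<tau> i \<in> L" "\<iota> c \<in> L" for i c using \<tau> \<iota> by auto
  \<comment> \<open>The line has coefficients in the image of L, which A fixes.\<close>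
  have \<pi>_fixed: "map_poly \<alpha> (\<pi> p) = \<pi> p" if \<alpha>: "\<alpha> \<in> A" for \<alpha> p
  proof -
    have "map_poly \<alpha> (hp c) = hp c" for c
      using fix_L[OF \<alpha> \<tau>L(2)] coeff_hom.hom_zero[OF hom[OF \<alpha>]] by (simp add: hp_def map_poly_pCons)
    moreover have "map_poly \<alpha> (path i) = path i" for i
      using fix_L[OF \<alpha>] \<tau>L coeff_hom.hom_zero[OF hom[OF \<alpha>]] L.diff_closed
      by (simp add: path_def map_poly_pCons)
    ultimately show ?thesis
      unfolding \<pi>_def meval_hom[OF map_hom[OF \<alpha>]] by (simp add: comp_def)
  qed
  have \<pi>Q: "poly (\<pi> (Q x)) 1 \<noteq> 0" "poly (\<pi> (Q x)) 0 \<noteq> 0" "\<pi> (Q x) \<noteq> 0" if "x \<in> S" for x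
  proof -
    show 1: "poly (\<pi> (Q x)) 1 \<noteq> 0" using Q(3)[OF that] by (simp add: \<pi>1 coeff_hom_eq_0_iff[OF j])
    then show "\<pi> (Q x) \<noteq> 0" by auto
    have "?u (Q x) \<noteq> 0"
      using u that \<open>finite S\<close> by (simp add: coeff_hom.hom_mult[OF hu] coeff_hom_prod[OF hu])
    then show "poly (\<pi> (Q x)) 0 \<noteq> 0" using coeff_hom_eq_0_iff[OF ji] by (simp add: \<pi>0)
  qed

  let ?h = "to_fract \<circ> hp" and ?p = "to_fract \<circ> path"
  have hh: "coeff_hom ?h" by (intro coeff_hom_comp coeff_hom_to_fract hp)
  \<comment> \<open>The elements of L whose images are defined at the generic point of the line;
    \<open>V\<close> is their restriction to the line.\<close>
  define \<Lambda> where "\<Lambda> = {x \<in> L. \<exists>c. has_val ?h ?p (\<Psi> x) c}"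
  define V where "V x = rf_eval ?h ?p (\<Psi> x)" for x
  have V: "V x = c" if "has_val ?h ?p (\<Psi> x) c" for x c
    unfolding V_def by (rule rf_eval_eq[OF hh that])
  have V_val: "has_val ?h ?p (\<Psi> x) (V x)" if "x \<in> \<Lambda>" for x
    using that V unfolding \<Lambda>_def by auto
  have \<Psi>_1: "\<Psi> 1 = 1"
    using \<Psi>_const[of 1] coeff_hom.hom_one[OF \<iota>(1)] coeff_hom.hom_one[OF coeff_hom_rf_const] by simp
  have \<Psi>_minus: "\<Psi> (- x) = - \<Psi> x" if "x \<in> L" for x
  proof -
    have "\<Psi> (- x) = \<Psi> (\<iota> (- 1) * x)"
      by (simp add: coeff_hom_minus[OF \<iota>(1)] coeff_hom.hom_one[OF \<iota>(1)])
    also have "\<dots> = - \<Psi> x"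
      using \<Psi>_mult[OF \<tau>L(2) that, of "- 1"] \<Psi>_const[of "- 1"]
      by (simp add: coeff_hom_minus[OF coeff_hom_rf_const] coeff_hom.hom_one[OF coeff_hom_rf_const])
    finally show ?thesis .
  qed
  interpret V: partial_hom \<Lambda> V
  proof
    show "subdomain \<Lambda>"
      unfolding subdomain_def
    proof (intro conjI ballI)
      show "1 \<in> \<Lambda>" unfolding \<Lambda>_def using has_val_1[OF hh] \<Psi>_1 by auto
      fix a b assume ab: "a \<in> \<Lambda>" "b \<in> \<Lambda>"
      then have L: "a \<in> L" "b \<in> L" by (auto simp: \<Lambda>_def)
      show "a + b \<in> \<Lambda>"
        using has_val_add[OF hh V_val[OF ab(1)] V_val[OF ab(2)]] L by (auto simp: \<Lambda>_def \<Psi>_add)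
      show "a * b \<in> \<Lambda>"
        using has_val_mult[OF hh V_val[OF ab(1)] V_val[OF ab(2)]] L by (auto simp: \<Lambda>_def \<Psi>_mult)
      show "- a \<in> \<Lambda>"
        using has_val_minus[OF hh V_val[OF ab(1)]] L by (auto simp: \<Lambda>_def \<Psi>_minus)
    qed
    show "V 1 = 1" using V[of 1 1] has_val_1[OF hh, of ?p] \<Psi>_1 by simp
    fix x y assume xy: "x \<in> \<Lambda>" "y \<in> \<Lambda>"
    then have L: "x \<in> L" "y \<in> L" by (auto simp: \<Lambda>_def)
    show "V (x + y) = V x + V y"
      using has_val_add[OF hh V_val[OF xy(1)] V_val[OF xy(2)]] V by (simp add: \<Psi>_add[OF L])
    show "V (x * y) = V x * V y"
      using has_val_mult[OF hh V_val[OF xy(1)] V_val[OF xy(2)]] V by (simp add: \<Psi>_mult[OF L])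
  qed
  have val_S: "has_val ?h ?p (\<Psi> x) (to_fract (\<pi> (P x)) / to_fract (\<pi> (Q x)))" if "x \<in> S" for x
    unfolding Q(2)[OF that]
    using \<pi>Q(3)[OF that] unfolding \<pi>_def by (intro has_val_Fract[OF hh]) (simp_all flip: meval_hom[OF coeff_hom_to_fract])
  have S\<Lambda>: "S \<subseteq> \<Lambda>" using val_S SL unfolding \<Lambda>_def by blast
  have over: "p \<in> polys_over \<Lambda>" if "p \<in> {\<theta>, q, r, w1, r1, w2, r2}" for p
    using coeff_S[OF that] S\<Lambda> unfolding polys_over_def by blast
  define Z where "Z = to_fract [:\<zeta>:]"
  define ev where "ev p = poly (map_poly V p) Z" for p
  have Vmono: "map_poly V (monom 1 k) = monom 1 k" for k
    by (simp add: map_poly_monom V.f_0 V.f_1)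
  have over_mult: "p * p' \<in> polys_over \<Lambda>" if "p \<in> polys_over \<Lambda>" "p' \<in> polys_over \<Lambda>" for p p'
    using that by (auto simp: polys_over_def coeff_mult intro!: V.sum_closed)
  have over_1: "1 \<in> polys_over \<Lambda>" by (auto simp: polys_over_def)
  have over_pow: "p ^ k \<in> polys_over \<Lambda>" if "p \<in> polys_over \<Lambda>" for p k
    using that over_1 by (induction k) (auto intro: over_mult)
  have over_mono: "monom 1 k \<in> polys_over \<Lambda>" for k by (auto simp: polys_over_def)
  have over_\<Phi>: "\<Phi> \<in> polys_over \<Lambda>"
    unfolding \<Phi>_def using over_mono over_1 by (auto simp: polys_over_def)
  have Z_half: "Z ^ (m div 2) = - 1"
  proof -
    have "[:\<zeta>:] ^ k = [:\<zeta> ^ k:]" for k by (induction k) (auto simp: one_pCons)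
    moreover have "to_fract (1 :: 'f poly) = 1" by (rule coeff_hom.hom_one[OF coeff_hom_to_fract])
    moreover have "to_fract (- 1 :: 'f poly) = - to_fract 1" by (rule coeff_hom_minus[OF coeff_hom_to_fract])
    moreover have "[:- 1:] = (- 1 :: 'f poly)" by (simp add: one_pCons)
    ultimately show ?thesis
      unfolding Z_def by (simp add: \<zeta> flip: coeff_hom_power[OF coeff_hom_to_fract])
  qed
  have ev_\<Phi>: "ev \<Phi> = 0"
  proof -
    have "map_poly V \<Phi> = monom 1 (m div 2) + 1"
      unfolding \<Phi>_def using V.map_add[OF over_mono over_1] Vmono V.map_const[of 1]
      by (simp add: V.f_1 one_pCons del: one_poly_eq_simps)
    then show ?thesis by (simp add: ev_def poly_monom Z_half)
  qed
  have ev_mult: "ev (p * p') = ev p * ev p'" if "p \<in> polys_over \<Lambda>" "p' \<in> polys_over \<Lambda>" for p p'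
    using V.map_mult[OF that] by (simp add: ev_def)
  have ev_pow: "ev (p ^ k) = ev p ^ k" if "p \<in> polys_over \<Lambda>" for p k
    using V.map_power[OF that] by (simp add: ev_def)
  have ev_cong: "ev (p + \<Phi> * p') = ev p" if "p \<in> polys_over \<Lambda>" "p' \<in> polys_over \<Lambda>" for p p'
    using V.map_add[OF that(1) over_mult[OF over_\<Phi> that(2)]] ev_mult[OF over_\<Phi> that(2)] ev_\<Phi> by (simp add: ev_def)

  \<comment> \<open>A common denominator on the line; g x is the numerator of \<open>V x\<close>
    over it.\<close>
  define h where "h = (\<Prod>x\<in>S. \<pi> (Q x))"
  define g where "g x = \<pi> (P x) * (\<Prod>y\<in>S - {x}. \<pi> (Q y))" for x
  have h_split: "h = \<pi> (Q x) * (\<Prod>y\<in>S - {x}. \<pi> (Q y))" if "x \<in> S" for x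
    unfolding h_def using that \<open>finite S\<close> by (rule prod.remove[rotated])
  have h1: "poly h 1 \<noteq> 0" and h0: "h \<noteq> 0" using \<pi>Q \<open>finite S\<close> by (auto simp: h_def poly_prod)
  have Vg: "V x * to_fract h = to_fract (g x)" if "x \<in> S" for x
    using V[OF val_S[OF that]] \<pi>Q(3)[OF that]
    unfolding h_split[OF that] g_def by (simp add: field_simps)
  have g1: "poly (g x) 1 = j x * poly h 1" if "x \<in> S" for x
    unfolding h_split[OF that] g_def using Q(4)[OF that] by (simp add: \<pi>1 coeff_hom.hom_mult[OF j])
  have h_fixed: "map_poly \<alpha> h = h" if "\<alpha> \<in> A" for \<alpha>
    unfolding h_def by (simp add: coeff_hom_prod[OF map_hom[OF that]] \<pi>_fixed[OF that])
  have g_fixed: "map_poly \<alpha> (g x) = g x" if "\<alpha> \<in> A" for \<alpha> x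
    unfolding g_def
    by (simp add: coeff_hom_prod[OF map_hom[OF that]] coeff_hom.hom_mult[OF map_hom[OF that]] \<pi>_fixed[OF that])
  \<comment> \<open>The value at \<xi> of p with coefficients restricted to the line, cleared of the
    denominator h.\<close>
  define N where "N p \<xi> = (\<Sum>i\<le>degree p. smult (\<xi> ^ i) (g (coeff p i)))" for p \<xi>
  have N: "poly (map_poly V p) (to_fract [:\<xi>:]) * to_fract h = to_fract (N p \<xi>)"
    if p: "p \<in> {\<theta>, q, r, w1, r1, w2, r2}" for p \<xi>
  proof -
    have pow: "to_fract [:\<xi>:] ^ i = to_fract [:\<xi> ^ i:]" for i
    proof -
      have "[:\<xi>:] ^ i = [:\<xi> ^ i:]" by (induction i) (auto simp: one_pCons)
      then show ?thesis by (simp flip: coeff_hom_power[OF coeff_hom_to_fract])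
    qed
    have "poly (map_poly V p) (to_fract [:\<xi>:]) = (\<Sum>i\<le>degree p. V (coeff p i) * to_fract [:\<xi>:] ^ i)"
    proof -
      have "degree (map_poly V p) \<le> degree p" by (rule map_poly_degree_leq)
      then show ?thesis
        unfolding poly_altdef
        by (intro sum.mono_neutral_cong_left) (auto simp: coeff_map_poly V.f_0 intro!: le_degree)
    qed
    then have "poly (map_poly V p) (to_fract [:\<xi>:]) * to_fract h
        = (\<Sum>i\<le>degree p. (V (coeff p i) * to_fract h) * to_fract [:\<xi> ^ i:])"
      by (simp add: sum_distrib_left pow mult_ac)
    also have "\<dots> = (\<Sum>i\<le>degree p. to_fract (smult (\<xi> ^ i) (g (coeff p i))))"
      unfolding Vg[OF coeff_S[OF p]] by (intro sum.cong refl) (simp add: mult.commute flip: to_fract_mult)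
    finally show ?thesis by (simp add: N_def coeff_hom_sum[OF coeff_hom_to_fract])
  qed
  have N_map: "map_poly \<alpha> (N p \<xi>) = N p (\<alpha> \<xi>)" if "\<alpha> \<in> A" for \<alpha> p \<xi>
    unfolding N_def
    by (simp add: coeff_hom_sum[OF map_hom[OF that]] map_smult[OF that] g_fixed[OF that] coeff_hom_power[OF hom[OF that]])
  let ?\<Theta> = "N \<theta> \<zeta>"
  have inj: "x = y" if "to_fract x = to_fract y" for x y :: "'f poly" using that by simp
  have rel0: "?\<Theta> * g ?d = N q \<zeta> ^ 2"
  proof (rule inj)
    have d_over: "[:?d:] \<in> polys_over \<Lambda>"
      using dS S\<Lambda> by (auto simp: polys_over_def coeff_pCons split: nat.split)
    have "ev \<theta> * V ?d = ev q ^ 2"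
      using arg_cong[OF \<theta>(5), of ev] ev_mult[OF over d_over, of \<theta>] ev_cong[OF over_pow[OF over] over, of q r] ev_pow[OF over, of q]
      by (simp add: ev_def V.map_const)
    then have "(ev \<theta> * to_fract h) * (V ?d * to_fract h) = (ev q * to_fract h) ^ 2"
      by (simp add: power_mult_distrib power2_eq_square ac_simps)
    then show "to_fract (?\<Theta> * g ?d) = to_fract (N q \<zeta> ^ 2)"
      unfolding ev_def Z_def using N[of \<theta> \<zeta>] N[of q \<zeta>] Vg[OF dS(1)]
      by (simp add: coeff_hom_power[OF coeff_hom_to_fract])
  qed
  \<comment> \<open>The powers of h balance the two sides: m - \<chi> + 1 denominators are cleared
    in the factors on the left and m on the right.\<close>
  have rel_\<chi>: "N \<theta> (\<zeta> ^ \<chi>) * ?\<Theta> ^ (m - \<chi>) * h ^ m = N w \<zeta> ^ m * h ^ Suc (m - \<chi>)"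
    if w: "(\<theta> \<circ>\<^sub>p monom 1 \<chi>) * \<theta> ^ (m - \<chi>) = w ^ m + \<Phi> * r'" "w \<in> {\<theta>, q, r, w1, r1, w2, r2}"
      "r' \<in> {\<theta>, q, r, w1, r1, w2, r2}" for \<chi> w r'
  proof (rule inj)
    have Z\<chi>: "Z ^ \<chi> = to_fract [:\<zeta> ^ \<chi>:]"
    proof -
      have "[:\<zeta>:] ^ k = [:\<zeta> ^ k:]" for k by (induction k) (auto simp: one_pCons)
      then show ?thesis by (simp add: Z_def flip: coeff_hom_power[OF coeff_hom_to_fract])
    qed
    have "poly (map_poly V (\<theta> \<circ>\<^sub>p monom 1 \<chi>)) Z = poly (map_poly V \<theta>) (Z ^ \<chi>)"
      using V.map_pcompose_monom[OF over, of \<theta> \<chi>] by (simp add: poly_pcompose poly_monom)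
    moreover have "map_poly V ((\<theta> \<circ>\<^sub>p monom 1 \<chi>) * \<theta> ^ (m - \<chi>)) = map_poly V (\<theta> \<circ>\<^sub>p monom 1 \<chi>) * map_poly V \<theta> ^ (m - \<chi>)"
    proof -
      have "\<theta> \<circ>\<^sub>p monom 1 \<chi> \<in> polys_over \<Lambda>"
        using over[of \<theta>] unfolding polys_over_def
        by (auto intro!: coeff_pcompose_semiring_closed)
      then show ?thesis using V.map_mult[OF _ over_pow[OF over], of _ \<theta>] V.map_power[OF over, of \<theta>] by simp
    qed
    ultimately have "poly (map_poly V \<theta>) (Z ^ \<chi>) * ev \<theta> ^ (m - \<chi>) = ev w ^ m"
      using arg_cong[OF w(1), of ev] ev_cong[OF over_pow[OF over[OF w(2)]] over[OF w(3)], of m] ev_pow[OF over[OF w(2)], of m]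
      by (simp add: ev_def)
    then have "(poly (map_poly V \<theta>) (Z ^ \<chi>) * to_fract h) * (ev \<theta> * to_fract h) ^ (m - \<chi>) * to_fract h ^ m
        = (ev w * to_fract h) ^ m * to_fract h ^ Suc (m - \<chi>)"
      by (simp add: power_mult_distrib)
    then show "to_fract (N \<theta> (\<zeta> ^ \<chi>) * ?\<Theta> ^ (m - \<chi>) * h ^ m) = to_fract (N w \<zeta> ^ m * h ^ Suc (m - \<chi>))"
      unfolding Z\<chi> unfolding ev_def Z_def using N[of \<theta> \<zeta>] N[OF w(2), of \<zeta>] N[of \<theta> "\<zeta> ^ \<chi>"]
      by (simp only: to_fract_mult coeff_hom_power[OF coeff_hom_to_fract] insert_iff simp_thms)
  qed
  have N1: "poly (N p \<zeta>) 1 = poly (map_poly j p) \<zeta> * poly h 1" if "p \<in> {\<theta>, q, r, w1, r1, w2, r2}" for p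
  proof -
    have "degree (map_poly j p) = degree p" using coeff_hom_eq_0_iff[OF j] by (intro degree_map_poly) auto
    then show ?thesis
      unfolding poly_altdef[of "map_poly j p"]
      by (simp add: N_def poly_sum g1[OF coeff_S[OF that]] coeff_map_poly coeff_hom.hom_zero[OF j]
          sum_distrib_left mult_ac del: insert_iff)
  qed
  \<comment> \<open>Up to the factor h(1), this is the value of \<open>N \<theta> \<zeta>\<close> at
    parameter 1; the resolvent being nonzero, the polynomial cannot vanish.\<close>
  have "poly (map_poly j \<theta>) \<zeta> = poly (map_poly j (Y 1)) \<zeta> ^ m"
  proof -
    obtain s where s: "Y 1 ^ m - \<theta> = \<Phi> * s" using \<theta>(4) unfolding cong_def dvd_def by auto
    note hj = coeff_hom_map_poly[OF j]
    have "map_poly j (Y 1) ^ m - map_poly j \<theta> = map_poly j \<Phi> * map_poly j s"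
      using arg_cong[OF s, of "map_poly j"]
      by (simp add: coeff_hom_diff[OF hj] coeff_hom_power[OF hj] coeff_hom.hom_mult[OF hj])
    moreover have "poly (map_poly j \<Phi>) \<zeta> = 0"
      unfolding \<Phi>_def coeff_hom.hom_add[OF hj]
      by (simp add: map_poly_monom coeff_hom.hom_zero[OF j] coeff_hom.hom_one[OF j] coeff_hom.hom_one[OF hj] poly_monom \<zeta>)
    ultimately have "poly (map_poly j (Y 1) ^ m - map_poly j \<theta>) \<zeta> = 0" by simp
    then show ?thesis by simp
  qed
  then have "poly ?\<Theta> 1 \<noteq> 0" using N1[of \<theta>] nz(1) h1 by simp
  then have \<Theta>0: "?\<Theta> \<noteq> 0" by auto
  have gd1: "poly (g ?d) 1 = j ?d * poly h 1" by (rule g1[OF dS(1)])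
  then have "poly (g ?d) 1 \<noteq> 0" using h1 d0 coeff_hom_eq_0_iff[OF j, of ?d] by simp
  then have gd0: "g ?d \<noteq> 0" by auto
  have Nq0: "N q \<zeta> \<noteq> 0" using rel0 \<Theta>0 gd0 by auto
  \<comment> \<open>Since g x = V x * h in the field of fractions, D is the restriction of
    \<open>\<delta> ^ 2\<close> to the line times the square of h.\<close>
  define D where "D = g ?d * h"
  have even: "even (vp p D)" if p: "irreducible p" "\<alpha> \<in> A" "\<alpha> \<notin> Ac" "map_poly \<alpha> p = p" for p \<alpha>
  proof -
    obtain \<chi> w r' where \<chi>: "\<alpha> \<zeta> = \<zeta> ^ \<chi>" "\<chi> \<in> {\<chi>1, \<chi>2}"
        "(\<theta> \<circ>\<^sub>p monom 1 \<chi>) * \<theta> ^ (m - \<chi>) = w ^ m + \<Phi> * r'" "w \<in> {\<theta>, q, r, w1, r1, w2, r2}"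
        "r' \<in> {\<theta>, q, r, w1, r1, w2, r2}"
    proof -
      from A_\<zeta>[OF p(2,3)] consider "\<alpha> \<zeta> = \<zeta> ^ \<chi>1" | "\<alpha> \<zeta> = \<zeta> ^ \<chi>2"
        unfolding \<chi>1_def \<chi>2_def by blast
      then show thesis
      proof cases
        case 1
        show thesis by (rule that[OF 1 _ w1(3)]) auto
      next
        case 2
        show thesis by (rule that[OF 2 _ w2(3)]) auto
      qed
    qed
    have eq: "map_poly \<alpha> ?\<Theta> * ?\<Theta> ^ (m - \<chi>) * h ^ m = N w \<zeta> ^ m * h ^ Suc (m - \<chi>)"
      using rel_\<chi>[OF \<chi>(3-5)] N_map[OF p(2)] \<chi>(1) by simp
    have \<alpha>\<Theta>0: "map_poly \<alpha> ?\<Theta> \<noteq> 0"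
      using \<Theta>0 map_lead[OF p(2), of ?\<Theta>] coeff_hom_eq_0_iff[OF hom[OF p(2)]] by auto
    then have "N w \<zeta> ^ m * h ^ Suc (m - \<chi>) \<noteq> 0" using \<Theta>0 h0 unfolding eq[symmetric] by simp
    then have w0: "N w \<zeta> \<noteq> 0" using m_pos by (auto simp: power_0_left)
    have "vp p (map_poly \<alpha> ?\<Theta> * ?\<Theta> ^ (m - \<chi>) * h ^ m) = Suc (m - \<chi>) * vp p ?\<Theta> + m * vp p h"
      using \<Theta>0 \<alpha>\<Theta>0 h0 vp_map[OF p(2,4)] by (simp add: vp_mult[OF p(1)] vp_power[OF p(1)])
    moreover have "vp p (N w \<zeta> ^ m * h ^ Suc (m - \<chi>)) = m * vp p (N w \<zeta>) + Suc (m - \<chi>) * vp p h"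
      using w0 h0 by (simp add: vp_mult[OF p(1)] vp_power[OF p(1)] del: power_Suc)
    ultimately have val: "Suc (m - \<chi>) * vp p ?\<Theta> + m * vp p h = m * vp p (N w \<zeta>) + Suc (m - \<chi>) * vp p h"
      using eq by simp
    have "Suc (m - \<chi>) = 4 * k \<or> Suc (m - \<chi>) = 2 * (2 * k + 1)"
      using \<chi>(2) \<chi>12(5,6) k by auto
    then have "even (vp p ?\<Theta> + vp p h)"
      using val m_pos unfolding k by (intro even_valuation_sum[of "Suc (8 * k - \<chi>)" _ k]) simp_all
    moreover have "vp p ?\<Theta> + vp p (g ?d) = 2 * vp p (N q \<zeta>)"
      using arg_cong[OF rel0, of "vp p"] \<Theta>0 gd0 Nq0 by (simp add: vp_mult[OF p(1)] vp_power[OF p(1)])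
    then have "even (vp p ?\<Theta> + vp p (g ?d))" by simp
    ultimately show ?thesis
      unfolding D_def vp_mult[OF p(1) gd0 h0] by presburger
  qed
  have "D \<noteq> 0" using gd0 h0 by (simp add: D_def)
  moreover have "map_poly \<alpha> D = D" if "\<alpha> \<in> A" for \<alpha>
    unfolding D_def by (simp add: coeff_hom.hom_mult[OF map_hom[OF that]] g_fixed[OF that] h_fixed[OF that])
  ultimately obtain c W Z' where dec: "D = smult c (W ^ 2 * (Z' * map_poly l Z'))"
      "\<forall>\<alpha>\<in>A. \<alpha> c = c \<and> map_poly \<alpha> W = W" "\<forall>\<alpha>\<in>Ac. map_poly \<alpha> Z' = Z'"
    using decompose[of D] even by metis
  \<comment> \<open>The values of both factors of D at parameter 0, computed in k.\<close>
  define a b where "a = ?u (P ?d * (\<Prod>x\<in>S - {?d}. Q x))" and "b = ?u (\<Prod>x\<in>S. Q x)"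
  have ab: "poly (g ?d) 0 = j (\<iota> a)" "poly h 0 = j (\<iota> b)"
    unfolding g_def h_def a_def b_def
    by (simp_all add: \<pi>0 poly_prod coeff_hom.hom_mult[OF hu] coeff_hom_prod[OF hu]
        coeff_hom.hom_mult[OF \<iota>(1)] coeff_hom_prod[OF \<iota>(1)] coeff_hom.hom_mult[OF j] coeff_hom_prod[OF j])
  have "a * b \<noteq> 0"
    using u \<open>finite S\<close> unfolding a_def b_def
    by (auto simp: coeff_hom.hom_mult[OF hu] coeff_hom_prod[OF hu])
  \<comment> \<open>In D(1) * D(0) the constant of the decomposition appears squared and is absorbed
    by \<mu>. As 0 and 1 are fixed by l, evaluation at them commutes with l.\<close>
  moreover have "j ?d * j (\<iota> (a * b)) = (c * poly W 1 * poly W 0 / poly h 1) ^ 2 *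
      ((poly Z' 1 * poly Z' 0) * l (poly Z' 1 * poly Z' 0))"
  proof -
    note hl = hom[OF l(1)]
    have ev_l: "poly (map_poly l Z') (of_nat k) = l (poly Z' (of_nat k))" for k
      using coeff_hom_poly_map[OF hl, of Z' "of_nat k"] by (simp add: coeff_hom_of_nat[OF hl])
    have "poly D 1 * poly D 0 = (j ?d * poly h 1 * poly h 1) * (j (\<iota> a) * j (\<iota> b))"
      unfolding D_def poly_mult gd1 ab by simp
    also have "\<dots> = j ?d * j (\<iota> (a * b)) * poly h 1 ^ 2"
      by (simp add: coeff_hom.hom_mult[OF \<iota>(1)] coeff_hom.hom_mult[OF j] power2_eq_square)
    finally have "j ?d * j (\<iota> (a * b)) * poly h 1 ^ 2 = poly D 1 * poly D 0" by simp
    also have "\<dots> = (c * poly W 1 * poly W 0) ^ 2 * ((poly Z' 1 * poly Z' 0) * l (poly Z' 1 * poly Z' 0))"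
      unfolding dec(1) using ev_l[of 1] ev_l[of 0]
      by (simp add: coeff_hom.hom_mult[OF hl] power2_eq_square)
    finally show ?thesis using h1 by (simp add: power_divide field_simps)
  qed
  moreover have fixed: "\<alpha> (poly p 1) = poly p 1" "\<alpha> (poly p 0) = poly p 0" if "\<alpha> \<in> A" "map_poly \<alpha> p = p" for \<alpha> p
    using coeff_hom_poly_map[OF hom[OF that(1)], of p] that(2) coeff_hom.hom_one[OF hom[OF that(1)]]
      coeff_hom.hom_zero[OF hom[OF that(1)]] by metis+
  have "\<alpha> (c * poly W 1 * poly W 0 / poly h 1) = c * poly W 1 * poly W 0 / poly h 1" if "\<alpha> \<in> A" for \<alpha>
    using dec(2) that fixed[OF that, of W] fixed[OF that h_fixed[OF that]]
    by (simp add: coeff_hom.hom_mult[OF hom[OF that]] coeff_hom_divide[OF hom[OF that]])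
  moreover have "\<alpha> (poly Z' 1 * poly Z' 0) = poly Z' 1 * poly Z' 0" if "\<alpha> \<in> Ac" for \<alpha>
  proof -
    have "\<alpha> \<in> A" using that Ac_subset by blast
    then show ?thesis
      using dec(3) that fixed[of \<alpha> Z'] by (simp add: coeff_hom.hom_mult[OF hom])
  qed
  ultimately show ?thesis by blast
qed

section \<open>The Noether field of a group with a cyclic quotient\<close>

lemma ratfun_hom_eq:
  fixes f g :: "('i, 'a :: field) ratfun \<Rightarrow> 'b :: field"
  assumes fg: "coeff_hom f" "coeff_hom g"
    and const: "\<And>c. f (rf_const c) = g (rf_const c)" and var: "\<And>i. f (rf_var i) = g (rf_var i)"
  shows "f x = g x"
proof -
  have poly: "f (to_fract p) = g (to_fract p)" for p
  proof -
    have "p \<in> vars_in UNIV" by simp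
    then show ?thesis
    proof (induction rule: vars_in_induct)
      case (const c)
      show ?case using assms(3)[of c] by (simp add: rf_const_def)
    next
      case (var i)
      show ?case using assms(4)[of i] by (simp add: rf_var_def)
    qed (simp_all add: coeff_hom.hom_add[OF fg(1)] coeff_hom.hom_add[OF fg(2)]
        coeff_hom.hom_mult[OF fg(1)] coeff_hom.hom_mult[OF fg(2)])
  qed
  obtain p q where "q \<noteq> 0" "x = Fract p q" by (cases x) auto
  then have "x = to_fract p / to_fract q" by (simp add: to_fract_def divide_fract)
  then show ?thesis by (simp add: coeff_hom_divide[OF fg(1)] coeff_hom_divide[OF fg(2)] poly)
qed

lemma rf_map_rf_map:
  assumes "coeff_hom a" "coeff_hom b" "bij \<pi>" "bij \<rho>"
  shows "rf_map a \<pi> (rf_map b \<rho> x) = rf_map (a \<circ> b) (\<pi> \<circ> \<rho>) x"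
proof -
  have "coeff_hom (rf_map a \<pi> \<circ> rf_map b \<rho>)" by (intro coeff_hom_comp coeff_hom_rf_map assms)
  moreover have "coeff_hom (rf_map (a \<circ> b) (\<pi> \<circ> \<rho>))"
    by (intro coeff_hom_rf_map coeff_hom_comp bij_comp assms)
  ultimately have "(rf_map a \<pi> \<circ> rf_map b \<rho>) x = rf_map (a \<circ> b) (\<pi> \<circ> \<rho>) x"
    by (rule ratfun_hom_eq)
      (simp_all add: rf_map_const rf_map_var assms coeff_hom_comp bij_comp)
  then show ?thesis by simp
qed

lemma bij_self: "bij (\<lambda>i. i)"
  by (simp add: bij_def)

lemma rf_map_id: "rf_map (\<lambda>c. c) (\<lambda>i. i) x = x"
  by (rule ratfun_hom_eq[OF coeff_hom_rf_map[OF coeff_hom_id bij_self] coeff_hom_id])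
    (simp_all add: rf_map_const rf_map_var coeff_hom_id bij_self)

lemma bij_rf_map:
  assumes "coeff_hom a" "bij a" "bij \<pi>"
  shows "bij (rf_map a \<pi>)"
proof (rule o_bij)
  note a' = coeff_hom_inv_into[OF assms(1,2)] and \<pi>' = bij_imp_bij_inv[OF assms(3)]
  have c: "inv_into UNIV a \<circ> a = (\<lambda>c. c)" "a \<circ> inv_into UNIV a = (\<lambda>c. c)"
      "inv_into UNIV \<pi> \<circ> \<pi> = (\<lambda>c. c)" "\<pi> \<circ> inv_into UNIV \<pi> = (\<lambda>c. c)"
    using assms(2,3) by (auto simp: bij_is_inj bij_is_surj surj_f_inv_f fun_eq_iff)
  show "rf_map (inv_into UNIV a) (inv_into UNIV \<pi>) \<circ> rf_map a \<pi> = id"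
    by (simp add: fun_eq_iff rf_map_rf_map[OF a' assms(1) \<pi>' assms(3)] c rf_map_id)
  show "rf_map a \<pi> \<circ> rf_map (inv_into UNIV a) (inv_into UNIV \<pi>) = id"
    by (simp add: fun_eq_iff rf_map_rf_map[OF assms(1) a' assms(3) \<pi>'] c rf_map_id)
qed

text \<open>Used at points with natural number coordinates: these are fixed by a, so invariant
  functions have invariant values there.\<close>

lemma has_val_rf_map:
  fixes a :: "'a :: field \<Rightarrow> 'a"
  assumes a: "coeff_hom a" and "has_val (\<lambda>c. c) v r c"
  shows "has_val (\<lambda>c. c) (a \<circ> v) (rf_map a (\<lambda>i. i) r) (a c)"
proof -
  obtain P Q where PQ: "Q \<noteq> 0" "r = Fract P Q" "meval (\<lambda>c. c) v Q \<noteq> 0"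
      "c = meval (\<lambda>c. c) v P / meval (\<lambda>c. c) v Q"
    using assms(2) unfolding has_val_def by blast
  have eval: "meval (\<lambda>c. c) (a \<circ> v) (mmap a p) = a (meval (\<lambda>c. c) v p)" for p
    unfolding mmap_def meval_hom[OF a] meval_hom[OF coeff_hom_meval[OF coeff_hom_id]]
    by (simp add: comp_def coeff_hom.meval_const[OF coeff_hom_id] coeff_hom.meval_var[OF coeff_hom_id])
  show ?thesis
    unfolding PQ(2) rf_map_Fract[OF a bij_self PQ(1)] mrename_id
    using PQ(3,4) by (intro has_val_Fract coeff_hom_id) (simp_all add: eval coeff_hom_divide[OF a] coeff_hom_eq_0_iff[OF a])
qed

lemma nonvanishing_nat_point:
  fixes S :: "('i, 'a :: field_char_0) ratfun set"
  assumes "finite S" "0 \<notin> S"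
  shows "\<exists>u :: 'i \<Rightarrow> nat. \<forall>r\<in>S. \<exists>c. c \<noteq> 0 \<and> has_val (\<lambda>c. c) (\<lambda>i. of_nat (u i)) r c"
proof -
  have "\<forall>r. \<exists>PQ. snd PQ \<noteq> 0 \<and> r = Fract (fst PQ) (snd PQ)" for r :: "('i, 'a) ratfun"
    by (metis Fract_cases fst_conv snd_conv)
  then obtain PQ :: "('i, 'a) ratfun \<Rightarrow> _" where PQ: "snd (PQ r) \<noteq> 0" "r = Fract (fst (PQ r)) (snd (PQ r))" for r
    by metis
  have "fst (PQ r) \<noteq> 0" if "r \<in> S" for r
    using PQ[of r] assms(2) that by (metis fract_collapse(1))
  then have "(\<Prod>r\<in>S. fst (PQ r) * snd (PQ r)) \<noteq> 0" using PQ(1) assms(1) by simp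
  then obtain u :: "'i \<Rightarrow> nat" where
    "meval (\<lambda>c. c) (\<lambda>i. of_nat (u i)) (\<Prod>r\<in>S. fst (PQ r) * snd (PQ r)) \<noteq> (0 :: 'a)"
    using mpoly_nonroot_nat[OF coeff_hom_id] by blast
  moreover have hom: "coeff_hom (meval (\<lambda>c. c) (\<lambda>i. of_nat (u i) :: 'a))"
    by (intro coeff_hom_meval coeff_hom_id)
  ultimately have u: "meval (\<lambda>c. c) (\<lambda>i. of_nat (u i)) (fst (PQ r)) \<noteq> (0 :: 'a)"
    "meval (\<lambda>c. c) (\<lambda>i. of_nat (u i)) (snd (PQ r)) \<noteq> (0 :: 'a)" if "r \<in> S" for r
    using that assms(1) by (auto simp: coeff_hom_prod[OF hom] coeff_hom.hom_mult[OF hom])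
  show ?thesis
  proof (intro exI[of _ u] ballI)
    fix r assume r: "r \<in> S"
    let ?e = "meval (\<lambda>c. c) (\<lambda>i. of_nat (u i) :: 'a)"
    have "has_val (\<lambda>c. c) (\<lambda>i. of_nat (u i)) (Fract (fst (PQ r)) (snd (PQ r)))
        (?e (fst (PQ r)) / ?e (snd (PQ r)))"
      using u[OF r] by (intro has_val_Fract coeff_hom_id) simp_all
    then show "\<exists>c. c \<noteq> 0 \<and> has_val (\<lambda>c. c) (\<lambda>i. of_nat (u i)) r c"
      using u[OF r] PQ(2)[of r] by (metis divide_eq_0_iff)
  qed
qed

text \<open>Evaluation at the unit vector of j isolates the coefficient c j.\<close>

lemma rf_vars_independent:
  fixes c :: "'i \<Rightarrow> 'a :: field"
  assumes "finite S" "(\<Sum>i\<in>S. rf_const (c i) * rf_var i) = 0" "j \<in> S"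
  shows "c j = 0"
proof -
  have "to_fract (\<Sum>i\<in>S. mconst (c i) * mvar i) = 0"
    using assms(2) by (simp add: rf_const_def rf_var_def coeff_hom_sum[OF coeff_hom_to_fract])
  then have "(\<Sum>i\<in>S. mconst (c i) * mvar i) = 0" by (simp only: to_fract_eq_0_iff)
  then have "meval (\<lambda>c. c) (\<lambda>i. if i = j then 1 else 0) (\<Sum>i\<in>S. mconst (c i) * mvar i) = 0"
    by (simp add: coeff_hom.meval_0[OF coeff_hom_id])
  then show ?thesis
    using assms(1,3)
    by (simp add: coeff_hom.meval_sum[OF coeff_hom_id] coeff_hom.meval_mult[OF coeff_hom_id]
        coeff_hom.meval_const[OF coeff_hom_id] coeff_hom.meval_var[OF coeff_hom_id] if_distrib[of "(*) _"]
        cong: if_cong)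
qed

lemma two_power_times_odd:
  fixes k :: nat
  assumes "k > 0"
  shows "\<exists>r q. k = 2 ^ r * q \<and> odd q"
  using assms
proof (induction k rule: less_induct)
  case (less k)
  show ?case
  proof (cases "odd k")
    case True
    then show ?thesis by (intro exI[of _ 0] exI[of _ k]) simp
  next
    case False
    then obtain i where i: "k = 2 * i" by (auto elim: evenE)
    then obtain r q where "i = 2 ^ r * q" "odd q" using less.IH[of i] less.prems by auto
    then show ?thesis using i by (intro exI[of _ "Suc r"] exI[of _ q]) simp
  qed
qed

text \<open>A lift g of the generator need not have 2-power order. With q the odd part of the group
  order, g^(q^(2^n)) has, and since q^(2^n) is 1 modulo 2^n its degree is still 1. The 2-power order
  is what \<open>no_twisted_unit\<close> asks of the permutation.\<close>

lemma cyclic_quotient_degree: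
  fixes G :: "('g, 'b) monoid_scheme"
  assumes "group G" "finite (carrier G)" "N \<lhd> G" "(G Mod N) \<cong> integer_mod_group (2 ^ n)" "n > 0"
  obtains \<phi> :: "'g \<Rightarrow> nat" and \<sigma> r where
    "\<And>g h. g \<in> carrier G \<Longrightarrow> h \<in> carrier G \<Longrightarrow> \<phi> (g \<otimes>\<^bsub>G\<^esub> h) = (\<phi> g + \<phi> h) mod 2 ^ n"
    "\<And>g. g \<in> carrier G \<Longrightarrow> \<phi> g < 2 ^ n"
    "\<sigma> \<in> carrier G" "\<phi> \<sigma> = 1" "\<sigma> [^]\<^bsub>G\<^esub> (2 ^ r :: nat) = \<one>\<^bsub>G\<^esub>"
proof -
  interpret group G by fact
  interpret normal N G by fact
  let ?m = "2 ^ n :: nat"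
  let ?Z = "integer_mod_group ?m"
  obtain f where f: "f \<in> iso (G Mod N) ?Z" using assms(4) unfolding is_iso_def by blast
  define \<psi> where "\<psi> g = f (N #>\<^bsub>G\<^esub> g)" for g
  have \<psi>: "\<psi> \<in> hom G ?Z"
    using r_coset_hom_Mod f unfolding iso_def \<psi>_def hom_def by (auto simp: Pi_iff)
  have carr: "carrier ?Z = {0..<int ?m}" by (simp add: carrier_integer_mod_group)
  have range: "\<psi> g \<in> {0..<int ?m}" if "g \<in> carrier G" for g
    using hom_in_carrier[OF \<psi> that] carr by simp
  have mult: "\<psi> (g \<otimes>\<^bsub>G\<^esub> h) = (\<psi> g + \<psi> h) mod int ?m" if "g \<in> carrier G" "h \<in> carrier G" for g h
    using hom_mult[OF \<psi> that] by simp
  define \<phi> where "\<phi> g = nat (\<psi> g)" for g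
  have \<phi>: "int (\<phi> g) = \<psi> g" if "g \<in> carrier G" for g
    using range[OF that] by (simp add: \<phi>_def)
  have \<phi>_mult: "\<phi> (g \<otimes>\<^bsub>G\<^esub> h) = (\<phi> g + \<phi> h) mod ?m" if "g \<in> carrier G" "h \<in> carrier G" for g h
  proof -
    have "int (\<phi> (g \<otimes>\<^bsub>G\<^esub> h)) = int ((\<phi> g + \<phi> h) mod ?m)"
      using that by (simp add: \<phi> mult zmod_int)
    then show ?thesis by (simp only: of_nat_eq_iff)
  qed
  have \<phi>_less: "\<phi> g < ?m" if "g \<in> carrier G" for g
  proof -
    have "int (\<phi> g) < int ?m" using \<phi>[OF that] range[OF that] by simp
    then show ?thesis by (simp only: of_nat_less_iff)
  qed
  have "(1 :: int) \<in> carrier ?Z" using assms(5) by (simp add: carr)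
  moreover have "f ` carrier (G Mod N) = carrier ?Z" using f by (auto simp: iso_def bij_betw_def)
  ultimately obtain C where C: "C \<in> carrier (G Mod N)" "f C = 1" by (metis imageE)
  then obtain g where g: "g \<in> carrier G" "C = N #>\<^bsub>G\<^esub> g"
    by (auto simp: FactGroup_def RCOSETS_def)
  have \<phi>g: "\<phi> g = 1" using C g by (simp add: \<phi>_def \<psi>_def)
  have \<phi>_pow: "\<phi> (g [^]\<^bsub>G\<^esub> k) = k mod ?m" for k :: nat
  proof (induction k)
    case 0
    have "\<phi> \<one>\<^bsub>G\<^esub> = (\<phi> \<one>\<^bsub>G\<^esub> + \<phi> \<one>\<^bsub>G\<^esub>) mod ?m" using \<phi>_mult[of "\<one>\<^bsub>G\<^esub>" "\<one>\<^bsub>G\<^esub>"] by simp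
    then have "\<phi> \<one>\<^bsub>G\<^esub> = 0" using \<phi>_less[of "\<one>\<^bsub>G\<^esub>"] by (auto simp: mod_if split: if_splits)
    then show ?case by simp
  next
    case (Suc k)
    then show ?case using \<phi>_mult[of "g [^]\<^bsub>G\<^esub> k" g] g(1) by (simp add: \<phi>g mod_Suc_eq)
  qed
  have "Coset.order G > 0" using assms(2) order_gt_0_iff_finite by blast
  then obtain r q where q: "Coset.order G = 2 ^ r * q" "odd q" using two_power_times_odd by blast
  obtain c where c: "q ^ ?m = ?m * c + 1"
  proof -
    obtain c where "q ^ ?m - 1 = ?m * c" using odd_power_mod[OF q(2), of n] by blast
    moreover have "q ^ ?m > 0" using q(2) by (simp add: odd_pos)
    ultimately have "q ^ ?m = ?m * c + 1" by (metis Suc_eq_plus1 Suc_diff_1)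
    then show thesis by (rule that)
  qed
  define \<sigma> where "\<sigma> = g [^]\<^bsub>G\<^esub> (q ^ ?m)"
  have "\<sigma> [^]\<^bsub>G\<^esub> (2 ^ r :: nat) = \<one>\<^bsub>G\<^esub>"
  proof -
    have "q ^ ?m * 2 ^ r = Coset.order G * q ^ (?m - 1)"
      using power_Suc[of q "?m - 1"] by (simp add: q(1))
    then show ?thesis
      using g(1) pow_order_eq_1[OF g(1)] by (simp add: \<sigma>_def nat_pow_pow flip: nat_pow_pow[of g "Coset.order G"])
  qed
  moreover have "\<phi> \<sigma> = 1"
  proof -
    have "1 < ?m" using assms(5) by (intro one_less_power) simp_all
    moreover have "\<phi> \<sigma> = (?m * c + 1) mod ?m" using \<phi>_pow[of "q ^ ?m"] by (simp only: \<sigma>_def c)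
    ultimately show ?thesis by (simp only: mod_mult_self4 mod_less)
  qed
  moreover have "\<sigma> \<in> carrier G" using g(1) by (simp add: \<sigma>_def)
  ultimately show thesis using that[of \<phi>] \<phi>_mult \<phi>_less by blast
qed

text \<open>Extended by the identity outside the carrier because the rules for \<open>rf_map\<close>
  require a permutation of the whole index type.\<close>

definition left_translation :: "('g, 'b) monoid_scheme \<Rightarrow> 'g \<Rightarrow> 'g \<Rightarrow> 'g" where
  "left_translation G g h = (if h \<in> carrier G then g \<otimes>\<^bsub>G\<^esub> h else h)"

context group
begin

lemma left_translation_compose:
  assumes "g \<in> carrier G" "h \<in> carrier G"
  shows "left_translation G g \<circ> left_translation G h = left_translation G (g \<otimes> h)"
  using assms by (auto simp: left_translation_def m_assoc fun_eq_iff)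

lemma left_translation_one: "left_translation G \<one> = (\<lambda>h. h)"
  by (auto simp: left_translation_def fun_eq_iff)

lemma left_translation_power:
  assumes "g \<in> carrier G"
  shows "left_translation G g ^^ k = left_translation G (g [^] k)"
proof (induction k)
  case (Suc k)
  have "left_translation G g ^^ Suc k = left_translation G (g \<otimes> g [^] k)"
    using Suc assms by (simp add: left_translation_compose)
  then show ?case using nat_pow_Suc2[OF assms, of k] by simp
qed (simp add: left_translation_one id_def)

lemma bij_left_translation:
  assumes "g \<in> carrier G"
  shows "bij (left_translation G g)"
  using left_translation_compose[of "inv g" g] left_translation_compose[of g "inv g"] assms
  by (intro o_bij[of "left_translation G (inv g)"]) (simp_all add: left_translation_one id_def)

text \<open>Uniqueness of the described automorphism lets the definite description be replaced by a
  concrete \<open>rf_map\<close>.\<close>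

lemma noether_action_eq:
  assumes g: "g \<in> carrier G" and f: "f \<in> ratfun_field G"
  shows "noether_action G g f = rf_map (\<lambda>c. c) (left_translation G g) (f :: ('a, 'k :: field) ratfun)"
proof -
  let ?L = "ratfun_field G :: ('a, 'k) ratfun set"
  define \<tau> :: "'a \<Rightarrow> ('a, 'k) ratfun \<Rightarrow> _" where "\<tau> g = rf_map (\<lambda>c. c) (left_translation G g)" for g
  note tr = bij_left_translation
  have hom: "coeff_hom (\<tau> g)" if "g \<in> carrier G" for g
    unfolding \<tau>_def by (intro coeff_hom_rf_map coeff_hom_id tr that)
  have const: "\<tau> g (rf_const c) = rf_const c" and var: "\<tau> g (rf_var h) = rf_var (left_translation G g h)"
    if "g \<in> carrier G" for g c h
    unfolding \<tau>_def by (simp_all add: rf_map_const rf_map_var coeff_hom_id tr that)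
  have comp: "\<tau> (inv g) (\<tau> g x) = x" if "g \<in> carrier G" for g x
    using that left_translation_compose[of "inv g" g]
    by (simp add: \<tau>_def rf_map_rf_map coeff_hom_id tr left_translation_one rf_map_id comp_def)
  have closed: "\<tau> g x \<in> ?L" if g: "g \<in> carrier G" and x: "x \<in> ?L" for g x
    using x unfolding ratfun_field_def
  proof (induction rule: adjoin_induct)
    case (base x)
    then show ?case using g by (auto simp: const var left_translation_def adjoin_closed)
  next
    case (inverse x)
    have "\<tau> g x \<noteq> 0" using inverse(2) coeff_hom_eq_0_iff[OF hom[OF g]] by simp
    then show ?case using inverse by (simp add: coeff_hom_inverse[OF hom[OF g]] adjoin_closed)
  qed (auto simp: coeff_hom.hom_one[OF hom[OF g]] coeff_hom.hom_add[OF hom[OF g]]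
      coeff_hom.hom_mult[OF hom[OF g]] coeff_hom_minus[OF hom[OF g]] adjoin_closed)
  have "bij_betw (\<tau> g) ?L ?L"
    by (rule bij_betw_byWitness[of _ "\<tau> (inv g)"])
      (use g closed comp[of g] comp[of "inv g"] in auto)
  then have "restrict (\<tau> g) ?L \<in> Bij ?L"
    by (auto simp: Bij_def cong: bij_betw_cong)
  moreover have "x + y \<in> ?L" "x * y \<in> ?L" if "x \<in> ?L" "y \<in> ?L" for x y
    using that by (auto simp: ratfun_field_def adjoin_closed)
  moreover have "rf_const c \<in> ?L" "h \<in> carrier G \<Longrightarrow> rf_var h \<in> ?L" for c h
    by (auto simp: ratfun_field_def adjoin_closed)
  ultimately have \<tau>: "restrict (\<tau> g) ?L \<in> carrier (aut_group (range rf_const) ?L) \<and>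
      (\<forall>h\<in>carrier G. restrict (\<tau> g) ?L (rf_var h) = rf_var (g \<otimes> h))"
    using g by (auto simp: aut_group_def coeff_hom.hom_add[OF hom] coeff_hom.hom_mult[OF hom] const var
        left_translation_def)
  have unique: "\<exists>!\<sigma>. \<sigma> \<in> carrier (aut_group (range rf_const) ?L) \<and> (\<forall>h\<in>carrier G. \<sigma> (rf_var h) = rf_var (g \<otimes> h))"
    by (rule noether_action_exists_unique[OF group_axioms g])
  have "noether_action G g = restrict (\<tau> g) ?L"
    unfolding noether_action_def by (rule the1_equality[OF unique]) (rule \<tau>)
  then show ?thesis using f by (simp add: \<tau>_def)
qed

end

text \<open>The sign in \<alpha> z relative to z and 1/z is multiplicative in \<alpha>, and
  \<open>Ac\<close> is its kernel; the conditions on z keep the two signs apart.\<close>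

lemma automorphisms_of_sign:
  fixes z :: "'f :: field"
  assumes z: "z \<noteq> 0" "z \<noteq> - z" "z * z \<noteq> - 1"
    and A: "A = {\<alpha>. coeff_hom \<alpha> \<and> bij \<alpha> \<and> (\<forall>x\<in>S. \<alpha> x = x) \<and> \<alpha> z \<in> {z, inverse z, - z, - inverse z}}"
    and Ac: "Ac = {\<alpha> \<in> A. \<alpha> z \<in> {z, inverse z}}"
    and l: "l \<in> A" "l z = - z"
  shows "automorphisms A Ac l"
proof (rule automorphisms.intro)
  have neq: "z \<noteq> - z" "- z \<noteq> z" "z \<noteq> - inverse z" "- inverse z \<noteq> z" "inverse z \<noteq> - z" "- z \<noteq> inverse z"
    "inverse z \<noteq> - inverse z" "- inverse z \<noteq> inverse z"
    using z by (auto simp: field_simps) (metis neg_equal_iff_equal minus_minus)+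
  note hom = coeff_hom_minus coeff_hom_inverse
  show "\<alpha> \<in> A \<Longrightarrow> coeff_hom \<alpha>" for \<alpha> by (simp add: A)
  show "(\<lambda>x. x) \<in> Ac" by (simp add: A Ac coeff_hom_id bij_self)
  show "Ac \<subseteq> A" by (simp add: Ac)
  show "l \<in> A" by (rule l)
  show "l \<notin> Ac" using l neq by (simp add: Ac)
  fix \<alpha> assume \<alpha>: "\<alpha> \<in> A"
  then have h\<alpha>: "coeff_hom \<alpha>" "bij \<alpha>" and \<alpha>z: "\<alpha> z \<in> {z, inverse z, - z, - inverse z}" by (simp_all add: A)
  have \<alpha>i: "\<alpha> (inverse z) = inverse (\<alpha> z)" "\<alpha> (- z) = - \<alpha> z" "\<alpha> (- inverse z) = - inverse (\<alpha> z)"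
    by (simp_all add: coeff_hom_minus[OF h\<alpha>(1)] coeff_hom_inverse[OF h\<alpha>(1)])
  show comp: "\<alpha> \<circ> \<beta> \<in> A" if "\<beta> \<in> A" for \<beta>
    using that \<alpha> \<alpha>z \<alpha>i unfolding A by (auto simp: coeff_hom_comp bij_comp)
  show "\<alpha> \<circ> \<beta> \<in> Ac \<longleftrightarrow> (\<alpha> \<in> Ac \<longleftrightarrow> \<beta> \<in> Ac)" if "\<beta> \<in> A" for \<beta>
  proof -
    have "\<beta> z \<in> {z, inverse z, - z, - inverse z}" using that by (simp add: A)
    then have "\<alpha> (\<beta> z) \<in> {z, inverse z} \<longleftrightarrow> (\<alpha> z \<in> {z, inverse z} \<longleftrightarrow> \<beta> z \<in> {z, inverse z})"
      using \<alpha>z by (elim insertE emptyE) (simp_all add: \<alpha>i neq)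
    then show ?thesis using comp[OF that] \<alpha> that by (simp add: Ac)
  qed
  show "\<exists>\<beta>\<in>A. \<beta> \<circ> \<alpha> = (\<lambda>x. x) \<and> \<alpha> \<circ> \<beta> = (\<lambda>x. x)"
  proof (rule bexI)
    let ?\<beta> = "inv_into UNIV \<alpha>"
    have \<beta>\<alpha>: "?\<beta> (\<alpha> x) = x" for x using h\<alpha>(2) by (simp add: bij_is_inj)
    note h\<beta> = coeff_hom_inv_into[OF h\<alpha>]
    show "?\<beta> \<circ> \<alpha> = (\<lambda>x. x) \<and> \<alpha> \<circ> ?\<beta> = (\<lambda>x. x)"
      using h\<alpha>(2) by (auto simp: bij_is_inj bij_is_surj surj_f_inv_f fun_eq_iff)
    have "?\<beta> x = x" if "x \<in> S" for x using \<beta>\<alpha>[of x] \<alpha> that by (simp add: A)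
    moreover have "?\<beta> z \<in> {z, inverse z, - z, - inverse z}"
      using \<alpha>z \<beta>\<alpha>[of z] \<beta>\<alpha>[of "inverse z"] \<beta>\<alpha>[of "- z"] \<beta>\<alpha>[of "- inverse z"]
      by (elim insertE emptyE) (simp_all add: \<alpha>i)
    ultimately show "?\<beta> \<in> A"
      unfolding A using h\<beta> h\<alpha>(2) by (simp add: bij_imp_bij_inv)
  qed
qed

text \<open>X j is the sum of the variables of degree j, and G shifts these sums through its cyclic
  quotient. The contradiction is reached over the closure of k, where Galois automorphisms and group
  elements act on the same field.\<close>

theorem noether_field_no_retraction:
  fixes n :: nat and G :: "('g, 'b) monoid_scheme" and N :: "'g set"
    and \<zeta> :: "'k :: field_char_0 alg_closure"
  assumes n: "n \<ge> 3" and G: "group G" "finite (carrier G)"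
    and N: "N \<lhd> G" "(G Mod N) \<cong> integer_mod_group (2 ^ n)"
    and \<zeta>: "primitive_root_of_unity (2 ^ n) \<zeta>"
    and noncyclic: "\<not> cyclic_extension (range to_ac) (adjoin (range to_ac) {\<zeta>})"
  shows "\<not> retract_property TYPE('i) (rf_const :: 'k \<Rightarrow> ('g, 'k) ratfun) (noether_field G)"
proof
  assume retract: "retract_property TYPE('i) (rf_const :: 'k \<Rightarrow> ('g, 'k) ratfun) (noether_field G)"
  interpret group G by fact
  let ?C = "carrier G" and ?P = "left_translation G"
  define m :: nat where "m = 2 ^ n"
  have n0: "n > 0" using n by simp
  obtain \<phi> :: "'g \<Rightarrow> nat" and \<sigma> r where
    \<phi>: "\<And>g h. g \<in> ?C \<Longrightarrow> h \<in> ?C \<Longrightarrow> \<phi> (g \<otimes>\<^bsub>G\<^esub> h) = (\<phi> g + \<phi> h) mod m" "\<And>g. g \<in> ?C \<Longrightarrow> \<phi> g < m"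
    and \<sigma>: "\<sigma> \<in> ?C" "\<phi> \<sigma> = 1" "\<sigma> [^]\<^bsub>G\<^esub> (2 ^ r :: nat) = \<one>\<^bsub>G\<^esub>"
    unfolding m_def using cyclic_quotient_degree[OF G N n0] by metis
  define X :: "nat \<Rightarrow> ('g, 'k) ratfun" where "X j = (\<Sum>h | h \<in> ?C \<and> \<phi> h = j mod m. rf_var h)" for j
  define t :: "'g \<Rightarrow> ('g, 'k) ratfun \<Rightarrow> _" where "t g = rf_map (\<lambda>c. c) (?P g)" for g
  have t: "coeff_hom (t g)" "t g (rf_const c) = rf_const c" "t g (rf_var h) = rf_var (?P g h)"
    if "g \<in> ?C" for g h c
    unfolding t_def using that bij_left_translation
    by (simp_all add: coeff_hom_rf_map rf_map_const rf_map_var coeff_hom_id)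
  have \<phi>_one: "\<phi> \<one>\<^bsub>G\<^esub> = 0"
    using \<phi>(1)[of "\<one>\<^bsub>G\<^esub>" "\<one>\<^bsub>G\<^esub>"] \<phi>(2)[of "\<one>\<^bsub>G\<^esub>"] by (auto simp: mod_if split: if_splits)
  have t_X: "t g (X i) = X (i + \<phi> g)" if g: "g \<in> ?C" for g i
  proof -
    have "t g (X i) = (\<Sum>h | h \<in> ?C \<and> \<phi> h = i mod m. rf_var (g \<otimes>\<^bsub>G\<^esub> h))"
      by (simp add: X_def coeff_hom_sum[OF t(1)[OF g]] t(3)[OF g] left_translation_def)
    also have "\<dots> = X (i + \<phi> g)"
      unfolding X_def
    proof (rule sum.reindex_bij_witness[of _ "\<lambda>h. inv\<^bsub>G\<^esub> g \<otimes>\<^bsub>G\<^esub> h" "\<lambda>h. g \<otimes>\<^bsub>G\<^esub> h"])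
      fix h assume h: "h \<in> {h \<in> ?C. \<phi> h = (i + \<phi> g) mod m}"
      have "(\<phi> (inv\<^bsub>G\<^esub> g) + \<phi> g) mod m = 0"
        using \<phi>(1)[of "inv\<^bsub>G\<^esub> g" g] g by (simp add: \<phi>_one)
      moreover have "(\<phi> (inv\<^bsub>G\<^esub> g) + (i + \<phi> g) mod m) mod m = (i + (\<phi> (inv\<^bsub>G\<^esub> g) + \<phi> g) mod m) mod m"
        by (simp add: mod_add_right_eq ac_simps)
      ultimately show "inv\<^bsub>G\<^esub> g \<otimes>\<^bsub>G\<^esub> h \<in> {h \<in> ?C. \<phi> h = i mod m}"
        using g h \<phi>(1)[of "inv\<^bsub>G\<^esub> g" h] by simp
    qed (use g in \<open>auto simp: \<phi>(1) mod_add_right_eq add.commute m_assoc[symmetric]\<close>)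
    finally show ?thesis .
  qed
  define T where "T = t ` ?C"
  have subfld: "subfld (ratfun_field G :: ('g, 'k) ratfun set)" unfolding ratfun_field_def by (rule subfld_adjoin)
  interpret F: subfld_hom "ratfun_field G :: ('g, 'k) ratfun set" "\<lambda>x. x"
    by unfold_locales (rule subfld, rule hom_on_id)
  interpret K: kummer n m "ratfun_field G" T X
  proof (rule kummer.intro)
    show "coeff_hom t'" if "t' \<in> T" for t' using that t(1) by (auto simp: T_def)
    show "\<exists>c. \<forall>j. t' (X j) = X (j + c)" if "t' \<in> T" for t' using that t_X by (auto simp: T_def)
    show "X j \<in> ratfun_field G" for j
      unfolding X_def by (intro F.sum_closed) (simp add: ratfun_field_def adjoin_closed)
    show "X (j + m) = X j" for j by (simp add: X_def)
  qed (use n m_def subfld in auto)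
  have KL: "K.L = {x \<in> ratfun_field G. \<forall>g\<in>?C. t g x = x}"
    unfolding K.L_def by (simp add: T_def)
  then have L: "K.L = noether_field G"
    unfolding noether_field_def by (auto simp: noether_action_eq t_def)
  define j :: "('g, 'k) ratfun \<Rightarrow> ('g, 'k alg_closure) ratfun" where "j = rf_map to_ac (\<lambda>i. i)"
  have j: "coeff_hom j" "j (rf_const c) = rf_const (to_ac c)" "j (rf_var i) = rf_var i" for c i
    unfolding j_def by (simp_all add: coeff_hom_rf_map rf_map_const rf_map_var coeff_hom_to_ac bij_self)
  obtain e where e: "coeff_hom e" "bij e" "\<And>c. e (to_ac c) = to_ac c" "e \<zeta> = inverse \<zeta>"
    using noncyclic_closure_automorphisms(1)[OF _ \<zeta> noncyclic] n by auto
  obtain l where l: "coeff_hom l" "bij l" "\<And>c. l (to_ac c) = to_ac c" "l \<zeta> = - \<zeta>"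
    using noncyclic_closure_automorphisms(2)[OF _ \<zeta> noncyclic] n by auto
  define s :: "('g, 'k alg_closure) ratfun \<Rightarrow> _" where "s = rf_map (\<lambda>c. c) (?P \<sigma>)"
  have s: "coeff_hom s" "bij s" "s (rf_const c) = rf_const c" "s (rf_var i) = rf_var (?P \<sigma> i)" for c i
    unfolding s_def using bij_left_translation[OF \<sigma>(1)]
    by (simp_all add: coeff_hom_rf_map rf_map_const rf_map_var coeff_hom_id bij_rf_map bij_self)
  have s_j: "s (j x) = j (t \<sigma> x)" for x
    using ratfun_hom_eq[OF coeff_hom_comp[OF s(1) j(1)] coeff_hom_comp[OF j(1) t(1)[OF \<sigma>(1)]], of x]
    by (simp add: s j t[OF \<sigma>(1)])
  have coeff_j: "rf_map a (\<lambda>i. i) (j x) = j x" if a: "coeff_hom a" "\<And>c. a (to_ac c) = to_ac c" for a x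
    using ratfun_hom_eq[OF coeff_hom_comp[OF coeff_hom_rf_map[OF a(1) bij_self] j(1)] j(1), of x]
    by (simp add: rf_map_const rf_map_var a bij_self j)
  define Z :: "('g, 'k alg_closure) ratfun" where "Z = rf_const \<zeta>"
  have c: "coeff_hom (rf_const :: 'k alg_closure \<Rightarrow> ('g, 'k alg_closure) ratfun)" by (rule coeff_hom_rf_const)
  have \<zeta>0: "\<zeta> \<noteq> 0" using \<zeta> by (auto simp: primitive_root_of_unity_def zero_power)
  have \<zeta>_half: "\<zeta> ^ (m div 2) = - 1"
  proof -
    have "(\<zeta> ^ (m div 2)) ^ 2 = 1"
      using \<zeta> K.half by (simp add: primitive_root_of_unity_def m_def mult.commute flip: power_mult)
    moreover have "\<zeta> ^ (m div 2) \<noteq> 1"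
      using \<zeta> K.half_pos K.half unfolding primitive_root_of_unity_def m_def[symmetric] by auto
    ultimately show ?thesis by (simp add: power2_eq_1_iff)
  qed
  have Z_half: "Z ^ (m div 2) = - 1"
    unfolding Z_def using \<zeta>_half
    by (simp add: coeff_hom_minus[OF c] coeff_hom.hom_one[OF c] flip: coeff_hom_power[OF c])
  have Z0: "Z \<noteq> 0" using \<zeta>0 by (simp add: Z_def coeff_hom_eq_0_iff[OF c])
  \<comment> \<open>The maps l and e come from Galois automorphisms and s from \<sigma>; all fix the
    Noether field. As e inverts Z and s fixes it, both lie in \<open>Ac\<close>, while l does
    not.\<close>
  define A where "A = {\<alpha>. coeff_hom \<alpha> \<and> bij \<alpha> \<and> (\<forall>x\<in>j ` noether_field G. \<alpha> x = x) \<and>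
    \<alpha> Z \<in> {Z, inverse Z, - Z, - inverse Z}}"
  define Ac where "Ac = {\<alpha> \<in> A. \<alpha> Z \<in> {Z, inverse Z}}"
  let ?l = "rf_map l (\<lambda>i. i)" and ?e = "rf_map e (\<lambda>i. i)"
  have l_A: "?l \<in> A" "?l Z = - Z"
    using l by (simp_all add: A_def Z_def coeff_hom_rf_map bij_rf_map bij_self coeff_j rf_map_const coeff_hom_minus[OF c])
  have e_Ac: "?e \<in> Ac"
    using e by (simp add: A_def Ac_def Z_def coeff_hom_rf_map bij_rf_map bij_self coeff_j rf_map_const coeff_hom_inverse[OF c])
  have s_Ac: "s \<in> Ac"
    using s \<sigma>(1) by (auto simp: A_def Ac_def Z_def s_j KL L[symmetric])
  have auto: "automorphisms A Ac ?l"
  proof (rule automorphisms_of_sign[OF Z0 _ _ A_def Ac_def l_A])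
    have "(2 :: 'k alg_closure) * \<zeta> \<noteq> 0" using \<zeta>0 by simp
    then have "\<zeta> \<noteq> - \<zeta>" by (metis add.right_inverse mult_2)
    then show "Z \<noteq> - Z"
      unfolding Z_def using injD[OF coeff_hom_inj[OF c]] by (metis coeff_hom_minus[OF c])
    have "\<zeta> * \<zeta> \<noteq> - 1"
    proof
      assume "\<zeta> * \<zeta> = - 1"
      then have "\<zeta> ^ 4 = 1" by (simp add: power4_eq_xxxx mult.assoc[of "\<zeta> * \<zeta>"])
      then have "2 ^ n dvd (4 :: nat)" by (rule primitive_root_power_eq_1[OF \<zeta>])
      moreover have "(2 :: nat) ^ 3 \<le> 2 ^ n" using n by (intro power_increasing) auto
      ultimately show False by (auto dest: dvd_imp_le)
    qed
    then show "Z * Z \<noteq> - 1"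
      unfolding Z_def using injD[OF coeff_hom_inj[OF c]]
      by (metis coeff_hom_minus[OF c] coeff_hom.hom_one[OF c] coeff_hom.hom_mult[OF c])
  qed
  \<comment> \<open>Resolvents are linear combinations of the independent variables; the coefficient
    at \<sigma>, whose degree is 1, shows that they are nonzero.\<close>
  have combination: "(\<Sum>i<m. j (X i) * rf_const (a i)) \<noteq> 0" if a: "a 1 \<noteq> 0" for a :: "nat \<Rightarrow> 'k alg_closure"
  proof
    assume zero: "(\<Sum>i<m. j (X i) * rf_const (a i)) = 0"
    have "(\<Sum>i<m. j (X i) * rf_const (a i))
        = (\<Sum>i<m. \<Sum>h | h \<in> ?C \<and> \<phi> h = i. rf_const (a (\<phi> h)) * rf_var h)"
      by (intro sum.cong refl)
        (simp add: X_def coeff_hom_sum[OF j(1)] j(3) sum_distrib_left mult.commute)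
    also have "\<dots> = (\<Sum>h\<in>?C. rf_const (a (\<phi> h)) * rf_var h)"
      by (rule sum.group) (use G(2) \<phi>(2) in auto)
    finally show False
      using rf_vars_independent[OF G(2) _ \<sigma>(1), of "\<lambda>h. a (\<phi> h)"] zero a \<sigma>(2) by simp
  qed
  have "j K.\<delta> = (\<Sum>i<m. j (X i) * rf_const ((- 1) ^ (m - i)))"
    unfolding K.\<delta>_def
    by (simp add: coeff_hom_sum[OF j(1)] coeff_hom.hom_mult[OF j(1)] coeff_hom_power[OF j(1)]
        coeff_hom_minus[OF j(1)] coeff_hom.hom_one[OF j(1)] coeff_hom_power[OF c] coeff_hom_minus[OF c]
        coeff_hom.hom_one[OF c])
  then have d0: "j K.\<delta> \<noteq> 0" using combination[of "\<lambda>i. (- 1) ^ (m - i)"] by simp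
  then have \<delta>0: "K.\<delta> \<noteq> 0" by (auto simp: coeff_hom.hom_zero[OF j(1)])
  have "poly (map_poly j (K.Y 1)) Z = (\<Sum>i<m. j (X i) * rf_const (\<zeta> ^ (m - i)))"
    unfolding K.Y_def
    by (simp add: coeff_hom_sum[OF coeff_hom_map_poly[OF j(1)]] map_poly_monom coeff_hom.hom_zero[OF j(1)]
        poly_sum poly_monom Z_def coeff_hom_power[OF c])
  then have Y0: "poly (map_poly j (K.Y 1)) Z \<noteq> 0"
    using combination[of "\<lambda>i. \<zeta> ^ (m - i)"] \<zeta>0 by simp
  have A_Z: "\<alpha> Z = Z ^ (m div 2 + 1) \<or> \<alpha> Z = Z ^ (m div 2 - 1)" if "\<alpha> \<in> A" "\<alpha> \<notin> Ac" for \<alpha>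
  proof -
    have "Z ^ (m div 2 - 1) * Z = - 1"
      using Z_half K.half_pos by (metis Suc_diff_1 power_Suc2)
    then have "Z ^ (m div 2 - 1) = - inverse Z" using Z0 by (simp add: field_simps)
    moreover have "Z ^ (m div 2 + 1) = - Z" by (simp add: power_add Z_half)
    ultimately show ?thesis using that by (auto simp: A_def Ac_def)
  qed
  have const_L: "range (rf_const :: 'k \<Rightarrow> ('g, 'k) ratfun) \<subseteq> K.L"
    unfolding KL using t(2) by (auto simp: ratfun_field_def adjoin_closed)
  have "\<exists>c \<mu> \<omega>. c \<noteq> 0 \<and> j (K.\<delta> ^ 2) * j (rf_const c) = \<mu> ^ 2 * (\<omega> * ?l \<omega>) \<and>
      (\<forall>\<alpha>\<in>A. \<alpha> \<mu> = \<mu>) \<and> (\<forall>\<alpha>\<in>Ac. \<alpha> \<omega> = \<omega>)"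
  proof (rule K.lift_along_path[where \<iota> = rf_const and j = j and A = A and Ac = Ac and l = ?l and \<zeta> = Z,
        OF auto coeff_hom_rf_const const_L j(1) _ Z_half _ Y0 \<delta>0])
    show "\<alpha> Z = Z ^ (m div 2 + 1) \<or> \<alpha> Z = Z ^ (m div 2 - 1)" if "\<alpha> \<in> A" "\<alpha> \<notin> Ac" for \<alpha>
      using that by (rule A_Z)
    show "\<alpha> (j x) = j x" if "\<alpha> \<in> A" "x \<in> K.L" for \<alpha> x using that by (auto simp: A_def L)
    show "retract_property TYPE('i) (rf_const :: 'k \<Rightarrow> ('g, 'k) ratfun) K.L" using retract by (simp add: L)
  qed
  then obtain b \<mu> \<omega> where b: "b \<noteq> 0" and lift: "j (K.\<delta> ^ 2) * j (rf_const b) = \<mu> ^ 2 * (\<omega> * ?l \<omega>)"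
    and \<mu>: "\<And>\<alpha>. \<alpha> \<in> A \<Longrightarrow> \<alpha> \<mu> = \<mu>" and \<omega>: "\<And>\<alpha>. \<alpha> \<in> Ac \<Longrightarrow> \<alpha> \<omega> = \<omega>"
    by blast
  define d where "d = j K.\<delta>"
  have eq: "d ^ 2 * rf_const (to_ac b) = \<mu> ^ 2 * (\<omega> * ?l \<omega>)"
    using lift by (simp add: d_def coeff_hom_power[OF j(1)] j(2))
  have "d ^ 2 * rf_const (to_ac b) \<noteq> 0"
    using d0 b coeff_hom_eq_0_iff[OF c] by (simp add: d_def)
  then have nz: "\<mu> \<noteq> 0" "\<omega> \<noteq> 0" "d \<noteq> 0" unfolding eq using d0 by (auto simp: d_def)
  have fixed: "?l \<mu> = \<mu>" "?l d = d" "?e \<mu> = \<mu>" "?e d = d" "?e \<omega> = \<omega>" "s \<mu> = \<mu>" "s \<omega> = \<omega>"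
    using \<mu>[OF l_A(1)] \<mu>[of ?e] \<mu>[of s] \<omega>[OF e_Ac] \<omega>[OF s_Ac] e_Ac s_Ac coeff_j[OF l(1,3)] coeff_j[OF e(1,3)]
    by (auto simp: Ac_def d_def)
  \<comment> \<open>The degree of \<sigma> is 1, an odd shift.\<close>
  have "s d = - d"
    using K.T_\<delta>[of "t \<sigma>" 1] t_X[OF \<sigma>(1)] \<sigma> by (simp add: d_def s_j T_def coeff_hom_minus[OF j(1)])
  \<comment> \<open>At a natural number point where \<mu>, \<omega> and d are defined and nonzero,
    the identity \<open>eq\<close> specialises to one between scalars with the same invariance under
    l and e.\<close>
  obtain x where x: "\<forall>y\<in>{\<mu>, \<omega>, d}. \<exists>c. c \<noteq> 0 \<and> has_val (\<lambda>c. c) (\<lambda>i. of_nat (x i)) y c"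
    using nonvanishing_nat_point[of "{\<mu>, \<omega>, d}"] nz by auto
  let ?v = "\<lambda>i. of_nat (x i) :: 'k alg_closure"
  obtain \<mu>0 \<omega>0 d0 where val: "has_val (\<lambda>c. c) ?v \<mu> \<mu>0" "has_val (\<lambda>c. c) ?v \<omega> \<omega>0" "has_val (\<lambda>c. c) ?v d d0"
    and val_nz: "\<mu>0 \<noteq> 0" "\<omega>0 \<noteq> 0" "d0 \<noteq> 0"
    using x by auto
  have i: "coeff_hom (\<lambda>c :: 'k alg_closure. c)" by (rule coeff_hom_id)
  have val_map: "has_val (\<lambda>c. c) ?v (rf_map a (\<lambda>i. i) y) (a z)" if "coeff_hom a" "has_val (\<lambda>c. c) ?v y z" for a y z
    using has_val_rf_map[OF that] by (simp add: comp_def coeff_hom_of_nat[OF that(1)])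
  have val_fixed: "l \<mu>0 = \<mu>0" "l d0 = d0" "e \<mu>0 = \<mu>0" "e d0 = d0" "e \<omega>0 = \<omega>0"
    using val_map[OF l(1) val(1)] val_map[OF l(1) val(3)] val_map[OF e(1) val(1)] val_map[OF e(1) val(3)]
      val_map[OF e(1) val(2)] val has_val_unique[OF i] unfolding fixed by metis+
  have "d0 ^ 2 * to_ac b = \<mu>0 ^ 2 * (\<omega>0 * l \<omega>0)"
  proof (rule has_val_unique[OF i])
    show "has_val (\<lambda>c. c) ?v (d ^ 2 * rf_const (to_ac b)) (d0 ^ 2 * to_ac b)"
      unfolding rf_const_def by (intro has_val_mult[OF i] has_val_power[OF i] has_val_const[OF i] val)
    show "has_val (\<lambda>c. c) ?v (d ^ 2 * rf_const (to_ac b)) (\<mu>0 ^ 2 * (\<omega>0 * l \<omega>0))"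
      unfolding eq by (intro has_val_mult[OF i] has_val_power[OF i] val val_map[OF l(1)])
  qed
  then have val_eq: "d0 * d0 * to_ac b = \<mu>0 * \<mu>0 * (\<omega>0 * l \<omega>0)" by (simp add: power2_eq_square)
  \<comment> \<open>By the scalar identity, q * l q is the inverse of the factor from k left over in
    \<open>eq\<close>.\<close>
  define q where "q = d0 / (\<mu>0 * \<omega>0)"
  have "l q = d0 / (\<mu>0 * l \<omega>0)"
    by (simp add: q_def coeff_hom_divide[OF l(1)] coeff_hom.hom_mult[OF l(1)] val_fixed)
  then have "q * l q * to_ac b = (d0 * d0 * to_ac b) / (\<mu>0 * \<mu>0 * (\<omega>0 * l \<omega>0))"
    by (simp add: q_def)
  then have q: "q * l q * to_ac b = 1"
    unfolding val_eq using val_nz coeff_hom_eq_0_iff[OF l(1)] by simp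
  \<comment> \<open>The scalar q makes u * l u equal to 1; e fixes all the ingredients, and s
    negates d only.\<close>
  define u where "u = rf_const q * (\<mu> * \<omega> / d)"
  have rl: "coeff_hom ?l" and re: "coeff_hom ?e" by (intro coeff_hom_rf_map l e bij_self)+
  have "u * ?l u = rf_const (q * l q) * (\<mu> ^ 2 * (\<omega> * ?l \<omega>) / d ^ 2)"
    unfolding u_def
    by (simp add: coeff_hom.hom_mult[OF rl] coeff_hom_divide[OF rl] fixed rf_map_const[OF l(1) bij_self]
        coeff_hom.hom_mult[OF c] power2_eq_square)
  also have "\<dots> = rf_const (q * l q * to_ac b)"
    unfolding eq[symmetric] using nz by (simp add: coeff_hom.hom_mult[OF c])
  finally have u1: "u * ?l u = 1" by (simp add: q coeff_hom.hom_one[OF c])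
  have u2: "rf_map (\<lambda>c. c) (?P \<sigma>) u = - u"
    unfolding u_def s_def[symmetric]
    by (simp add: coeff_hom.hom_mult[OF s(1)] coeff_hom_divide[OF s(1)] fixed s(3) \<open>s d = - d\<close>)
  have "e q = q"
    by (simp add: q_def coeff_hom_divide[OF e(1)] coeff_hom.hom_mult[OF e(1)] val_fixed)
  then have u3: "?e u = u"
    unfolding u_def
    by (simp add: coeff_hom.hom_mult[OF re] coeff_hom_divide[OF re] fixed rf_map_const[OF e(1) bij_self])
  have \<sigma>_power: "?P \<sigma> ^^ (2 ^ r) = (\<lambda>i. i)"
    by (simp add: left_translation_power[OF \<sigma>(1)] \<sigma>(3) left_translation_one)
  have "2 \<le> n" using n by simp
  show False
    by (rule no_twisted_unit[where e = e and e' = "inv_into UNIV e" and l = l and l' = "inv_into UNIV l" and \<pi> = "?P \<sigma>" and u = u and r = r, OF \<zeta> \<open>2 \<le> n\<close> e(1) coeff_hom_inv_into[OF e(1,2)] _ _ e(4)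
          l(1) coeff_hom_inv_into[OF l(1,2)] _ _ l(4) bij_left_translation[OF \<sigma>(1)] \<sigma>_power u1 u2 u3])
      (use e(2) l(2) in \<open>simp_all add: bij_is_inj bij_is_surj surj_f_inv_f\<close>)
qed

section \<open>Consequences of stable rationality\<close>

text \<open>Points with natural number coordinates are also chosen over coefficient fields that are
  rational function fields themselves, which must be known to have characteristic 0.\<close>

instance mpoly :: (type, "{comm_ring_1, ring_char_0}") ring_char_0
proof
  have "(of_nat n :: ('a, 'b) mpoly) = mconst (of_nat n)" for n
    by (simp add: coeff_hom_of_nat[OF mconst.coeff_hom_axioms])
  then show "inj (of_nat :: nat \<Rightarrow> ('a, 'b) mpoly)"
    by (auto intro!: injI simp: mconst_eq_iff)
qed

instance fract :: ("{idom, ring_char_0}") field_char_0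
proof
  have "(of_nat n :: 'a fract) = to_fract (of_nat n)" for n
    by (simp add: coeff_hom_of_nat[OF coeff_hom_to_fract])
  then show "inj (of_nat :: nat \<Rightarrow> 'a fract)"
    by (auto intro!: injI)
qed

lemma meval_mmap: "coeff_hom h \<Longrightarrow> meval h v (mmap a p) = meval (h \<circ> a) v p"
  unfolding mmap_def
  by (subst meval_hom[OF coeff_hom_meval])
     (simp_all add: comp_def coeff_hom.meval_const coeff_hom.meval_var)

text \<open>Used to specialise polynomial expressions in a transcendence basis when only the values
  of its members are known.\<close>

lemma has_val_meval:
  assumes h: "coeff_hom h" and g: "coeff_hom g" and k: "coeff_hom k"
    and const: "\<And>c. has_val h v (g c) (k c)" and var: "\<And>i. i \<in> V \<Longrightarrow> has_val h v (w i) (u i)"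
    and p: "p \<in> vars_in V"
  shows "has_val h v (meval g w p) (meval k u p)"
  using p
  by (induction rule: vars_in_induct)
     (auto simp: coeff_hom.meval_add[OF g] coeff_hom.meval_add[OF k] coeff_hom.meval_mult[OF g]
       coeff_hom.meval_mult[OF k] coeff_hom.meval_const[OF g] coeff_hom.meval_const[OF k]
       coeff_hom.meval_var[OF g] coeff_hom.meval_var[OF k] const var
       intro: has_val_add[OF h] has_val_mult[OF h])

text \<open>An embedding obtained by choosing representations is most easily given as a relation;
  totality and single-valuedness then turn it into a function.\<close>

lemma retract_propertyI:
  fixes R :: "'e :: field \<Rightarrow> ('i, 'k :: field) ratfun \<Rightarrow> bool"
  assumes L: "subdomain L" "range \<iota> \<subseteq> L"
    and total: "\<And>x. x \<in> L \<Longrightarrow> \<exists>r. R x r"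
    and unique: "\<And>x r r'. R x r \<Longrightarrow> R x r' \<Longrightarrow> r = r'"
    and add: "\<And>x y r s. R x r \<Longrightarrow> R y s \<Longrightarrow> R (x + y) (r + s)"
    and mult: "\<And>x y r s. R x r \<Longrightarrow> R y s \<Longrightarrow> R (x * y) (r * s)"
    and const: "\<And>c. R (\<iota> c) (rf_const c)"
    and point: "\<And>S. finite S \<Longrightarrow> S \<subseteq> L \<Longrightarrow>
      \<exists>\<tau>. range \<tau> \<subseteq> L \<and> (\<forall>x\<in>S. \<exists>r. R x r \<and> has_val \<iota> \<tau> r x)"
  shows "retract_property TYPE('i) \<iota> L"
  unfolding retract_property_def
proof (intro allI impI)
  fix S assume S: "finite S \<and> S \<subseteq> L"
  define \<Psi> where "\<Psi> x = (THE r. R x r)" for x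
  have eq: "\<Psi> x = r" if "R x r" for x r
    unfolding \<Psi>_def using that by (blast intro: unique)
  have \<Psi>: "R x (\<Psi> x)" if "x \<in> L" for x
    using total[OF that] eq by blast
  obtain \<tau> where \<tau>: "range \<tau> \<subseteq> L" "\<forall>x\<in>S. \<exists>r. R x r \<and> has_val \<iota> \<tau> r x"
    using point S by blast
  show "\<exists>(\<Psi> :: 'e \<Rightarrow> ('i, 'k) ratfun) \<tau>. range \<tau> \<subseteq> L \<and> (\<forall>c. \<Psi> (\<iota> c) = rf_const c) \<and>
      (\<forall>x\<in>L. \<forall>y\<in>L. \<Psi> (x + y) = \<Psi> x + \<Psi> y \<and> \<Psi> (x * y) = \<Psi> x * \<Psi> y) \<and>
      (\<forall>x\<in>S. has_val \<iota> \<tau> (\<Psi> x) x)"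
  proof (intro exI conjI allI ballI)
    show "\<Psi> (\<iota> c) = rf_const c" for c by (rule eq[OF const])
    show "\<Psi> (x + y) = \<Psi> x + \<Psi> y" "\<Psi> (x * y) = \<Psi> x * \<Psi> y" if "x \<in> L" "y \<in> L" for x y
      by (intro eq add mult \<Psi> that)+
    show "has_val \<iota> \<tau> (\<Psi> x) x" if "x \<in> S" for x
      using \<tau>(2) that eq by metis
  qed (rule \<tau>(1))
qed

text \<open>Natural numbers lie in L, so setting the variables to them maps L(y) back into L
  wherever it is defined. The polynomial D collects the denominators met while x is built
  up.\<close>

lemma adjoin_rf_var_value:
  fixes L :: "'e :: field_char_0 set" and x :: "('i, 'e) ratfun"
  assumes L: "subfld L" and x: "x \<in> adjoin (rf_const ` L) (rf_var ` I)"
  shows "\<exists>D. D \<noteq> 0 \<and> (\<forall>u :: 'i \<Rightarrow> nat. meval (\<lambda>c :: 'e. c) (\<lambda>i. of_nat (u i)) D \<noteq> 0 \<longrightarrow>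
    (\<exists>c\<in>L. has_val (\<lambda>c. c) (\<lambda>i. of_nat (u i)) x c))"
  using x
proof (induction rule: adjoin_induct)
  let ?e = "\<lambda>u :: 'i \<Rightarrow> nat. meval (\<lambda>c :: 'e. c) (\<lambda>i. of_nat (u i))"
  let ?h = "\<lambda>u :: 'i \<Rightarrow> nat. has_val (\<lambda>c :: 'e. c) (\<lambda>i. of_nat (u i))"
  interpret subdomain_locale L using L by unfold_locales (simp add: subfld_def)
  note i = coeff_hom_id
  have nat: "of_nat k \<in> L" for k by (induction k) auto
  {
    case one
    show ?case by (intro exI[of _ 1]) (auto intro: has_val_1[OF i] closed)
  next
    case (base x)
    then have "\<exists>c\<in>L. ?h u x c" for u
    proof
      assume "x \<in> rf_const ` L"
      then show ?thesis unfolding rf_const_def by (blast intro: has_val_const[OF i])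
    next
      assume "x \<in> rf_var ` I"
      then obtain k where "x = to_fract (mvar k)" by (auto simp: rf_var_def)
      then have "?h u x (of_nat (u k))"
        using has_val_to_fract[OF i, of _ "mvar k"] by (metis coeff_hom.meval_var[OF i])
      then show ?thesis using nat by blast
    qed
    then show ?case by (intro exI[of _ 1]) auto
  next
    case (add x y)
    obtain D where D: "D \<noteq> 0" "\<forall>u. ?e u D \<noteq> 0 \<longrightarrow> (\<exists>c\<in>L. ?h u x c)"
      using add.IH(1) by (elim exE conjE)
    obtain E where E: "E \<noteq> 0" "\<forall>u. ?e u E \<noteq> 0 \<longrightarrow> (\<exists>c\<in>L. ?h u y c)"
      using add.IH(2) by (elim exE conjE)
    have "\<exists>c\<in>L. ?h u (x + y) c" if u: "?e u (D * E) \<noteq> 0" for u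
    proof -
      obtain c d where "c \<in> L" "?h u x c" "d \<in> L" "?h u y d"
        using D(2)[rule_format, of u] E(2)[rule_format, of u] u by (auto simp: coeff_hom.meval_mult[OF i])
      then show ?thesis using has_val_add[OF i] closed by metis
    qed
    then show ?case using D(1) E(1) by (intro exI[of _ "D * E"]) auto
  next
    case (mult x y)
    obtain D where D: "D \<noteq> 0" "\<forall>u. ?e u D \<noteq> 0 \<longrightarrow> (\<exists>c\<in>L. ?h u x c)"
      using mult.IH(1) by (elim exE conjE)
    obtain E where E: "E \<noteq> 0" "\<forall>u. ?e u E \<noteq> 0 \<longrightarrow> (\<exists>c\<in>L. ?h u y c)"
      using mult.IH(2) by (elim exE conjE)
    have "\<exists>c\<in>L. ?h u (x * y) c" if u: "?e u (D * E) \<noteq> 0" for u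
    proof -
      obtain c d where "c \<in> L" "?h u x c" "d \<in> L" "?h u y d"
        using D(2)[rule_format, of u] E(2)[rule_format, of u] u by (auto simp: coeff_hom.meval_mult[OF i])
      then show ?thesis using has_val_mult[OF i] closed by metis
    qed
    then show ?case using D(1) E(1) by (intro exI[of _ "D * E"]) auto
  next
    case (minus x)
    obtain D where D: "D \<noteq> 0" "\<forall>u. ?e u D \<noteq> 0 \<longrightarrow> (\<exists>c\<in>L. ?h u x c)"
      using minus.IH by (elim exE conjE)
    have "\<exists>c\<in>L. ?h u (- x) c" if "?e u D \<noteq> 0" for u
      using D(2) that has_val_minus[OF i] closed by metis
    then show ?case using D(1) by (intro exI[of _ D]) auto
  next
    case (inverse x)
    obtain D where D: "D \<noteq> 0" "\<forall>u. ?e u D \<noteq> 0 \<longrightarrow> (\<exists>c\<in>L. ?h u x c)"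
      using inverse.IH by (elim exE conjE)
    \<comment> \<open>The numerator joins the excluded locus, so that the value of x is not
      0.\<close>
    obtain A B where AB: "B \<noteq> 0" "x = Fract A B" by (cases x) auto
    with inverse have "A \<noteq> 0" by (auto simp: fract_collapse)
    moreover have "\<exists>c\<in>L. ?h u (inverse x) c" if u: "?e u (D * (A * B)) \<noteq> 0" for u
    proof -
      obtain c where c: "c \<in> L" "?h u x c"
        using D(2)[rule_format, of u] u by (auto simp: coeff_hom.meval_mult[OF i])
      have "?h u x (?e u A / ?e u B)"
        using u unfolding AB(2) by (intro has_val_Fract[OF i]) (auto simp: coeff_hom.meval_mult[OF i])
      then have "c = ?e u A / ?e u B" using c has_val_unique[OF i] by blast
      then have "c \<noteq> 0" using u by (auto simp: coeff_hom.meval_mult[OF i])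
      then show ?thesis using has_val_inverse[OF i c(2)] c(1) L unfolding subfld_def by blast
    qed
    ultimately show ?case using D(1) AB(1) by (intro exI[of _ "D * (A * B)"]) auto
  }
qed

text \<open>L lies in L(y) = k(B), and writing its elements through B gives rational functions in
  variables indexed by B. Setting y to natural numbers is the identity on L and sends members of B
  to elements of L, the coordinates of \<tau>.\<close>

theorem stably_rational_retract_property:
  fixes \<iota> :: "'k :: field_char_0 \<Rightarrow> 'e :: field_char_0"
  assumes \<iota>: "coeff_hom \<iota>" "range \<iota> \<subseteq> L" and L: "subfld L" and rational: "stably_rational \<iota> L"
  shows "retract_property TYPE((nat, 'e) ratfun) \<iota> L"
proof -
  interpret subdomain_locale L using L by unfold_locales (simp add: subfld_def)
  define a where "a = (\<lambda>c. rf_const (\<iota> c) :: (nat, 'e) ratfun)"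
  obtain m B where B: "alg_independent (range a) B"
    "adjoin (rf_const ` L) (rf_var ` {..<m}) = adjoin (range a) B"
    using rational unfolding stably_rational_def purely_transcendental_def a_def by blast
  have a: "coeff_hom a"
    using coeff_hom_comp[OF coeff_hom_rf_const \<iota>(1)] by (simp add: a_def comp_def)
  note i = coeff_hom_id and c = coeff_hom_rf_const[where 'a = 'e and 'b = nat]
  define ev where "ev = meval a (\<lambda>b. b)"
  have ev: "coeff_hom ev" unfolding ev_def by (rule coeff_hom_meval[OF a])
  have ev_0: "p = 0" if "p \<in> vars_in B" "ev p = 0" for p
  proof -
    have "meval (\<lambda>c. c) (\<lambda>b. b) (mmap a p) = ev p"
      by (simp add: meval_mmap[OF i] ev_def comp_def)
    moreover have "mcoeff (mmap a p) k \<in> range a \<and> (mcoeff (mmap a p) k \<noteq> 0 \<longrightarrow> Poly_Mapping.keys k \<subseteq> B)" for k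
      using mmap_vars_in[OF a that(1)] by (simp add: mcoeff_mmap[OF a] vars_in_def)
    ultimately have "mmap a p = 0"
      using B(1) that(2) unfolding alg_independent_def by metis
    then have "a (mcoeff p k) = 0" for k
      by (metis mcoeff_mmap[OF a] mcoeff_simps(1))
    then show ?thesis
      using coeff_hom_eq_0_iff[OF a] by (intro mpoly_eqI) simp
  qed
  define R where "R x r \<longleftrightarrow> (\<exists>P Q. P \<in> vars_in B \<and> Q \<in> vars_in B \<and> ev Q \<noteq> 0 \<and>
    rf_const x * ev Q = ev P \<and> r = Fract P Q)" for x r
  have quotient: "\<exists>P Q. P \<in> vars_in B \<and> Q \<in> vars_in B \<and> ev Q \<noteq> 0 \<and> x * ev Q = ev P"
    if "x \<in> adjoin (range a) B" for x
    using that
  proof (induction rule: adjoin_induct)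
    case one
    show ?case
      using mconst_vars_in[of 1 B] by (intro exI[of _ 1]) (simp add: mconst.hom_one coeff_hom.hom_one[OF ev])
  next
    case (base x)
    then have "\<exists>P. P \<in> vars_in B \<and> ev P = x"
      unfolding ev_def
      by (metis UnE rangeE mconst_vars_in mvar_vars_in coeff_hom.meval_const[OF a] coeff_hom.meval_var[OF a])
    then obtain P where "P \<in> vars_in B" "ev P = x" by blast
    then show ?case
      using mconst_vars_in[of 1 B]
      by (intro exI[of _ P] exI[of _ 1]) (simp add: mconst.hom_one coeff_hom.hom_one[OF ev])
  next
    case (add x y)
    then obtain P Q P' Q' where *: "P \<in> vars_in B" "Q \<in> vars_in B" "ev Q \<noteq> 0" "x * ev Q = ev P"
      "P' \<in> vars_in B" "Q' \<in> vars_in B" "ev Q' \<noteq> 0" "y * ev Q' = ev P'" by blast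
    then have "(x + y) * ev (Q * Q') = ev (P * Q' + P' * Q)"
      by (simp add: coeff_hom.hom_mult[OF ev] coeff_hom.hom_add[OF ev] flip: *(4,8)) (simp add: algebra_simps)
    then show ?case
      using * by (intro exI[of _ "P * Q' + P' * Q"] exI[of _ "Q * Q'"])
        (simp add: coeff_hom.hom_mult[OF ev] add_vars_in mult_vars_in)
  next
    case (mult x y)
    then obtain P Q P' Q' where *: "P \<in> vars_in B" "Q \<in> vars_in B" "ev Q \<noteq> 0" "x * ev Q = ev P"
      "P' \<in> vars_in B" "Q' \<in> vars_in B" "ev Q' \<noteq> 0" "y * ev Q' = ev P'" by blast
    then have "(x * y) * ev (Q * Q') = ev (P * P')"
      by (simp add: coeff_hom.hom_mult[OF ev] flip: *(4,8))
    then show ?case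
      using * by (intro exI[of _ "P * P'"] exI[of _ "Q * Q'"])
        (simp add: coeff_hom.hom_mult[OF ev] mult_vars_in)
  next
    case (minus x)
    then obtain P Q where "P \<in> vars_in B" "Q \<in> vars_in B" "ev Q \<noteq> 0" "x * ev Q = ev P" by blast
    then show ?case
      by (intro exI[of _ "- P"] exI[of _ Q]) (simp add: minus_vars_in coeff_hom_minus[OF ev])
  next
    case (inverse x)
    then obtain P Q where "P \<in> vars_in B" "Q \<in> vars_in B" "ev Q \<noteq> 0" "x * ev Q = ev P" by blast
    moreover from this have "ev P \<noteq> 0" using inverse(2) by (metis mult_eq_0_iff)
    ultimately show ?case
      using inverse(2) by (intro exI[of _ Q] exI[of _ P]) (auto simp: field_simps)
  qed
  have in_B: "rf_const x \<in> adjoin (range a) B" if "x \<in> L" for x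
    unfolding B(2)[symmetric] using that by (intro adjoin_closed) auto
  show ?thesis
  proof (rule retract_propertyI[where R = R])
    show "subdomain L" "range \<iota> \<subseteq> L" using L \<iota> by (auto simp: subfld_def)
    show "\<exists>r. R x r" if "x \<in> L" for x
      using quotient[OF in_B[OF that]] unfolding R_def by blast
    show "r = r'" if r: "R x r" "R x r'" for x r r'
    proof -
      obtain P Q P' Q' where *: "P \<in> vars_in B" "Q \<in> vars_in B" "ev Q \<noteq> 0" "rf_const x * ev Q = ev P"
        "P' \<in> vars_in B" "Q' \<in> vars_in B" "ev Q' \<noteq> 0" "rf_const x * ev Q' = ev P'"
        "r = Fract P Q" "r' = Fract P' Q'"
        using r unfolding R_def by blast
      have "ev (P * Q' + - (P' * Q)) = 0"
        unfolding coeff_hom.hom_mult[OF ev] coeff_hom.hom_add[OF ev] coeff_hom_minus[OF ev] *(4,8)[symmetric]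
        by simp
      moreover have "P * Q' + - (P' * Q) \<in> vars_in B"
        using * by (intro add_vars_in minus_vars_in mult_vars_in)
      ultimately have "P * Q' = P' * Q" using ev_0 by fastforce
      moreover have "Q \<noteq> 0" "Q' \<noteq> 0" using * coeff_hom.hom_zero[OF ev] by auto
      ultimately show ?thesis using * by (simp add: eq_fract)
    qed
    show "R (x + y) (r + s)" if rs: "R x r" "R y s" for x y r s
    proof -
      obtain P Q P' Q' where *: "P \<in> vars_in B" "Q \<in> vars_in B" "ev Q \<noteq> 0" "rf_const x * ev Q = ev P"
        "P' \<in> vars_in B" "Q' \<in> vars_in B" "ev Q' \<noteq> 0" "rf_const y * ev Q' = ev P'"
        "r = Fract P Q" "s = Fract P' Q'"
        using rs unfolding R_def by blast
      have "rf_const (x + y) * ev (Q * Q') = ev (P * Q' + P' * Q)"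
        by (simp add: coeff_hom.hom_mult[OF ev] coeff_hom.hom_add[OF ev] coeff_hom.hom_add[OF c] flip: *(4,8))
           (simp add: algebra_simps)
      moreover have "Q \<noteq> 0" "Q' \<noteq> 0" using * coeff_hom.hom_zero[OF ev] by auto
      ultimately show ?thesis
        unfolding R_def using * by (intro exI[of _ "P * Q' + P' * Q"] exI[of _ "Q * Q'"])
          (simp add: coeff_hom.hom_mult[OF ev] add_vars_in mult_vars_in)
    qed
    show "R (x * y) (r * s)" if rs: "R x r" "R y s" for x y r s
    proof -
      obtain P Q P' Q' where *: "P \<in> vars_in B" "Q \<in> vars_in B" "ev Q \<noteq> 0" "rf_const x * ev Q = ev P"
        "P' \<in> vars_in B" "Q' \<in> vars_in B" "ev Q' \<noteq> 0" "rf_const y * ev Q' = ev P'"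
        "r = Fract P Q" "s = Fract P' Q'"
        using rs unfolding R_def by blast
      have "rf_const (x * y) * ev (Q * Q') = ev (P * P')"
        by (simp add: coeff_hom.hom_mult[OF ev] coeff_hom.hom_mult[OF c] flip: *(4,8))
      then show ?thesis
        unfolding R_def using * by (intro exI[of _ "P * P'"] exI[of _ "Q * Q'"])
          (simp add: coeff_hom.hom_mult[OF ev] mult_vars_in)
    qed
    show "R (\<iota> x) (rf_const x)" for x
    proof -
      have "(1 :: ((nat, 'e) ratfun, 'k) mpoly) \<in> vars_in B"
        using mconst_vars_in[of 1 B] by (simp add: mconst.hom_one)
      moreover have "ev (mconst x) = rf_const (\<iota> x)"
        by (simp add: ev_def coeff_hom.meval_const[OF a]) (simp add: a_def)
      moreover have "rf_const x = Fract (mconst x) 1"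
        by (simp add: rf_const_def to_fract_def)
      ultimately show ?thesis
        unfolding R_def using coeff_hom.hom_one[OF ev]
        by (intro exI[of _ "mconst x"] exI[of _ 1]) simp
    qed
    fix S assume S: "finite S" "S \<subseteq> L"
    have "\<forall>x\<in>S. \<exists>PQ. fst PQ \<in> vars_in B \<and> snd PQ \<in> vars_in B \<and> ev (snd PQ) \<noteq> 0 \<and>
        rf_const x * ev (snd PQ) = ev (fst PQ)"
    proof
      fix x assume "x \<in> S"
      then obtain P Q where "P \<in> vars_in B" "Q \<in> vars_in B" "ev Q \<noteq> 0" "rf_const x * ev Q = ev P"
        using quotient[OF in_B] S(2) by blast
      then show "\<exists>PQ. fst PQ \<in> vars_in B \<and> snd PQ \<in> vars_in B \<and> ev (snd PQ) \<noteq> 0 \<and>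
          rf_const x * ev (snd PQ) = ev (fst PQ)"
        by (intro exI[of _ "(P, Q)"]) simp
    qed
    then obtain PQ where PQ: "\<And>x. x \<in> S \<Longrightarrow> fst (PQ x) \<in> vars_in B" "\<And>x. x \<in> S \<Longrightarrow> snd (PQ x) \<in> vars_in B"
      "\<And>x. x \<in> S \<Longrightarrow> ev (snd (PQ x)) \<noteq> 0" "\<And>x. x \<in> S \<Longrightarrow> rf_const x * ev (snd (PQ x)) = ev (fst (PQ x))"
      by metis
    have "\<forall>p :: ((nat, 'e) ratfun, 'k) mpoly. \<exists>W. finite W \<and> p \<in> vars_in W" using finite_vars by blast
    then obtain W where W: "\<And>p :: ((nat, 'e) ratfun, 'k) mpoly. finite (W p)" "\<And>p :: ((nat, 'e) ratfun, 'k) mpoly. p \<in> vars_in (W p)"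
      by metis
    \<comment> \<open>Only the finitely many members of B needed for S have to be specialised;
      \<tau> is 0 at all others.\<close>
    define V where "V = B \<inter> (\<Union>x\<in>S. W (fst (PQ x)) \<union> W (snd (PQ x)))"
    have V: "finite V" "V \<subseteq> B" using S(1) W(1) by (auto simp: V_def)
    have in_V: "fst (PQ x) \<in> vars_in V" "snd (PQ x) \<in> vars_in V" if "x \<in> S" for x
      using W(2)[of "fst (PQ x)"] W(2)[of "snd (PQ x)"] PQ(1,2)[OF that] that
      unfolding vars_in_def V_def by fastforce+
    have "\<forall>b\<in>V. \<exists>D. D \<noteq> 0 \<and> (\<forall>u :: nat \<Rightarrow> nat. meval (\<lambda>c :: 'e. c) (\<lambda>i. of_nat (u i)) D \<noteq> 0 \<longrightarrow>
        (\<exists>c\<in>L. has_val (\<lambda>c. c) (\<lambda>i. of_nat (u i)) b c))"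
    proof
      fix b assume "b \<in> V"
      then have "b \<in> adjoin (range a) B" using V by (intro adjoin_closed) auto
      then show "\<exists>D. D \<noteq> 0 \<and> (\<forall>u :: nat \<Rightarrow> nat. meval (\<lambda>c :: 'e. c) (\<lambda>i. of_nat (u i)) D \<noteq> 0 \<longrightarrow>
          (\<exists>c\<in>L. has_val (\<lambda>c. c) (\<lambda>i. of_nat (u i)) b c))"
        using adjoin_rf_var_value[OF L] unfolding B(2)[symmetric] by blast
    qed
    from bchoice[OF this] obtain D where D: "\<forall>b\<in>V. D b \<noteq> 0 \<and> (\<forall>u :: nat \<Rightarrow> nat.
        meval (\<lambda>c :: 'e. c) (\<lambda>i. of_nat (u i)) (D b) \<noteq> 0 \<longrightarrow> (\<exists>c\<in>L. has_val (\<lambda>c. c) (\<lambda>i. of_nat (u i)) b c))"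
      by (elim exE)
    \<comment> \<open>The point has to avoid the excluded loci of the members of V and the zeros of
      the denominators.\<close>
    let ?S = "(\<lambda>b. to_fract (D b)) ` V \<union> (\<lambda>x. ev (snd (PQ x))) ` S"
    have "to_fract (D b) \<noteq> 0" if "b \<in> V" for b using D that by simp
    then have "0 \<notin> ?S" using PQ(3) by (metis (no_types, lifting) UnE imageE)
    moreover have "finite ?S" using V(1) S(1) by simp
    ultimately obtain u :: "nat \<Rightarrow> nat"
      where u: "\<forall>r\<in>?S. \<exists>c. c \<noteq> 0 \<and> has_val (\<lambda>c. c) (\<lambda>i. of_nat (u i)) r c"
      using nonvanishing_nat_point by metis
    let ?h = "has_val (\<lambda>c :: 'e. c) (\<lambda>i. of_nat (u i))"
    have u_nz: "c \<noteq> 0" if "r \<in> ?S" "?h r c" for r c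
      using u that(1) has_val_unique[OF i that(2)] by metis
    have "meval (\<lambda>c :: 'e. c) (\<lambda>i. of_nat (u i)) (D b) \<noteq> 0" if "b \<in> V" for b
      using that by (intro u_nz[OF _ has_val_to_fract[OF i]]) blast
    then have "\<forall>b\<in>V. \<exists>c\<in>L. ?h b c" using D by blast
    then obtain t where t: "\<And>b. b \<in> V \<Longrightarrow> t b \<in> L" "\<And>b. b \<in> V \<Longrightarrow> ?h b (t b)" by metis
    define \<tau> where "\<tau> b = (if b \<in> V then t b else 0)" for b
    have val: "?h (ev p) (meval \<iota> \<tau> p)" if "p \<in> vars_in V" for p
      unfolding ev_def
    proof (rule has_val_meval[OF i a \<iota>(1) _ _ that])
      show "?h (a c) (\<iota> c)" for c
        unfolding a_def rf_const_def by (rule has_val_const[OF i])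
    qed (simp add: \<tau>_def t)
    have "R x (Fract (fst (PQ x)) (snd (PQ x))) \<and> has_val \<iota> \<tau> (Fract (fst (PQ x)) (snd (PQ x))) x" if x: "x \<in> S" for x
    proof
      show "R x (Fract (fst (PQ x)) (snd (PQ x)))" unfolding R_def using PQ x by blast
      show "has_val \<iota> \<tau> (Fract (fst (PQ x)) (snd (PQ x))) x"
      proof (rule has_val_Fract[OF \<iota>(1)])
        show "meval \<iota> \<tau> (snd (PQ x)) \<noteq> 0"
          using x by (intro u_nz[OF _ val[OF in_V(2)[OF x]]]) blast
        have "?h (rf_const x * ev (snd (PQ x))) (x * meval \<iota> \<tau> (snd (PQ x)))"
          unfolding rf_const_def by (intro has_val_mult[OF i] has_val_const[OF i] val in_V x)
        then show "x * meval \<iota> \<tau> (snd (PQ x)) = meval \<iota> \<tau> (fst (PQ x))"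
          unfolding PQ(4)[OF x] by (rule has_val_unique[OF i]) (intro val in_V x)
      qed
    qed
    moreover have "range \<tau> \<subseteq> L" using t(1) by (auto simp: \<tau>_def)
    ultimately show "\<exists>\<tau>. range \<tau> \<subseteq> L \<and> (\<forall>x\<in>S. \<exists>r. R x r \<and> has_val \<iota> \<tau> r x)" by blast
  qed
qed

section \<open>Quasi-projective varieties\<close>

lemma homogeneous_iff:
  "homogeneous N d F \<longleftrightarrow>
    (\<forall>m. mcoeff F m \<noteq> 0 \<longrightarrow> Poly_Mapping.keys m \<subseteq> {..N} \<and> (\<Sum>i\<le>N. Poly_Mapping.lookup m i) = d)"
proof -
  have "(\<Sum>i\<in>Poly_Mapping.keys m. Poly_Mapping.lookup m i) = (\<Sum>i\<le>N. Poly_Mapping.lookup m i)"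
    if "Poly_Mapping.keys m \<subseteq> {..N}" for m :: "nat \<Rightarrow>\<^sub>0 nat"
    using that by (intro sum.mono_neutral_left) (auto simp: in_keys_iff)
  then show ?thesis unfolding homogeneous_def by metis
qed

lemma homogeneous_vars_in: "homogeneous N d F \<Longrightarrow> F \<in> vars_in {..N}"
  by (simp add: homogeneous_def vars_in_def)

lemma homogeneous_const: "homogeneous N 0 (mconst c)"
  by (auto simp: homogeneous_def mconst_def mcoeff_monom when_def)

lemma homogeneous_var: "i \<le> N \<Longrightarrow> homogeneous N 1 (mvar i)"
  by (auto simp: homogeneous_def mvar_def mcoeff_monom when_def split: if_splits)

lemma homogeneous_add: "homogeneous N d F \<Longrightarrow> homogeneous N d H \<Longrightarrow> homogeneous N d (F + H)"
  unfolding homogeneous_def by simp (metis add.right_neutral)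

lemma homogeneous_mult:
  assumes "homogeneous N d F" "homogeneous N e H"
  shows "homogeneous N (d + e) (F * H)"
  unfolding homogeneous_iff
proof (intro allI impI)
  fix m
  let ?k = "\<lambda>p. Poly_Mapping.keys (mapping_of p)"
  assume nz: "mcoeff (F * H) m \<noteq> 0"
  have sum: "mcoeff (sum f A) m = (\<Sum>x\<in>A. mcoeff (f x) m)"
    for f :: "(nat \<Rightarrow>\<^sub>0 nat) \<Rightarrow> (nat, 'a) mpoly" and A
    by (induction A rule: infinite_finite_induct) auto
  have "F * H = (\<Sum>a\<in>?k F. \<Sum>b\<in>?k H. mmonom (a + b) (mcoeff F a * mcoeff H b))"
    unfolding mmonom_mult[symmetric] sum_product[symmetric]
    by (rule arg_cong2[where f = "(*)", OF mpoly_sum_monoms mpoly_sum_monoms])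
  then have "(\<Sum>a\<in>?k F. \<Sum>b\<in>?k H. (mcoeff F a * mcoeff H b) when a + b = m) \<noteq> 0"
    using nz by (simp add: sum mcoeff_monom)
  then obtain a where "(\<Sum>b\<in>?k H. (mcoeff F a * mcoeff H b) when a + b = m) \<noteq> 0"
    by (meson sum.not_neutral_contains_not_neutral)
  then obtain b where "((mcoeff F a * mcoeff H b) when a + b = m) \<noteq> 0"
    by (meson sum.not_neutral_contains_not_neutral)
  then have ab: "mcoeff F a \<noteq> 0" "mcoeff H b \<noteq> 0" "m = a + b"
    by (auto simp: when_def split: if_splits)
  then show "Poly_Mapping.keys m \<subseteq> {..N} \<and> (\<Sum>i\<le>N. Poly_Mapping.lookup m i) = d + e"
    using assms keys_add[of a b] unfolding homogeneous_iff
    by (simp add: lookup_add sum.distrib) (meson Un_least subset_trans)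
qed

lemma homogeneous_minus: "homogeneous N d F \<Longrightarrow> homogeneous N d (- F)"
  using homogeneous_mult[OF homogeneous_const[of N "- 1"], of d F]
  by (simp add: coeff_hom_minus[OF mconst.coeff_hom_axioms] mconst.hom_one)

lemma meval_scale:
  assumes "homogeneous N d F"
  shows "meval h (\<lambda>i. c * v i) F = c ^ d * meval h v F"
proof -
  have "monom_eval (\<lambda>i. c * v i) m = c ^ d * monom_eval v m" if "m \<in> Poly_Mapping.keys (mapping_of F)" for m
    using that assms
    by (auto simp: monom_eval_def homogeneous_def keys_mapping_of power_mult_distrib prod.distrib power_sum)
  then show ?thesis
    unfolding meval_def sum_distrib_left by (intro sum.cong) (auto simp: algebra_simps)
qed

definition proj_point :: "(nat \<Rightarrow> 'k :: field alg_closure) \<Rightarrow> 'k point" where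
  "proj_point v = {\<lambda>i. c * v i | c. c \<noteq> 0}"

lemma proj_point_self: "v \<in> proj_point v"
  unfolding proj_point_def by (rule CollectI, rule exI[of _ 1]) simp

lemma proj_point_in: "v i \<noteq> 0 \<Longrightarrow> (\<And>j. j > N \<Longrightarrow> v j = 0) \<Longrightarrow> proj_point v \<in> proj_space N"
  unfolding proj_space_def proj_point_def by blast

lemma proj_spaceD:
  assumes "P \<in> proj_space N" "v \<in> P"
  shows "P = proj_point v" "i > N \<Longrightarrow> v i = 0"
proof -
  obtain u where u: "P = proj_point u" "\<And>i. i > N \<Longrightarrow> u i = 0"
    using assms(1) unfolding proj_space_def proj_point_def by blast
  then obtain c where c: "c \<noteq> 0" "v = (\<lambda>i. c * u i)"
    using assms(2) unfolding proj_point_def by blast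
  show "P = proj_point v"
  proof (intro equalityI subsetI)
    fix x assume "x \<in> P"
    then obtain d where "d \<noteq> 0" "x = (\<lambda>i. d * u i)" unfolding u(1) proj_point_def by blast
    then have "d / c \<noteq> 0" "x = (\<lambda>i. (d / c) * v i)" using c by auto
    then show "x \<in> proj_point v" unfolding proj_point_def by blast
  next
    fix x assume "x \<in> proj_point v"
    then obtain d where "d \<noteq> 0" "x = (\<lambda>i. d * v i)" unfolding proj_point_def by blast
    then have "d * c \<noteq> 0" "x = (\<lambda>i. (d * c) * u i)" using c by (auto simp: algebra_simps)
    then show "x \<in> P" unfolding u(1) proj_point_def by blast
  qed
  show "i > N \<Longrightarrow> v i = 0" using u(2) c(2) by simp
qed

lemma proj_space_nonempty: "P \<in> proj_space N \<Longrightarrow> \<exists>v. v \<in> P"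
  unfolding proj_space_def using proj_point_self unfolding proj_point_def by blast

lemma meval_proj_eq_0:
  assumes "P \<in> proj_space N" "v \<in> P" "w \<in> P" "homogeneous N d F" "meval h v F = 0"
  shows "meval h w F = 0"
proof -
  obtain c where "w = (\<lambda>i. c * v i)"
    using proj_spaceD(1)[OF assms(1,2)] assms(3) unfolding proj_point_def by blast
  then show ?thesis using meval_scale[OF assms(4), of h c v] assms(5) by simp
qed

lemma zariski_closed_zeros:
  assumes "homogeneous N d F"
  shows "zariski_closed N {P \<in> proj_space N. \<forall>v\<in>P. meval to_ac v F = 0}"
  unfolding zariski_closed_def using assms by (intro exI[of _ "{F}"]) auto

lemma zariski_closed_empty: "zariski_closed N ({} :: 'k :: field point set)"
proof -
  have empty: "{P \<in> proj_space N. \<forall>v\<in>P. meval to_ac v (mconst 1 :: (nat, 'k) mpoly) = 0} = {}"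
    using proj_space_nonempty by (auto simp: coeff_hom.meval_const[OF coeff_hom_to_ac])
  show ?thesis by (rule zariski_closed_zeros[OF homogeneous_const, of N "1 :: 'k", unfolded empty])
qed

lemma zariski_closed_Un:
  assumes "zariski_closed N (A :: 'k :: field point set)" "zariski_closed N B"
  shows "zariski_closed N (A \<union> B)"
proof -
  obtain S T :: "(nat, 'k) mpoly set" where S: "\<forall>F\<in>S. \<exists>d. homogeneous N d F" "A = {P \<in> proj_space N. \<forall>F\<in>S. \<forall>v\<in>P. meval to_ac v F = 0}"
    and T: "\<forall>F\<in>T. \<exists>d. homogeneous N d F" "B = {P \<in> proj_space N. \<forall>F\<in>T. \<forall>v\<in>P. meval to_ac v F = 0}"
    using assms unfolding zariski_closed_def by blast
  let ?Q = "(\<lambda>(F, H). F * H) ` (S \<times> T)"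
  note m = coeff_hom.meval_mult[OF coeff_hom_to_ac]
  have "A \<union> B = {P \<in> proj_space N. \<forall>F\<in>?Q. \<forall>v\<in>P. meval to_ac v F = 0}"
  proof (intro equalityI subsetI)
    fix P assume "P \<in> A \<union> B"
    then show "P \<in> {P \<in> proj_space N. \<forall>F\<in>?Q. \<forall>v\<in>P. meval to_ac v F = 0}"
      unfolding S T by (auto simp: m)
  next
    fix P assume P: "P \<in> {P \<in> proj_space N. \<forall>F\<in>?Q. \<forall>v\<in>P. meval to_ac v F = 0}"
    show "P \<in> A \<union> B"
    proof (rule ccontr)
      assume "P \<notin> A \<union> B"
      then obtain F v H w where *: "F \<in> S" "v \<in> P" "meval to_ac v F \<noteq> 0" "H \<in> T" "w \<in> P" "meval to_ac w H \<noteq> 0"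
        using P unfolding S T by auto
      moreover obtain d where "homogeneous N d H" using T(1) * by blast
      \<comment> \<open>The two forms may be nonzero at different coordinate vectors of P;
        homogeneity brings both to the same vector.\<close>
      ultimately have "meval to_ac v H \<noteq> 0" using P meval_proj_eq_0 by blast
      then have "meval to_ac v (F * H) \<noteq> 0" using * by (simp add: m)
      then show False using P * by force
    qed
  qed
  moreover have "\<forall>F\<in>?Q. \<exists>d. homogeneous N d F" using S(1) T(1) homogeneous_mult by fastforce
  ultimately show ?thesis unfolding zariski_closed_def by blast
qed

lemma open_in_self: "open_in N X X"
  unfolding open_in_def using zariski_closed_empty by (intro exI[of _ "{}"]) simp

lemma open_in_subset: "open_in N X U \<Longrightarrow> U \<subseteq> X"
  by (auto simp: open_in_def)

lemma open_in_trans: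
  assumes "open_in N X U" "open_in N U V"
  shows "open_in N X V"
proof -
  obtain A B where "zariski_closed N A" "U = X - A" "zariski_closed N B" "V = U - B"
    using assms unfolding open_in_def by blast
  then show ?thesis
    unfolding open_in_def using zariski_closed_Un[of N A B] by (intro exI[of _ "A \<union> B"]) auto
qed

lemma open_in_Int:
  assumes "open_in N X U" "open_in N X V"
  shows "open_in N X (U \<inter> V)"
proof -
  obtain A B where "zariski_closed N A" "U = X - A" "zariski_closed N B" "V = X - B"
    using assms unfolding open_in_def by blast
  then show ?thesis
    unfolding open_in_def using zariski_closed_Un[of N A B] by (intro exI[of _ "A \<union> B"]) auto
qed

lemma open_in_restrict: "open_in N X U \<Longrightarrow> V \<subseteq> X \<Longrightarrow> open_in N V (U \<inter> V)"
  unfolding open_in_def by blast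

lemma irreducible_open_Int:
  assumes "irreducible_variety N X" "open_in N X U" "U \<noteq> {}" "open_in N X V" "V \<noteq> {}"
  shows "U \<inter> V \<noteq> {}"
proof
  assume empty: "U \<inter> V = {}"
  obtain A B where AB: "zariski_closed N A" "U = X - A" "zariski_closed N B" "V = X - B"
    using assms(2,4) unfolding open_in_def by blast
  then have "X \<subseteq> A \<union> B" using empty by blast
  then have "X \<subseteq> A \<or> X \<subseteq> B" using assms(1) AB(1,3) by (simp add: irreducible_variety_def)
  then show False using AB(2,4) assms(3,5) by blast
qed

lemma irreducible_subset_proj_space: "irreducible_variety N X \<Longrightarrow> X \<subseteq> proj_space N"
  unfolding irreducible_variety_def quasi_projective_def zariski_closed_def by blast

lemma regular_on_open:
  assumes "regular_on N U f" "open_in N U V"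
  shows "regular_on N V f"
  unfolding regular_on_def
proof
  fix P assume P: "P \<in> V"
  then have "P \<in> U" using open_in_subset[OF assms(2)] by blast
  then obtain A d F H where A: "open_in N U A" "P \<in> A" "homogeneous N d F" "homogeneous N d H"
    "\<forall>Q\<in>A. \<forall>v\<in>Q. meval to_ac v H \<noteq> 0 \<and> f Q = meval to_ac v F / meval to_ac v H"
    using assms(1) unfolding regular_on_def by blast
  have "open_in N V (A \<inter> V)"
    by (rule open_in_restrict[OF A(1) open_in_subset[OF assms(2)]])
  then show "\<exists>U d F H. open_in N V U \<and> P \<in> U \<and> homogeneous N d F \<and> homogeneous N d H \<and>
      (\<forall>Q\<in>U. \<forall>v\<in>Q. meval to_ac v H \<noteq> 0 \<and> f Q = meval to_ac v F / meval to_ac v H)"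
  proof (intro exI conjI)
    show "open_in N V (A \<inter> V)" by fact
    show "\<forall>Q\<in>A \<inter> V. \<forall>v\<in>Q. meval to_ac v H \<noteq> 0 \<and> f Q = meval to_ac v F / meval to_ac v H" using A(5) by blast
  qed (use A P in auto)
qed

lemma regular_on_const: "regular_on N U (\<lambda>_. to_ac c)"
  unfolding regular_on_def
proof
  fix P assume P: "P \<in> U"
  show "\<exists>A d F H. open_in N U A \<and> P \<in> A \<and> homogeneous N d F \<and> homogeneous N d H \<and>
      (\<forall>Q\<in>A. \<forall>v\<in>Q. meval to_ac v H \<noteq> 0 \<and> to_ac c = meval to_ac v F / meval to_ac v H)"
  proof (intro exI conjI)
    show "open_in N U U" by (rule open_in_self)
    show "homogeneous N 0 (mconst c)" "homogeneous N 0 (mconst 1)" by (rule homogeneous_const)+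
  qed (simp_all add: P coeff_hom.meval_const[OF coeff_hom_to_ac])
qed

lemma regular_on_add_mult:
  assumes "regular_on N U f" "regular_on N U g"
  shows "regular_on N U (\<lambda>P. f P + g P)" "regular_on N U (\<lambda>P. f P * g P)"
proof -
  note h = coeff_hom.meval_mult[OF coeff_hom_to_ac] coeff_hom.meval_add[OF coeff_hom_to_ac]
  have "(\<exists>A d F H. open_in N U A \<and> P \<in> A \<and> homogeneous N d F \<and> homogeneous N d H \<and>
        (\<forall>Q\<in>A. \<forall>v\<in>Q. meval to_ac v H \<noteq> 0 \<and> f Q + g Q = meval to_ac v F / meval to_ac v H)) \<and>
      (\<exists>A d F H. open_in N U A \<and> P \<in> A \<and> homogeneous N d F \<and> homogeneous N d H \<and>
        (\<forall>Q\<in>A. \<forall>v\<in>Q. meval to_ac v H \<noteq> 0 \<and> f Q * g Q = meval to_ac v F / meval to_ac v H))"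
    if P: "P \<in> U" for P
  proof -
    obtain A d F H where A: "open_in N U A" "P \<in> A" "homogeneous N d F" "homogeneous N d H"
      "\<forall>Q\<in>A. \<forall>v\<in>Q. meval to_ac v H \<noteq> 0 \<and> f Q = meval to_ac v F / meval to_ac v H"
      using assms(1) P unfolding regular_on_def by blast
    obtain B e F' H' where B: "open_in N U B" "P \<in> B" "homogeneous N e F'" "homogeneous N e H'"
      "\<forall>Q\<in>B. \<forall>v\<in>Q. meval to_ac v H' \<noteq> 0 \<and> g Q = meval to_ac v F' / meval to_ac v H'"
      using assms(2) P unfolding regular_on_def by blast
    have "homogeneous N (d + e) (F * H' + F' * H)"
      using homogeneous_add homogeneous_mult[OF A(3) B(4)] homogeneous_mult[OF B(3) A(4)]
      by (metis add.commute)
    moreover have "homogeneous N (d + e) (H * H')" "homogeneous N (d + e) (F * F')"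
      by (intro homogeneous_mult A B)+
    moreover have "open_in N U (A \<inter> B)" "P \<in> A \<inter> B" using open_in_Int A(1,2) B(1,2) by auto
    moreover have "\<forall>Q\<in>A \<inter> B. \<forall>v\<in>Q. meval to_ac v (H * H') \<noteq> 0 \<and>
        f Q + g Q = meval to_ac v (F * H' + F' * H) / meval to_ac v (H * H') \<and>
        f Q * g Q = meval to_ac v (F * F') / meval to_ac v (H * H')"
    proof (intro ballI)
      fix Q v assume Q: "Q \<in> A \<inter> B" "v \<in> Q"
      have "meval to_ac v H \<noteq> 0" "f Q = meval to_ac v F / meval to_ac v H" using A(5) Q by blast+
      moreover have "meval to_ac v H' \<noteq> 0" "g Q = meval to_ac v F' / meval to_ac v H'" using B(5) Q by blast+
      ultimately show "meval to_ac v (H * H') \<noteq> 0 \<and>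
          f Q + g Q = meval to_ac v (F * H' + F' * H) / meval to_ac v (H * H') \<and>
          f Q * g Q = meval to_ac v (F * F') / meval to_ac v (H * H')"
        by (simp add: h add_frac_eq)
    qed
    note AB = calculation this
    show ?thesis
      by (rule conjI; intro exI conjI; (rule AB)?; use AB in simp)
  qed
  then show "regular_on N U (\<lambda>P. f P + g P)" "regular_on N U (\<lambda>P. f P * g P)"
    unfolding regular_on_def by simp_all
qed

text \<open>Where two regular functions agree is locally the zero set of a form.\<close>

lemma regular_identity:
  assumes X: "irreducible_variety N X" and germs: "(U, f) \<in> germ_pairs N X" "(V, g) \<in> germ_pairs N X"
    and W: "open_in N X W" "W \<noteq> {}" "\<And>P. P \<in> W \<Longrightarrow> f P = g P" and P: "P \<in> U" "P \<in> V"
  shows "f P = g P"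
proof -
  have UV: "open_in N X U" "open_in N X V" "regular_on N U f" "regular_on N V g"
    using germs by (auto simp: germ_pairs_def)
  obtain A d F H where A: "open_in N U A" "P \<in> A" "homogeneous N d F" "homogeneous N d H"
    "\<forall>Q\<in>A. \<forall>v\<in>Q. meval to_ac v H \<noteq> 0 \<and> f Q = meval to_ac v F / meval to_ac v H"
    using UV(3) P unfolding regular_on_def by blast
  obtain B e F' H' where B: "open_in N V B" "P \<in> B" "homogeneous N e F'" "homogeneous N e H'"
    "\<forall>Q\<in>B. \<forall>v\<in>Q. meval to_ac v H' \<noteq> 0 \<and> g Q = meval to_ac v F' / meval to_ac v H'"
    using UV(4) P unfolding regular_on_def by blast
  define E where "E = F * H' + - (F' * H)"
  have E: "meval to_ac v E = meval to_ac v F * meval to_ac v H' - meval to_ac v F' * meval to_ac v H" for v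
    by (simp add: E_def coeff_hom.meval_mult[OF coeff_hom_to_ac] coeff_hom.meval_add[OF coeff_hom_to_ac]
        coeff_hom_minus[OF coeff_hom_meval[OF coeff_hom_to_ac]] coeff_hom_diff[OF coeff_hom_meval[OF coeff_hom_to_ac]])
  have "homogeneous N (d + e) E"
    unfolding E_def using homogeneous_add homogeneous_mult[OF A(3) B(4)]
      homogeneous_minus[OF homogeneous_mult[OF B(3) A(4)]] by (metis add.commute)
  note Z = zariski_closed_zeros[OF this]
  have AB: "open_in N X (A \<inter> B)"
    using open_in_trans UV(1,2) A(1) B(1) open_in_Int by blast
  moreover have "A \<inter> B \<noteq> {}" using A(2) B(2) by blast
  ultimately have "A \<inter> B \<inter> W \<noteq> {}" using irreducible_open_Int[OF X _ _ W(1,2)] by blast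
  moreover obtain C where C: "zariski_closed N C" "A \<inter> B \<inter> W = X - C"
    using open_in_Int[OF AB W(1)] unfolding open_in_def by blast
  moreover have on: "Q \<in> {P \<in> proj_space N. \<forall>v\<in>P. meval to_ac v E = 0}" if "Q \<in> A \<inter> B \<inter> W" for Q
  proof -
    have "Q \<in> proj_space N" using that C irreducible_subset_proj_space[OF X] by blast
    moreover have "meval to_ac v E = 0" if "v \<in> Q" for v
      using A(5) B(5) W(3)[of Q] \<open>Q \<in> A \<inter> B \<inter> W\<close> that by (auto simp: E frac_eq_eq)
    ultimately show ?thesis by blast
  qed
  ultimately have "X \<subseteq> {P \<in> proj_space N. \<forall>v\<in>P. meval to_ac v E = 0} \<union> C" "\<not> X \<subseteq> C" by blast+
  then have "X \<subseteq> {P \<in> proj_space N. \<forall>v\<in>P. meval to_ac v E = 0}"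
    using X Z C(1) unfolding irreducible_variety_def by blast
  moreover have PX: "P \<in> X" using P(1) open_in_subset[OF UV(1)] by blast
  moreover obtain v where "v \<in> P" using proj_space_nonempty irreducible_subset_proj_space[OF X] PX by blast
  ultimately show ?thesis using A(2,5) B(2,5) by (auto simp: E frac_eq_eq)
qed

section \<open>Germs and the function field\<close>

lemma germ_rel_iff:
  "((U, f), (V, g)) \<in> germ_rel N X \<longleftrightarrow>
    (U, f) \<in> germ_pairs N X \<and> (V, g) \<in> germ_pairs N X \<and> (\<forall>P\<in>U \<inter> V. f P = g P)"
  by (simp add: germ_rel_def)

text \<open>Transitivity needs irreducibility: f and h agree on the triple intersection, which is
  nonempty, and hence by \<open>regular_identity\<close> wherever both are defined.\<close>

lemma equiv_germ_rel:
  assumes X: "irreducible_variety N X"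
  shows "equiv (germ_pairs N X) (germ_rel N X)"
proof (rule equivI)
  show "germ_rel N X \<subseteq> germ_pairs N X \<times> germ_pairs N X"
    by (auto simp: germ_rel_def)
  show "refl_on (germ_pairs N X) (germ_rel N X)"
    by (auto simp: refl_on_def germ_rel_iff)
  show "sym (germ_rel N X)"
    by (auto simp: sym_def germ_rel_def)
  show "trans (germ_rel N X)"
  proof (rule transI)
    fix x y z assume "(x, y) \<in> germ_rel N X" "(y, z) \<in> germ_rel N X"
    moreover obtain U f V g W h where xyz: "x = (U, f)" "y = (V, g)" "z = (W, h)" by (cases x, cases y, cases z) auto
    ultimately have *: "(U, f) \<in> germ_pairs N X" "(V, g) \<in> germ_pairs N X" "(W, h) \<in> germ_pairs N X"
      "\<And>P. P \<in> U \<inter> V \<Longrightarrow> f P = g P" "\<And>P. P \<in> V \<inter> W \<Longrightarrow> g P = h P"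
      by (auto simp: germ_rel_iff)
    have UVW: "open_in N X U" "U \<noteq> {}" "open_in N X V" "V \<noteq> {}" "open_in N X W" "W \<noteq> {}"
      using *(1-3) by (auto simp: germ_pairs_def)
    note UV = open_in_Int[OF UVW(1,3)] irreducible_open_Int[OF X UVW(1-4)]
    have "f P = h P" if "P \<in> U \<inter> V \<inter> W" for P using that *(4,5) by auto
    then have "f P = h P" if "P \<in> U \<inter> W" for P
      using regular_identity[OF X *(1,3) open_in_Int[OF UV(1) UVW(5)] irreducible_open_Int[OF X UV UVW(5,6)]] that
      by blast
    then show "(x, z) \<in> germ_rel N X" using * by (simp add: xyz germ_rel_iff)
  qed
qed

lemma germ_pairs_add_mult:
  assumes X: "irreducible_variety N X" and "(U, f) \<in> germ_pairs N X" "(V, g) \<in> germ_pairs N X"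
  shows "(U \<inter> V, \<lambda>P. f P + g P) \<in> germ_pairs N X" "(U \<inter> V, \<lambda>P. f P * g P) \<in> germ_pairs N X"
proof -
  have UV: "open_in N X U" "U \<noteq> {}" "regular_on N U f" "open_in N X V" "V \<noteq> {}" "regular_on N V g"
    using assms by (auto simp: germ_pairs_def)
  note open_in_restrict[OF UV(4) open_in_subset[OF UV(1)]] open_in_restrict[OF UV(1) open_in_subset[OF UV(4)]]
  then have "regular_on N (U \<inter> V) f" "regular_on N (U \<inter> V) g"
    using regular_on_open UV(3,6) by (metis Int_commute)+
  then show "(U \<inter> V, \<lambda>P. f P + g P) \<in> germ_pairs N X" "(U \<inter> V, \<lambda>P. f P * g P) \<in> germ_pairs N X"
    using open_in_Int[OF UV(1,4)] irreducible_open_Int[OF X UV(1,2,4,5)]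
    by (simp_all add: germ_pairs_def regular_on_add_mult)
qed

lemma germ_pairs_const: "irreducible_variety N X \<Longrightarrow> (X, \<lambda>_. to_ac c) \<in> germ_pairs N X"
  by (simp add: germ_pairs_def open_in_self regular_on_const irreducible_variety_def)

text \<open>The operations of \<open>function_field\<close> are unions over all pairs of
  representatives; every member of such a union is the same class.\<close>

lemma germ_class_op:
  assumes X: "irreducible_variety N X" and UV: "(U, f) \<in> germ_pairs N X" "(V, g) \<in> germ_pairs N X"
    and closed: "\<And>U V f g. (U, f) \<in> germ_pairs N X \<Longrightarrow> (V, g) \<in> germ_pairs N X \<Longrightarrow>
      (U \<inter> V, \<lambda>P. op (f P) (g P)) \<in> germ_pairs N X"
  shows "(\<Union>(U, f)\<in>germ_rel N X `` {(U, f)}. \<Union>(V, g)\<in>germ_rel N X `` {(V, g)}.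
      germ_rel N X `` {(U \<inter> V, \<lambda>P. op (f P) (g P))}) = germ_rel N X `` {(U \<inter> V, \<lambda>P. op (f P) (g P))}"
    (is "?lhs = ?C U f V g")
proof -
  note E = equiv_germ_rel[OF X]
  have C: "?C U' f' V' g' = ?C U f V g"
    if "(U', f') \<in> germ_rel N X `` {(U, f)}" "(V', g') \<in> germ_rel N X `` {(V, g)}" for U' f' V' g'
  proof -
    have *: "(U', f') \<in> germ_pairs N X" "(V', g') \<in> germ_pairs N X"
      "\<forall>P\<in>U \<inter> U'. f P = f' P" "\<forall>P\<in>V \<inter> V'. g P = g' P"
      using that by (auto simp: germ_rel_iff)
    have "((U \<inter> V, \<lambda>P. op (f P) (g P)), (U' \<inter> V', \<lambda>P. op (f' P) (g' P))) \<in> germ_rel N X"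
      using * closed[OF UV] closed[OF *(1,2)] by (simp add: germ_rel_iff)
    then show ?thesis by (rule equiv_class_eq[OF E, symmetric])
  qed
  have "?lhs = (\<Union>x\<in>germ_rel N X `` {(U, f)}. \<Union>y\<in>germ_rel N X `` {(V, g)}. ?C U f V g)"
  proof (intro SUP_cong refl)
    fix x assume x: "x \<in> germ_rel N X `` {(U, f)}"
    obtain U' f' where U': "x = (U', f')" by (cases x)
    have "(case y of (V', g') \<Rightarrow> ?C U' f' V' g') = ?C U f V g" if y: "y \<in> germ_rel N X `` {(V, g)}" for y
      using C[of U' f' "fst y" "snd y"] x y by (simp add: U' case_prod_unfold)
    then show "(case x of (U', f') \<Rightarrow> \<Union>(V', g')\<in>germ_rel N X `` {(V, g)}. ?C U' f' V' g') =
        (\<Union>y\<in>germ_rel N X `` {(V, g)}. ?C U f V g)"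
      unfolding U' prod.case by (intro SUP_cong refl)
  qed
  moreover have "germ_rel N X `` {(U, f)} \<noteq> {}" "germ_rel N X `` {(V, g)} \<noteq> {}"
    using equiv_class_self[OF E UV(1)] equiv_class_self[OF E UV(2)] by blast+
  ultimately show ?thesis by simp
qed

text \<open>An isomorphism from the function field, as a map \<open>\<gamma>\<close> on the representatives of germs.\<close>

lemma function_field_germs:
  fixes \<iota> :: "'k :: field \<Rightarrow> 'e :: field" and X :: "'k point set"
  assumes X: "irreducible_variety N X" and L: "is_function_field \<iota> L N X"
  obtains \<gamma> :: "'k point set \<Rightarrow> ('k point \<Rightarrow> 'k alg_closure) \<Rightarrow> 'e" where
    "\<And>U f. (U, f) \<in> germ_pairs N X \<Longrightarrow> \<gamma> U f \<in> L"
    "\<And>x. x \<in> L \<Longrightarrow> \<exists>U f. (U, f) \<in> germ_pairs N X \<and> \<gamma> U f = x"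
    "\<And>U f V g. (U, f) \<in> germ_pairs N X \<Longrightarrow> (V, g) \<in> germ_pairs N X \<Longrightarrow>
      \<gamma> U f = \<gamma> V g \<longleftrightarrow> (\<forall>P\<in>U \<inter> V. f P = g P)"
    "\<And>U f V g. (U, f) \<in> germ_pairs N X \<Longrightarrow> (V, g) \<in> germ_pairs N X \<Longrightarrow>
      \<gamma> (U \<inter> V) (\<lambda>P. f P + g P) = \<gamma> U f + \<gamma> V g"
    "\<And>U f V g. (U, f) \<in> germ_pairs N X \<Longrightarrow> (V, g) \<in> germ_pairs N X \<Longrightarrow>
      \<gamma> (U \<inter> V) (\<lambda>P. f P * g P) = \<gamma> U f * \<gamma> V g"
    "\<And>c. \<gamma> X (\<lambda>_. to_ac c) = \<iota> c"
proof -
  let ?F = "function_field N X"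
  obtain \<theta> where \<theta>: "\<theta> \<in> ring_iso ?F (ring_of_type_algebra\<lparr>carrier := L\<rparr>)" "\<And>c. \<theta> (germ_const N X c) = \<iota> c"
    using L unfolding is_function_field_def by blast
  note E = equiv_germ_rel[OF X]
  define C where "C U f = germ_rel N X `` {(U, f)}" for U f
  have carrier: "carrier ?F = germ_pairs N X // germ_rel N X"
    by (simp add: function_field_def)
  have C: "C U f \<in> carrier ?F" if "(U, f) \<in> germ_pairs N X" for U f
    unfolding carrier C_def using that by (rule quotientI)
  have hom: "\<theta> \<in> ring_hom ?F (ring_of_type_algebra\<lparr>carrier := L\<rparr>)" and bij: "bij_betw \<theta> (carrier ?F) L"
    using \<theta>(1) by (auto simp: ring_iso_def)
  show thesis
  proof (rule that[of "\<lambda>U f. \<theta> (C U f)"])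
    show "\<theta> (C U f) \<in> L" if "(U, f) \<in> germ_pairs N X" for U f
      using bij_betwE[OF bij] C[OF that] by blast
    show "\<exists>U f. (U, f) \<in> germ_pairs N X \<and> \<theta> (C U f) = x" if x: "x \<in> L" for x
    proof -
      have "x \<in> \<theta> ` carrier ?F" using bij_betw_imp_surj_on[OF bij] x by simp
      then obtain p where "p \<in> germ_pairs N X" "x = \<theta> (germ_rel N X `` {p})"
        unfolding carrier quotient_def by blast
      then show ?thesis unfolding C_def by (metis surj_pair)
    qed
    show "\<theta> (C U f) = \<theta> (C V g) \<longleftrightarrow> (\<forall>P\<in>U \<inter> V. f P = g P)"
      if "(U, f) \<in> germ_pairs N X" "(V, g) \<in> germ_pairs N X" for U f V g
    proof -
      have "\<theta> (C U f) = \<theta> (C V g) \<longleftrightarrow> C U f = C V g"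
        using inj_on_eq_iff[OF bij_betw_imp_inj_on[OF bij]] C that by metis
      also have "\<dots> \<longleftrightarrow> ((U, f), (V, g)) \<in> germ_rel N X"
        unfolding C_def using eq_equiv_class_iff[OF E that] by simp
      finally show ?thesis using that by (simp add: germ_rel_iff)
    qed
    fix U f V g assume UV: "(U, f) \<in> germ_pairs N X" "(V, g) \<in> germ_pairs N X"
    have "C U f \<oplus>\<^bsub>?F\<^esub> C V g = C (U \<inter> V) (\<lambda>P. f P + g P)"
      using germ_class_op[OF X UV germ_pairs_add_mult(1)[OF X]] by (simp add: function_field_def C_def)
    then show "\<theta> (C (U \<inter> V) (\<lambda>P. f P + g P)) = \<theta> (C U f) + \<theta> (C V g)"
      using ring_hom_add[OF hom C[OF UV(1)] C[OF UV(2)]] by (simp add: ring_of_type_algebra_def)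
    have "C U f \<otimes>\<^bsub>?F\<^esub> C V g = C (U \<inter> V) (\<lambda>P. f P * g P)"
      using germ_class_op[OF X UV germ_pairs_add_mult(2)[OF X]] by (simp add: function_field_def C_def)
    then show "\<theta> (C (U \<inter> V) (\<lambda>P. f P * g P)) = \<theta> (C U f) * \<theta> (C V g)"
      using ring_hom_mult[OF hom C[OF UV(1)] C[OF UV(2)]] by (simp add: ring_of_type_algebra_def)
  next
    show "\<theta> (C X (\<lambda>_. to_ac c)) = \<iota> c" for c
      using \<theta>(2)[of c] by (simp add: germ_const_def C_def)
  qed
qed

text \<open>Multiply E by one equation of the complement of A and by the coordinate of the chart. A
  natural number point where the product is nonzero lies in A, but E does not vanish there.\<close>

lemma dense_open_affine:
  fixes E :: "(nat, 'k :: field_char_0) mpoly"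
  assumes A: "open_in m (affine_space m) A" "A \<noteq> {}" and E: "E \<in> vars_in {..m}"
    and zero: "\<And>P v. P \<in> A \<Longrightarrow> v \<in> P \<Longrightarrow> meval to_ac v E = 0"
  shows "E = 0"
proof (rule ccontr)
  assume nz: "E \<noteq> 0"
  note h = coeff_hom_to_ac[where 'a = 'k]
  obtain W where W: "zariski_closed m W" "A = affine_space m - W"
    using A(1) unfolding open_in_def by blast
  obtain S :: "(nat, 'k) mpoly set" where S: "\<forall>F\<in>S. \<exists>d. homogeneous m d F"
    "W = {P \<in> proj_space m. \<forall>F\<in>S. \<forall>v\<in>P. meval to_ac v F = 0}"
    using W(1) unfolding zariski_closed_def by blast
  obtain P where "P \<in> affine_space m" "P \<notin> W" using A(2) W(2) by blast
  then obtain F w where F: "F \<in> S" "meval to_ac w F \<noteq> 0"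
    unfolding S(2) affine_space_def by blast
  then have "F \<in> vars_in {..m}" using S(1) homogeneous_vars_in by blast
  then have vars: "E * (F * mvar 0) \<in> vars_in {..m}" by (intro mult_vars_in E mvar_vars_in) simp_all
  have "F \<noteq> 0" using F(2) by (auto simp: coeff_hom.meval_0[OF h])
  moreover have "(mvar 0 :: (nat, 'k) mpoly) \<noteq> 0"
    using coeff_hom.meval_var[OF h, of "\<lambda>_. 1" 0] coeff_hom.meval_0[OF h, of "\<lambda>_. 1"]
    by (metis zero_neq_one)
  ultimately have "E * (F * mvar 0) \<noteq> 0" using nz by simp
  then obtain u :: "nat \<Rightarrow> nat" where u: "meval to_ac (\<lambda>i. of_nat (u i)) (E * (F * mvar 0)) \<noteq> 0"
    using mpoly_nonroot_nat[OF h] coeff_hom_eq_0_iff[OF h] by blast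
  define v :: "nat \<Rightarrow> 'k alg_closure" where "v i = (if i \<le> m then of_nat (u i) else 0)" for i
  have "meval to_ac v (E * (F * mvar 0)) \<noteq> 0"
    using u meval_cong_vars[OF h vars, of v "\<lambda>i. of_nat (u i)"] by (simp add: v_def)
  then have v: "meval to_ac v E \<noteq> 0" "meval to_ac v F \<noteq> 0" "v 0 \<noteq> 0"
    by (auto simp: coeff_hom.meval_mult[OF h] coeff_hom.meval_var[OF h])
  have P: "proj_point v \<in> proj_space m"
    by (rule proj_point_in[where i = 0]) (use v(3) in \<open>simp_all add: v_def\<close>)
  moreover have "\<forall>w\<in>proj_point v. w 0 \<noteq> 0" using v(3) by (auto simp: proj_point_def)
  moreover have "proj_point v \<notin> W"
    using F(1) v(2) proj_point_self unfolding S(2) by blast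
  ultimately have "proj_point v \<in> A" unfolding W(2) affine_space_def by blast
  then show False using zero[OF _ proj_point_self] v(1) by blast
qed

text \<open>The coordinates of \<open>\<phi>\<close> give the \<open>L\<close>-rational point of the affine space, and composition with \<open>\<psi>\<close>
  gives the embedding of \<open>L\<close>, in homogeneous coordinates.\<close>

theorem retract_rational_retract_property:
  fixes \<iota> :: "'k :: field_char_0 \<Rightarrow> 'e :: field"
  assumes \<iota>: "coeff_hom \<iota>" "range \<iota> \<subseteq> L" and L: "subdomain L" and rational: "retract_rational \<iota> L"
  shows "retract_property TYPE(nat) \<iota> L"
proof -
  note h = coeff_hom_to_ac[where 'a = 'k]
  obtain N m and X :: "'k point set" and U Y \<phi> \<psi> where
    X: "irreducible_variety N X" and "irreducible_variety N U" and Y: "irreducible_variety m Y"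
    and \<phi>: "morphism N U m Y \<phi>" and \<psi>: "morphism m Y N X \<psi>"
    and L_X: "is_function_field \<iota> L N X" and UX: "open_in N X U" and \<psi>\<phi>: "\<forall>P\<in>U. \<psi> (\<phi> P) = P"
    and Y_affine: "open_in m (affine_space m) Y"
    using rational unfolding retract_rational_def by (elim exE conjE) (rule that; assumption)
  have U: "U \<noteq> {}" using \<open>irreducible_variety N U\<close> by (simp add: irreducible_variety_def)
  have \<phi>Y: "\<phi> P \<in> Y" if "P \<in> U" for P using \<phi> that unfolding morphism_def by blast
  have Y_proj: "P \<in> proj_space m" "v \<in> P \<Longrightarrow> v 0 \<noteq> 0" if "P \<in> Y" for P v
    using open_in_subset[OF Y_affine] that unfolding affine_space_def by blast+
  obtain \<gamma> :: "'k point set \<Rightarrow> ('k point \<Rightarrow> 'k alg_closure) \<Rightarrow> 'e" where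
    \<gamma>_L: "\<And>U f. (U, f) \<in> germ_pairs N X \<Longrightarrow> \<gamma> U f \<in> L" and
    \<gamma>_surj: "\<And>x. x \<in> L \<Longrightarrow> \<exists>U f. (U, f) \<in> germ_pairs N X \<and> \<gamma> U f = x" and
    \<gamma>_eq: "\<And>U f V g. (U, f) \<in> germ_pairs N X \<Longrightarrow> (V, g) \<in> germ_pairs N X \<Longrightarrow>
      \<gamma> U f = \<gamma> V g \<longleftrightarrow> (\<forall>P\<in>U \<inter> V. f P = g P)" and
    \<gamma>_add: "\<And>U f V g. (U, f) \<in> germ_pairs N X \<Longrightarrow> (V, g) \<in> germ_pairs N X \<Longrightarrow>
      \<gamma> (U \<inter> V) (\<lambda>P. f P + g P) = \<gamma> U f + \<gamma> V g" and
    \<gamma>_mult: "\<And>U f V g. (U, f) \<in> germ_pairs N X \<Longrightarrow> (V, g) \<in> germ_pairs N X \<Longrightarrow>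
      \<gamma> (U \<inter> V) (\<lambda>P. f P * g P) = \<gamma> U f * \<gamma> V g" and
    \<gamma>_const: "\<And>c. \<gamma> X (\<lambda>_. to_ac c) = \<iota> c"
    by (rule function_field_germs[OF X L_X]) (rule that; assumption)
  \<comment> \<open>On the nonempty open set A of Y, the composite of f with \<psi> is the quotient
    of forms F / H.\<close>
  define rep where "rep V f A F H \<longleftrightarrow> (V, f) \<in> germ_pairs N X \<and> open_in m Y A \<and> A \<noteq> {} \<and>
    (\<exists>d. homogeneous m d F \<and> homogeneous m d H) \<and>
    (\<forall>Q\<in>A. \<psi> Q \<in> V \<and> (\<forall>v\<in>Q. meval to_ac v H \<noteq> 0 \<and> f (\<psi> Q) = meval to_ac v F / meval to_ac v H))"
    for V f A F H
  have H_nz: "H \<noteq> 0" if rep: "rep V f A F H" for V f A F H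
  proof -
    obtain Q where "Q \<in> A" using rep unfolding rep_def by blast
    moreover from this have "Q \<in> Y" using rep open_in_subset unfolding rep_def by blast
    then obtain v where "v \<in> Q" using Y_proj(1) proj_space_nonempty by blast
    ultimately show "H \<noteq> 0" using rep unfolding rep_def by (auto simp: coeff_hom.meval_0[OF h])
  qed
  define R where "R x r \<longleftrightarrow> (\<exists>V f A F H. rep V f A F H \<and> \<gamma> V f = x \<and> r = Fract F H)" for x r
  \<comment> \<open>P is taken in U and in the domain of f, and the representation near \<phi> P.
    Thus A meets the image of \<phi>, and H does not vanish identically along \<phi>.\<close>
  have exists_rep: "\<exists>V f A F H P. rep V f A F H \<and> \<gamma> V f = x \<and> P \<in> U \<and> \<phi> P \<in> A" if "x \<in> L" for x
  proof -
    obtain V f where V: "(V, f) \<in> germ_pairs N X" "\<gamma> V f = x" using \<gamma>_surj[OF \<open>x \<in> L\<close>] by blast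
    then have V': "open_in N X V" "V \<noteq> {}" "regular_on N V f" by (auto simp: germ_pairs_def)
    then obtain P where P: "P \<in> U" "P \<in> V" using irreducible_open_Int[OF X UX U V'(1,2)] by blast
    let ?B = "{Q \<in> Y. \<psi> Q \<in> V}"
    have B: "open_in m Y ?B" "regular_on m ?B (f \<circ> \<psi>)"
      using \<psi> V'(1,3) unfolding morphism_def by blast+
    have "\<phi> P \<in> ?B" using P \<phi>Y \<psi>\<phi> by simp
    then obtain A d F H where A: "open_in m ?B A" "\<phi> P \<in> A" "homogeneous m d F" "homogeneous m d H"
      "\<forall>Q\<in>A. \<forall>v\<in>Q. meval to_ac v H \<noteq> 0 \<and> (f \<circ> \<psi>) Q = meval to_ac v F / meval to_ac v H"
      using B(2) unfolding regular_on_def by blast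
    have "rep V f A F H"
      unfolding rep_def
    proof (intro conjI)
      show "open_in m Y A" by (rule open_in_trans[OF B(1) A(1)])
      show "\<forall>Q\<in>A. \<psi> Q \<in> V \<and> (\<forall>v\<in>Q. meval to_ac v H \<noteq> 0 \<and> f (\<psi> Q) = meval to_ac v F / meval to_ac v H)"
        using A(5) open_in_subset[OF A(1)] by auto
    qed (use V(1) A(2-4) in blast)+
    then show ?thesis using V(2) P(1) A(2) by blast
  qed
  have combine: "rep (V \<inter> V') f'' (A \<inter> A') F'' (H * H')"
    if rep: "rep V f A F H" "rep V' f' A' F' H'" and germ: "(V \<inter> V', f'') \<in> germ_pairs N X"
      and hom: "\<And>d e. homogeneous m d F \<Longrightarrow> homogeneous m d H \<Longrightarrow> homogeneous m e F' \<Longrightarrow>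
        homogeneous m e H' \<Longrightarrow> homogeneous m (d + e) F''"
      and eq: "\<And>P v. meval to_ac v H \<noteq> 0 \<Longrightarrow> meval to_ac v H' \<noteq> 0 \<Longrightarrow>
        f P = meval to_ac v F / meval to_ac v H \<Longrightarrow> f' P = meval to_ac v F' / meval to_ac v H' \<Longrightarrow>
        f'' P = meval to_ac v F'' / meval to_ac v (H * H')"
    for V f A F H V' f' A' F' H' f'' F''
    unfolding rep_def
  proof (intro conjI)
    have AA: "open_in m Y A" "A \<noteq> {}" "open_in m Y A'" "A' \<noteq> {}"
      using rep unfolding rep_def by simp_all
    show "open_in m Y (A \<inter> A')" "A \<inter> A' \<noteq> {}"
      by (rule open_in_Int[OF AA(1,3)], rule irreducible_open_Int[OF Y AA])
    obtain d e where "homogeneous m d F" "homogeneous m d H" "homogeneous m e F'" "homogeneous m e H'"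
      using rep unfolding rep_def by (elim conjE exE) (rule that; assumption)
    then show "\<exists>d. homogeneous m d F'' \<and> homogeneous m d (H * H')" using hom homogeneous_mult by blast
    show "\<forall>Q\<in>A \<inter> A'. \<psi> Q \<in> V \<inter> V' \<and> (\<forall>v\<in>Q. meval to_ac v (H * H') \<noteq> 0 \<and>
        f'' (\<psi> Q) = meval to_ac v F'' / meval to_ac v (H * H'))"
    proof (intro ballI conjI)
      fix Q assume Q: "Q \<in> A \<inter> A'"
      show "\<psi> Q \<in> V \<inter> V'" using Q rep unfolding rep_def by blast
      fix v assume "v \<in> Q"
      then have *: "meval to_ac v H \<noteq> 0" "meval to_ac v H' \<noteq> 0"
        "f (\<psi> Q) = meval to_ac v F / meval to_ac v H" "f' (\<psi> Q) = meval to_ac v F' / meval to_ac v H'"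
        using Q rep unfolding rep_def by blast+
      show "meval to_ac v (H * H') \<noteq> 0" using * by (simp add: coeff_hom.meval_mult[OF h])
      show "f'' (\<psi> Q) = meval to_ac v F'' / meval to_ac v (H * H')" by (rule eq[OF *])
    qed
  qed (rule germ)
  \<comment> \<open>Affine coordinates on the chart. Any coordinate vector may be picked, since the
    quotient by the zeroth coordinate does not depend on the choice.\<close>
  define c :: "nat \<Rightarrow> 'k point \<Rightarrow> 'k alg_closure" where
    "c i Q = (SOME v. v \<in> Q) i / (SOME v. v \<in> Q) 0" for i Q
  define g where "g i P = c i (\<phi> P)" for i P
  have c_eq: "c i Q = v i / v 0" if Q: "Q \<in> Y" "v \<in> Q" for Q v i
  proof -
    define w where "w = (SOME v. v \<in> Q)"
    have w: "w \<in> Q" unfolding w_def by (rule someI[of "\<lambda>v. v \<in> Q"]) (rule Q(2))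
    then obtain a where "a \<noteq> 0" "w = (\<lambda>i. a * v i)"
      using proj_spaceD(1)[OF Y_proj(1)[OF Q(1)] Q(2)] unfolding proj_point_def by blast
    then show ?thesis by (simp add: c_def flip: w_def)
  qed
  have g_in: "(\<lambda>i. g i P) \<in> \<phi> P" if P: "P \<in> U" for P
  proof -
    note \<phi>P = \<phi>Y[OF P]
    obtain v where v: "v \<in> \<phi> P" using Y_proj(1)[OF \<phi>P] proj_space_nonempty by blast
    have "(\<lambda>i. g i P) = (\<lambda>i. inverse (v 0) * v i)" using c_eq[OF \<phi>P v] by (simp add: g_def field_simps)
    moreover have "inverse (v 0) \<noteq> 0" using Y_proj(2)[OF \<phi>P v] by simp
    ultimately show ?thesis
      using proj_spaceD(1)[OF Y_proj(1)[OF \<phi>P] v] unfolding proj_point_def by blast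
  qed
  have g_germ: "(U, g i) \<in> germ_pairs N X" if i: "i \<le> m" for i
  proof -
    have "regular_on m Y (c i)"
      unfolding regular_on_def
    proof
      fix P assume P: "P \<in> Y"
      have "\<forall>Q\<in>Y. \<forall>v\<in>Q. meval to_ac v (mvar 0 :: (nat, 'k) mpoly) \<noteq> 0 \<and>
          c i Q = meval to_ac v (mvar i :: (nat, 'k) mpoly) / meval to_ac v (mvar 0 :: (nat, 'k) mpoly)"
        using c_eq Y_proj(2) by (simp add: coeff_hom.meval_var[OF h])
      then show "\<exists>A d (F :: (nat, 'k) mpoly) H. open_in m Y A \<and> P \<in> A \<and> homogeneous m d F \<and> homogeneous m d H \<and>
          (\<forall>Q\<in>A. \<forall>v\<in>Q. meval to_ac v H \<noteq> 0 \<and> c i Q = meval to_ac v F / meval to_ac v H)"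
        using P homogeneous_var[OF i] homogeneous_var[of 0 m] open_in_self
        by (intro exI[of _ Y] exI[of _ "1 :: nat"] exI[of _ "mvar i"] exI[of _ "mvar 0"] conjI) auto
    qed
    then have "regular_on N {P \<in> U. \<phi> P \<in> Y} (c i \<circ> \<phi>)"
      using \<phi> open_in_self unfolding morphism_def by blast
    moreover have "{P \<in> U. \<phi> P \<in> Y} = U" using \<phi>Y by blast
    moreover have "c i \<circ> \<phi> = g i" by (simp add: fun_eq_iff g_def)
    ultimately show ?thesis using UX U by (simp add: germ_pairs_def)
  qed
  \<comment> \<open>The point is indexed by all natural numbers, so a default in L is needed beyond
    m.\<close>
  define \<tau> where "\<tau> i = (if i \<le> m then \<gamma> U (g i) else \<iota> 0)" for i
  have \<tau>_L: "range \<tau> \<subseteq> L" using \<gamma>_L[OF g_germ] \<iota>(2) by (auto simp: \<tau>_def)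
  define e where "e p P = meval to_ac (\<lambda>i. g i P) p" for p :: "(nat, 'k) mpoly" and P
  have const_germ: "(U, \<lambda>_. to_ac c) \<in> germ_pairs N X" for c
    using UX U by (simp add: germ_pairs_def regular_on_const)
  have \<gamma>_const': "\<gamma> U (\<lambda>_. to_ac c) = \<iota> c" for c
    using \<gamma>_eq[OF const_germ germ_pairs_const[OF X], of c c] \<gamma>_const by simp
  \<comment> \<open>Evaluating p at \<tau> in L amounts to pulling p back along \<phi>.\<close>
  have e: "(U, e p) \<in> germ_pairs N X \<and> \<gamma> U (e p) = meval \<iota> \<tau> p" if "p \<in> vars_in {..m}" for p
    using that
  proof (induction rule: vars_in_induct)
    case (const c)
    have "e (mconst c) = (\<lambda>_. to_ac c)" by (simp add: e_def fun_eq_iff coeff_hom.meval_const[OF h])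
    then show ?case using const_germ \<gamma>_const' by (simp add: coeff_hom.meval_const[OF \<iota>(1)])
  next
    case (var i)
    have "e (mvar i) = g i" by (simp add: e_def fun_eq_iff coeff_hom.meval_var[OF h])
    then show ?case using var g_germ by (simp add: coeff_hom.meval_var[OF \<iota>(1)] \<tau>_def)
  next
    case (add p q)
    have "e (p + q) = (\<lambda>P. e p P + e q P)" by (simp add: e_def fun_eq_iff coeff_hom.meval_add[OF h])
    then show ?case
      using add germ_pairs_add_mult(1)[OF X, of U "e p" U "e q"] \<gamma>_add[of U "e p" U "e q"]
      by (simp add: coeff_hom.meval_add[OF \<iota>(1)])
  next
    case (mult p q)
    have "e (p * q) = (\<lambda>P. e p P * e q P)" by (simp add: e_def fun_eq_iff coeff_hom.meval_mult[OF h])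
    then show ?case
      using mult germ_pairs_add_mult(2)[OF X, of U "e p" U "e q"] \<gamma>_mult[of U "e p" U "e q"]
      by (simp add: coeff_hom.meval_mult[OF \<iota>(1)])
  qed
  have point: "\<exists>r. R x r \<and> has_val \<iota> \<tau> r x" if x: "x \<in> L" for x
  proof -
    obtain V f A F H P where rep: "rep V f A F H" and \<gamma>: "\<gamma> V f = x" and P: "P \<in> U" "\<phi> P \<in> A"
      using exists_rep[OF x] by blast
    have V: "(V, f) \<in> germ_pairs N X" and A: "open_in m Y A"
      and FH: "F \<in> vars_in {..m}" "H \<in> vars_in {..m}"
      using rep homogeneous_vars_in unfolding rep_def by blast+
    have val: "P \<in> V" "e H P \<noteq> 0" "f P = e F P / e H P" if "P \<in> U" "\<phi> P \<in> A" for P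
      using rep that \<psi>\<phi> g_in[of P] unfolding rep_def e_def by metis+
    \<comment> \<open>Otherwise the pullback of H would be the zero germ, yet it is nonzero at
      P.\<close>
    have "meval \<iota> \<tau> H \<noteq> 0"
    proof
      assume "meval \<iota> \<tau> H = 0"
      then have "\<gamma> U (e H) = \<gamma> U (\<lambda>_. to_ac 0)"
        using e[OF FH(2)] \<gamma>_const'[of 0] coeff_hom.hom_zero[OF \<iota>(1)] by simp
      then have "e H P = to_ac 0" using \<gamma>_eq e[OF FH(2)] const_germ P(1) by blast
      then show False using val(2)[OF P] by simp
    qed
    \<comment> \<open>Where \<phi> lands in A, the pullbacks satisfy f * H = F, because \<psi> after
      \<phi> is the identity; the identity principle extends this to all common points.\<close>
    moreover have "x * meval \<iota> \<tau> H = meval \<iota> \<tau> F"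
    proof -
      note fH = germ_pairs_add_mult(2)[OF X V conjunct1[OF e[OF FH(2)]]]
      note F = conjunct1[OF e[OF FH(1)]]
      let ?W = "{P \<in> U. \<phi> P \<in> A}"
      have "open_in N U ?W" using \<phi> A unfolding morphism_def by blast
      then have W: "open_in N X ?W" by (rule open_in_trans[OF UX])
      have "?W \<noteq> {}" using P by blast
      moreover have "f P * e H P = e F P" if "P \<in> ?W" for P
        using that val(2,3)[of P] by simp
      ultimately have "\<forall>P\<in>(V \<inter> U) \<inter> U. f P * e H P = e F P"
        using regular_identity[OF X fH F W] by blast
      then have "\<gamma> (V \<inter> U) (\<lambda>P. f P * e H P) = \<gamma> U (e F)" using \<gamma>_eq[OF fH F] by blast
      then show ?thesis using \<gamma>_mult[OF V conjunct1[OF e[OF FH(2)]]] e FH \<gamma> by simp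
    qed
    ultimately have "has_val \<iota> \<tau> (Fract F H) x" by (rule has_val_Fract[OF \<iota>(1)])
    then show ?thesis using rep \<gamma> unfolding R_def by blast
  qed
  show ?thesis
  proof (rule retract_propertyI[where R = R])
    show "subdomain L" "range \<iota> \<subseteq> L" by fact+
    show "\<exists>r. R x r" if "x \<in> L" for x using point[OF that] by blast
    show "r = r'" if r: "R x r" "R x r'" for x r r'
    proof -
      obtain V f A F H V' f' A' F' H' where rep: "rep V f A F H" "rep V' f' A' F' H'"
        and eq: "\<gamma> V f = \<gamma> V' f'" "r = Fract F H" "r' = Fract F' H'"
        using r unfolding R_def by metis
      define E where "E = F * H' + - (F' * H)"
      \<comment> \<open>Representations of the same germ agree on a nonempty open part of affine
        space, hence as fractions of polynomials.\<close>
      have "E = 0"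
      proof (rule dense_open_affine)
        have AA: "open_in m Y A" "open_in m Y A'" "A \<noteq> {}" "A' \<noteq> {}"
          using rep unfolding rep_def by blast+
        show "open_in m (affine_space m) (A \<inter> A')"
          by (rule open_in_trans[OF Y_affine open_in_Int[OF AA(1,2)]])
        show "A \<inter> A' \<noteq> {}" by (rule irreducible_open_Int[OF Y AA(1,3,2,4)])
        have "F \<in> vars_in {..m}" "H \<in> vars_in {..m}" "F' \<in> vars_in {..m}" "H' \<in> vars_in {..m}"
          using rep homogeneous_vars_in unfolding rep_def by blast+
        then show "E \<in> vars_in {..m}" unfolding E_def by (intro add_vars_in minus_vars_in mult_vars_in)
        fix Q v assume Q: "Q \<in> A \<inter> A'" "v \<in> Q"
        have *: "meval to_ac v H \<noteq> 0" "meval to_ac v H' \<noteq> 0" "\<psi> Q \<in> V \<inter> V'"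
          "f (\<psi> Q) = meval to_ac v F / meval to_ac v H" "f' (\<psi> Q) = meval to_ac v F' / meval to_ac v H'"
          using Q rep unfolding rep_def by blast+
        have "f (\<psi> Q) = f' (\<psi> Q)"
          using *(3) eq(1) \<gamma>_eq[of V f V' f'] rep unfolding rep_def by blast
        then have "meval to_ac v F * meval to_ac v H' = meval to_ac v F' * meval to_ac v H"
          using * by (simp add: frac_eq_eq)
        then show "meval to_ac v E = 0"
          unfolding E_def coeff_hom.meval_add[OF h] coeff_hom_minus[OF coeff_hom_meval[OF h]]
            coeff_hom.meval_mult[OF h] by simp
      qed
      then have "F * H' = F' * H" by (simp add: E_def)
      then show ?thesis using H_nz rep by (simp add: eq eq_fract)
    qed
    show "R (x + y) (r + s)" if rs: "R x r" "R y s" for x y r s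
    proof -
      obtain V f A F H V' f' A' F' H' where rep: "rep V f A F H" "rep V' f' A' F' H'"
        and eq: "\<gamma> V f = x" "\<gamma> V' f' = y" "r = Fract F H" "s = Fract F' H'"
        using rs unfolding R_def by blast
      have germ: "(V, f) \<in> germ_pairs N X" "(V', f') \<in> germ_pairs N X" using rep unfolding rep_def by blast+
      have "rep (V \<inter> V') (\<lambda>P. f P + f' P) (A \<inter> A') (F * H' + F' * H) (H * H')"
      proof (rule combine[OF rep germ_pairs_add_mult(1)[OF X germ]])
        fix d e assume *: "homogeneous m d F" "homogeneous m d H" "homogeneous m e F'" "homogeneous m e H'"
        show "homogeneous m (d + e) (F * H' + F' * H)"
          using homogeneous_add homogeneous_mult[OF *(1,4)] homogeneous_mult[OF *(3,2)] by (metis add.commute)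
      qed (simp add: coeff_hom.meval_mult[OF h] coeff_hom.meval_add[OF h] add_frac_eq)
      moreover have "r + s = Fract (F * H' + F' * H) (H * H')" using H_nz rep by (simp add: eq)
      ultimately show ?thesis unfolding R_def using \<gamma>_add[OF germ] eq by blast
    qed
    show "R (x * y) (r * s)" if rs: "R x r" "R y s" for x y r s
    proof -
      obtain V f A F H V' f' A' F' H' where rep: "rep V f A F H" "rep V' f' A' F' H'"
        and eq: "\<gamma> V f = x" "\<gamma> V' f' = y" "r = Fract F H" "s = Fract F' H'"
        using rs unfolding R_def by blast
      have germ: "(V, f) \<in> germ_pairs N X" "(V', f') \<in> germ_pairs N X" using rep unfolding rep_def by blast+
      have "rep (V \<inter> V') (\<lambda>P. f P * f' P) (A \<inter> A') (F * F') (H * H')"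
        by (rule combine[OF rep germ_pairs_add_mult(2)[OF X germ]])
          (simp_all add: coeff_hom.meval_mult[OF h] homogeneous_mult)
      moreover have "r * s = Fract (F * F') (H * H')" by (simp add: eq)
      ultimately show ?thesis unfolding R_def using \<gamma>_mult[OF germ] eq by blast
    qed
    show "R (\<iota> c) (rf_const c)" for c
    proof -
      have "Y \<noteq> {}" using Y by (simp add: irreducible_variety_def)
      moreover have "\<psi> Q \<in> X" if "Q \<in> Y" for Q using \<psi> that unfolding morphism_def by blast
      ultimately have "rep X (\<lambda>_. to_ac c) Y (mconst c) (mconst 1)"
        unfolding rep_def using germ_pairs_const[OF X] open_in_self
        by (intro conjI exI[of _ 0] homogeneous_const) (auto simp: coeff_hom.meval_const[OF h])
      moreover have "rf_const c = Fract (mconst c) (mconst 1)"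
        by (simp add: rf_const_def to_fract_def mconst.hom_one)
      ultimately show ?thesis unfolding R_def using \<gamma>_const by blast
    qed
    show "\<exists>\<tau>. range \<tau> \<subseteq> L \<and> (\<forall>x\<in>S. \<exists>r. R x r \<and> has_val \<iota> \<tau> r x)" if "S \<subseteq> L" for S
      using that point \<tau>_L by blast
  qed
qed

lemma (in group) subfld_noether_field: "subfld (noether_field G :: ('a, 'k :: field) ratfun set)"
proof -
  let ?K = "ratfun_field G :: ('a, 'k) ratfun set"
  define t :: "'a \<Rightarrow> ('a, 'k) ratfun \<Rightarrow> _" where "t g = rf_map (\<lambda>c. c) (left_translation G g)" for g
  have t: "coeff_hom (t g)" if "g \<in> carrier G" for g
    unfolding t_def by (intro coeff_hom_rf_map coeff_hom_id bij_left_translation that)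
  have eq: "noether_field G = {x \<in> ?K. \<forall>g\<in>carrier G. t g x = x}"
    unfolding noether_field_def by (auto simp: noether_action_eq t_def)
  have "subfld ?K" unfolding ratfun_field_def by (rule subfld_adjoin)
  then show ?thesis
    unfolding eq subfld_def subdomain_def
    by (auto simp: coeff_hom.hom_one[OF t] coeff_hom.hom_add[OF t] coeff_hom.hom_mult[OF t]
        coeff_hom_minus[OF t] coeff_hom_inverse[OF t])
qed

lemma (in group) rf_const_in_noether_field: "rf_const c \<in> noether_field G"
proof -
  have "rf_const c \<in> ratfun_field G" by (simp add: ratfun_field_def adjoin_closed)
  then show ?thesis
    by (simp add: noether_field_def noether_action_eq rf_map_const coeff_hom_id bij_left_translation)
qed

theorem theorem1p2:
  fixes n :: nat
    and G :: "('g, 'b) monoid_scheme"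
    and N :: "'g set"
    and \<zeta> :: "'k :: field_char_0 alg_closure"
  assumes "n \<ge> 3"
    and "group G" and "finite (carrier G)"
    and "N \<lhd> G" and "(G Mod N) \<cong> integer_mod_group (2 ^ n)"
    and "primitive_root_of_unity (2 ^ n) \<zeta>"
    and "\<not> cyclic_extension (range to_ac) (adjoin (range to_ac) {\<zeta>})"
  shows
    "\<not> stably_rational (rf_const :: 'k \<Rightarrow> ('g, 'k) ratfun) (noether_field G) \<and>
    \<not> retract_rational (rf_const :: 'k \<Rightarrow> ('g, 'k) ratfun) (noether_field G)"
proof -
  interpret group G by fact
  have L: "subfld (noether_field G :: ('g, 'k) ratfun set)" "range (rf_const :: 'k \<Rightarrow> ('g, 'k) ratfun) \<subseteq> noether_field G"
    using subfld_noether_field rf_const_in_noether_field by blast+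
  note no = noether_field_no_retraction[OF assms]
  show ?thesis
    using stably_rational_retract_property[OF coeff_hom_rf_const L(2,1)] no
      retract_rational_retract_property[OF coeff_hom_rf_const L(2)] L(1) no
    unfolding subfld_def by blast
qed

end
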